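(* Let $G=(V,E)$ be a finite simple connected graph. Then for any vertex $w$ of $G$, $$\beth^{3}(G/w)\le \beth^{3}(G),$$ where $G/w$ is a graph obtained from $G$ by vertex compression of $w$.
   Context: All graphs are finite and simple. A nonedge contraction of a pair $u,v$ of distinct nonadjacent vertices identifies $u$ and $v$ to a single vertex adjacent to exactly those other vertices that are adjacent to $u$ or $v$ (no loops or multiple edges). Vertex compression: for a vertex $w$ of $G$, let $G_w$ be the induced subgraph of $G$ with vertex set $\Gamma_G(w)\cup\{w\}$, where $\Gamma_G(w)$ is the set of neighbours of $w$. $G/w$ denotes the graph obtained from $G$ by successive nonedge contractions on (pairs of vertices of) $G_w$ so that $G_w$ becomes the complete graph $K_w:=K^{\chi(G_w)}$ on $\chi(G_w)$ vertices in $G/w$; the operation is called the vertex compression of $w$. Equivalently, one takes a proper colouring of $G_w$ with $\chi(G_w)$ colours and identifies, in $G$, the vertices within each colour class. The assertion is for any such choice. $C(G)$ is the set of all induced cycles in $G$ (of length at least 3). Solid graphs are the graphs of the following four kinds. (1) Pyramid: a graph consisting of a cycle $C$ and a vertex $a\notin V(C)$ together with at least three edges between $a$ and $C$. (2) Trihedron: the union of three paths $P_1,P_2,P_3$, each of length at least 2, having the same two (distinct) endpoints, such that no interior vertex of any of the paths is used in another of the paths. (3) Stamp: the union of a triangle $T$ and three paths $P_1,P_2,P_3$ of length $\ge 1$ that start at the three different vertices of $T$ and all end at the same vertex $x\notin V(T)$, such that the $P_i-x$ are pairwise vertex-disjoint and each $P_i$ meets $T$ only in its starting vertex. (4) Prism: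 $T\cup T'\cup P_1\cup P_2\cup P_3$ where $T,T'$ are vertex-disjoint triangles with vertices $x_1,x_2,x_3$ and $y_1,y_2,y_3$ respectively, and the $P_i$ are pairwise vertex-disjoint paths from $x_i$ to $y_i$ (so $P_i$ meets $T\cup T'$ only in $x_i,y_i$). A solid in $G$ is an induced subgraph of $G$ that is isomorphic to a solid graph; $S(G)$ is the set of all solids in $G$. The third graph characteristic is $\beth^{3}(G)=|S(G)|-|C(G)|+|E(G)|-|V(G)|$. *)

theory Defs
  imports Main
begin

datatype 'a graph = Graph (verts: "'a set") (edges: "'a set set")

definition simple_graph :: "'a graph \<Rightarrow> bool" where
  "simple_graph G \<longleftrightarrow> finite (verts G) \<and> (\<forall>e\<in>edges G. e \<subseteq> verts G \<and> card e = 2)"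

definition adjacent :: "'a graph \<Rightarrow> 'a \<Rightarrow> 'a \<Rightarrow> bool" where
  "adjacent G u v \<longleftrightarrow> {u, v} \<in> edges G"

definition neighbours :: "'a graph \<Rightarrow> 'a \<Rightarrow> 'a set" where
  "neighbours G w = {v. adjacent G w v}"

definition connected_graph :: "'a graph \<Rightarrow> bool" where
  "connected_graph G \<longleftrightarrow> verts G \<noteq> {} \<and> (\<forall>u\<in>verts G. \<forall>v\<in>verts G. (adjacent G)\<^sup>*\<^sup>* u v)"

definition induced :: "'a graph \<Rightarrow> 'a set \<Rightarrow> 'a graph" where
  "induced G W = Graph W {e \<in> edges G. e \<subseteq> W}"

definition complete_graph :: "'a graph \<Rightarrow> bool" where
  "complete_graph G \<longleftrightarrow> (\<forall>u\<in>verts G. \<forall>v\<in>verts G. u \<noteq> v \<longrightarrow> adjacent G u v)"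

definition proper_colouring :: "'a graph \<Rightarrow> nat \<Rightarrow> ('a \<Rightarrow> nat) \<Rightarrow> bool" where
  "proper_colouring G k c \<longleftrightarrow>
     c ` verts G \<subseteq> {..<k} \<and>
     (\<forall>u\<in>verts G. \<forall>v\<in>verts G. adjacent G u v \<longrightarrow> c u \<noteq> c v)"

definition chromatic_number :: "'a graph \<Rightarrow> nat" where
  "chromatic_number G = (LEAST k. \<exists>c. proper_colouring G k c)"


(* The vertex obtained by identifying u and v keeps the name u.  This makes no loop
   when u and v are nonadjacent, and parallel edges coincide because edges form a set. *)
definition contract :: "'a graph \<Rightarrow> 'a \<Rightarrow> 'a \<Rightarrow> 'a graph" where
  "contract G u v =
     Graph (verts G - {v}) ({e \<in> edges G. v \<notin> e} \<union> {{u, x} | x. adjacent G v x})"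

(* nonedge_contractions G W H X: H arises from G by successive nonedge contractions of pairs
   inside the vertex set W, or rather inside its current image; X is the image of W in H. *)
inductive nonedge_contractions ::
  "'a graph \<Rightarrow> 'a set \<Rightarrow> 'a graph \<Rightarrow> 'a set \<Rightarrow> bool" for G W where
  refl: "nonedge_contractions G W G W"
| step: "nonedge_contractions G W H X \<Longrightarrow> u \<in> X \<Longrightarrow> v \<in> X \<Longrightarrow> u \<noteq> v \<Longrightarrow> \<not> adjacent H u v \<Longrightarrow>
         nonedge_contractions G W (contract H u v) (X - {v})"

definition closed_neighbourhood :: "'a graph \<Rightarrow> 'a \<Rightarrow> 'a set" where
  "closed_neighbourhood G w = neighbours G w \<union> {w}"

(* A relation, since the outcome depends on the choice of the contracted pairs. *)
definition vertex_compression :: "'a graph \<Rightarrow> 'a \<Rightarrow> 'a graph \<Rightarrow> bool" where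
  "vertex_compression G w H \<longleftrightarrow>
     (\<exists>X. nonedge_contractions G (closed_neighbourhood G w) H X \<and>
          complete_graph (induced H X) \<and>
          card X = chromatic_number (induced G (closed_neighbourhood G w)))"


(* Paths and cycles are given by the lists of their vertices in order; the length of a path
   is one less than the length of its list. *)
definition path_edges :: "'a list \<Rightarrow> 'a set set" where
  "path_edges p = {{p ! i, p ! Suc i} | i. Suc i < length p}"

definition path_between :: "'a \<Rightarrow> 'a list \<Rightarrow> 'a \<Rightarrow> bool" where
  "path_between x p y \<longleftrightarrow> p \<noteq> [] \<and> distinct p \<and> hd p = x \<and> last p = y"

definition cycle_list :: "'a list \<Rightarrow> bool" where
  "cycle_list c \<longleftrightarrow> distinct c \<and> 3 \<le> length c"

definition cycle_edges :: "'a list \<Rightarrow> 'a set set" where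
  "cycle_edges c = path_edges c \<union> {{last c, hd c}}"

definition cycle_graph :: "'a graph \<Rightarrow> bool" where
  "cycle_graph G \<longleftrightarrow> (\<exists>c. cycle_list c \<and> G = Graph (set c) (cycle_edges c))"

(* N is the set of ends on the cycle of the edges at the apex a. *)
definition pyramid :: "'a graph \<Rightarrow> bool" where
  "pyramid G \<longleftrightarrow>
     (\<exists>c a N. cycle_list c \<and> a \<notin> set c \<and> N \<subseteq> set c \<and> 3 \<le> card N \<and>
        G = Graph (set c \<union> {a}) (cycle_edges c \<union> {{a, x} | x. x \<in> N}))"

definition trihedron :: "'a graph \<Rightarrow> bool" where
  "trihedron G \<longleftrightarrow>
     (\<exists>x y (P :: nat \<Rightarrow> 'a list). x \<noteq> y \<and>
        (\<forall>i<3. path_between x (P i) y \<and> 2 \<le> length (P i) - 1) \<and>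
        (\<forall>i<3. \<forall>j<3. i \<noteq> j \<longrightarrow> (set (P i) - {x, y}) \<inter> set (P j) = {}) \<and>
        G = Graph (\<Union>i<3. set (P i)) (\<Union>i<3. path_edges (P i)))"

definition triangle_edges :: "(nat \<Rightarrow> 'a) \<Rightarrow> 'a set set" where
  "triangle_edges t = {{t i, t j} | i j. i < 3 \<and> j < 3 \<and> i \<noteq> j}"

definition stamp :: "'a graph \<Rightarrow> bool" where
  "stamp G \<longleftrightarrow>
     (\<exists>(t :: nat \<Rightarrow> 'a) x (P :: nat \<Rightarrow> 'a list).
        inj_on t {..<3} \<and> x \<notin> t ` {..<3} \<and>
        (\<forall>i<3. path_between (t i) (P i) x \<and> 1 \<le> length (P i) - 1 \<and>
                set (P i) \<inter> t ` {..<3} = {t i}) \<and>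
        (\<forall>i<3. \<forall>j<3. i \<noteq> j \<longrightarrow> (set (P i) - {x}) \<inter> (set (P j) - {x}) = {}) \<and>
        G = Graph (t ` {..<3} \<union> (\<Union>i<3. set (P i)))
                  (triangle_edges t \<union> (\<Union>i<3. path_edges (P i))))"

definition prism :: "'a graph \<Rightarrow> bool" where
  "prism G \<longleftrightarrow>
     (\<exists>(s :: nat \<Rightarrow> 'a) (t :: nat \<Rightarrow> 'a) (P :: nat \<Rightarrow> 'a list).
        inj_on s {..<3} \<and> inj_on t {..<3} \<and> s ` {..<3} \<inter> t ` {..<3} = {} \<and>
        (\<forall>i<3. path_between (s i) (P i) (t i) \<and>
                set (P i) \<inter> (s ` {..<3} \<union> t ` {..<3}) = {s i, t i}) \<and>
        (\<forall>i<3. \<forall>j<3. i \<noteq> j \<longrightarrow> set (P i) \<inter> set (P j) = {}) \<and>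
        G = Graph (s ` {..<3} \<union> t ` {..<3} \<union> (\<Union>i<3. set (P i)))
                  (triangle_edges s \<union> triangle_edges t \<union> (\<Union>i<3. path_edges (P i))))"

(* Closed under isomorphism: the four kinds are described for arbitrary vertices, so a graph
   isomorphic to a solid graph is itself one. *)
definition solid_graph :: "'a graph \<Rightarrow> bool" where
  "solid_graph G \<longleftrightarrow> pyramid G \<or> trihedron G \<or> stamp G \<or> prism G"

definition induced_subgraphs :: "'a graph \<Rightarrow> 'a graph set" where
  "induced_subgraphs G = {induced G W | W. W \<subseteq> verts G}"

definition induced_cycles :: "'a graph \<Rightarrow> 'a graph set" where
  "induced_cycles G = {H \<in> induced_subgraphs G. cycle_graph H}"

definition solids :: "'a graph \<Rightarrow> 'a graph set" where
  "solids G = {H \<in> induced_subgraphs G. solid_graph H}"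

definition beth3 :: "'a graph \<Rightarrow> int" where
  "beth3 G = int (card (solids G)) - int (card (induced_cycles G))
             + int (card (edges G)) - int (card (verts G))"

end

theory Submission
  imports Defs
begin

text \<open>
  Cells of dimension 0, 1, 2, 3, 4 are the empty set, the vertices, the edges, the induced cycles and the solids, and
  \<open>tot_wt j\<close> is the alternating sum of the numbers of cells of dimension at most j, ending with a plus sign at j,
  so that \<open>tot_wt 4\<close> is one more than the characteristic. The compression of w is split into two moves:
  first complete N[w] to a clique, then contract edges of that clique.

  \<^item> If contracting the edge x x' turns a set containing x, x' or both into a solid, then one of these three preimages is
    already a solid. Grouping the sets by their traces outside x, x', this shows that a contraction does not increase the
    alternating sum over the sets that are not contained in N[w].

  \<^item> Completing N[w] does not increase that sum either: it suffices to compare the pairs Y, Y + w, because if Y becomes a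
    solid then Y or Y + w is a solid, w taking the place of the new edges.

  \<^item> Inside N[w], the vertex w is a cone point, hence the sets Y and Y + w cancel and the alternating sum is the
    number of j-cells in the neighbourhood of w. In the clique on k vertices that results, it is the
    binomial coefficient of k - 1 over j.

  It remains to see that a graph that is not n-colourable has at least as many j-cells as the complete graph on n + 1 vertices.
  By induction on the number of vertices this may be assumed for the neighbourhoods, so that compressions do not increase
  the alternating sum; compressing until the graph is a cone bounds the alternating sums of a connected graph
  from below, and two consecutive ones add up to the number of cells.
\<close>

subsection \<open>Induced paths and cycles as vertex sets\<close>

text \<open>The pairs merged by a compression are not adjacent, and a path or cycle through the
  merged vertex need not lift to the graph before the merge. Once N[w] is a clique, every merge is
  the contraction of an edge, and lifts exist. Completing N[w] adds edges, but a cycle or ear using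
  one can be rerouted through w. This fails for sets inside N[w]: two nonadjacent neighbours of w
  become an edge with no loss elsewhere. Hence those sets are compared only with the final clique,
  and only there the number of colours enters.

  Since cycles and solids have opposite signs, lifting solids is not enough: a surplus of cycles
  must be paid for. A triangle through x and x' makes up for an edge that is lost; every other
  surplus cycle comes with a solid, because one of x, x', w has a big set of neighbours on it.

  The sums truncated at j < 4 are carried along because the number of j-cells is the sum of the
  truncations at j and at j - 1, where Pascal's rule adds up the two lower bounds.\<close>

definition graph_rel :: "('a \<Rightarrow> 'a \<Rightarrow> bool) \<Rightarrow> bool" where
  "graph_rel E \<longleftrightarrow> (\<forall>u v. E u v \<longrightarrow> E v u) \<and> (\<forall>u. \<not> E u u)"

lemma graph_rel_sym: "graph_rel E \<Longrightarrow> E u v \<longleftrightarrow> E v u" and graph_rel_irrefl: "graph_rel E \<Longrightarrow> \<not> E u u"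
  by (auto simp: graph_rel_def)

text \<open>Induced paths are given by their vertex sets, because cells are sets of vertices. The
  order of the vertices is recovered as a list only in \<open>ipath_path_list\<close>.\<close>

inductive ipath :: "('a \<Rightarrow> 'a \<Rightarrow> bool) \<Rightarrow> 'a set \<Rightarrow> 'a \<Rightarrow> 'a \<Rightarrow> bool" for E where
  single: "ipath E {a} a a"
| step: "ipath E P b c \<Longrightarrow> a \<notin> P \<Longrightarrow> (\<And>p. p \<in> P \<Longrightarrow> E a p \<longleftrightarrow> p = b) \<Longrightarrow> ipath E (insert a P) a c"

lemma ipath_finite: "ipath E P a b \<Longrightarrow> finite P"
  by (induction rule: ipath.induct) auto

lemma ipath_ends: "ipath E P a b \<Longrightarrow> a \<in> P \<and> b \<in> P"
  by (induction rule: ipath.induct) auto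

lemma ipath_append:
  assumes "ipath E P a b" "ipath E R c d" "P \<inter> R = {}"
    "\<And>u v. u \<in> P \<Longrightarrow> v \<in> R \<Longrightarrow> E u v \<longleftrightarrow> u = b \<and> v = c"
  shows "ipath E (P \<union> R) a d"
  using assms
proof (induction rule: ipath.induct)
  case (single a)
  then show ?case using ipath.step[of E R c d a] by auto
next
  case (step P b' c' a)
  have b: "c' \<in> P" using step.hyps(1) ipath_ends by fast
  have "ipath E (P \<union> R) b' d" by (rule step.IH) (use step in auto)
  then have "ipath E (insert a (P \<union> R)) a d"
  proof (rule ipath.step)
    show "a \<notin> P \<union> R" using step by auto
    fix p assume "p \<in> P \<union> R"
    then show "E a p \<longleftrightarrow> p = b'"
      using step.hyps step.prems b ipath_ends[OF step.hyps(1)] by (metis Int_iff Un_iff empty_iff insertCI)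
  qed
  then show ?case by simp
qed

lemma ipath_rev:
  assumes "graph_rel E" "ipath E P a b" shows "ipath E P b a"
  using assms(2)
proof (induction rule: ipath.induct)
  case (single a) show ?case by (rule ipath.single)
next
  case (step P b c a)
  have "ipath E (P \<union> {a}) c a"
    by (rule ipath_append[OF step.IH ipath.single]) (use step graph_rel_sym[OF assms(1)] in auto)
  then show ?case by simp
qed

lemma ipath_cong:
  assumes "ipath E P a b" "\<And>u v. u \<in> P \<Longrightarrow> v \<in> P \<Longrightarrow> E u v \<longleftrightarrow> E' u v"
  shows "ipath E' P a b"
  using assms
proof (induction rule: ipath.induct)
  case (single a) show ?case by (rule ipath.single)
next
  case (step P b c a)
  have "ipath E' P b c" using step by auto
  then show ?case by (rule ipath.step) (use step in auto)
qed

lemma ipath_eqD: "ipath E P a b \<Longrightarrow> a = b \<Longrightarrow> P = {a}"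
  by (induction rule: ipath.induct) (auto dest: ipath_ends)

lemma ipath_uncons:
  assumes "ipath E P a b" "a \<noteq> b"
  obtains n R where "P = insert a R" "a \<notin> R" "ipath E R n b" "\<And>p. p \<in> R \<Longrightarrow> E a p \<longleftrightarrow> p = n"
  using assms by (cases rule: ipath.cases) auto

text \<open>The cut is made just before \<open>v\<close>, so that \<open>v\<close> starts the second
  part. This singles out a vertex inside an ear or inside an arc of a cycle.\<close>

lemma ipath_cut:
  assumes "ipath E P a b" "v \<in> P" "v \<noteq> a"
  obtains P1 P2 c where "P = P1 \<union> P2" "P1 \<inter> P2 = {}" "ipath E P1 a c" "ipath E P2 v b"
    "\<And>u r. u \<in> P1 \<Longrightarrow> r \<in> P2 \<Longrightarrow> E u r \<longleftrightarrow> u = c \<and> r = v"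
proof -
  have "\<exists>P1 P2 c. P = P1 \<union> P2 \<and> P1 \<inter> P2 = {} \<and> ipath E P1 a c \<and> ipath E P2 v b \<and>
    (\<forall>u\<in>P1. \<forall>r\<in>P2. E u r \<longleftrightarrow> u = c \<and> r = v)"
    using assms
  proof (induction rule: ipath.induct)
    case (single a) then show ?case by simp
  next
    case (step P b c a)
    show ?case
    proof (cases "v = b")
      case True
      show ?thesis
        by (rule exI[of _ "{a}"], rule exI[of _ P], rule exI[of _ a])
          (use step True ipath.single in auto)
    next
      case False
      then obtain P1 P2 c' where *: "P = P1 \<union> P2" "P1 \<inter> P2 = {}" "ipath E P1 b c'" "ipath E P2 v c"
        "\<And>u r. u \<in> P1 \<Longrightarrow> r \<in> P2 \<Longrightarrow> E u r \<longleftrightarrow> u = c' \<and> r = v"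
        using step.IH[OF _ False] step.prems by blast
      have "ipath E (insert a P1) a c'" by (rule ipath.step[OF *(3)]) (use step * in auto)
      moreover have "b \<in> P1" "c' \<in> P1" using *(3) ipath_ends by fast+
      ultimately show ?thesis
        by (intro exI[of _ "insert a P1"] exI[of _ P2] exI[of _ c']) (use * step.hyps(2,3) in auto)
    qed
  qed
  then show thesis using that by blast
qed

lemma ipath_degree:
  assumes "graph_rel E" "ipath E P a b" "x \<in> P" "p \<in> P" "q \<in> P" "r \<in> P" "E x p" "E x q" "E x r"
  shows "p = q \<or> p = r \<or> q = r"
  using assms(2-)
proof (induction arbitrary: x p q r rule: ipath.induct)
  case (single a)
  then show ?case by auto
next
  case (step P b c a)
  have ends: "b \<in> P" using step.hyps ipath_ends by fast
  note s = graph_rel_sym[OF assms(1)] graph_rel_irrefl[OF assms(1)]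
  show ?case
  proof (cases "x = a")
    case True then show ?thesis using step s by (metis insert_iff)
  next
    case False
    then have xP: "x \<in> P" using step by auto
    show ?thesis
    proof (cases "a = p \<or> a = q \<or> a = r")
      case True
      have xb: "x = b" using True step.prems step.hyps xP s by metis
      have "\<forall>u v. u \<in> P \<longrightarrow> v \<in> P \<longrightarrow> E b u \<longrightarrow> E b v \<longrightarrow> u = v"
        using step.hyps(1) s(2) by (cases rule: ipath.cases) auto
      then show ?thesis using True xb step.prems step.hyps s by (metis insert_iff)
    next
      case False
      then show ?thesis using step xP by blast
    qed
  qed
qed

lemma ipath_end_degree:
  assumes "graph_rel E" "ipath E P a b" "p \<in> P" "q \<in> P" "E a p" "E a q"
  shows "p = q"
  using assms(2-) graph_rel_irrefl[OF assms(1)] by (cases rule: ipath.cases) auto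

text \<open>The cycle is opened at one vertex; \<open>a \<noteq> b\<close> forces at least three
  vertices. That every vertex of the cycle can play the part of \<open>x\<close> is
  \<open>icycle_at\<close>.\<close>

definition icycle :: "('a \<Rightarrow> 'a \<Rightarrow> bool) \<Rightarrow> 'a set \<Rightarrow> bool" where
  "icycle E C \<longleftrightarrow> (\<exists>x P a b. C = insert x P \<and> x \<notin> P \<and> ipath E P a b \<and> a \<noteq> b \<and>
     (\<forall>p\<in>P. E x p \<longleftrightarrow> p = a \<or> p = b))"

lemma icycleI:
  assumes "ipath E P a b" "a \<noteq> b" "x \<notin> P" "\<And>p. p \<in> P \<Longrightarrow> E x p \<longleftrightarrow> p = a \<or> p = b"
  shows "icycle E (insert x P)"
  using assms unfolding icycle_def by blast

lemma icycle_finite: "icycle E C \<Longrightarrow> finite C"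
  by (auto simp: icycle_def ipath_finite)

text \<open>Two arcs closed to a cycle. One of them may be a single vertex but not both, since the
  two joining edges would coincide.\<close>

lemma icycle_join:
  assumes E: "graph_rel E" and P: "ipath E P a b" "ipath E R c d" "P \<inter> R = {}" "a \<noteq> b \<or> c \<noteq> d"
    and cr: "\<And>u v. u \<in> P \<Longrightarrow> v \<in> R \<Longrightarrow> E u v \<longleftrightarrow> u = b \<and> v = c \<or> u = a \<and> v = d"
  shows "icycle E (P \<union> R)"
proof -
  note s = graph_rel_sym[OF E] graph_rel_irrefl[OF E]
  \<comment> \<open>If the second arc has two different ends, its first vertex \<open>c\<close>
    serves as the vertex at which the cycle is opened; otherwise the arcs change places.\<close>
  have main: "icycle E (P \<union> R)" if P: "ipath E P a b" "ipath E R c d" "P \<inter> R = {}" "c \<noteq> d"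
    and cr: "\<And>u v. u \<in> P \<Longrightarrow> v \<in> R \<Longrightarrow> E u v \<longleftrightarrow> u = b \<and> v = c \<or> u = a \<and> v = d"
  for P a b R c d
  proof -
    have cr': "E u v \<longleftrightarrow> v = b \<and> u = c \<or> v = a \<and> u = d" if "u \<in> R" "v \<in> P" for u v
      using cr[OF that(2,1)] s(1)[of u v] by blast
    obtain n R' where R: "R = insert c R'" "c \<notin> R'" "ipath E R' n d" "\<And>p. p \<in> R' \<Longrightarrow> E c p \<longleftrightarrow> p = n"
      using ipath_uncons[OF P(2,4)] by metis
    have e: "a \<in> P" "b \<in> P" "n \<in> R'" "d \<in> R'" using P R ipath_ends by metis+
    have "ipath E (R' \<union> P) n b"
      by (rule ipath_append[OF R(3) P(1)]) (use P(3) R(1,2) cr' in auto)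
    then have "icycle E (insert c (R' \<union> P))"
    proof (rule icycleI)
      show "n \<noteq> b" "c \<notin> R' \<union> P" using P R e by auto
      fix p assume "p \<in> R' \<union> P"
      then show "E c p \<longleftrightarrow> p = n \<or> p = b"
      proof
        assume "p \<in> R'" then show ?thesis using R e P(3) by auto
      next
        assume "p \<in> P" then show ?thesis using cr'[of c p] R P(3,4) e by auto
      qed
    qed
    then show ?thesis using R by (simp add: Un_commute)
  qed
  show ?thesis
  proof (cases "c = d")
    case False then show ?thesis using main[of P a b R c d] P cr by blast
  next
    case True
    have "icycle E (R \<union> P)"
    proof (rule main[of R d c P b a])
      fix u v assume "u \<in> R" "v \<in> P"
      then show "E u v \<longleftrightarrow> u = c \<and> v = b \<or> u = d \<and> v = a"
        using cr[of v u] s(1)[of u v] by blast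
    qed (use True P ipath_rev[OF E] in auto)
    then show ?thesis by (simp add: Un_commute)
  qed
qed

text \<open>A rotation of the cycle. Passing from \<open>y\<close> to its neighbour \<open>a\<close>
  is a single step; a vertex further inside is reached by cutting the path there and closing the
  rest through \<open>y\<close>.\<close>

lemma icycle_at:
  assumes E: "graph_rel E" and C: "icycle E C" "x \<in> C"
  obtains P a b where "C = insert x P" "x \<notin> P" "ipath E P a b" "a \<noteq> b" "\<And>p. p \<in> P \<Longrightarrow> E x p \<longleftrightarrow> p = a \<or> p = b"
proof -
  note s = graph_rel_sym[OF E] graph_rel_irrefl[OF E]
  from C obtain y P a b where C': "C = insert y P" "y \<notin> P" "ipath E P a b" "a \<noteq> b"
    "\<And>p. p \<in> P \<Longrightarrow> E y p \<longleftrightarrow> p = a \<or> p = b" unfolding icycle_def by blast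
  have *: "\<exists>R c d. C = insert a R \<and> a \<notin> R \<and> ipath E R c d \<and> c \<noteq> d \<and> (\<forall>p\<in>R. E a p \<longleftrightarrow> p = c \<or> p = d)"
    if C': "C = insert y P" "y \<notin> P" "ipath E P a b" "a \<noteq> b"
    "\<And>p. p \<in> P \<Longrightarrow> E y p \<longleftrightarrow> p = a \<or> p = b" for a b P
  proof -
    obtain n R where R: "P = insert a R" "a \<notin> R" "ipath E R n b" "\<And>p. p \<in> R \<Longrightarrow> E a p \<longleftrightarrow> p = n"
      using ipath_uncons[OF C'(3,4)] by metis
    have e: "n \<in> R" "b \<in> R" using R ipath_ends by metis+
    have "ipath E (R \<union> {y}) n y"
      by (rule ipath_append[OF R(3) ipath.single]) (use R(1,2) C' s(1)[of _ y] in auto)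
    moreover have "E a y" using s(1)[of a y] C' R by auto
    ultimately show ?thesis
      by (intro exI[of _ "R \<union> {y}"] exI[of _ n] exI[of _ y]) (use R C' e in auto)
  qed
  show thesis
  proof (cases "x = y \<or> x = a")
    case True
    then show ?thesis
    proof
      assume "x = y" then show thesis using that[of P a b] C' by blast
    next
      assume "x = a" then show thesis using *[OF C'] that by blast
    qed
  next
    case False
    then have "x \<in> P" "x \<noteq> a" using C' C by auto
    then obtain P1 P2 c where cut: "P = P1 \<union> P2" "P1 \<inter> P2 = {}" "ipath E P1 a c" "ipath E P2 x b"
      "\<And>u r. u \<in> P1 \<Longrightarrow> r \<in> P2 \<Longrightarrow> E u r \<longleftrightarrow> u = c \<and> r = x" using ipath_cut[OF C'(3)] by metis
    have e: "a \<in> P1" "c \<in> P1" "x \<in> P2" "b \<in> P2" using cut ipath_ends by metis+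
    have y1: "ipath E (insert y P1) y c"
      by (rule ipath.step[OF cut(3)]) (use C' cut e in auto)
    have cutr: "E r u \<longleftrightarrow> u = c \<and> r = x" if "u \<in> P1" "r \<in> P2" for u r
      using cut(5)[OF that] s(1)[of u r] by blast
    have yp: "E p y \<longleftrightarrow> p = a \<or> p = b" if "p \<in> P" for p
      using C'(5)[OF that] s(1)[of p y] by blast
    have ab: "a \<notin> P2" "c \<notin> P2" "x \<notin> P1" "b \<notin> P1" "y \<notin> P1" "y \<notin> P2" using e cut(1,2) C'(2) by auto
    show thesis
    proof (cases "x = b")
      case True
      then have "P2 = {x}" using cut ipath_eqD by metis
      then show thesis
        using that[of "insert y P1" y c] y1 C'(1) cut(1,2) e True cutr yp ab by auto
    next
      case False
      obtain n R where R: "P2 = insert x R" "x \<notin> R" "ipath E R n b" "\<And>p. p \<in> R \<Longrightarrow> E x p \<longleftrightarrow> p = n"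
        using ipath_uncons[OF cut(4) False] by metis
      have e': "n \<in> R" "b \<in> R" using R ipath_ends by metis+
      have "ipath E (R \<union> insert y P1) n c"
        by (rule ipath_append[OF R(3) y1]) (use cut(1,2) R(1,2) cutr yp ab in auto)
      moreover have "E x p \<longleftrightarrow> p = n \<or> p = c" if "p \<in> R \<union> insert y P1" for p
        using that R cutr[of p x] yp[of x] ab e e' cut(1) False \<open>x \<noteq> a\<close> by auto
      moreover have "n \<noteq> c" using e' ab R by auto
      ultimately show thesis using that[of "R \<union> insert y P1" n c] C'(1) cut(1) R(1,2) ab False e \<open>x \<in> P\<close> C'(2) by auto
    qed
  qed
qed

subsection \<open>Solids as cycles with an ear\<close>

definition nbrs :: "('a \<Rightarrow> 'a \<Rightarrow> bool) \<Rightarrow> 'a \<Rightarrow> 'a set \<Rightarrow> 'a set" where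
  "nbrs E s D = {d \<in> D. E s d}"

text \<open>A set of vertices of an induced cycle is big if it is not contained in an edge of the cycle. All four kinds of solids
  consist of an induced cycle D and a disjoint induced path Z that attaches to D only by its ends s and t, the attachments being big
  together but, unless Z is a single vertex, not separately. A single vertex with a big attachment is the hub of a pyramid
  or the middle of a path of length 2 in a trihedron.\<close>

definition big :: "('a \<Rightarrow> 'a \<Rightarrow> bool) \<Rightarrow> 'a set \<Rightarrow> bool" where
  "big E A \<longleftrightarrow> (\<exists>p\<in>A. \<exists>q\<in>A. p \<noteq> q \<and> \<not> E p q) \<or>
     (\<exists>p\<in>A. \<exists>q\<in>A. \<exists>r\<in>A. p \<noteq> q \<and> p \<noteq> r \<and> q \<noteq> r)"

definition ears :: "('a \<Rightarrow> 'a \<Rightarrow> bool) \<Rightarrow> 'a set \<Rightarrow> 'a set \<Rightarrow> 'a \<Rightarrow> 'a \<Rightarrow> bool" where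
  "ears E D Z s t \<longleftrightarrow> icycle E D \<and> ipath E Z s t \<and> D \<inter> Z = {} \<and> big E (nbrs E s D \<union> nbrs E t D) \<and>
     (s \<noteq> t \<longrightarrow> \<not> big E (nbrs E s D) \<and> \<not> big E (nbrs E t D) \<and> (\<forall>z\<in>Z - {s, t}. nbrs E z D = {}))"

definition solid :: "('a \<Rightarrow> 'a \<Rightarrow> bool) \<Rightarrow> 'a set \<Rightarrow> bool" where
  "solid E W \<longleftrightarrow> (\<exists>D Z s t. W = D \<union> Z \<and> ears E D Z s t)"

lemma nbrs_iff [simp]: "d \<in> nbrs E s D \<longleftrightarrow> d \<in> D \<and> E s d"
  by (simp add: nbrs_def)

lemma nbrs_empty: "nbrs E s D = {} \<longleftrightarrow> (\<forall>d\<in>D. \<not> E s d)"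
  by auto

lemma nbrs_subset: "nbrs E s D \<subseteq> D" by auto

lemma big_mono: "big E A \<Longrightarrow> A \<subseteq> B \<Longrightarrow> big E B"
  unfolding big_def by blast

lemma big_cong: "(\<And>p q. p \<in> A \<Longrightarrow> q \<in> A \<Longrightarrow> E p q \<longleftrightarrow> F p q) \<Longrightarrow> big E A \<longleftrightarrow> big F A"
  unfolding big_def by blast

lemma not_big_empty [simp]: "\<not> big E {}"
  by (simp add: big_def)

lemma not_big_single [simp]: "\<not> big E {p}"
  by (simp add: big_def)

lemma big_pair: "graph_rel E \<Longrightarrow> big E {p, q} \<longleftrightarrow> p \<noteq> q \<and> \<not> E p q"
  by (auto simp: big_def graph_rel_def)

lemma big3: "p \<in> A \<Longrightarrow> q \<in> A \<Longrightarrow> r \<in> A \<Longrightarrow> p \<noteq> q \<Longrightarrow> p \<noteq> r \<Longrightarrow> q \<noteq> r \<Longrightarrow> big E A"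
  unfolding big_def by blast

lemma big2: "p \<in> A \<Longrightarrow> q \<in> A \<Longrightarrow> p \<noteq> q \<Longrightarrow> \<not> E p q \<Longrightarrow> big E A"
  unfolding big_def by blast

lemma not_big_at:
  assumes "\<not> big E A" "p \<in> A" "A \<noteq> {p}"
  obtains q where "A = {p, q}" "q \<noteq> p" "E p q"
proof -
  obtain q where q: "q \<in> A" "q \<noteq> p" using assms by auto
  have "A \<subseteq> {p, q}" using assms(1) big3[of p A q] assms(2) q by blast
  moreover have "E p q" using assms(1) big2[of p A q E] assms(2) q by blast
  ultimately show thesis using that[of q] q assms(2) by blast
qed

lemma ears_rev: "graph_rel E \<Longrightarrow> ears E D Z s t \<Longrightarrow> ears E D Z t s"
  unfolding ears_def by (auto simp: Un_commute insert_commute intro: ipath_rev)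

lemma solid_hub: "icycle E D \<Longrightarrow> h \<notin> D \<Longrightarrow> big E (nbrs E h D) \<Longrightarrow> solid E (insert h D)"
  unfolding solid_def ears_def
  by (rule exI[of _ D], rule exI[of _ "{h}"], rule exI[of _ h], rule exI[of _ h]) (auto simp: ipath.single)

lemma solid_ears: "ears E D Z s t \<Longrightarrow> W = D \<union> Z \<Longrightarrow> solid E W"
  unfolding solid_def by blast

lemma solid_earI:
  assumes "icycle E D" "ipath E Z s t" "D \<inter> Z = {}" "s \<noteq> t" "\<not> big E (nbrs E s D)" "\<not> big E (nbrs E t D)"
    "big E (nbrs E s D \<union> nbrs E t D)" "\<And>z. z \<in> Z \<Longrightarrow> z \<noteq> s \<Longrightarrow> z \<noteq> t \<Longrightarrow> nbrs E z D = {}" "W = D \<union> Z"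
  shows "solid E W"
  using assms unfolding solid_def ears_def by blast

lemma icycle_nbrs:
  assumes "graph_rel E" "icycle E C" "x \<in> C"
  obtains a b where "a \<in> C" "b \<in> C" "a \<noteq> b" "a \<noteq> x" "b \<noteq> x" "\<And>p. p \<in> C \<Longrightarrow> E x p \<longleftrightarrow> p = a \<or> p = b"
proof -
  obtain P a b where "C = insert x P" "x \<notin> P" "ipath E P a b" "a \<noteq> b" "\<And>p. p \<in> P \<Longrightarrow> E x p \<longleftrightarrow> p = a \<or> p = b"
    using icycle_at[OF assms] by metis
  then show thesis using that[of a b] ipath_ends[of E P a b] graph_rel_irrefl[OF assms(1)] by auto
qed

lemma icycle_big: "icycle E C \<Longrightarrow> big E C"
proof -
  assume "icycle E C"
  then obtain x P a b where "C = insert x P" "x \<notin> P" "ipath E P a b" "a \<noteq> b" unfolding icycle_def by blast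
  then show ?thesis using big3[of x C a b] ipath_ends[of E P a b] by auto
qed

lemma icycle_cong:
  assumes "icycle E C" "\<And>u v. u \<in> C \<Longrightarrow> v \<in> C \<Longrightarrow> E u v \<longleftrightarrow> F u v"
  shows "icycle F C"
proof -
  from assms(1) obtain x P a b where "C = insert x P" "x \<notin> P" "ipath E P a b" "a \<noteq> b"
     "\<forall>p\<in>P. E x p \<longleftrightarrow> p = a \<or> p = b" unfolding icycle_def by blast
  then show ?thesis unfolding icycle_def using ipath_cong[of E P a b F] assms(2)
    by (intro exI[of _ x] exI[of _ P] exI[of _ a] exI[of _ b]) auto
qed

lemma nbrs_cong: "(\<And>u. u \<in> D \<Longrightarrow> E s u \<longleftrightarrow> F s u) \<Longrightarrow> nbrs E s D = nbrs F s D"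
  by auto

lemma ears_cong:
  assumes "ears E D Z s t" "\<And>u v. u \<in> D \<union> Z \<Longrightarrow> v \<in> D \<union> Z \<Longrightarrow> E u v \<longleftrightarrow> F u v"
  shows "ears F D Z s t"
proof -
  have st: "s \<in> Z" "t \<in> Z" using assms(1) ipath_ends unfolding ears_def by metis+
  have nbrs: "nbrs F z D = nbrs E z D" if "z \<in> Z" for z
    using that assms(2) by auto
  have b: "big F A \<longleftrightarrow> big E A" if "A \<subseteq> D" for A
    by (rule big_cong) (use that assms(2) in blast)
  have "nbrs E s D \<union> nbrs E t D \<subseteq> D" "nbrs E s D \<subseteq> D" "nbrs E t D \<subseteq> D" by auto
  then show ?thesis
    using assms(1) st nbrs b icycle_cong[of E D F] ipath_cong[of E Z s t F] assms(2) unfolding ears_def by auto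
qed

lemma solid_cong:
  assumes "solid E W" "\<And>u v. u \<in> W \<Longrightarrow> v \<in> W \<Longrightarrow> E u v \<longleftrightarrow> F u v"
  shows "solid F W"
proof -
  obtain D Z s t where "W = D \<union> Z" "ears E D Z s t" using assms(1) unfolding solid_def by blast
  then show ?thesis using ears_cong[of E D Z s t F] assms(2) solid_ears by metis
qed

text \<open>If both ends see a common vertex of the cycle, that vertex is the hub of a wheel.\<close>

lemma solid_disjoint:
  assumes E: "graph_rel E" and "solid E W"
  obtains D Z s t where "W = D \<union> Z" "ears E D Z s t" "s \<noteq> t \<Longrightarrow> nbrs E s D \<inter> nbrs E t D = {}"
proof -
  note sym = graph_rel_sym[OF E] and irr = graph_rel_irrefl[OF E]
  from assms(2) obtain D Z s t where "W = D \<union> Z \<and> ears E D Z s t" unfolding solid_def by iprover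
  then have W: "W = D \<union> Z" and e: "ears E D Z s t" by iprover+
  show thesis
  proof (cases "s \<noteq> t \<and> nbrs E s D \<inter> nbrs E t D \<noteq> {}")
    case False then show ?thesis using that[OF W e] by blast
  next
    case True
    then obtain p where st: "s \<noteq> t" and p: "p \<in> D" "E s p" "E t p" by auto
    have ee: "icycle E D" "ipath E Z s t" "D \<inter> Z = {}" "big E (nbrs E s D \<union> nbrs E t D)"
      "\<not> big E (nbrs E s D)" "\<not> big E (nbrs E t D)" "\<And>z. z \<in> Z \<Longrightarrow> z \<noteq> s \<Longrightarrow> z \<noteq> t \<Longrightarrow> nbrs E z D = {}"
      using e st unfolding ears_def by auto
    have two: "\<exists>q. q \<noteq> p \<and> E p q \<and> q \<in> D \<and> E z q \<and> (\<forall>r\<in>D. E z r \<longrightarrow> r = p \<or> r = q)"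
      if "\<not> big E (nbrs E z D)" "E z p" "nbrs E z D \<noteq> {p}" for z
    proof -
      from that p obtain q where "nbrs E z D = {p, q}" "q \<noteq> p" "E p q"
        using not_big_at[of E "nbrs E z D" p] by auto
      then show ?thesis by (intro exI[of _ q]) (auto simp: set_eq_iff)
    qed
    \<comment> \<open>An attachment consisting of \<open>p\<close> only would be contained in the
      other one, which is not big. So each end sees a second vertex of the cycle, and this vertex is
      adjacent to \<open>p\<close>.\<close>
    have "nbrs E s D \<noteq> {p}"
    proof
      assume "nbrs E s D = {p}"
      then have "nbrs E s D \<union> nbrs E t D = nbrs E t D" using p by auto
      then show False using ee(4,6) by simp
    qed
    moreover have "nbrs E t D \<noteq> {p}"
    proof
      assume "nbrs E t D = {p}"
      then have "nbrs E s D \<union> nbrs E t D = nbrs E s D" using p by auto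
      then show False using ee(4,5) by simp
    qed
    ultimately obtain p1 p2 where q: "p1 \<noteq> p" "E p p1" "p1 \<in> D" "E s p1" "\<forall>r\<in>D. E s r \<longrightarrow> r = p \<or> r = p1"
      "p2 \<noteq> p" "E p p2" "p2 \<in> D" "E t p2" "\<forall>r\<in>D. E t r \<longrightarrow> r = p \<or> r = p2"
      using two[of s] two[of t] ee p by metis
    have p12: "p1 \<noteq> p2"
    proof
      assume "p1 = p2"
      then have "nbrs E s D \<union> nbrs E t D \<subseteq> {p, p1}" using q by auto
      then have "big E {p, p1}" using ee(4) big_mono by metis
      then show False using q by (simp add: big_pair[OF E])
    qed
    obtain P a b where P: "D = insert p P" "p \<notin> P" "ipath E P a b" "a \<noteq> b"
      "\<And>r. r \<in> P \<Longrightarrow> E p r \<longleftrightarrow> r = a \<or> r = b" using icycle_at[OF E ee(1) p(1)] by metis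
    have "p1 \<in> P" "p2 \<in> P" using P q by auto
    then have "p1 = a \<and> p2 = b \<or> p1 = b \<and> p2 = a" using P(5) q p12 by blast
    then have ipP: "ipath E P p1 p2" using P(3) ipath_rev[OF E] by blast
    \<comment> \<open>\<open>p1\<close> and \<open>p2\<close> are the two neighbours of
      \<open>p\<close> on the cycle. The new cycle takes the ear in place of \<open>p\<close>, and
      \<open>p\<close> sees \<open>p1\<close>, \<open>p2\<close> and \<open>s\<close> on it.\<close>
    have "icycle E (P \<union> Z)"
    proof (rule icycle_join[OF E ipP ipath_rev[OF E ee(2)]])
      show "P \<inter> Z = {}" using ee P by auto
      show "p1 \<noteq> p2 \<or> t \<noteq> s" using st by auto
      fix u v assume uv: "u \<in> P" "v \<in> Z"
      have "E u v \<longleftrightarrow> E v u" using sym .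
      moreover have "E s u \<longleftrightarrow> u = p1" "E t u \<longleftrightarrow> u = p2" using q uv P by auto
      moreover have "\<not> E v u" if "v \<noteq> s" "v \<noteq> t" using ee(7)[OF uv(2) that] uv P(1) by (auto simp: set_eq_iff)
      ultimately show "E u v \<longleftrightarrow> u = p2 \<and> v = t \<or> u = p1 \<and> v = s" using st by metis
    qed
    moreover have "p \<notin> P \<union> Z" using ee P by auto
    moreover have "big E (nbrs E p (P \<union> Z))"
      by (rule big3[of p1 _ p2 s])
        (use q p12 P ee ipath_ends[OF ee(2)] p sym[of p s] in auto)
    ultimately have "ears E (P \<union> Z) {p} p p" unfolding ears_def by (auto simp: ipath.single)
    then show thesis using that[of "P \<union> Z" "{p}" p p] W P by auto
  qed
qed

lemma solid_finite: "solid E W \<Longrightarrow> finite W"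
  unfolding solid_def ears_def by (auto dest: icycle_finite ipath_finite)

subsection \<open>Contraction of an edge\<close>

text \<open>The vertex y of the graph F arises by contracting the edge x x' of E; R collects the other vertices.\<close>

definition splits :: "('a \<Rightarrow> 'a \<Rightarrow> bool) \<Rightarrow> ('a \<Rightarrow> 'a \<Rightarrow> bool) \<Rightarrow> 'a set \<Rightarrow> 'a \<Rightarrow> 'a \<Rightarrow> 'a \<Rightarrow> bool" where
  "splits E F R y x x' \<longleftrightarrow> graph_rel E \<and> graph_rel F \<and> y \<notin> R \<and> x \<notin> R \<and> x' \<notin> R \<and> x \<noteq> x' \<and> E x x' \<and>
     (\<forall>u\<in>R. \<forall>v\<in>R. F u v \<longleftrightarrow> E u v) \<and> (\<forall>r\<in>R. F y r \<longleftrightarrow> E x r \<or> E x' r)"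

definition split_solid :: "('a \<Rightarrow> 'a \<Rightarrow> bool) \<Rightarrow> 'a set \<Rightarrow> 'a \<Rightarrow> 'a \<Rightarrow> bool" where
  "split_solid E R x x' \<longleftrightarrow> solid E (insert x R) \<or> solid E (insert x' R) \<or> solid E (insert x (insert x' R))"

lemma splits_sym: "splits E F R y x x' \<Longrightarrow> splits E F R y x' x"
  unfolding splits_def graph_rel_def by auto

lemma split_solid_sym: "split_solid E R x x' \<longleftrightarrow> split_solid E R x' x"
  unfolding split_solid_def by (auto simp: insert_commute)

text \<open>The attachment of \<open>y\<close> is the union of those of \<open>x\<close> and
  \<open>x'\<close>. If one of these is big, it gives a hub; otherwise the edge \<open>x x'\<close>
  is an ear with two ends.\<close>

lemma split_hub:
  assumes sp: "splits E F D y x x'" and c: "icycle F D" and b: "big F (nbrs F y D)"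
  shows "split_solid E D x x'"
proof -
  have E: "graph_rel E" and xs: "x \<notin> D" "x' \<notin> D" "x \<noteq> x'" "E x x'" using sp unfolding splits_def by auto
  have cE: "icycle E D" using icycle_cong[OF c] sp unfolding splits_def by blast
  have un: "nbrs E x D \<union> nbrs E x' D = nbrs F y D" using sp unfolding splits_def by auto
  have bE: "big E (nbrs E x D \<union> nbrs E x' D)"
    using b unfolding un by (subst big_cong[of _ E F]) (use sp in \<open>auto simp: splits_def\<close>)
  show ?thesis
  proof (cases "big E (nbrs E x D) \<or> big E (nbrs E x' D)")
    case True then show ?thesis using solid_hub[OF cE] xs unfolding split_solid_def by blast
  next
    case False
    have ipath: "ipath E {x, x'} x x'" using ipath.step[OF ipath.single, of x x' E] xs by auto
    have "solid E (insert x (insert x' D))"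
      by (rule solid_earI[OF cE ipath]) (use False xs bE in auto)
    then show ?thesis unfolding split_solid_def by blast
  qed
qed

text \<open>Here \<open>y\<close> is an end of a longer ear and \<open>n\<close> is the next vertex.
  Usually \<open>x\<close>, \<open>x'\<close> or the path from \<open>x'\<close> to \<open>x\<close>
  takes the place of \<open>y\<close>. In the two remaining configurations the attachments are so
  small that the cycle itself has to be exchanged.\<close>

lemma split_end_aux:
  assumes sp: "splits E F (D \<union> Z) y x x'" and e: "ears F D (insert y Z) y t" and yZ: "y \<notin> Z"
    and ipF: "ipath F Z n t" and yn: "\<And>p. p \<in> Z \<Longrightarrow> F y p \<longleftrightarrow> p = n"
    and disj: "nbrs F y D \<inter> nbrs F t D = {}" and xn: "E x n"
  shows "split_solid E (D \<union> Z) x x'"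
proof -
  have E: "graph_rel E" and xs: "x \<notin> D" "x' \<notin> D" "x \<noteq> x'" "E x x'" "x \<notin> Z" "x' \<notin> Z" "y \<notin> D"
    using sp unfolding splits_def by auto
  note sym = graph_rel_sym[OF E] and irr = graph_rel_irrefl[OF E]
  have FE: "F u v \<longleftrightarrow> E u v" if "u \<in> D \<union> Z" "v \<in> D \<union> Z" for u v using sp that unfolding splits_def by blast
  have Fy: "F y r \<longleftrightarrow> E x r \<or> E x' r" if "r \<in> D \<union> Z" for r using sp that unfolding splits_def by blast
  have nt: "n \<in> Z" "t \<in> Z" using ipath_ends[OF ipF] by auto
  have yt: "y \<noteq> t" using nt yZ by auto
  have cE: "icycle E D" using e FE icycle_cong[of F D E] unfolding ears_def by blast
  have ipE: "ipath E Z n t" using ipath_cong[OF ipF] FE by blast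
  have DZ: "D \<inter> Z = {}" using e unfolding ears_def by auto
  define A1 A2 B where AB: "A1 = nbrs E x D" "A2 = nbrs E x' D" "B = nbrs E t D"
  have un: "nbrs F y D = A1 \<union> A2" unfolding AB using Fy by auto
  have nt': "nbrs F t D = B" unfolding AB using FE nt by auto
  have bc: "big F S \<longleftrightarrow> big E S" if "S \<subseteq> D" for S by (rule big_cong) (use that FE in blast)
  have sub: "A1 \<subseteq> D" "A2 \<subseteq> D" "B \<subseteq> D" unfolding AB by auto
  have bg: "big E (A1 \<union> A2 \<union> B)" "\<not> big E (A1 \<union> A2)" "\<not> big E B"
    using e yt sub unfolding ears_def un nt' by (auto simp: bc)
  have int: "nbrs E z D = {}" if "z \<in> Z" "z \<noteq> t" for z
  proof -
    have "nbrs F z D = {}" using e that yt yZ unfolding ears_def by auto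
    then show ?thesis using FE that unfolding nbrs_empty by blast
  qed
  have xp: "E x p \<longleftrightarrow> p = n" if "p \<in> Z" for p using yn[OF that] Fy[of p] that xn by auto
  have xp': "E x' p \<longleftrightarrow> p = n \<and> E x' n" if "p \<in> Z" for p using yn[OF that] Fy[of p] that by auto
  have b12: "\<not> big E A1" "\<not> big E A2" using bg big_mono by blast+
  have BA: "B \<inter> (A1 \<union> A2) = {}" using disj un nt' by auto
  have ipx: "ipath E (insert x Z) x t" by (rule ipath.step[OF ipE]) (use xs xp in auto)
  have okx: "split_solid E (D \<union> Z) x x'" if "big E (A1 \<union> B)"
    unfolding split_solid_def
    by (rule disjI1, rule solid_earI[OF cE ipx]) (use that AB DZ xs nt b12 bg int in auto)
  have okx': "split_solid E (D \<union> Z) x x'" if "big E (A2 \<union> B)" "E x' n"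
  proof -
    have ipx: "ipath E (insert x' Z) x' t" by (rule ipath.step[OF ipE]) (use xs xp' that in auto)
    show ?thesis unfolding split_solid_def
      by (rule disjI2, rule disjI1, rule solid_earI[OF cE ipx]) (use that AB DZ xs nt b12 bg int in auto)
  qed
  show ?thesis
  proof (cases "big E (A1 \<union> B) \<or> big E (A2 \<union> B) \<and> E x' n")
    case True then show ?thesis using okx okx' by blast
  next
    case False
    then have no: "\<not> big E (A1 \<union> B)" "E x' n \<Longrightarrow> \<not> big E (A2 \<union> B)" by auto
    have x'Z: "x' \<notin> insert x Z" using xs by auto
    show ?thesis
    proof (cases "A1 = {} \<and> \<not> E x' n")
      case True
      \<comment> \<open>\<open>x\<close> sees nothing on the cycle and \<open>x'\<close> nothing on
        the rest of the ear, so both become consecutive vertices of the ear.\<close>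
      have ipx': "ipath E (insert x' (insert x Z)) x' t"
        by (rule ipath.step[OF ipx]) (use xs xp' True sym[of x x'] in auto)
      have "solid E (insert x (insert x' (D \<union> Z)))"
        by (rule solid_earI[OF cE ipx']) (use True AB DZ xs nt b12 bg int in auto)
      then show ?thesis unfolding split_solid_def by blast
    next
      case False
      \<comment> \<open>From here on the attachments are forced: \<open>x\<close> sees only
        \<open>p\<close>, \<open>x\<close> and \<open>x'\<close> together see the edge
        \<open>p p'\<close>, and \<open>t\<close> sees only \<open>q\<close>, a neighbour of
        \<open>p\<close>. So \<open>p'\<close> and \<open>q\<close> are the two neighbours of
        \<open>p\<close> on the cycle.\<close>
      have "A1 \<noteq> {}"
      proof
        assume "A1 = {}"
        then have "E x' n" using False by blast
        then show False using no bg \<open>A1 = {}\<close> by simp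
      qed
      then obtain p where p: "p \<in> A1" by auto
      have "A1 \<noteq> A1 \<union> A2" using no bg by auto
      then have "A1 \<union> A2 \<noteq> {p}" using p by auto
      then obtain p' where p': "A1 \<union> A2 = {p, p'}" "p' \<noteq> p" "E p p'"
        using not_big_at[OF bg(2), of p] p by auto
      have A1: "A1 = {p}" "p' \<in> A2" using \<open>A1 \<noteq> A1 \<union> A2\<close> p p' by auto
      have "B \<noteq> {}" using bg by auto
      then obtain q where q: "q \<in> B" by auto
      have pB: "p \<notin> B" "p' \<notin> B" using BA p' by auto
      have q': "B = {q}" "E p q"
        using no(1) q pB A1 big3[of p "A1 \<union> B" q] big2[of p "A1 \<union> B" q E] by blast+
      have mem: "p \<in> D" "p' \<in> D" "q \<in> D" using sub p p' q by auto
      have qn: "q \<noteq> p" "q \<noteq> p'" using pB q by auto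
      obtain P a b where P0: "D = insert p P" "p \<notin> P" "ipath E P a b" "a \<noteq> b"
        "\<And>r. r \<in> P \<Longrightarrow> E p r \<longleftrightarrow> r = a \<or> r = b" using icycle_at[OF E cE mem(1)] by metis
      have ipP: "ipath E P p' q"
      proof -
        have "p' \<in> P" "q \<in> P" using P0 mem qn p' by auto
        then have "p' = a \<or> p' = b" "q = a \<or> q = b" using P0(5)[of p'] P0(5)[of q] p'(3) q'(2) by simp_all
        then have "p' = a \<and> q = b \<or> p' = b \<and> q = a" using qn by metis
        then show ?thesis using P0(3) ipath_rev[OF E] by blast
      qed
      have xD: "E x d \<longleftrightarrow> d = p" if "d \<in> D" for d using A1(1) AB(1) that nbrs_iff[of d E x D] by (metis singleton_iff)
      have tD: "E t d \<longleftrightarrow> d = q" if "d \<in> D" for d using q'(1) AB(3) that nbrs_iff[of d E t D] by (metis singleton_iff)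
      have x'D: "d = p \<or> d = p'" if "d \<in> D" "E x' d" for d
      proof -
        have "d \<in> A1 \<union> A2" using that AB(2) by simp
        then show ?thesis using p'(1) by simp
      qed
      have x'p': "E x' p'" using A1 AB by auto
      have zD: "\<not> E z d" if "z \<in> Z" "z \<noteq> t" "d \<in> D" for z d using int[OF that(1,2)] that(3) by auto
      show ?thesis
      proof (cases "E x' n")
        case False
        have ipx': "ipath E (insert x' (insert x Z)) x' t"
          by (rule ipath.step[OF ipx]) (use xs xp' False sym[of x x'] in auto)
        \<comment> \<open>The ear closes the path left from \<open>D\<close> by removing
          \<open>p\<close>, and on this cycle \<open>p\<close> sees \<open>p'\<close>,
          \<open>q\<close> and \<open>x\<close>.\<close>
        have "icycle E (P \<union> insert x' (insert x Z))"
        proof (rule icycle_join[OF E ipP ipath_rev[OF E ipx']])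
          show "P \<inter> insert x' (insert x Z) = {}" using P0 xs DZ by auto
          show "p' \<noteq> q \<or> t \<noteq> x'" using qn by auto
          fix u v assume uv: "u \<in> P" "v \<in> insert x' (insert x Z)"
          have uD: "u \<in> D" "u \<noteq> p" using uv P0 by auto
          have "E v u \<longleftrightarrow> u = q \<and> v = t \<or> u = p' \<and> v = x'"
            using uv uD xD[of u] tD[of u] x'D[of u] x'p' zD[of v u] xs nt by auto
          then show "E u v \<longleftrightarrow> u = q \<and> v = t \<or> u = p' \<and> v = x'" using sym[of u v] by simp
        qed
        moreover have "p \<notin> P \<union> insert x' (insert x Z)" using P0 xs mem DZ by auto
        moreover have "big E (nbrs E p (P \<union> insert x' (insert x Z)))"
          by (rule big3[of p' _ q x]) (use P0 mem p' q' qn xD[of p] sym[of p x] xs in auto)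
        ultimately have "solid E (insert p (P \<union> insert x' (insert x Z)))" by (rule solid_hub)
        moreover have "insert p (P \<union> insert x' (insert x Z)) = insert x (insert x' (D \<union> Z))" using P0 by auto
        ultimately show ?thesis unfolding split_solid_def by simp
      next
        case True
        have "A2 \<noteq> {p, p'}" using no(2)[OF True] bg(1) p' by auto
        then have A2: "A2 = {p'}" using A1 p' by auto
        have "E p' q" using no(2)[OF True] A2 q' qn big2[of p' "A2 \<union> B" q E] by auto
        have "P = {p', q}"
        proof -
          have "p' \<noteq> q" using qn by auto
          then obtain m R where R: "P = insert p' R" "p' \<notin> R" "ipath E R m q" "\<And>p. p \<in> R \<Longrightarrow> E p' p \<longleftrightarrow> p = m"
            using ipath_uncons[OF ipP] by metis
          then have "q = m" using \<open>E p' q\<close> ipath_ends[OF R(3)] by auto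
          then show ?thesis using R ipath_eqD by metis
        qed
        then have D: "D = {p, p', q}" using P0 by auto
        have x'D: "E x' d \<longleftrightarrow> d = p'" if "d \<in> D" for d using A2 AB(2) that nbrs_iff[of d E x' D] by (metis singleton_iff)
        \<comment> \<open>\<open>D\<close> is the triangle \<open>p p' q\<close>, and the whole set
          is a prism with triangles \<open>x x' n\<close> and \<open>p p' q\<close>. The 4-cycle
          \<open>x x' p' p\<close> between two of its rows is taken as the cycle, the third row from
          \<open>n\<close> to \<open>q\<close> as the ear.\<close>
        have c4: "icycle E ({x, x'} \<union> {p', p})"
        proof (rule icycle_join[OF E, of _ x x' _ p' p])
          show "ipath E {x, x'} x x'" using ipath.step[OF ipath.single, of x x' E] xs by auto
          show "ipath E {p', p} p' p" using ipath.step[OF ipath.single, of p' p E] p' sym[of p p'] by auto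
          fix u v assume "u \<in> {x, x'}" "v \<in> {p', p}"
          then show "E u v \<longleftrightarrow> u = x' \<and> v = p' \<or> u = x \<and> v = p"
            using xD x'D mem p' xs by auto
        qed (use xs mem in auto)
        have ipq: "ipath E (Z \<union> {q}) n q"
        proof (rule ipath_append[OF ipE ipath.single])
          fix u v assume "u \<in> Z" "v \<in> {q}"
          then show "E u v \<longleftrightarrow> u = t \<and> v = q" using tD[of q] zD[of u q] mem by auto
        qed (use DZ mem in auto)
        have zx: "E z x \<longleftrightarrow> z = n" "E z x' \<longleftrightarrow> z = n" if "z \<in> Z" for z
          using xp[OF that] xp'[OF that] True sym[of z] by auto
        have qx: "\<not> E q x" "\<not> E q x'" using xD[of q] x'D[of q] mem qn sym[of q] by auto
        have zp: "\<not> E z p" "\<not> E z p'" if "z \<in> Z" for z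
          using zD[OF that, of p] zD[OF that, of p'] tD[of p] tD[of p'] mem qn by auto
        have qp: "E q p" "E q p'" using q' \<open>E p' q\<close> sym[of q] by auto
        have nn: "nbrs E n ({x, x'} \<union> {p', p}) = {x, x'}" using zx[OF nt(1)] zp[OF nt(1)] by auto
        have nq: "nbrs E q ({x, x'} \<union> {p', p}) = {p', p}" using qx qp by auto
        have "solid E (({x, x'} \<union> {p', p}) \<union> (Z \<union> {q}))"
        proof (rule solid_earI[OF c4 ipq])
          show "\<not> big E (nbrs E n ({x, x'} \<union> {p', p}))" unfolding nn using xs by (simp add: big_pair[OF E])
          show "\<not> big E (nbrs E q ({x, x'} \<union> {p', p}))" unfolding nq using p' sym[of p p'] by (simp add: big_pair[OF E])
          show "big E (nbrs E n ({x, x'} \<union> {p', p}) \<union> nbrs E q ({x, x'} \<union> {p', p}))"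
            unfolding nn nq by (rule big3[of x _ x' p]) (use xs mem in auto)
          fix z assume "z \<in> Z \<union> {q}" "z \<noteq> n" "z \<noteq> q"
          then show "nbrs E z ({x, x'} \<union> {p', p}) = {}" using zx zp by auto
        qed (use xs mem DZ nt qn in auto)
        moreover have "({x, x'} \<union> {p', p}) \<union> (Z \<union> {q}) = insert x (insert x' (D \<union> Z))" using D by auto
        ultimately show ?thesis unfolding split_solid_def by simp
      qed
    qed
  qed
qed

text \<open>\<open>x\<close> and \<open>x'\<close> enter symmetrically, and the next vertex of the
  ear is seen by at least one of them.\<close>

lemma split_end:
  assumes sp: "splits E F (D \<union> Z) y x x'" and e: "ears F D (insert y Z) y t" and yZ: "y \<notin> Z" and Z: "Z \<noteq> {}"
    and disj: "nbrs F y D \<inter> nbrs F t D = {}"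
  shows "split_solid E (D \<union> Z) x x'"
proof -
  have 1: "ipath F (insert y Z) y t" using e unfolding ears_def by auto
  have 2: "y \<noteq> t" using Z yZ ipath_eqD[OF 1] by auto
  obtain n R where R: "insert y Z = insert y R" "y \<notin> R" "ipath F R n t" "\<And>p. p \<in> R \<Longrightarrow> F y p \<longleftrightarrow> p = n"
    by (rule ipath_uncons[OF 1 2]) blast
  then have RZ: "R = Z" using yZ by (metis insert_ident)
  have "n \<in> Z" using R RZ ipath_ends by metis
  then have "E x n \<or> E x' n" using R(4)[of n] RZ sp unfolding splits_def by auto
  then show ?thesis
  proof
    assume "E x n" then show ?thesis using split_end_aux[OF sp e yZ _ _ disj] R RZ by auto
  next
    assume "E x' n" then show ?thesis
      using split_end_aux[OF splits_sym[OF sp] e yZ _ _ disj] R RZ by (auto simp: split_solid_sym[of E _ x])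
  qed
qed

text \<open>Inside the ear \<open>y\<close> has the two neighbours \<open>c\<close> and
  \<open>d\<close>. Either one of \<open>x\<close>, \<open>x'\<close> sees both and replaces
  \<open>y\<close>, or each sees exactly one of them and both are inserted in series. The
  attachments at the ends do not change.\<close>

lemma split_mid:
  assumes sp: "splits E F (D \<union> Z1 \<union> Z2) y x x'" and e: "ears F D (insert y (Z1 \<union> Z2)) s t"
    and Z1: "ipath F Z1 s c" and Z2: "ipath F Z2 d t" and Z12: "Z1 \<inter> Z2 = {}"
    and cr: "\<And>u v. u \<in> Z1 \<Longrightarrow> v \<in> Z2 \<Longrightarrow> \<not> F u v"
    and y1: "\<And>p. p \<in> Z1 \<Longrightarrow> F y p \<longleftrightarrow> p = c" and y2: "\<And>p. p \<in> Z2 \<Longrightarrow> F y p \<longleftrightarrow> p = d"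
  shows "split_solid E (D \<union> Z1 \<union> Z2) x x'"
proof -
  have E: "graph_rel E" and xs: "x \<notin> D" "x' \<notin> D" "x \<noteq> x'" "E x x'" "x \<notin> Z1" "x' \<notin> Z1" "x \<notin> Z2" "x' \<notin> Z2" "y \<notin> D" "y \<notin> Z1" "y \<notin> Z2"
    using sp unfolding splits_def by auto
  note sym = graph_rel_sym[OF E]
  have FE: "F u v \<longleftrightarrow> E u v" if "u \<in> D \<union> Z1 \<union> Z2" "v \<in> D \<union> Z1 \<union> Z2" for u v using sp that unfolding splits_def by blast
  have Fy: "F y r \<longleftrightarrow> E x r \<or> E x' r" if "r \<in> D \<union> Z1 \<union> Z2" for r using sp that unfolding splits_def by blast
  have mem: "s \<in> Z1" "c \<in> Z1" "d \<in> Z2" "t \<in> Z2" using ipath_ends Z1 Z2 by metis+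
  have st: "s \<noteq> t" using mem Z12 by auto
  have cE: "icycle E D" using e FE icycle_cong[of F D E] unfolding ears_def by blast
  have i1: "ipath E Z1 s c" by (rule ipath_cong[OF Z1]) (use FE in blast)
  have i2: "ipath E Z2 d t" by (rule ipath_cong[OF Z2]) (use FE in blast)
  have ee: "D \<inter> insert y (Z1 \<union> Z2) = {}" "big F (nbrs F s D \<union> nbrs F t D)" "\<not> big F (nbrs F s D)" "\<not> big F (nbrs F t D)"
    and int: "\<And>z. z \<in> insert y (Z1 \<union> Z2) \<Longrightarrow> z \<noteq> s \<Longrightarrow> z \<noteq> t \<Longrightarrow> nbrs F z D = {}"
    using e st unfolding ears_def by auto
  have bc: "big F S \<longleftrightarrow> big E S" if "S \<subseteq> D" for S by (rule big_cong) (use that FE in blast)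
  have nbz: "nbrs F z D = nbrs E z D" if "z \<in> Z1 \<union> Z2" for z by (rule nbrs_cong) (use FE that in blast)
  have be: "big E (nbrs E s D \<union> nbrs E t D)" "\<not> big E (nbrs E s D)" "\<not> big E (nbrs E t D)"
    using ee(2-4) nbz[of s] nbz[of t] mem bc[of "nbrs E s D \<union> nbrs E t D"] bc[of "nbrs E s D"] bc[of "nbrs E t D"]
    by (simp_all add: nbrs_subset)
  have yD: "nbrs F y D = {}" using int[of y] mem xs by auto
  \<comment> \<open>\<open>M\<close> is the piece of the edge \<open>x x'\<close> that takes the
    place of \<open>y\<close>, entered at \<open>m1\<close> and left at \<open>m2\<close>.\<close>
  have key: "solid E (M \<union> (D \<union> Z1 \<union> Z2))"
    if M: "ipath E M m1 m2" "M \<subseteq> {x, x'}"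
      "\<And>u m. u \<in> Z1 \<Longrightarrow> m \<in> M \<Longrightarrow> E m u \<longleftrightarrow> u = c \<and> m = m1"
      "\<And>r m. r \<in> Z2 \<Longrightarrow> m \<in> M \<Longrightarrow> E m r \<longleftrightarrow> r = d \<and> m = m2" for M m1 m2
  proof -
    have MZ: "M \<inter> Z1 = {}" "M \<inter> Z2 = {}" "M \<inter> D = {}" using M(2) xs by auto
    have "ipath E (M \<union> Z2) m1 t" by (rule ipath_append[OF M(1) i2]) (use MZ M(4) in auto)
    then have i3: "ipath E (Z1 \<union> (M \<union> Z2)) s t"
    proof (rule ipath_append[OF i1])
      show "Z1 \<inter> (M \<union> Z2) = {}" using MZ Z12 by auto
      fix u v assume uv: "u \<in> Z1" "v \<in> M \<union> Z2"
      show "E u v \<longleftrightarrow> u = c \<and> v = m1"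
      proof (cases "v \<in> M")
        case True then show ?thesis using M(3)[OF uv(1) True] sym[of u v] by simp
      next
        case False
        then have "v \<in> Z2" using uv by auto
        then have "\<not> E u v" using cr[OF uv(1)] FE[of u v] uv by auto
        moreover have "m1 \<in> M" using M(1) ipath_ends by fast
        ultimately show ?thesis using False by auto
      qed
    qed
    have nbM: "nbrs E m D = {}" if "m \<in> M" for m
    proof -
      have "\<not> E m r" if "r \<in> D" for r using yD Fy[of r] that \<open>m \<in> M\<close> M(2) unfolding nbrs_empty by auto
      then show ?thesis unfolding nbrs_empty by blast
    qed
    show ?thesis
    proof (rule solid_earI[OF cE i3])
      fix z assume z: "z \<in> Z1 \<union> (M \<union> Z2)" "z \<noteq> s" "z \<noteq> t"
      show "nbrs E z D = {}"
      proof (cases "z \<in> M")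
        case True then show ?thesis by (rule nbM)
      next
        case False then have "z \<in> Z1 \<union> Z2" using z by auto
        then show ?thesis using int[of z] nbz[of z] z by auto
      qed
    qed (use MZ ee(1) st be in auto)
  qed
  have x1: "E m u \<longleftrightarrow> u = c \<and> E m c" if "u \<in> Z1" "m = x \<or> m = x'" for u m
    using y1[OF that(1)] Fy[of u] that by auto
  have x2: "E m u \<longleftrightarrow> u = d \<and> E m d" if "u \<in> Z2" "m = x \<or> m = x'" for u m
    using y2[OF that(1)] Fy[of u] that by auto
  have cd: "E x c \<or> E x' c" "E x d \<or> E x' d" using y1[of c] y2[of d] Fy mem by auto
  have sing: "solid E ({m} \<union> (D \<union> Z1 \<union> Z2))" if "m = x \<or> m = x'" "E m c" "E m d" for m
    by (rule key[OF ipath.single]) (use that x1 x2 in auto)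
  have dbl: "solid E ({m, m'} \<union> (D \<union> Z1 \<union> Z2))"
    if "m = x \<and> m' = x' \<or> m = x' \<and> m' = x" "E m c" "\<not> E m d" "E m' d" "\<not> E m' c" for m m'
  proof (rule key)
    show "ipath E {m, m'} m m'" using ipath.step[OF ipath.single, of m m' E] that xs sym[of x x'] by auto
    show "E u v \<longleftrightarrow> v = c \<and> u = m" if "v \<in> Z1" "u \<in> {m, m'}" for v u
      using that x1[OF that(1), of u] \<open>m = x \<and> m' = x' \<or> m = x' \<and> m' = x\<close> \<open>E m c\<close> \<open>\<not> E m' c\<close> by auto
    show "E u v \<longleftrightarrow> v = d \<and> u = m'" if "v \<in> Z2" "u \<in> {m, m'}" for v u
      using that x2[OF that(1), of u] \<open>m = x \<and> m' = x' \<or> m = x' \<and> m' = x\<close> \<open>E m' d\<close> \<open>\<not> E m d\<close> by auto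
  qed (use that in auto)
  consider "E x c" "E x d" | "E x' c" "E x' d" | "E x c" "\<not> E x d" "E x' d" "\<not> E x' c"
    | "E x' c" "\<not> E x' d" "E x d" "\<not> E x c" using cd by blast
  then show ?thesis unfolding split_solid_def
  proof cases
    case 1 then show "solid E (insert x (D \<union> Z1 \<union> Z2)) \<or> solid E (insert x' (D \<union> Z1 \<union> Z2)) \<or> solid E (insert x (insert x' (D \<union> Z1 \<union> Z2)))"
      using sing[of x] by auto
  next
    case 2 then show "solid E (insert x (D \<union> Z1 \<union> Z2)) \<or> solid E (insert x' (D \<union> Z1 \<union> Z2)) \<or> solid E (insert x (insert x' (D \<union> Z1 \<union> Z2)))"
      using sing[of x'] by auto
  next
    case 3 then show "solid E (insert x (D \<union> Z1 \<union> Z2)) \<or> solid E (insert x' (D \<union> Z1 \<union> Z2)) \<or> solid E (insert x (insert x' (D \<union> Z1 \<union> Z2)))"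
      using dbl[of x x'] by auto
  next
    case 4 then show "solid E (insert x (D \<union> Z1 \<union> Z2)) \<or> solid E (insert x' (D \<union> Z1 \<union> Z2)) \<or> solid E (insert x (insert x' (D \<union> Z1 \<union> Z2)))"
      using dbl[of x' x] by (auto simp: insert_commute)
  qed
qed

lemma split_ear:
  assumes sp: "splits E F R y x x'" and e: "ears F D Z s t" and disj: "s \<noteq> t \<Longrightarrow> nbrs F s D \<inter> nbrs F t D = {}"
    and y: "y \<in> Z" "insert y R = D \<union> Z"
  shows "split_solid E R x x'"
proof -
  have F: "graph_rel F" and yR: "y \<notin> R" using sp unfolding splits_def by auto
  have ipath: "ipath F Z s t" and DZ: "D \<inter> Z = {}" using e unfolding ears_def by auto
  have fin: ?thesis if sp: "splits E F R y x x'" and e: "ears F D Z s t" and disj: "nbrs F s D \<inter> nbrs F t D = {}"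
    and ne: "s \<noteq> t" and "y = s" for s t
  proof -
    have ipath: "ipath F Z s t" using e unfolding ears_def by auto
    obtain n Z' where Z': "Z = insert s Z'" "s \<notin> Z'" "ipath F Z' n t" by (rule ipath_uncons[OF ipath ne]) blast
    have "insert y R = insert y (D \<union> Z')" using Z' y \<open>y = s\<close> by auto
    moreover have "y \<notin> D \<union> Z'" using Z' y DZ \<open>y = s\<close> by auto
    ultimately have "R = D \<union> Z'" using yR by (metis insert_ident)
    moreover have "Z' \<noteq> {}" using Z'(3) ipath_ends by fast
    ultimately show ?thesis using split_end[of E F D Z' y x x' t] sp e disj \<open>y = s\<close> Z' by auto
  qed
  show ?thesis
  proof (cases "s = t")
    case True
    then have "Z = {s}" using ipath ipath_eqD by metis
    then have "Z = {y}" "s = y" using y by auto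
    then have "R = D" using y yR DZ by auto
    moreover have "icycle F D" "big F (nbrs F y D)" using e \<open>s = y\<close> True unfolding ears_def by auto
    ultimately show ?thesis using split_hub sp by metis
  next
    case False
    consider "y = s" | "y = t" | "y \<noteq> s" "y \<noteq> t" by blast
    then show ?thesis
    proof cases
      case 1 then show ?thesis using fin[OF sp e disj] False by blast
    next
      case 2 then show ?thesis using fin[OF sp ears_rev[OF F e]] disj False by blast
    next
      case 3
      obtain Z1 Z2 c where Z: "Z = Z1 \<union> Z2" "Z1 \<inter> Z2 = {}" "ipath F Z1 s c" "ipath F Z2 y t"
        "\<And>u r. u \<in> Z1 \<Longrightarrow> r \<in> Z2 \<Longrightarrow> F u r \<longleftrightarrow> u = c \<and> r = y" by (rule ipath_cut[OF ipath y(1) 3(1)]) blast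
      obtain d Z3 where Z3: "Z2 = insert y Z3" "y \<notin> Z3" "ipath F Z3 d t" "\<And>p. p \<in> Z3 \<Longrightarrow> F y p \<longleftrightarrow> p = d"
        by (rule ipath_uncons[OF Z(4) 3(2)]) blast
      have "insert y R = insert y (D \<union> Z1 \<union> Z3)" using y Z(1) Z3(1) by auto
      moreover have "y \<notin> D \<union> Z1 \<union> Z3" using y DZ Z(1,2) Z3(1,2) by auto
      ultimately have R: "R = D \<union> Z1 \<union> Z3" using yR by (metis insert_ident)
      show ?thesis unfolding R
      proof (rule split_mid)
        show "splits E F (D \<union> Z1 \<union> Z3) y x x'" using sp R by simp
        have "Z = insert y (Z1 \<union> Z3)" using Z Z3 by auto
        then show "ears F D (insert y (Z1 \<union> Z3)) s t" using e by simp
        show "\<not> F u v" if "u \<in> Z1" "v \<in> Z3" for u v using Z(5)[of u v] Z3 that by auto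
        show "F y p \<longleftrightarrow> p = c" if "p \<in> Z1" for p using Z(5)[of p y] that Z3 graph_rel_sym[OF F, of y p] by auto
      qed (use Z Z3 in auto)
    qed
  qed
qed

text \<open>\<open>m\<close> stands for a preimage of \<open>y\<close>. It sees no more of
  \<open>S\<close> than \<open>y\<close> does, and a missing edge can only help a set to be
  big.\<close>

lemma big_transfer:
  assumes "graph_rel E" "graph_rel F" "big F (insert y S)" "y \<notin> S" "m \<notin> S"
    "\<And>p q. p \<in> S \<Longrightarrow> q \<in> S \<Longrightarrow> F p q \<longleftrightarrow> E p q" "\<And>r. r \<in> S \<Longrightarrow> E m r \<Longrightarrow> F y r"
  shows "big E (insert m S)"
proof (rule ccontr)
  assume nbrs: "\<not> big E (insert m S)"
  show False
  proof (cases "S = {}")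
    case True then show False using assms(3) by simp
  next
    case False
    then have "insert m S \<noteq> {m}" using assms(5) by auto
    then obtain q where q: "insert m S = {m, q}" "q \<noteq> m" "E m q"
      using not_big_at[OF nbrs, of m] by blast
    then have "S = {q}" using assms(5) by auto
    then show False using assms(3,4,7) q by (simp add: big_pair[OF assms(2)])
  qed
qed

text \<open>A set \<open>T\<close> of preimages replaces \<open>y\<close> on the cycle while the ear
  is kept. An end that sees \<open>y\<close> must see nothing else on the cycle: it may see two
  vertices of \<open>T\<close>, and a further neighbour would make its attachment big.\<close>

lemma icycle_replace:
  assumes sp: "splits E F (P \<union> Z) y x x'" and e: "ears F (insert y P) Z s t" and yP: "y \<notin> P"
    and T: "T \<subseteq> {x, x'}" "icycle E (T \<union> P)"
    and TZ: "\<And>z. z \<in> Z \<Longrightarrow> (\<exists>m\<in>T. E m z) \<longleftrightarrow> F y z"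
    and ends: "s \<noteq> t \<Longrightarrow> F y s \<Longrightarrow> nbrs F s P = {}" "s \<noteq> t \<Longrightarrow> F y t \<Longrightarrow> nbrs F t P = {}"
  shows "solid E (T \<union> P \<union> Z)"
proof -
  have E: "graph_rel E" and F: "graph_rel F" and xs: "x \<notin> P" "x' \<notin> P" "x \<noteq> x'" "E x x'" "x \<notin> Z" "x' \<notin> Z" "y \<notin> Z"
    using sp unfolding splits_def by auto
  note sym = graph_rel_sym[OF E] and symF = graph_rel_sym[OF F]
  have FE: "F u v \<longleftrightarrow> E u v" if "u \<in> P \<union> Z" "v \<in> P \<union> Z" for u v using sp that unfolding splits_def by blast
  have Fy: "F y r \<longleftrightarrow> E x r \<or> E x' r" if "r \<in> P \<union> Z" for r using sp that unfolding splits_def by blast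
  have iF: "ipath F Z s t" and PZ: "P \<inter> Z = {}" and bF: "big F (nbrs F s (insert y P) \<union> nbrs F t (insert y P))"
    and nF: "s \<noteq> t \<Longrightarrow> \<not> big F (nbrs F s (insert y P))" "s \<noteq> t \<Longrightarrow> \<not> big F (nbrs F t (insert y P))"
    and int: "\<And>z. s \<noteq> t \<Longrightarrow> z \<in> Z \<Longrightarrow> z \<noteq> s \<Longrightarrow> z \<noteq> t \<Longrightarrow> nbrs F z (insert y P) = {}"
    using e unfolding ears_def by auto
  have st: "s \<in> Z" "t \<in> Z" using iF ipath_ends by metis+
  have iE: "ipath E Z s t" by (rule ipath_cong[OF iF]) (use FE in blast)
  have TC: "\<not> big E S" if "S \<subseteq> T" for S
  proof
    assume "big E S"
    then have "big E {x, x'}" using that T(1) big_mono by blast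
    then show False using xs by (simp add: big_pair[OF E])
  qed
  have nbE: "nbrs E z (T \<union> P) = {m\<in>T. E m z} \<union> nbrs F z P" if "z \<in> Z" for z
    using FE[of z] that sym[of z] by auto
  have nbF: "nbrs F z (insert y P) = (if F y z then {y} else {}) \<union> nbrs F z P" if "z \<in> Z" for z
    using symF[of z y] by auto
  have bc: "big F S \<longleftrightarrow> big E S" if "S \<subseteq> P" for S by (rule big_cong) (use that FE in blast)
  have nbE0: "nbrs E z (T \<union> P) = nbrs F z P" "nbrs F z (insert y P) = nbrs F z P" if "z \<in> Z" "\<not> F y z" for z
    using nbE[OF that(1)] nbF[OF that(1)] TZ[OF that(1)] that by auto
  define S where "S = nbrs F s P \<union> nbrs F t P"
  have SP: "S \<subseteq> P" unfolding S_def by auto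
  have big: "big E (nbrs E s (T \<union> P) \<union> nbrs E t (T \<union> P))"
  proof (cases "F y s \<or> F y t")
    case False
    then have "nbrs E s (T \<union> P) \<union> nbrs E t (T \<union> P) = S" "nbrs F s (insert y P) \<union> nbrs F t (insert y P) = S"
      using nbE0[of s] nbE0[of t] st unfolding S_def by auto
    then show ?thesis using bF bc[OF SP] by simp
  next
    case True
    then obtain m where m: "m \<in> T" "m \<in> nbrs E s (T \<union> P) \<union> nbrs E t (T \<union> P)"
      using TZ[of s] TZ[of t] st sym by auto
    have sub: "insert m S \<subseteq> nbrs E s (T \<union> P) \<union> nbrs E t (T \<union> P)"
      using m nbE[of s] nbE[of t] st unfolding S_def by auto
    have "nbrs F s (insert y P) \<union> nbrs F t (insert y P) = insert y S"
      using True nbF[of s] nbF[of t] st unfolding S_def by auto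
    then have "big F (insert y S)" using bF by simp
    then have "big E (insert m S)"
    proof (rule big_transfer[OF E F])
      show "y \<notin> S" "m \<notin> S" using m T SP xs yP by auto
      show "F p q \<longleftrightarrow> E p q" if "p \<in> S" "q \<in> S" for p q using that FE SP by blast
      show "F y r" if "r \<in> S" "E m r" for r using Fy[of r] that SP m(1) T(1) by auto
    qed
    then show ?thesis using sub big_mono by blast
  qed
  have nbg: "\<not> big E (nbrs E z (T \<union> P))" if "s \<noteq> t" "z = s \<or> z = t" for z
  proof (cases "F y z")
    case True
    then have "nbrs F z P = {}" using ends that by auto
    then show ?thesis using nbE[of z] that st TC[of "nbrs E z (T \<union> P)"] by auto
  next
    case False
    then show ?thesis using nbE0[of z] that st nF bc[of "nbrs F z P"] nbrs_subset[of F z P] by auto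
  qed
  have "ears E (T \<union> P) Z s t"
    unfolding ears_def
  proof (intro conjI impI ballI)
    show "(T \<union> P) \<inter> Z = {}" using T xs PZ by auto
    fix z assume z: "s \<noteq> t" "z \<in> Z - {s, t}"
    then have "nbrs F z (insert y P) = {}" using int by auto
    then have "\<not> F y z" "nbrs F z P = {}" using symF[of y z] unfolding nbrs_empty by auto
    then show "nbrs E z (T \<union> P) = {}" using nbE0[of z] z by auto
  qed (use T iE big nbg in auto)
  then show ?thesis by (rule solid_ears) auto
qed

text \<open>\<open>x\<close> alone can take the place of \<open>y\<close> on the cycle, unless the
  ear is attached to \<open>y\<close> through \<open>x'\<close> only. Then \<open>x'\<close>
  replaces \<open>y\<close> if it also sees both \<open>a\<close> and \<open>b\<close>; otherwise it
  prolongs the ear, with an attachment consisting of \<open>x\<close> and at most one of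
  \<open>a\<close>, \<open>b\<close>.\<close>

lemma split_cycle_aux:
  assumes sp: "splits E F (P \<union> Z) y x x'" and e: "ears F (insert y P) Z s t" and yP: "y \<notin> P"
    and P: "ipath F P a b" "a \<noteq> b" "\<And>p. p \<in> P \<Longrightarrow> F y p \<longleftrightarrow> p = a \<or> p = b"
    and yz: "\<And>z. z \<in> Z \<Longrightarrow> F y z \<Longrightarrow> z = s"
    and single: "s \<noteq> t \<Longrightarrow> F y s \<Longrightarrow> nbrs F s P = {}"
    and xab: "E x a" "E x b"
  shows "split_solid E (P \<union> Z) x x'"
proof -
  have E: "graph_rel E" and F: "graph_rel F" and xs: "x \<notin> P" "x' \<notin> P" "x \<noteq> x'" "E x x'" "x \<notin> Z" "x' \<notin> Z" "y \<notin> Z"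
    using sp unfolding splits_def by auto
  note sym = graph_rel_sym[OF E] and symF = graph_rel_sym[OF F]
  have FE: "F u v \<longleftrightarrow> E u v" if "u \<in> P \<union> Z" "v \<in> P \<union> Z" for u v using sp that unfolding splits_def by blast
  have Fy: "F y r \<longleftrightarrow> E x r \<or> E x' r" if "r \<in> P \<union> Z" for r using sp that unfolding splits_def by blast
  have iF: "ipath F Z s t" and PZ: "P \<inter> Z = {}" and bF: "big F (nbrs F s (insert y P) \<union> nbrs F t (insert y P))"
    and nF: "s \<noteq> t \<Longrightarrow> \<not> big F (nbrs F s (insert y P))" "s \<noteq> t \<Longrightarrow> \<not> big F (nbrs F t (insert y P))"
    and int: "\<And>z. s \<noteq> t \<Longrightarrow> z \<in> Z \<Longrightarrow> z \<noteq> s \<Longrightarrow> z \<noteq> t \<Longrightarrow> nbrs F z (insert y P) = {}"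
    using e unfolding ears_def by auto
  have st: "s \<in> Z" "t \<in> Z" using iF ipath_ends by metis+
  have iP: "ipath E P a b" by (rule ipath_cong[OF P(1)]) (use FE in blast)
  have iE: "ipath E Z s t" by (rule ipath_cong[OF iF]) (use FE in blast)
  have ab: "a \<in> P" "b \<in> P" using iP ipath_ends by metis+
  have yt: "s \<noteq> t \<Longrightarrow> \<not> F y t" using yz[of t] st by auto
  have xp: "E m p \<Longrightarrow> p = a \<or> p = b" if "p \<in> P" "m = x \<or> m = x'" for m p
    using P(3)[OF that(1)] Fy[of p] that by auto
  have cyc1: "icycle E (insert m P)" if "E m a" "E m b" "m = x \<or> m = x'" for m
    by (rule icycleI[OF iP P(2)]) (use xs xp[of _ m] that in auto)
  have direct: "solid E (insert m (P \<union> Z))" if m: "m = x \<or> m = x'" "E m a" "E m b" "F y s \<longrightarrow> E m s" for m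
  proof -
    have "solid E ({m} \<union> P \<union> Z)"
    proof (rule icycle_replace[OF sp e yP])
      show "(\<exists>m'\<in>{m}. E m' z) \<longleftrightarrow> F y z" if "z \<in> Z" for z
        using Fy[of z] yz[of z] that m by auto
    qed (use m cyc1[of m] single yt in auto)
    then show ?thesis by simp
  qed
  show ?thesis
  proof (cases "F y s \<longrightarrow> E x s")
    case True then show ?thesis using direct[of x] xab unfolding split_solid_def by auto
  next
    case no: False
    then have ys: "F y s" "\<not> E x s" "E x' s" using Fy[of s] st by auto
    have s't: "E x' z \<longleftrightarrow> z = s" "\<not> E x z" if "z \<in> Z" for z using yz[OF that] Fy[of z] ys that by auto
    show ?thesis
    proof (cases "E x' a \<and> E x' b")
      case True then show ?thesis using direct[of x'] ys unfolding split_solid_def by auto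
    next
      case False
      define D1 where "D1 = insert x P"
      have c1: "icycle E D1" unfolding D1_def using cyc1[of x] xab by auto
      have nbz: "nbrs E z D1 = nbrs F z P" if "z \<in> Z" for z
        using FE[of z] s't(2)[OF that] sym[of z x] that unfolding D1_def by auto
      \<comment> \<open>If the ear has two ends, \<open>s\<close> sees only \<open>y\<close> on the
        cycle. So the big union consists of \<open>y\<close> and what \<open>t\<close> sees on
        \<open>P\<close>, and \<open>x\<close> inherits the part of \<open>y\<close> in it.\<close>
      have bt: "big F (insert y (nbrs F t P))"
      proof -
        have "nbrs F s (insert y P) \<union> nbrs F t (insert y P) = insert y (nbrs F t P)"
          using single[OF _ ys(1)] ys(1) yt symF[of _ y] by (cases "s = t") auto
        then show ?thesis using bF by simp
      qed
      have bx: "big E (insert x (nbrs F t P))"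
        by (rule big_transfer[OF E F bt]) (use yP xs FE Fy in auto)
      \<comment> \<open>A one-vertex ear may have a big attachment even without \<open>y\<close>. It
        is then a hub of the cycle \<open>D1\<close> and must not be prolonged, because the end
        \<open>t\<close> of the longer ear would have a big attachment of its own.\<close>
      show ?thesis
      proof (cases "s = t \<and> big E (nbrs F s P)")
        case True
        then have "Z = {s}" using iE ipath_eqD by metis
        have "solid E (insert s D1)"
          by (rule solid_hub[OF c1]) (use True nbz[OF st(1)] st PZ xs D1_def in auto)
        moreover have "insert s D1 = insert x (P \<union> Z)" using \<open>Z = {s}\<close> D1_def by auto
        ultimately show ?thesis unfolding split_solid_def by simp
      next
        case hub: False
        have "solid E (insert x (insert x' (P \<union> Z)))"
        proof (rule solid_earI[OF c1])
          show "ipath E (insert x' Z) x' t" by (rule ipath.step[OF iE]) (use xs s't in auto)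
          show "D1 \<inter> insert x' Z = {}" using xs PZ D1_def by auto
          show "x' \<noteq> t" using xs st by auto
          have sub: "nbrs E x' D1 \<subseteq> {x, a, b}" unfolding nbrs_def D1_def using xp[of _ x'] by blast
          have "nbrs E x' D1 \<subseteq> {x, a} \<or> nbrs E x' D1 \<subseteq> {x, b}"
          proof (cases "E x' a")
            case True
            then have "b \<notin> nbrs E x' D1" using False by simp
            then show ?thesis using sub by blast
          next
            case False
            then have "a \<notin> nbrs E x' D1" by simp
            then show ?thesis using sub by blast
          qed
          moreover have "\<not> big E {x, a}" "\<not> big E {x, b}" using xab by (simp_all add: big_pair[OF E])
          ultimately show "\<not> big E (nbrs E x' D1)" using big_mono by metis
          show "\<not> big E (nbrs E t D1)"
          proof (cases "s = t")
            case True then show ?thesis using hub nbz[OF st(2)] by auto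
          next
            case False
            then have "nbrs F t (insert y P) = nbrs F t P" using yt symF[of t y] by auto
            then have "\<not> big F (nbrs F t P)" using nF(2)[OF False] by simp
            moreover have "big F (nbrs F t P) \<longleftrightarrow> big E (nbrs F t P)" by (rule big_cong) (use FE in auto)
            ultimately show ?thesis using nbz[OF st(2)] by simp
          qed
          have "insert x (nbrs F t P) \<subseteq> nbrs E x' D1 \<union> nbrs E t D1"
            using nbz[OF st(2)] sym[of x x'] xs D1_def by auto
          then show "big E (nbrs E x' D1 \<union> nbrs E t D1)" using bx big_mono by metis
          fix z assume z: "z \<in> insert x' Z" "z \<noteq> x'" "z \<noteq> t"
          then have zZ: "z \<in> Z" by auto
          have "s \<noteq> t" using ipath_eqD[OF iE] zZ z by auto
          have "nbrs F z P = {}"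
          proof (cases "z = s")
            case True then show ?thesis using single[OF \<open>s \<noteq> t\<close> ys(1)] by simp
          next
            case False then show ?thesis using int[OF \<open>s \<noteq> t\<close> zZ False z(3)] unfolding nbrs_empty by auto
          qed
          then show "nbrs E z D1 = {}" using nbz[OF zZ] by simp
        qed (use D1_def in auto)
        then show ?thesis unfolding split_solid_def by blast
      qed
    qed
  qed
qed

text \<open>For an ear with two ends, the hypotheses let only \<open>s\<close> see \<open>y\<close>,
  and then nothing else on the cycle; the opposite case is moved to the ear by
  \<open>swap_ear\<close>. If neither \<open>x\<close> nor \<open>x'\<close> sees both neighbours
  \<open>a\<close>, \<open>b\<close> of \<open>y\<close>, the cycle passes through \<open>x\<close>
  and \<open>x'\<close> one after the other.\<close>

lemma split_cycle:
  assumes sp: "splits E F R y x x'" and e: "ears F D Z s t" and y: "y \<in> D" "insert y R = D \<union> Z"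
    and yt: "s \<noteq> t \<Longrightarrow> \<not> F t y" and single: "s \<noteq> t \<Longrightarrow> F s y \<Longrightarrow> nbrs F s D = {y}"
  shows "split_solid E R x x'"
proof -
  have E: "graph_rel E" and F: "graph_rel F" and yR: "y \<notin> R" using sp unfolding splits_def by auto
  note sym = graph_rel_sym[OF E] and symF = graph_rel_sym[OF F]
  have cF: "icycle F D" and DZ: "D \<inter> Z = {}" and iF: "ipath F Z s t" using e unfolding ears_def by auto
  obtain P a b where P: "D = insert y P" "y \<notin> P" "ipath F P a b" "a \<noteq> b"
    "\<And>r. r \<in> P \<Longrightarrow> F y r \<longleftrightarrow> r = a \<or> r = b" using icycle_at[OF F cF y(1)] by metis
  have "insert y R = insert y (P \<union> Z)" using y P by auto
  moreover have "y \<notin> P \<union> Z" using P DZ by auto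
  ultimately have R: "R = P \<union> Z" using yR by (metis insert_ident)
  have sp': "splits E F (P \<union> Z) y x x'" and e': "ears F (insert y P) Z s t" using sp e R P by auto
  have yz: "z = s" if "z \<in> Z" "F y z" for z
  proof (cases "s = t")
    case True then show ?thesis using iF ipath_eqD that by fastforce
  next
    case False
    have "nbrs F z D = {}" if "z \<noteq> s" "z \<noteq> t" using e False that \<open>z \<in> Z\<close> unfolding ears_def by auto
    then show ?thesis using that yt[OF False] y(1) symF[of y z] unfolding nbrs_empty by blast
  qed
  have sg': "nbrs F s P = {}" if "s \<noteq> t" "F y s"
  proof -
    have "nbrs F s D = {y}" using single[OF that(1)] that(2) symF[of y s] by blast
    moreover have "nbrs F s P \<subseteq> nbrs F s D" "y \<notin> nbrs F s P" using P(1,2) by auto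
    ultimately have "nbrs F s P \<subseteq> {y}" by simp
    then show ?thesis using \<open>y \<notin> nbrs F s P\<close> by (metis singletonI subset_singletonD)
  qed
  have xs: "x \<notin> P" "x' \<notin> P" "x \<noteq> x'" "E x x'" "x \<notin> Z" "x' \<notin> Z" using sp' unfolding splits_def by auto
  have FE: "F u v \<longleftrightarrow> E u v" if "u \<in> P \<union> Z" "v \<in> P \<union> Z" for u v using sp' that unfolding splits_def by blast
  have Fy: "F y r \<longleftrightarrow> E x r \<or> E x' r" if "r \<in> P \<union> Z" for r using sp' that unfolding splits_def by blast
  have ab: "a \<in> P" "b \<in> P" using P ipath_ends by metis+
  have iP: "ipath E P a b" by (rule ipath_cong[OF P(3)]) (use FE in blast)
  have xp: "p = a \<or> p = b" if "p \<in> P" "m = x \<or> m = x'" "E m p" for m p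
    using P(5)[OF that(1)] Fy[of p] that by auto
  have beta: ?thesis if m: "m = x \<and> m' = x' \<or> m = x' \<and> m' = x" "E m a" "\<not> E m b" "E m' b" "\<not> E m' a" for m m'
  proof -
    have mm: "E m m'" "E m' m" using m xs sym[of x x'] by auto
    have "icycle E (P \<union> {m', m})"
    proof (rule icycle_join[OF E iP])
      show "ipath E {m', m} m' m" using ipath.step[OF ipath.single, of m' m E] m mm xs by auto
      fix u v assume "u \<in> P" "v \<in> {m', m}"
      then show "E u v \<longleftrightarrow> u = b \<and> v = m' \<or> u = a \<and> v = m"
        using m xp[of u v] sym[of u v] P(4) by auto
    qed (use m xs P(4) in auto)
    moreover have "P \<union> {m', m} = {x, x'} \<union> P" using m by auto
    ultimately have c: "icycle E ({x, x'} \<union> P)" by simp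
    have "solid E ({x, x'} \<union> P \<union> Z)"
    proof (rule icycle_replace[OF sp' e' P(2) _ c])
      show "(\<exists>m\<in>{x, x'}. E m z) \<longleftrightarrow> F y z" if "z \<in> Z" for z using Fy[of z] that by auto
      show "nbrs F t P = {}" if "s \<noteq> t" "F y t" using yt that symF[of y t] by auto
    qed (use sg' in auto)
    then show ?thesis unfolding split_solid_def R by simp
  qed
  have cov: "E x a \<or> E x' a" "E x b \<or> E x' b" using P(5) Fy ab by auto
  consider "E x a" "E x b" | "E x' a" "E x' b" | "E x a" "\<not> E x b" "E x' b" "\<not> E x' a"
    | "E x' a" "\<not> E x' b" "E x b" "\<not> E x a" using cov by blast
  then show ?thesis
  proof cases
    case 1
    then show ?thesis unfolding R using split_cycle_aux[OF sp' e' P(2-5) yz sg'] by blast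
  next
    case 2
    then have "split_solid E (P \<union> Z) x' x" using split_cycle_aux[OF splits_sym[OF sp'] e' P(2-5) yz sg'] by blast
    then show ?thesis unfolding R by (simp add: split_solid_sym)
  next
    case 3 then show ?thesis using beta[of x x'] by auto
  next
    case 4 then show ?thesis using beta[of x' x] by auto
  qed
qed

text \<open>A vertex of the cycle in an adjacent attachment pair can be moved into the ear, by exchanging the ear with an arc of the cycle.\<close>

lemma swap_ear:
  assumes E: "graph_rel E" and e: "ears E D Z s t" and disj: "nbrs E s D \<inter> nbrs E t D = {}" and st: "s \<noteq> t"
    and y: "y \<in> D" "E s y" "nbrs E s D \<noteq> {y}"
  obtains D' Z' s' t' where "D' \<union> Z' = D \<union> Z" "ears E D' Z' s' t'" "s' \<noteq> t' \<Longrightarrow> nbrs E s' D' \<inter> nbrs E t' D' = {}" "y \<in> Z'"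
proof -
  note sym = graph_rel_sym[OF E] and irr = graph_rel_irrefl[OF E]
  have ee: "icycle E D" "ipath E Z s t" "D \<inter> Z = {}" "big E (nbrs E s D \<union> nbrs E t D)"
      "\<not> big E (nbrs E s D)" "\<not> big E (nbrs E t D)" "\<And>z. z \<in> Z \<Longrightarrow> z \<noteq> s \<Longrightarrow> z \<noteq> t \<Longrightarrow> nbrs E z D = {}"
      using e st unfolding ears_def by auto
  have stZ: "s \<in> Z" "t \<in> Z" using ee(2) ipath_ends by metis+
  obtain p where p: "nbrs E s D = {y, p}" "p \<noteq> y" "E y p" using not_big_at[OF ee(5), of y] y by auto
  obtain P0 a0 b0 where P0: "D = insert y P0" "y \<notin> P0" "ipath E P0 a0 b0" "a0 \<noteq> b0"
    "\<And>r. r \<in> P0 \<Longrightarrow> E y r \<longleftrightarrow> r = a0 \<or> r = b0" using icycle_at[OF E ee(1) y(1)] by metis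
  have pD: "p \<in> D" using p(1) by auto
  then have "p = a0 \<or> p = b0" using P0 p by auto
  then obtain P b where P: "D = insert y P" "y \<notin> P" "ipath E P p b" "p \<noteq> b" "\<And>r. r \<in> P \<Longrightarrow> E y r \<longleftrightarrow> r = p \<or> r = b"
    using P0 ipath_rev[OF E P0(3)] that by metis
  define B where "B = nbrs E t D"
  have B: "y \<notin> B" "p \<notin> B" "\<not> big E B" "B \<noteq> {}" "B \<subseteq> P"
    using disj p ee(4-6) P(1) unfolding B_def by auto
  \<comment> \<open>\<open>q\<close> is the first vertex, coming from \<open>p\<close>, that
    \<open>t\<close> sees. The attachment of \<open>t\<close> is at most an edge, so an attached
    vertex before a tentative cut must be the last one before it, and the cut moves by one
    step.\<close>
  have "\<exists>P1 P2 c q. P = P1 \<union> P2 \<and> P1 \<inter> P2 = {} \<and> ipath E P1 p c \<and> ipath E P2 q b \<and>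
     (\<forall>u\<in>P1. \<forall>r\<in>P2. E u r \<longleftrightarrow> u = c \<and> r = q) \<and> q \<in> B \<and> P1 \<inter> B = {}"
  proof -
    obtain q where q: "q \<in> B" "q \<in> P" "q \<noteq> p" using B by auto
    obtain P1 P2 c where cut: "P = P1 \<union> P2" "P1 \<inter> P2 = {}" "ipath E P1 p c" "ipath E P2 q b"
      "\<And>u r. u \<in> P1 \<Longrightarrow> r \<in> P2 \<Longrightarrow> E u r \<longleftrightarrow> u = c \<and> r = q" by (rule ipath_cut[OF P(3) q(2,3)]) blast
    show ?thesis
    proof (cases "P1 \<inter> B = {}")
      case True
      then show ?thesis
        by (intro exI[of _ P1] exI[of _ P2] exI[of _ c] exI[of _ q]) (use cut q in auto)
    next
      case False
      then obtain c' where c': "c' \<in> P1" "c' \<in> B" by auto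
      have qP2: "q \<in> P2" using cut ipath_ends by metis
      have "c' \<noteq> q" using c' cut(2) qP2 by auto
      then have "B = {q, c'}" "E q c'" using not_big_at[OF B(3) q(1)] c'(2) by (metis insertE singletonD)+
      then have "c' = c" using cut(5)[OF c'(1) qP2] sym[of q c'] by auto
      have "c \<noteq> p" using c' \<open>c' = c\<close> B by auto
      obtain Q1 Q2 c0 where Q: "P1 = Q1 \<union> Q2" "Q1 \<inter> Q2 = {}" "ipath E Q1 p c0" "ipath E Q2 c c"
        "\<And>u r. u \<in> Q1 \<Longrightarrow> r \<in> Q2 \<Longrightarrow> E u r \<longleftrightarrow> u = c0 \<and> r = c"
        by (rule ipath_cut[OF cut(3), of c]) (use c' \<open>c' = c\<close> \<open>c \<noteq> p\<close> in auto)
      have Q2: "Q2 = {c}" using Q(4) ipath_eqD by metis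
      have "ipath E (insert c P2) c b"
        by (rule ipath.step[OF cut(4)]) (use cut(2,5) c' \<open>c' = c\<close> in auto)
      moreover have "E u r \<longleftrightarrow> u = c0 \<and> r = c" if "u \<in> Q1" "r \<in> insert c P2" for u r
        using that Q(2) Q(5)[of u r] cut(2) cut(5)[of u r] Q(1) Q2 c' \<open>c' = c\<close> by auto
      ultimately show ?thesis
        by (intro exI[of _ Q1] exI[of _ "insert c P2"] exI[of _ c0] exI[of _ c])
          (use Q(1-3) Q2 cut(1,2) c' \<open>c' = c\<close> \<open>B = {q, c'}\<close> qP2 in auto)
    qed
  qed
  then obtain P1 P2 c q where cut: "P = P1 \<union> P2" "P1 \<inter> P2 = {}" "ipath E P1 p c" "ipath E P2 q b"
     "\<And>u r. u \<in> P1 \<Longrightarrow> r \<in> P2 \<Longrightarrow> E u r \<longleftrightarrow> u = c \<and> r = q" "q \<in> B" "P1 \<inter> B = {}" by metis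
  have mem: "p \<in> P1" "c \<in> P1" "q \<in> P2" "b \<in> P2" using cut ipath_ends by metis+
  have sD: "E s d \<longleftrightarrow> d = y \<or> d = p" if "d \<in> D" for d
  proof -
    have "d \<in> nbrs E s D \<longleftrightarrow> d = y \<or> d = p" unfolding p(1) by auto
    then show ?thesis using that by simp
  qed
  have tD: "E t d \<longleftrightarrow> d \<in> B" if "d \<in> D" for d using that unfolding B_def by auto
  have zD: "\<not> E z d" if "z \<in> Z" "z \<noteq> s" "z \<noteq> t" "d \<in> D" for z d using ee(7)[OF that(1-3)] that(4) unfolding nbrs_empty by auto
  have qB: "r \<in> B \<Longrightarrow> r = q \<or> E q r" for r using B(3) big2[OF cut(6), of r E] by blast
  have ipq: "ipath E (P1 \<union> {q}) p q" by (rule ipath_append[OF cut(3) ipath.single]) (use cut mem in auto)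
  \<comment> \<open>The new cycle leads from \<open>s\<close> over \<open>p\<close> to
    \<open>q\<close> and back through \<open>Z\<close>. What remains of the old cycle, from
    \<open>y\<close> round to the vertex after \<open>q\<close>, becomes the ear; it is
    \<open>y\<close> alone if \<open>q = b\<close>.\<close>
  define D' where "D' = (P1 \<union> {q}) \<union> Z"
  have c': "icycle E D'" unfolding D'_def
  proof (rule icycle_join[OF E ipq ipath_rev[OF E ee(2)]])
    show "(P1 \<union> {q}) \<inter> Z = {}" using ee(3) cut mem P by auto
    show "p \<noteq> q \<or> t \<noteq> s" using st by auto
    fix u v assume uv: "u \<in> P1 \<union> {q}" "v \<in> Z"
    then have uD: "u \<in> D" "u \<noteq> y" using P cut mem by auto
    have "q \<noteq> p" using mem cut by auto
    have "E v u \<longleftrightarrow> u = q \<and> v = t \<or> u = p \<and> v = s"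
      using uv uD sD[of u] tD[of u] zD[of v u] cut(6,7) st \<open>q \<noteq> p\<close> by auto
    then show "E u v \<longleftrightarrow> u = q \<and> v = t \<or> u = p \<and> v = s" using sym[of u v] by simp
  qed
  have ys: "E y s" "E y p" "\<not> E y t" using y sym[of y s] p(3) tD[of y] B(1) sym[of y t] by auto
  have yD': "y \<notin> D'" unfolding D'_def using P cut mem ee(3) by auto
  show thesis
  proof (cases "q = b")
    case True
    then have "P2 = {q}" using cut ipath_eqD by metis
    then have "D' \<union> {y} = D \<union> Z" unfolding D'_def using P cut by auto
    moreover have "ears E D' {y} y y"
    proof -
      have "big E (nbrs E y D')"
        by (rule big3[of p _ s b]) (use ys True P mem cut ee(3) stZ in \<open>auto simp: D'_def\<close>)
      then show ?thesis unfolding ears_def using c' yD' ipath.single by auto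
    qed
    ultimately show ?thesis using that[of D' "{y}" y y] by auto
  next
    case False
    obtain n P3 where P3: "P2 = insert q P3" "q \<notin> P3" "ipath E P3 n b" "\<And>r. r \<in> P3 \<Longrightarrow> E q r \<longleftrightarrow> r = n"
      by (rule ipath_uncons[OF cut(4) False]) blast
    have n: "n \<in> P3" "b \<in> P3" using P3 ipath_ends by metis+
    have ipy: "ipath E (insert y P3) y n"
    proof (rule ipath.step[OF ipath_rev[OF E P3(3)]])
      show "E y r \<longleftrightarrow> r = b" if "r \<in> P3" for r using P(5)[of r] that P3 cut mem by auto
    qed (use P cut P3 in auto)
    have r3: "r \<in> D" "r \<noteq> y" "r \<noteq> p" "r \<noteq> q" "r \<notin> P1" if "r \<in> P3" for r using that P cut P3 mem by auto
    have r3B: "r = n" if "r \<in> P3" "r \<in> B" for r using qB[OF that(2)] P3(4)[OF that(1)] r3[OF that(1)] by auto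
    have rz: "E r z \<longleftrightarrow> r = n \<and> n \<in> B \<and> z = t" if "r \<in> P3" "z \<in> Z" for r z
    proof -
      have "E z r \<longleftrightarrow> r = n \<and> n \<in> B \<and> z = t"
        using sD[of r] tD[of r] zD[of z r] r3[OF that(1)] r3B[OF that(1)] that st by auto
      then show ?thesis using sym[of r z] by simp
    qed
    have rP: "\<not> E r u" if "r \<in> P3" "u \<in> P1" for r u
      using cut(5)[OF that(2), of r] sym[of u r] P3(1,2) that by auto
    have rq: "E r q \<longleftrightarrow> r = n" if "r \<in> P3" for r using P3(4)[OF that] sym[of r q] by simp
    have qD: "q \<in> D" using P cut mem by auto
    have Eqt: "E q t" using tD[OF qD] cut(6) sym[of q t] by simp
    have yq: "\<not> E y q" using P(5)[of q] False mem cut by auto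
    have yP1: "E y u \<longleftrightarrow> u = p" if "u \<in> P1" for u using P(5)[of u] that mem cut by auto
    have yZ: "E y z \<longleftrightarrow> z = s" if "z \<in> Z" for z using ys zD[OF that, of y] y(1) sym[of y z] by auto
    have nby: "nbrs E y D' = {p, s}" unfolding D'_def using yq yP1 yZ mem stZ by auto
    have nbr: "nbrs E r D' = (if r = n then insert q (if n \<in> B then {t} else {}) else {})" if "r \<in> P3" for r
      unfolding D'_def using rz[OF that] rP[OF that] rq[OF that] stZ by auto
    have ne: "q \<noteq> p" "q \<noteq> s" "t \<noteq> p" using mem cut ee(3) qD stZ pD by auto
    have "ears E D' (insert y P3) y n"
      unfolding ears_def
    proof (intro conjI impI ballI)
      have "P3 \<inter> Z = {}" using r3(1) ee(3) by blast
      then show "D' \<inter> insert y P3 = {}" using yD' r3(4,5) unfolding D'_def by blast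
      show "big E (nbrs E y D' \<union> nbrs E n D')" unfolding nby nbr[OF n(1)]
        by (rule big3[of p _ s q]) (use ne pD stZ ee(3) in auto)
      have "\<not> big E {p, s}" "\<not> big E {q, t}" using y sD[OF pD] sym[of p s] Eqt by (simp_all add: big_pair[OF E])
      then show "\<not> big E (nbrs E y D')" "\<not> big E (nbrs E n D')" unfolding nby nbr[OF n(1)]
        by auto
      show "nbrs E z D' = {}" if "z \<in> insert y P3 - {y, n}" for z using nbr[of z] that by auto
    qed (use c' ipy in auto)
    moreover have "D' \<union> insert y P3 = D \<union> Z" unfolding D'_def using P cut P3 by auto
    moreover have "nbrs E y D' \<inter> nbrs E n D' = {}" unfolding nby nbr[OF n(1)] using ne st by auto
    ultimately show ?thesis using that[of D' "insert y P3" y n] by auto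
  qed
qed

text \<open>With disjoint attachments, a vertex \<open>y\<close> of the cycle is seen by at most one
  end of a longer ear; after a reversal this is \<open>s\<close>. If \<open>s\<close> sees a second
  vertex of the cycle, \<open>swap_ear\<close> brings \<open>y\<close> onto the ear, and otherwise
  \<open>split_cycle\<close> applies.\<close>

theorem solid_split:
  assumes sp: "splits E F R y x x'" and s: "solid F (insert y R)"
  shows "split_solid E R x x'"
proof -
  have F: "graph_rel F" using sp unfolding splits_def by auto
  obtain D Z s t where W: "insert y R = D \<union> Z" "ears F D Z s t" "s \<noteq> t \<Longrightarrow> nbrs F s D \<inter> nbrs F t D = {}"
    using solid_disjoint[OF F s] by metis
  have main: ?thesis if W: "insert y R = D \<union> Z" "ears F D Z s t" "s \<noteq> t \<Longrightarrow> nbrs F s D \<inter> nbrs F t D = {}"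
    and y: "y \<in> D" "s \<noteq> t \<Longrightarrow> \<not> F t y" for D Z s t
  proof (cases "s \<noteq> t \<and> F s y \<and> nbrs F s D \<noteq> {y}")
    case False then show ?thesis using split_cycle[OF sp W(2) y(1) W(1) y(2)] by blast
  next
    case True
    then obtain D' Z' s' t' where "D' \<union> Z' = D \<union> Z" "ears F D' Z' s' t'" "s' \<noteq> t' \<Longrightarrow> nbrs F s' D' \<inter> nbrs F t' D' = {}" "y \<in> Z'"
      using swap_ear[OF F W(2) W(3) _ y(1)] by metis
    then show ?thesis using split_ear[OF sp] W(1) by metis
  qed
  show ?thesis
  proof (cases "y \<in> Z")
    case True then show ?thesis using split_ear[OF sp W(2,3) True W(1)] by blast
  next
    case False
    then have y: "y \<in> D" using W(1) by auto
    show ?thesis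
    proof (cases "s \<noteq> t \<and> F t y")
      case False then show ?thesis using main[OF W y] by blast
    next
      case True
      then have "\<not> F s y" using W(3) y by auto
      then show ?thesis using main[OF W(1) ears_rev[OF F W(2)] _ y] W(3) True by blast
    qed
  qed
qed

subsection \<open>Cliques in solids\<close>

lemma ipath_triangle_free:
  assumes E: "graph_rel E" and "ipath E P a b" "p \<in> P" "q \<in> P" "r \<in> P" "E p q" "E q r" "E p r"
  shows False
  using assms(2-)
proof (induction arbitrary: p q r rule: ipath.induct)
  case (single a) then show ?case using graph_rel_irrefl[OF E] by auto
next
  case (step P b c a)
  note s = graph_rel_sym[OF E] graph_rel_irrefl[OF E]
  have ne: "p \<noteq> q" "q \<noteq> r" "p \<noteq> r" using step.prems s(2) by metis+
  show ?case
  proof (cases "a = p \<or> a = q \<or> a = r")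
    case True
    have u: "E a u \<Longrightarrow> u \<in> insert a P \<Longrightarrow> u = b" for u using step.hyps(3)[of u] s(2) by auto
    show ?thesis using True step.prems u[of p] u[of q] u[of r] s(1)[of p q] s(1)[of q r] s(1)[of p r] ne by auto
  next
    case False then show ?thesis using step by blast
  qed
qed

lemma ipath_no_icycle:
  assumes E: "graph_rel E" and "ipath E P a b" "D \<subseteq> P" "icycle E D"
  shows False
  using assms(2-)
proof (induction rule: ipath.induct)
  case (single a)
  then show ?case using icycle_big[OF single(2)] big_mono[of E D "{a}"] by simp
next
  case (step P b c a)
  show ?case
  proof (cases "a \<in> D")
    case True
    obtain p q where pq: "p \<in> D" "q \<in> D" "p \<noteq> q" "p \<noteq> a" "q \<noteq> a" "\<And>r. r \<in> D \<Longrightarrow> E a r \<longleftrightarrow> r = p \<or> r = q"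
      by (rule icycle_nbrs[OF E step.prems(2) True]) blast
    have "p \<in> P" "q \<in> P" "E a p" "E a q" using pq step.prems(1) by auto
    then show ?thesis using step.hyps(3) pq(3) by auto
  next
    case False then show ?thesis using step by blast
  qed
qed

lemma ipath_interior:
  assumes E: "graph_rel E" and P: "ipath E P a b" "v \<in> P" "v \<noteq> a" "v \<noteq> b"
  obtains p q where "p \<in> P" "q \<in> P" "p \<noteq> q" "E v p" "E v q" "\<not> E p q"
proof -
  obtain P1 P2 c where c: "P = P1 \<union> P2" "P1 \<inter> P2 = {}" "ipath E P1 a c" "ipath E P2 v b"
    "\<And>u r. u \<in> P1 \<Longrightarrow> r \<in> P2 \<Longrightarrow> E u r \<longleftrightarrow> u = c \<and> r = v" by (rule ipath_cut[OF P(1-3)]) blast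
  obtain n R where R: "P2 = insert v R" "v \<notin> R" "ipath E R n b" "\<And>p. p \<in> R \<Longrightarrow> E v p \<longleftrightarrow> p = n"
    by (rule ipath_uncons[OF c(4) P(4)]) blast
  have m: "c \<in> P1" "n \<in> R" using ipath_ends[OF c(3)] ipath_ends[OF R(3)] by auto
  show thesis
  proof (rule that[of c n])
    show "E v c" using c(5)[of c v] m R graph_rel_sym[OF E, of v c] by auto
    show "\<not> E c n" using c(5)[of c n] m R by auto
  qed (use m c R in auto)
qed

text \<open>The first vertex \<open>a\<close> of the whole path has at most one neighbour. If its
  part has further vertices, \<open>a\<close> is an end of that part and has its neighbour there; so
  it has no edge to the other part and can be removed.\<close>

lemma ipath_cross_unique:
  assumes E: "graph_rel E" and "ipath E P a b" "P = Q \<union> Z" "Q \<inter> Z = {}" "ipath E Q c d" "ipath E Z s t"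
    "q \<in> Q" "q' \<in> Q" "z \<in> Z" "z' \<in> Z" "E q z" "E q' z'"
  shows "q = q' \<and> z = z'"
  using assms(2-)
proof (induction arbitrary: Q Z c d s t q q' z z' rule: ipath.induct)
  case (single a)
  then show ?case by (metis Int_iff Un_iff empty_iff singletonD)
next
  case (step P b0 c0 a)
  note sym = graph_rel_sym[OF E] and irr = graph_rel_irrefl[OF E]
  have main: "q = q' \<and> z = z'" if aQ: "a \<in> Q" and h: "insert a P = Q \<union> Z" "Q \<inter> Z = {}" "ipath E Q c d" "ipath E Z s t"
    "q \<in> Q" "q' \<in> Q" "z \<in> Z" "z' \<in> Z" "E q z" "E q' z'" for Q Z c d s t q q' z z'
  proof -
    have one: "E a u \<longleftrightarrow> u = b0" if "u \<in> Q \<union> Z" "u \<noteq> a" for u using step.hyps(3)[of u] that h(1) by auto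
    show ?thesis
    proof (cases "Q = {a}")
      case True
      then show ?thesis using h one[of z] one[of z'] by auto
    next
      case False
      have "a = c \<or> a = d"
      proof (rule ccontr)
        assume "\<not> (a = c \<or> a = d)"
        then obtain u v where uv: "u \<in> Q" "v \<in> Q" "u \<noteq> v" "E a u" "E a v"
          using ipath_interior[OF E h(3) aQ] by metis
        then show False using one[of u] one[of v] irr[of a] by auto
      qed
      then obtain d' where iQ: "ipath E Q a d'" using h(3) ipath_rev[OF E h(3)] by auto
      have ad: "a \<noteq> d'" using False ipath_eqD[OF iQ] by auto
      obtain n R where R: "Q = insert a R" "a \<notin> R" "ipath E R n d'" "\<And>p. p \<in> R \<Longrightarrow> E a p \<longleftrightarrow> p = n"
        by (rule ipath_uncons[OF iQ ad]) blast
      have n: "n \<in> R" "E a n" using R ipath_ends by metis+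
      have noaz: "\<not> E a u" if "u \<in> Z" for u
      proof -
        have "n = b0" using one[of n] n R by auto
        moreover have "u \<noteq> n" "u \<noteq> a" using that h(2) n R by auto
        ultimately show ?thesis using one[of u] that by auto
      qed
      have "P = R \<union> Z"
      proof -
        have "insert a P = insert a (R \<union> Z)" using h(1) R(1) by auto
        moreover have "a \<notin> R \<union> Z" using R h(2) by auto
        ultimately show ?thesis using step.hyps(2) by (metis insert_ident)
      qed
      moreover have "R \<inter> Z = {}" using R h(2) by auto
      moreover have "q \<in> R" "q' \<in> R" using h(5-10) R(1) noaz by auto
      ultimately show ?thesis using step.IH R(3) h(4,7-10) by blast
    qed
  qed
  show ?case
  proof (cases "a \<in> Q")
    case True then show ?thesis using main[of Q Z c d s t q q' z z'] step.prems by blast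
  next
    case False
    then have "a \<in> Z" using step.prems(1) by auto
    then have "z = z' \<and> q = q'"
      using main[of Z Q s t c d z z' q q'] step.prems sym[of q z] sym[of q' z'] by (simp add: Un_commute Int_commute)
    then show ?thesis by blast
  qed
qed

lemma icycle_triangle:
  assumes E: "graph_rel E" and D: "icycle E D" "p \<in> D" "q \<in> D" "r \<in> D" "E p q" "E q r" "E p r"
  shows "D = {p, q, r}"
proof -
  note sym = graph_rel_sym[OF E] and irr = graph_rel_irrefl[OF E]
  have ne: "p \<noteq> q" "q \<noteq> r" "p \<noteq> r" using D irr by metis+
  obtain P a b where P: "D = insert p P" "p \<notin> P" "ipath E P a b" "a \<noteq> b" "\<And>r. r \<in> P \<Longrightarrow> E p r \<longleftrightarrow> r = a \<or> r = b"
    by (rule icycle_at[OF E D(1,2)]) blast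
  have "q \<in> P" "r \<in> P" using P D ne by auto
  then have qr: "q = a \<and> r = b \<or> q = b \<and> r = a" using P(5)[of q] P(5)[of r] D ne by auto
  then have Eab: "E a b" using D(6) sym[of q r] by auto
  obtain n R where R: "P = insert a R" "a \<notin> R" "ipath E R n b" "\<And>p. p \<in> R \<Longrightarrow> E a p \<longleftrightarrow> p = n"
    by (rule ipath_uncons[OF P(3,4)]) blast
  have "b = n" using R ipath_ends[OF R(3)] Eab by auto
  then have "R = {b}" using ipath_eqD R(3) by metis
  then show ?thesis using P(1) R(1) qr by auto
qed

text \<open>Such a vertex occurs only in the complete graph on four vertices. On the cycle it forces
  a triangle, and every ear vertex that sees \<open>v\<close> sees the whole triangle. On an ear
  with two ends, every vertex has two nonadjacent neighbours. The lemma serves to exclude sets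
  containing a vertex that is not adjacent to \<open>v\<close>.\<close>

lemma solid_simplicial:
  assumes E: "graph_rel E" and W: "solid E W" "v \<in> W"
    and cl: "\<And>p q. p \<in> W \<Longrightarrow> q \<in> W \<Longrightarrow> E v p \<Longrightarrow> E v q \<Longrightarrow> p \<noteq> q \<Longrightarrow> E p q"
    and u: "u \<in> W"
  shows "u = v \<or> E v u"
proof -
  note sym = graph_rel_sym[OF E] and irr = graph_rel_irrefl[OF E]
  obtain D Z s t where D: "W = D \<union> Z" "ears E D Z s t" "s \<noteq> t \<Longrightarrow> nbrs E s D \<inter> nbrs E t D = {}"
    using solid_disjoint[OF E W(1)] by metis
  have cD: "icycle E D" and DZ: "D \<inter> Z = {}" and iZ: "ipath E Z s t" and big: "big E (nbrs E s D \<union> nbrs E t D)"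
    using D(2) unfolding ears_def by auto
  have stZ: "s \<in> Z" "t \<in> Z" using iZ ipath_ends by metis+
  show ?thesis
  proof (cases "v \<in> D")
    case True
    obtain a b where ab: "a \<in> D" "b \<in> D" "a \<noteq> b" "a \<noteq> v" "b \<noteq> v" "\<And>p. p \<in> D \<Longrightarrow> E v p \<longleftrightarrow> p = a \<or> p = b"
      by (rule icycle_nbrs[OF E cD True]) blast
    then have "E v a" "E v b" "E a b" using cl D(1) by auto
    then have D3: "D = {v, a, b}" using icycle_triangle[OF E cD True ab(1,2)] by auto
    have vall: "nbrs E z D = D" if "z \<in> Z" "v \<in> nbrs E z D" for z
    proof -
      have "E v z" using that sym[of v z] by auto
      then have "E a z" "E b z" using cl[of a z] cl[of b z] that(1) D(1) ab \<open>E v a\<close> \<open>E v b\<close> DZ by blast+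
      then show ?thesis using that(2) D3 sym[of z] by auto
    qed
    have clD: "big E S \<Longrightarrow> S \<subseteq> D \<Longrightarrow> S = D" for S
      unfolding big_def D3 using \<open>E v a\<close> \<open>E v b\<close> \<open>E a b\<close> sym[of v a] sym[of v b] sym[of a b] by blast
    have un: "nbrs E s D \<union> nbrs E t D = D" by (rule clD[OF big]) auto
    have "s = t"
    proof (rule ccontr)
      assume st: "s \<noteq> t"
      then have "\<not> big E (nbrs E s D)" "\<not> big E (nbrs E t D)" using D(2) unfolding ears_def by auto
      then have "v \<notin> nbrs E s D" "v \<notin> nbrs E t D" using vall stZ icycle_big[OF cD] by auto
      then show False using un True by blast
    qed
    then have "Z = {s}" "nbrs E s D = D" using ipath_eqD[OF iZ] un by auto
    then have "E v s" using True sym[of v s] by (metis nbrs_iff)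
    then show ?thesis using u D(1) D3 ab(6)[OF ab(1)] ab(6)[OF ab(2)] \<open>Z = {s}\<close> by blast
  next
    case False
    then have vZ: "v \<in> Z" using W D by auto
    show ?thesis
    proof (cases "s = t")
      case True
      then have Z: "Z = {v}" "s = v" using ipath_eqD[OF iZ] vZ by auto
      have "big E (nbrs E v D)" using big True Z by auto
      then obtain p q r where pqr: "p \<in> D" "q \<in> D" "r \<in> D" "E v p" "E v q" "E v r" "p \<noteq> q" "p \<noteq> r" "q \<noteq> r"
        using cl D(1) unfolding big_def by auto
      then have "D = {p, q, r}" using icycle_triangle[OF E cD, of p q r] cl D(1) by auto
      then show ?thesis using u D(1) Z pqr by auto
    next
      case st: False
      have ne: "nbrs E s D \<noteq> {}" "nbrs E t D \<noteq> {}" using big D(2) st unfolding ears_def by auto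
      have int: "nbrs E z D = {}" if "z \<in> Z" "z \<noteq> s" "z \<noteq> t" for z using D(2) st that unfolding ears_def by auto
      have False if v: "v = s" and iZ: "ipath E Z s t" and st: "s \<noteq> t" and ne: "nbrs E s D \<noteq> {}"
        and disj: "nbrs E s D \<inter> nbrs E t D = {}" and int: "\<And>z. z \<in> Z \<Longrightarrow> z \<noteq> s \<Longrightarrow> z \<noteq> t \<Longrightarrow> nbrs E z D = {}" for s t
      proof -
        obtain n R where R: "Z = insert s R" "s \<notin> R" "ipath E R n t" "\<And>p. p \<in> R \<Longrightarrow> E s p \<longleftrightarrow> p = n"
          by (rule ipath_uncons[OF iZ st]) blast
        have n: "n \<in> Z" "n \<noteq> s" "E s n" using R ipath_ends by fast+
        obtain p where p: "p \<in> D" "E s p" using ne by auto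
        have "E n p" using cl[of n p] n p v D(1) DZ by auto
        then have "n = t" using int[OF n(1,2)] p unfolding nbrs_empty by auto
        then show False using disj p \<open>E n p\<close> by auto
      qed
      note F = this
      have "v \<noteq> s" using F[OF _ iZ st ne(1) D(3)[OF st] int] by blast
      moreover have "v \<noteq> t" using F[OF _ ipath_rev[OF E iZ] _ ne(2) _ int] D(3)[OF st] st by blast
      ultimately obtain p q where "p \<in> Z" "q \<in> Z" "p \<noteq> q" "E v p" "E v q" "\<not> E p q"
        using ipath_interior[OF E iZ vZ] by metis
      then show ?thesis using cl[of p q] D(1) by auto
    qed
  qed
qed

text \<open>An ear contains no triangle, and two of its vertices have no common neighbour on the
  cycle. So three vertices of \<open>K\<close> form the cycle, and the fourth sees all of them and
  is the whole ear.\<close>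

lemma solid_clique4:
  assumes E: "graph_rel E" and W: "solid E W" and K: "K \<subseteq> W" "card K = 4" "\<And>p q. p \<in> K \<Longrightarrow> q \<in> K \<Longrightarrow> p \<noteq> q \<Longrightarrow> E p q"
  shows "W = K"
proof -
  note sym = graph_rel_sym[OF E] and irr = graph_rel_irrefl[OF E]
  obtain D Z s t where D: "W = D \<union> Z" "ears E D Z s t" "s \<noteq> t \<Longrightarrow> nbrs E s D \<inter> nbrs E t D = {}"
    using solid_disjoint[OF E W(1)] by metis
  have cD: "icycle E D" and DZ: "D \<inter> Z = {}" and iZ: "ipath E Z s t" using D(2) unfolding ears_def by auto
  have fK: "finite K" using K(2) card.infinite by fastforce
  have KDZ: "card (K \<inter> D) + card (K \<inter> Z) = 4"
  proof -
    have "K = (K \<inter> D) \<union> (K \<inter> Z)" using K(1) D(1) by blast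
    then have "card K = card ((K \<inter> D) \<union> (K \<inter> Z))" by simp
    also have "\<dots> = card (K \<inter> D) + card (K \<inter> Z)" by (rule card_Un_disjoint) (use fK DZ in auto)
    finally show ?thesis using K(2) by simp
  qed
  have three: "\<exists>p q r. p \<in> S \<and> q \<in> S \<and> r \<in> S \<and> p \<noteq> q \<and> q \<noteq> r \<and> p \<noteq> r" if c3: "card S \<ge> 3" for S :: "'a set"
  proof -
    obtain T where "T \<subseteq> S" "card T = 3" by (rule obtain_subset_with_card_n[OF c3]) blast
    then show ?thesis unfolding card_3_iff by blast
  qed
  have Z2: "card (K \<inter> Z) \<le> 2"
  proof (rule ccontr)
    assume "\<not> card (K \<inter> Z) \<le> 2"
    then obtain p q r where "p \<in> K \<inter> Z" "q \<in> K \<inter> Z" "r \<in> K \<inter> Z" "p \<noteq> q" "q \<noteq> r" "p \<noteq> r" using three[of "K \<inter> Z"] by auto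
    then show False using ipath_triangle_free[OF E iZ, of p q r] K(3) by auto
  qed
  have nbz: "z = s \<or> z = t" "s \<noteq> t \<Longrightarrow> \<not> big E (nbrs E z D)" if "z \<in> Z" "d \<in> D" "E z d" for z d
  proof -
    show 1: "z = s \<or> z = t"
    proof (cases "s = t")
      case True then show ?thesis using iZ ipath_eqD that by fastforce
    next
      case False then show ?thesis using D(2) that unfolding ears_def nbrs_empty by blast
    qed
    show "s \<noteq> t \<Longrightarrow> \<not> big E (nbrs E z D)" using 1 D(2) unfolding ears_def by auto
  qed
  have "card (K \<inter> Z) \<noteq> 2"
  proof
    assume 2: "card (K \<inter> Z) = 2"
    then obtain z1 z2 where z: "K \<inter> Z = {z1, z2}" "z1 \<noteq> z2" using card_2_iff[of "K \<inter> Z"] by auto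
    have "card (K \<inter> D) \<noteq> 0" using KDZ 2 by simp
    then obtain d where d: "d \<in> K" "d \<in> D" by (metis card.empty disjoint_iff)
    have zz: "z1 \<in> K" "z2 \<in> K" "z1 \<in> Z" "z2 \<in> Z" using z(1) by blast+
    have e: "E z1 d" "E z2 d" using K(3) zz d DZ by blast+
    then have "z1 = s \<and> z2 = t \<or> z1 = t \<and> z2 = s" using nbz(1) zz d z(2) by metis
    then have "d \<in> nbrs E s D \<inter> nbrs E t D" "s \<noteq> t" using e d z(2) by auto
    then show False using D(3) by blast
  qed
  then have D3: "card (K \<inter> D) \<ge> 3" using KDZ Z2 by linarith
  then obtain p q r where pqr: "p \<in> K \<inter> D" "q \<in> K \<inter> D" "r \<in> K \<inter> D" "p \<noteq> q" "q \<noteq> r" "p \<noteq> r" using three by blast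
  then have D': "D = {p, q, r}" using icycle_triangle[OF E cD, of p q r] K(3) by auto
  then have "card D = 3" using pqr by auto
  then have "card (K \<inter> D) \<le> 3" using icycle_finite[OF cD] card_mono[of D "K \<inter> D"] by auto
  then have "card (K \<inter> Z) \<noteq> 0" using KDZ by linarith
  then obtain z where z: "z \<in> K" "z \<in> Z" by (metis card.empty disjoint_iff)
  have zp: "E z p" "E z q" "E z r" using K(3) z pqr DZ by blast+
  have "big E (nbrs E z D)" by (rule big3[of p _ q r]) (use zp pqr in auto)
  then have "s = t" using nbz(2)[OF z(2) _ zp(1)] pqr by auto
  then have "Z = {z}" using iZ ipath_eqD z by fastforce
  then show ?thesis using D(1) D' z pqr K(1) by auto
qed

definition degree3 :: "('a \<Rightarrow> 'a \<Rightarrow> bool) \<Rightarrow> 'a set \<Rightarrow> 'a \<Rightarrow> bool" where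
  "degree3 E W v \<longleftrightarrow> (\<exists>a\<in>W. \<exists>b\<in>W. \<exists>c\<in>W. a \<noteq> b \<and> a \<noteq> c \<and> b \<noteq> c \<and> E v a \<and> E v b \<and> E v c)"

lemma degree3I: "a \<in> W \<Longrightarrow> b \<in> W \<Longrightarrow> c \<in> W \<Longrightarrow> a \<noteq> b \<Longrightarrow> a \<noteq> c \<Longrightarrow> b \<noteq> c \<Longrightarrow> E v a \<Longrightarrow> E v b \<Longrightarrow> E v c \<Longrightarrow> degree3 E W v"
  unfolding degree3_def by blast

text \<open>A solid has two nonadjacent vertices of degree at least 3, or four vertices of degree at
  least 3. A clique on at most three vertices contains neither.\<close>

lemma solid_degree3:
  assumes E: "graph_rel E" and W: "solid E W" and Y: "finite Y" "card Y \<le> 3" "\<And>p q. p \<in> Y \<Longrightarrow> q \<in> Y \<Longrightarrow> p \<noteq> q \<Longrightarrow> E p q"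
  shows "\<exists>v\<in>W - Y. degree3 E W v"
proof -
  note sym = graph_rel_sym[OF E] and irr = graph_rel_irrefl[OF E]
  obtain D Z s t where D: "W = D \<union> Z" "ears E D Z s t" "s \<noteq> t \<Longrightarrow> nbrs E s D \<inter> nbrs E t D = {}"
    using solid_disjoint[OF E W(1)] by metis
  have cD: "icycle E D" and DZ: "D \<inter> Z = {}" and iZ: "ipath E Z s t" and big: "big E (nbrs E s D \<union> nbrs E t D)"
    using D(2) unfolding ears_def by auto
  have stZ: "s \<in> Z" "t \<in> Z" using iZ ipath_ends by metis+
  have dD: "degree3 E W p" if p: "p \<in> D" "z \<in> Z" "E z p" for p z
  proof -
    obtain a b where ab: "a \<in> D" "b \<in> D" "a \<noteq> b" "\<And>q. q \<in> D \<Longrightarrow> E p q \<longleftrightarrow> q = a \<or> q = b"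
      by (rule icycle_nbrs[OF E cD p(1)]) blast
    then show ?thesis using degree3I[of a W b z E p] p sym[of p z] D(1) DZ by blast
  qed
  have two: ?thesis if "p \<in> W" "q \<in> W" "degree3 E W p" "degree3 E W q" "p \<noteq> q" "\<not> E p q" for p q
    using that Y(3)[of p q] by blast
  show ?thesis
  proof (cases "s = t")
    case True
    then have b: "big E (nbrs E s D)" using big by simp
    then show ?thesis unfolding big_def
    proof (elim disjE bexE)
      fix p q assume "p \<in> nbrs E s D" "q \<in> nbrs E s D" "p \<noteq> q \<and> \<not> E p q"
      then show ?thesis using two[of p q] dD[of p s] dD[of q s] stZ D(1) by auto
    next
      fix p q r assume h: "p \<in> nbrs E s D" "q \<in> nbrs E s D" "r \<in> nbrs E s D" "p \<noteq> q \<and> p \<noteq> r \<and> q \<noteq> r"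
      have d: "degree3 E W p" "degree3 E W q" "degree3 E W r" using h dD stZ by auto
      have ds: "degree3 E W s" using degree3I[of p W q r E s] h D(1) by auto
      have "s \<noteq> p" "s \<noteq> q" "s \<noteq> r" using h stZ DZ by auto
      then have "card {s, p, q, r} = 4" using h by auto
      then have "\<not> {s, p, q, r} \<subseteq> Y" using card_mono[OF Y(1), of "{s, p, q, r}"] Y(2) by linarith
      then show ?thesis using d ds h stZ D(1) by auto
    qed
  next
    case st: False
    have nbg: "\<not> big E (nbrs E s D)" "\<not> big E (nbrs E t D)" using D(2) st unfolding ears_def by auto
    have ne: "nbrs E s D \<noteq> {}" "nbrs E t D \<noteq> {}" using big nbg by auto
    have pair: ?thesis if iZ: "ipath E Z s t" and "s \<noteq> t" and pq: "q \<in> D" "q' \<in> D" "q \<noteq> q'" "E s q" "E s q'" "p \<in> D" "E t p"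
        and disj: "nbrs E s D \<inter> nbrs E t D = {}" for s t p q q'
    proof -
      obtain n R where R: "Z = insert s R" "s \<notin> R" "ipath E R n t" "\<And>p. p \<in> R \<Longrightarrow> E s p \<longleftrightarrow> p = n"
        by (rule ipath_uncons[OF iZ \<open>s \<noteq> t\<close>]) blast
      have n: "n \<in> Z" "E s n" using R ipath_ends by fast+
      have "degree3 E W s" using degree3I[of q W q' n E s] n pq D(1) DZ by blast
      moreover have "degree3 E W p" using dD[of p t] pq ipath_ends[OF iZ] by auto
      moreover have "\<not> E s p" using disj pq by auto
      moreover have "s \<in> Z" using R by auto
      ultimately show ?thesis using two[of s p] pq D(1) DZ by blast
    qed
    obtain p q where pq: "p \<in> nbrs E s D" "q \<in> nbrs E t D" using ne by (meson ex_in_conv)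
    show ?thesis
    proof (cases "nbrs E s D = {p} \<and> nbrs E t D = {q}")
      case True
      then have "big E {p, q}" using big by (simp add: insert_commute)
      then show ?thesis using two[of p q] dD[of p s] dD[of q t] stZ D(1) pq unfolding big_pair[OF E] by auto
    next
      case False
      then consider p' where "p' \<in> nbrs E s D" "p' \<noteq> p" | q' where "q' \<in> nbrs E t D" "q' \<noteq> q" using pq by blast
      then show ?thesis
      proof cases
        case 1 then show ?thesis using pair[OF iZ st, of p p' q] pq D(3)[OF st] by auto
      next
        case 2 then show ?thesis using pair[OF ipath_rev[OF E iZ], of q q' p] st pq D(3)[OF st] by auto
      qed
    qed
  qed
qed

text \<open>A path contains no cycle, so \<open>x\<close> lies on \<open>D\<close>, and
  \<open>P\<close> is split into the arc \<open>Q\<close> and the ear \<open>Z\<close>. At most one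
  edge joins these, and its vertex on \<open>Q\<close> is an end of the arc, hence adjacent to
  \<open>x\<close>. So the attachments lie within one edge at \<open>x\<close> and cannot be
  big.\<close>

lemma fan_not_solid:
  assumes E: "graph_rel E" and P: "ipath E P a b" "x \<notin> P"
  shows "\<not> solid E (insert x P)"
proof
  assume W: "solid E (insert x P)"
  note sym = graph_rel_sym[OF E] and irr = graph_rel_irrefl[OF E]
  obtain D Z s t where D: "insert x P = D \<union> Z" "ears E D Z s t"
    using W unfolding solid_def by blast
  have cD: "icycle E D" and DZ: "D \<inter> Z = {}" and iZ: "ipath E Z s t" and big: "big E (nbrs E s D \<union> nbrs E t D)"
    using D(2) unfolding ears_def by auto
  have stZ: "s \<in> Z" "t \<in> Z" using iZ ipath_ends by metis+
  have xD: "x \<in> D"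
  proof (rule ccontr)
    assume "x \<notin> D"
    then have "D \<subseteq> P" using D(1) by auto
    then show False using ipath_no_icycle[OF E P(1)] cD by blast
  qed
  obtain Q c d where Q: "D = insert x Q" "x \<notin> Q" "ipath E Q c d" "c \<noteq> d" "\<And>r. r \<in> Q \<Longrightarrow> E x r \<longleftrightarrow> r = c \<or> r = d"
    by (rule icycle_at[OF E cD xD]) blast
  have PQ: "P = Q \<union> Z"
  proof -
    have "insert x P = insert x (Q \<union> Z)" using D(1) Q(1) by auto
    moreover have "x \<notin> Q \<union> Z" using Q DZ by auto
    ultimately show ?thesis using P(2) by (metis insert_ident)
  qed
  have QZ: "Q \<inter> Z = {}" using DZ Q by auto
  have uniq: "q = q' \<and> z = z'" if "q \<in> Q" "q' \<in> Q" "z \<in> Z" "z' \<in> Z" "E z q" "E z' q'" for q q' z z'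
    using ipath_cross_unique[OF E P(1) PQ QZ Q(3) iZ, of q q' z z'] that sym[of z q] sym[of z' q'] by auto
  \<comment> \<open>An inner vertex of the arc with a neighbour on the ear would have three
    neighbours in the path \<open>P\<close>.\<close>
  have endq: "E x q" if q: "q \<in> Q" "z \<in> Z" "E z q" for q z
  proof (rule ccontr)
    assume "\<not> E x q"
    then have "q \<noteq> c" "q \<noteq> d" using Q(5) q by auto
    then obtain u v where uv: "u \<in> Q" "v \<in> Q" "u \<noteq> v" "E q u" "E q v" using ipath_interior[OF E Q(3) q(1)] by metis
    have "z \<notin> Q" using q QZ by auto
    then show False using ipath_degree[OF E P(1), of q u v z] uv q sym[of q z] PQ by auto
  qed
  define S where "S = nbrs E s D \<union> nbrs E t D"
  have el: "u = x \<or> u \<in> Q \<and> (E s u \<or> E t u)" if "u \<in> S" for u using that Q(1) unfolding S_def by auto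
  have "S \<subseteq> {x} \<or> (\<exists>q. S \<subseteq> {x, q} \<and> E x q)"
  proof (cases "S \<subseteq> {x}")
    case False
    then obtain q where q: "q \<in> S" "q \<noteq> x" by auto
    have "S \<subseteq> {x, q}" using el uniq el[OF q(1)] q(2) stZ by blast
    moreover have "E x q" using el[OF q(1)] q(2) endq stZ by blast
    ultimately show ?thesis by blast
  qed auto
  moreover have "\<not> big E {x}" "\<And>q. E x q \<Longrightarrow> \<not> big E {x, q}" by (simp_all add: big_pair[OF E])
  ultimately show False using big big_mono unfolding S_def[symmetric] by metis
qed

lemma icycle_not_solid:
  assumes E: "graph_rel E" and C: "icycle E C" shows "\<not> solid E C"
proof -
  obtain x P a b where "C = insert x P" "x \<notin> P" "ipath E P a b" using C unfolding icycle_def by blast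
  then show ?thesis using fan_not_solid[OF E] by metis
qed

text \<open>If \<open>w\<close> is on the ear, it sees the whole cycle and is a hub. If it is on the
  cycle, both ends of the ear see it and therefore coincide; the cycle is then a triangle seen
  completely by \<open>s\<close>, so the four vertices form a clique.\<close>

lemma dominating_solid:
  assumes E: "graph_rel E" and w: "w \<notin> W" "\<And>u. u \<in> W \<Longrightarrow> E w u"
  shows "solid E (insert w W) \<longleftrightarrow> icycle E W"
proof
  assume "icycle E W"
  moreover have "nbrs E w W = W" using w by auto
  ultimately show "solid E (insert w W)" using solid_hub[of E W w] w icycle_big by auto
next
  assume s: "solid E (insert w W)"
  note sym = graph_rel_sym[OF E] and irr = graph_rel_irrefl[OF E]
  obtain D Z s t where D: "insert w W = D \<union> Z" "ears E D Z s t" "s \<noteq> t \<Longrightarrow> nbrs E s D \<inter> nbrs E t D = {}"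
    using solid_disjoint[OF E s] by metis
  have cD: "icycle E D" and DZ: "D \<inter> Z = {}" and iZ: "ipath E Z s t" and big: "big E (nbrs E s D \<union> nbrs E t D)"
    using D(2) unfolding ears_def by auto
  have stZ: "s \<in> Z" "t \<in> Z" using iZ ipath_ends by metis+
  have adj: "E w u" "E u w" if "u \<in> D \<union> Z" "u \<noteq> w" for u
  proof -
    have "u \<in> W" using that D(1) by blast
    then show "E w u" "E u w" using w(2) sym[of u w] by auto
  qed
  show "icycle E W"
  proof (cases "w \<in> D")
    case False
    then have "w \<in> Z" using D by auto
    have "E w d" if "d \<in> D" for d using adj(1)[of d] that False by blast
    then have nbw: "nbrs E w D = D" by auto
    have "s = t"
    proof (rule ccontr)
      assume st: "s \<noteq> t"
      then have "w = s \<or> w = t" using D(2) \<open>w \<in> Z\<close> nbw icycle_big[OF cD] unfolding ears_def by force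
      then show False using D(2) st nbw icycle_big[OF cD] unfolding ears_def by auto
    qed
    then have "Z = {w}" using iZ ipath_eqD \<open>w \<in> Z\<close> by fastforce
    then have "insert w W = insert w D" using D(1) by auto
    then have "W = D" using w(1) False by (metis insert_ident)
    then show ?thesis using cD by simp
  next
    case True
    have ws: "E s w" "E t w" using adj stZ True DZ by auto
    have "s = t"
    proof (rule ccontr)
      assume "s \<noteq> t"
      then have "nbrs E s D \<inter> nbrs E t D = {}" by (rule D(3))
      then show False using ws True by auto
    qed
    then have Z: "Z = {s}" using iZ ipath_eqD by metis
    obtain P a b where P: "D = insert w P" "w \<notin> P" "ipath E P a b" "a \<noteq> b" "\<And>r. r \<in> P \<Longrightarrow> E w r \<longleftrightarrow> r = a \<or> r = b"
      by (rule icycle_at[OF E cD True]) blast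
    have ab: "a \<in> P" "b \<in> P" using P ipath_ends by metis+
    have Pab: "P = {a, b}" using P(5) adj(1) P(1,2) ab by auto
    have Eab: "E a b"
    proof -
      obtain n R where R: "P = insert a R" "a \<notin> R" "ipath E R n b" "\<And>p. p \<in> R \<Longrightarrow> E a p \<longleftrightarrow> p = n"
        by (rule ipath_uncons[OF P(3,4)]) blast
      have "n \<in> R" using R ipath_ends by metis
      then have "n \<in> {a, b}" "n \<noteq> a" using R(1,2) Pab by auto
      then have "n = b" by simp
      then show ?thesis using R \<open>n \<in> R\<close> by auto
    qed
    have "nbrs E s D = {w, a, b}"
    proof (rule ccontr)
      assume "nbrs E s D \<noteq> {w, a, b}"
      then have "nbrs E s D \<subseteq> {w, a} \<or> nbrs E s D \<subseteq> {w, b}" using P(1) Pab ws by auto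
      moreover have "\<not> big E {w, a}" "\<not> big E {w, b}" using P(5) ab by (auto simp: big_pair[OF E])
      ultimately show False using big \<open>s = t\<close> big_mono by (metis sup.idem)
    qed
    then have sab: "E s a" "E s b" by (metis insertCI nbrs_iff)+
    have "s \<notin> P" using DZ stZ P(1) by auto
    have "icycle E (insert s P)" by (rule icycleI[OF P(3,4) \<open>s \<notin> P\<close>]) (use sab Pab in auto)
    moreover have "W = insert s P"
    proof -
      have "insert w W = insert w (insert s P)" using D(1) P(1) Z by auto
      moreover have "w \<notin> insert s P" using P(2) DZ stZ True by auto
      ultimately show ?thesis using w(1) by (metis insert_ident)
    qed
    ultimately show ?thesis by simp
  qed
qed

text \<open>This position prepares \<open>solid_claw\<close>, where the edge \<open>u v\<close> of
  the cycle is subdivided by a vertex that \<open>s\<close> sees. Two triangle vertices on the ear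
  would share a neighbour on the cycle, and an ear contains no triangle; if the cycle is the
  triangle itself, it is exchanged for another one.\<close>

lemma triangle_in_solid:
  assumes E: "graph_rel E" and W: "solid E W" and T: "{x1, x2, x3} \<subseteq> W" "{x1, x2, x3} \<noteq> W" "E x1 x2" "E x1 x3" "E x2 x3"
  obtains u v D Z s t where "W = D \<union> Z" "ears E D Z s t" "s \<noteq> t \<Longrightarrow> nbrs E s D \<inter> nbrs E t D = {}"
    "{u, v, s} = {x1, x2, x3}" "u \<in> D" "v \<in> D" "u \<noteq> v"
proof -
  note result = that
  note sym = graph_rel_sym[OF E] and irr = graph_rel_irrefl[OF E]
  define P where "P = (\<lambda>u v s. \<exists>D Z t. W = D \<union> Z \<and> ears E D Z s t \<and> (s \<noteq> t \<longrightarrow> nbrs E s D \<inter> nbrs E t D = {})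
     \<and> u \<in> D \<and> v \<in> D)"
  have ne: "x1 \<noteq> x2" "x1 \<noteq> x3" "x2 \<noteq> x3" using T irr by metis+
  have fin: thesis if "P u v s" "{u, v, s} = {x1, x2, x3}" "u \<noteq> v" for u v s
  proof -
    from that(1) obtain D Z t where "W = D \<union> Z" "ears E D Z s t" "s \<noteq> t \<longrightarrow> nbrs E s D \<inter> nbrs E t D = {}" "u \<in> D" "v \<in> D"
      unfolding P_def by (elim exE conjE)
    then show thesis using that(2,3) by (intro result[of D Z s t u v]) simp_all
  qed
  obtain D Z s t where D: "W = D \<union> Z" "ears E D Z s t" "s \<noteq> t \<Longrightarrow> nbrs E s D \<inter> nbrs E t D = {}"
    using solid_disjoint[OF E W] by metis
  have cD: "icycle E D" and DZ: "D \<inter> Z = {}" and iZ: "ipath E Z s t" and big: "big E (nbrs E s D \<union> nbrs E t D)"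
    using D(2) unfolding ears_def by auto
  have stZ: "s \<in> Z" "t \<in> Z" using iZ ipath_ends by metis+
  have nbz: "z = s \<or> z = t" if "z \<in> Z" "d \<in> D" "E z d" for z d
  proof (cases "s = t")
    case True then show ?thesis using ipath_eqD[OF iZ] that by auto
  next
    case False then show ?thesis using D(2) that unfolding ears_def nbrs_empty by blast
  qed
  have one: thesis if "{u, v, z} = {x1, x2, x3}" "u \<noteq> v" "E z u" "u \<in> D" "v \<in> D" "z \<in> Z" for u v z
  proof -
    have "z = s \<or> z = t" using nbz that by blast
    then have "P u v z"
    proof
      assume "z = s" then show ?thesis unfolding P_def using D that by blast
    next
      assume "z = t" then show ?thesis unfolding P_def using D that ears_rev[OF E D(2)] by (metis inf_commute)
    qed
    then show thesis using fin that by blast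
  qed
  have two: False if "u \<in> D" "z \<in> Z" "z' \<in> Z" "z \<noteq> z'" "E z u" "E z' u" for u z z'
  proof -
    have "z = s \<and> z' = t \<or> z = t \<and> z' = s" using nbz that by metis
    then have "u \<in> nbrs E s D \<inter> nbrs E t D" "s \<noteq> t" using that by auto
    then show False using D(3) by blast
  qed
  have mem: "x1 \<in> D \<or> x1 \<in> Z" "x2 \<in> D \<or> x2 \<in> Z" "x3 \<in> D \<or> x3 \<in> Z" using T D(1) by auto
  have e: "E x2 x1" "E x3 x1" "E x3 x2" using T sym by auto
  show thesis
  proof (cases "x1 \<in> D \<and> x2 \<in> D \<and> x3 \<in> D")
    case False
    have i1: "{x2, x3, x1} = {x1, x2, x3}" "{x1, x3, x2} = {x1, x2, x3}" by auto
    consider "x1 \<in> Z" "x2 \<in> D" "x3 \<in> D" | "x2 \<in> Z" "x1 \<in> D" "x3 \<in> D" | "x3 \<in> Z" "x1 \<in> D" "x2 \<in> D"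
      | "x1 \<in> Z" "x2 \<in> Z" "x3 \<in> D" | "x1 \<in> Z" "x3 \<in> Z" "x2 \<in> D" | "x2 \<in> Z" "x3 \<in> Z" "x1 \<in> D" | "x1 \<in> Z" "x2 \<in> Z" "x3 \<in> Z"
      using mem False by blast
    then show thesis
    proof cases
      case 1 then show ?thesis using one[OF i1(1) ne(3)] T by blast
    next
      case 2 then show ?thesis using one[OF i1(2) ne(2)] e by blast
    next
      case 3 then show ?thesis using one[OF _ ne(1)] e by blast
    next
      case 4 then show ?thesis using two[of x3 x1 x2] T ne by blast
    next
      case 5 then show ?thesis using two[of x2 x1 x3] T e ne by blast
    next
      case 6 then show ?thesis using two[of x1 x2 x3] e ne by blast
    next
      case 7 then show ?thesis using ipath_triangle_free[OF E iZ, of x1 x2 x3] T by blast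
    qed
  next
    case True
    then have D3: "D = {x1, x2, x3}" using icycle_triangle[OF E cD, of x1 x2 x3] T by auto
    have adj: "E u v" if "u \<in> D" "v \<in> D" "u \<noteq> v" for u v using that D3 T e by auto
    have clD: "S = D" if S: "big E S" "S \<subseteq> D" for S
    proof -
      have "\<not> (\<exists>p\<in>S. \<exists>q\<in>S. p \<noteq> q \<and> \<not> E p q)" using S(2) adj by blast
      then have "\<exists>p\<in>S. \<exists>q\<in>S. \<exists>r\<in>S. p \<noteq> q \<and> p \<noteq> r \<and> q \<noteq> r" using S(1) unfolding big_def by blast
      then      obtain p q r where "p \<in> S" "q \<in> S" "r \<in> S" "p \<noteq> q" "p \<noteq> r" "q \<noteq> r"
        by blast
      then have "card {p, q, r} = 3" "{p, q, r} \<subseteq> D" "{p, q, r} \<subseteq> S" using that by auto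
      moreover have "card D = 3" "finite D" using D3 ne by auto
      ultimately have "{p, q, r} = D" using card_subset_eq by metis
      then show ?thesis using \<open>{p, q, r} \<subseteq> S\<close> that by auto
    qed
    have un: "nbrs E s D \<union> nbrs E t D = D" by (rule clD[OF big]) auto
    show thesis
    proof (cases "s = t")
      case True
      then have Z: "Z = {s}" using ipath_eqD[OF iZ] by simp
      have sall: "E s x1" "E s x2" "E s x3" using un True D3 by (metis Un_absorb insertCI nbrs_iff)+
      have sD: "s \<notin> D" using DZ stZ by auto
      have "ipath E {x1, x2} x1 x2" using ipath.step[OF ipath.single, of x1 x2 E] ne T by auto
      \<comment> \<open>The set is a clique on four vertices, and any of its triangles may serve as
        the cycle.\<close>
      then have c: "icycle E (insert s {x1, x2})" by (rule icycleI) (use ne sall sD D3 in auto)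
      have "ears E (insert s {x1, x2}) {x3} x3 x3"
      proof -
        have "big E (nbrs E x3 (insert s {x1, x2}))"
          by (rule big3[of s _ x1 x2]) (use e ne sall sym[of s x3] sD D3 in auto)
        then show ?thesis unfolding ears_def using c ipath.single sD D3 ne by auto
      qed
      moreover have "W = insert s {x1, x2} \<union> {x3}" using D(1) Z D3 by auto
      ultimately have "P x1 x2 x3" unfolding P_def by blast
      then show thesis using fin ne by blast
    next
      case st: False
      have nbg: "\<not> big E (nbrs E s D)" "\<not> big E (nbrs E t D)" using D(2) st unfolding ears_def by auto
      have neD: "nbrs E s D \<noteq> D" "nbrs E t D \<noteq> D" using nbg icycle_big[OF cD] by auto
      have disj: "nbrs E s D \<inter> nbrs E t D = {}" using D(3) st by blast
      \<comment> \<open>One end of the ear sees one vertex \<open>u\<close> of the triangle and the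
        other end sees the other two. The ear closed by the edge \<open>v u\<close> is a cycle with
        hub \<open>k\<close>.\<close>
      have key: thesis if A: "nbrs E s D = {u}" "nbrs E t D = {v, k}" "u \<noteq> v" "u \<noteq> k" "v \<noteq> k" "{u, v, k} = D"
        and iZ: "ipath E Z s t" and st: "s \<noteq> t" and int: "\<And>z. z \<in> Z \<Longrightarrow> z \<noteq> s \<Longrightarrow> z \<noteq> t \<Longrightarrow> nbrs E z D = {}" for u v k s t
      proof -
        have uvk: "u \<in> D" "v \<in> D" "k \<in> D" using A(6) by auto
        have stZ: "s \<in> Z" "t \<in> Z" using iZ ipath_ends by metis+
        have euv: "E u v" "E k u" "E k v" using adj uvk A by auto
        have sd: "E s d \<longleftrightarrow> d = u" if "d \<in> D" for d using A(1) that nbrs_iff[of d E s D] by (metis singleton_iff)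
        have td: "E t d \<longleftrightarrow> d = v \<or> d = k" if "d \<in> D" for d
        proof -
          have "d \<in> nbrs E t D \<longleftrightarrow> d = v \<or> d = k" unfolding A(2) by auto
          then show ?thesis using that by simp
        qed
        have ipuv: "ipath E {v, u} v u" using ipath.step[OF ipath.single, of v u E] A euv sym[of u v] by auto
        have "icycle E (Z \<union> {v, u})"
        proof (rule icycle_join[OF E iZ ipuv])
          show "Z \<inter> {v, u} = {}" using uvk DZ by auto
          fix z d assume zd: "z \<in> Z" "d \<in> {v, u}"
          show "E z d \<longleftrightarrow> z = t \<and> d = v \<or> z = s \<and> d = u"
          proof (cases "z = s \<or> z = t")
            case True then show ?thesis using sd[of d] td[of d] zd uvk A st by auto
          next
            case False then show ?thesis using int[of z] zd uvk unfolding nbrs_empty by auto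
          qed
        qed (use st in auto)
        moreover have "big E (nbrs E k (Z \<union> {v, u}))"
          by (rule big3[of u _ v t]) (use euv A uvk stZ DZ td[of k] sym[of t k] in auto)
        moreover have "k \<notin> Z \<union> {v, u}" using A uvk DZ by auto
        ultimately have "ears E (Z \<union> {v, u}) {k} k k" unfolding ears_def using ipath.single by auto
        moreover have "W = (Z \<union> {v, u}) \<union> {k}" using D(1) A(6) by auto
        ultimately have "P u v k" unfolding P_def by blast
        moreover have "{u, v, k} = {x1, x2, x3}" using A(6) D3 by simp
        ultimately show thesis using fin A(3) by blast
      qed
      have int: "nbrs E z D = {}" if "z \<in> Z" "z \<noteq> s" "z \<noteq> t" for z using D(2) st that unfolding ears_def by auto
      have part: "\<exists>u v k. A = {u} \<and> B = {v, k} \<and> u \<noteq> v \<and> u \<noteq> k \<and> v \<noteq> k \<and> {u, v, k} = D"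
        if "A \<union> B = D" "A \<inter> B = {}" "A = {u}" for A B u
      proof -
        have B: "B = D - {u}" using that by auto
        have "u \<in> {x1, x2, x3}" using that D3 by auto
        then consider "u = x1" | "u = x2" | "u = x3" by auto
        then show ?thesis
        proof cases
          case 1 show ?thesis
            by (rule exI[of _ x1], rule exI[of _ x2], rule exI[of _ x3]) (use 1 that(3) B D3 ne in auto)
        next
          case 2 show ?thesis
            by (rule exI[of _ x2], rule exI[of _ x1], rule exI[of _ x3]) (use 2 that(3) B D3 ne in auto)
        next
          case 3 show ?thesis
            by (rule exI[of _ x3], rule exI[of _ x1], rule exI[of _ x2]) (use 3 that(3) B D3 ne in auto)
        qed
      qed
      have "(\<exists>u. nbrs E s D = {u}) \<or> (\<exists>u. nbrs E t D = {u})"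
      proof (rule ccontr)
        assume no: "\<not> ?thesis"
        have two: "card S \<ge> 2" if "S \<subseteq> D" "\<nexists>u. S = {u}" "S \<noteq> {}" for S :: "'a set"
        proof -
          have f: "finite S" using that D3 finite_subset by blast
          have "card S \<noteq> 0" using f that by simp
          moreover have "card S \<noteq> 1" using that card_1_singleton_iff[of S] by auto
          ultimately show ?thesis by linarith
        qed
        have "nbrs E s D \<noteq> {}" "nbrs E t D \<noteq> {}" using un neD by auto
        then have "card (nbrs E s D) \<ge> 2" "card (nbrs E t D) \<ge> 2" using two no nbrs_subset by metis+
        moreover have "card (nbrs E s D \<union> nbrs E t D) = card (nbrs E s D) + card (nbrs E t D)"
          by (rule card_Un_disjoint) (use D3 disj in \<open>auto simp: nbrs_def\<close>)
        moreover have "card D = 3" using D3 ne by auto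
        ultimately show False using un by simp
      qed
      then show thesis
      proof
        assume "\<exists>u. nbrs E s D = {u}"
        then obtain u v k where "nbrs E s D = {u} \<and> nbrs E t D = {v, k} \<and> u \<noteq> v \<and> u \<noteq> k \<and> v \<noteq> k \<and> {u, v, k} = D"
          using part[OF un disj] by metis
        then show thesis using key[of s u t v k] iZ st int by blast
      next
        assume "\<exists>u. nbrs E t D = {u}"
        then obtain u v k where "nbrs E t D = {u} \<and> nbrs E s D = {v, k} \<and> u \<noteq> v \<and> u \<noteq> k \<and> v \<noteq> k \<and> {u, v, k} = D"
          using part[of "nbrs E t D" "nbrs E s D"] un disj by (metis Un_commute inf_commute)
        then show thesis using key[of t u s v k] ipath_rev[OF E iZ] st int by blast
      qed
    qed
  qed
qed

text \<open>Replacing the triangle x1 x2 x3 of F by a claw with centre w keeps the graph solid.\<close>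

lemma solid_claw:
  assumes E: "graph_rel E" and F: "graph_rel F" and ne: "x1 \<noteq> x2" "x1 \<noteq> x3" "x2 \<noteq> x3" and Q: "Q \<noteq> {}" "Q \<inter> {x1, x2, x3} = {}"
    and w: "w \<notin> Q \<union> {x1, x2, x3}" "\<And>x. x \<in> {x1, x2, x3} \<Longrightarrow> E w x" "\<And>q. q \<in> Q \<Longrightarrow> \<not> E w q"
    and FE: "\<And>q u. q \<in> Q \<Longrightarrow> u \<in> Q \<union> {x1, x2, x3} \<Longrightarrow> F q u \<longleftrightarrow> E q u"
    and tr: "\<And>x x'. x \<in> {x1, x2, x3} \<Longrightarrow> x' \<in> {x1, x2, x3} \<Longrightarrow> x \<noteq> x' \<Longrightarrow> F x x' \<and> \<not> E x x'"
    and s: "solid F (Q \<union> {x1, x2, x3})"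
  shows "solid E (insert w (Q \<union> {x1, x2, x3}))"
proof -
  note sym = graph_rel_sym[OF E] and irr = graph_rel_irrefl[OF E] and symF = graph_rel_sym[OF F]
  define X where "X = {x1, x2, x3}"
  have XW: "{x1, x2, x3} \<noteq> Q \<union> {x1, x2, x3}" using Q by auto
  obtain u v D Z s t where D: "Q \<union> {x1, x2, x3} = D \<union> Z" "ears F D Z s t" "s \<noteq> t \<Longrightarrow> nbrs F s D \<inter> nbrs F t D = {}"
    "{u, v, s} = {x1, x2, x3}" "u \<in> D" "v \<in> D" "u \<noteq> v"
    by (rule triangle_in_solid[OF F s _ XW]) (use tr ne in auto)
  have X: "{x1, x2, x3} = {u, v, s}" using D(4) by simp
  have cD: "icycle F D" and DZ: "D \<inter> Z = {}" and iZ: "ipath F Z s t" and big: "big F (nbrs F s D \<union> nbrs F t D)"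
    using D(2) unfolding ears_def by auto
  have stZ: "s \<in> Z" "t \<in> Z" using iZ ipath_ends by metis+
  note w' = w[unfolded X] and FE' = FE[unfolded X] and tr' = tr[unfolded X] and D1 = D(1)[unfolded X]
  have us: "u \<noteq> s" "v \<noteq> s" using D(5,6) DZ stZ(1) by blast+
  have Fuv: "F u v" "F s u" "F s v" "\<not> E u v" "\<not> E v u" "\<not> E s u" "\<not> E s v" "\<not> E u s" "\<not> E v s" using tr' us D(7) by auto
  have FE2: "F p q \<longleftrightarrow> E p q" if "p \<in> Q \<or> q \<in> Q" "p \<in> D \<union> Z" "q \<in> D \<union> Z" for p q
    using FE'[of p q] FE'[of q p] that D1 sym[of p q] symF[of p q] by blast
  have inQ: "p \<in> Q" if "p \<in> D" "p \<noteq> u" "p \<noteq> v" for p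
  proof -
    have "p \<noteq> s" using that DZ stZ by auto
    then show ?thesis using that D1 by blast
  qed
  have inQZ: "z \<in> Q" if "z \<in> Z" "z \<noteq> s" for z
  proof -
    have "z \<noteq> u" "z \<noteq> v" using that(1) D(5,6) DZ by blast+
    then show ?thesis using that D1 by blast
  qed
  have iZE: "ipath E Z s t"
    by (rule ipath_cong[OF iZ]) (metis FE2 UnCI inQZ graph_rel_irrefl[OF E] graph_rel_irrefl[OF F])
  obtain P a b where P: "D = insert u P" "u \<notin> P" "ipath F P a b" "a \<noteq> b" "\<And>r. r \<in> P \<Longrightarrow> F u r \<longleftrightarrow> r = a \<or> r = b"
    by (rule icycle_at[OF F cD D(5)]) blast
  have ab: "a \<in> P" "b \<in> P" using P ipath_ends by metis+
  have vP: "v \<in> P" using P D by auto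
  obtain b' where P': "ipath F P v b'" "v \<noteq> b'" "\<And>r. r \<in> P \<Longrightarrow> F u r \<longleftrightarrow> r = v \<or> r = b'"
  proof (cases "v = a")
    case True then show thesis using that[of b] P by auto
  next
    case False
    then have "v = b" using P(5)[OF vP] Fuv by auto
    then show thesis using that[of a] P ipath_rev[OF F P(3)] by auto
  qed
  have b': "b' \<in> P" "b' \<noteq> u" using P'(1) ipath_ends P(2) by metis+
  have FEP: "F p q \<longleftrightarrow> E p q" if "p \<in> P" "q \<in> P" for p q
  proof (cases "p = v \<and> q = v")
    case True then show ?thesis using graph_rel_irrefl[OF E] graph_rel_irrefl[OF F] by simp
  next
    case False
    then have "p \<in> Q \<or> q \<in> Q" using inQ that P(1,2) by blast
    then show ?thesis using FE2 that P(1) by auto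
  qed
  have iPE: "ipath E P v b'" by (rule ipath_cong[OF P'(1) FEP])
  have wD: "w \<notin> D" "w \<notin> Z" using w' D1 by auto
  have Ewd: "E w d \<longleftrightarrow> d = u \<or> d = v" if "d \<in> D" for d using w' inQ[OF that] that by auto
  have ipu: "ipath E (P \<union> {u}) v u"
  proof (rule ipath_append[OF iPE ipath.single])
    fix p r assume p: "p \<in> P" "r \<in> {u}"
    show "E p r \<longleftrightarrow> p = b' \<and> r = u"
    proof (cases "p = v")
      case True then show ?thesis using p Fuv P'(2) by auto
    next
      case False
      then have "p \<in> Q" using inQ p P by auto
      then have "E u p \<longleftrightarrow> F u p" using FE2[of u p] p P D by auto
      then show ?thesis using P'(3)[OF p(1)] p False sym[of u p] by auto
    qed
  qed (use P in auto)
  \<comment> \<open>\<open>w\<close> subdivides the edge \<open>u v\<close> of the cycle, which is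
    missing in \<open>E\<close>, and \<open>s\<close> sees \<open>w\<close> in place of
    \<open>u\<close> and \<open>v\<close>.\<close>
  define D' where "D' = insert w D"
  have cD': "icycle E D'"
  proof -
    have "icycle E (insert w (P \<union> {u}))"
      by (rule icycleI[OF ipu]) (use D(7) wD P(1) Ewd in auto)
    then show ?thesis unfolding D'_def P(1) by simp
  qed
  have nbs: "nbrs E s D' = insert w (nbrs F s D - {u, v})"
  proof -
    have "E s w" using w' sym by auto
    moreover have "E s d \<longleftrightarrow> F s d \<and> d \<noteq> u \<and> d \<noteq> v" if "d \<in> D" for d
      using Fuv FE2[of s d] inQ[OF that] that stZ by auto
    ultimately show ?thesis unfolding D'_def by auto
  qed
  have nbz: "nbrs E z D' = nbrs F z D" if "z \<in> Z" "z \<noteq> s" for z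
  proof -
    have "\<not> E z w" using w'(3)[OF inQZ[OF that]] sym[of z w] by auto
    moreover have "E z d \<longleftrightarrow> F z d" if "d \<in> D" for d using FE2[of z d] inQZ \<open>z \<in> Z\<close> \<open>z \<noteq> s\<close> that by auto
    ultimately show ?thesis unfolding D'_def by auto
  qed
  have uv: "u \<in> nbrs F s D" "v \<in> nbrs F s D" using Fuv D by auto
  have wbig: "big E (insert w S)" if "p \<in> S" "p \<in> D" "p \<noteq> u" "p \<noteq> v" for p S
    using big2[of w "insert w S" p E] w'(3)[OF inQ[OF that(2-4)]] that wD by auto
  have "solid E (D' \<union> Z)"
  proof (cases "s = t")
    case True
    then have "big F (nbrs F s D)" using big by simp
    then have "\<not> nbrs F s D \<subseteq> {u, v}" using big_mono Fuv(1) by (metis big_pair[OF F])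
    then obtain p where "p \<in> nbrs F s D" "p \<noteq> u" "p \<noteq> v" by blast
    then have "big E (nbrs E s D')" unfolding nbs using wbig[of p] by auto
    moreover have "s \<notin> D'" unfolding D'_def using stZ wD DZ by auto
    ultimately have "solid E (insert s D')" using solid_hub[OF cD'] by blast
    moreover have "Z = {s}" using ipath_eqD[OF iZ True] .
    ultimately show ?thesis by simp
  next
    case False
    have nbg: "\<not> big F (nbrs F s D)" "\<not> big F (nbrs F t D)" "\<And>z. z \<in> Z \<Longrightarrow> z \<noteq> s \<Longrightarrow> z \<noteq> t \<Longrightarrow> nbrs F z D = {}"
      using D(2) False unfolding ears_def by auto
    have "nbrs F s D = {u, v}" using not_big_at[OF nbg(1) uv(1)] uv(2) D(7) by (metis insertE singletonD)
    then have ns: "nbrs E s D' = {w}" unfolding nbs by auto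
    have nt: "nbrs E t D' = nbrs F t D" using nbz[OF stZ(2)] False by auto
    have tuv: "u \<notin> nbrs F t D" "v \<notin> nbrs F t D" using D(3)[OF False] uv by auto
    have bct: "big F (nbrs F t D) \<longleftrightarrow> big E (nbrs F t D)"
      by (rule big_cong) (use FE2 inQ tuv in \<open>metis UnI1 nbrs_iff\<close>)
    have "nbrs F t D \<noteq> {}" using big nbg by auto
    then obtain p where p: "p \<in> nbrs F t D" by (meson ex_in_conv)
    then have pw: "p \<in> D" "p \<noteq> u" "p \<noteq> v" using tuv by auto
    show ?thesis
    proof (rule solid_earI[OF cD' iZE])
      show "D' \<inter> Z = {}" unfolding D'_def using DZ wD by auto
      show "\<not> big E (nbrs E s D')" unfolding ns by simp
      show "\<not> big E (nbrs E t D')" unfolding nt using bct nbg by simp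
      show "big E (nbrs E s D' \<union> nbrs E t D')" unfolding ns nt using wbig[OF p pw] by simp
      show "nbrs E z D' = {}" if "z \<in> Z" "z \<noteq> s" "z \<noteq> t" for z using nbz[OF that(1,2)] nbg(3)[OF that] by simp
    qed (use False in auto)
  qed
  moreover have "D' \<union> Z = insert w (Q \<union> {x1, x2, x3})" unfolding D'_def D(1) by simp
  ultimately show ?thesis by simp
qed

subsection \<open>Completing a neighbourhood\<close>

definition fill :: "'a set \<Rightarrow> ('a \<Rightarrow> 'a \<Rightarrow> bool) \<Rightarrow> 'a \<Rightarrow> 'a \<Rightarrow> bool" where
  "fill X E u v \<longleftrightarrow> E u v \<or> u \<in> X \<and> v \<in> X \<and> u \<noteq> v"

lemma graph_rel_fill: "graph_rel E \<Longrightarrow> graph_rel (fill X E)"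
  unfolding graph_rel_def fill_def by auto

text \<open>If all vertices of \<open>Z\<close> but one, \<open>y\<close>, are pairwise adjacent
  already, completing acts on this set like contracting the edge \<open>y w\<close>, and
  \<open>solid_split\<close> applies. Otherwise \<open>Z\<close> is empty or consists of three
  pairwise nonadjacent vertices; in the second case \<open>w\<close> is the centre of a
  claw.\<close>

theorem solid_fill:
  assumes E: "graph_rel E" and Q: "Q \<noteq> {}" "Q \<inter> X = {}" and Z: "Z \<subseteq> X" "w \<notin> Z" "w \<in> X"
    and wX: "\<And>x. x \<in> Z \<Longrightarrow> E w x" "\<And>q. q \<in> Q \<Longrightarrow> \<not> E w q"
    and s: "solid (fill X E) (Q \<union> Z)"
  shows "solid E (Q \<union> Z) \<or> solid E (insert w (Q \<union> Z))"
proof -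
  let ?F = "fill X E"
  have F: "graph_rel ?F" using graph_rel_fill[OF E] .
  note sym = graph_rel_sym[OF E] and irr = graph_rel_irrefl[OF E]
  have wQ: "w \<notin> Q" using Q Z by auto
  have fin: "finite Z" using solid_finite[OF s] by simp
  have FEQ: "?F q u \<longleftrightarrow> E q u" "?F u q \<longleftrightarrow> E u q" if "q \<in> Q" for q u using that Q unfolding fill_def by auto
  have FZ: "?F u v \<longleftrightarrow> u \<noteq> v" if "u \<in> Z" "v \<in> Z" for u v using that Z irr unfolding fill_def by auto
  \<comment> \<open>Four vertices of \<open>Z\<close> would already be the whole solid by
    \<open>solid_clique4\<close>, leaving no room for \<open>Q\<close>.\<close>
  have le3: "card Z \<le> 3"
  proof (rule ccontr)
    assume "\<not> card Z \<le> 3"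
    then have "4 \<le> card Z" by simp
    then obtain K where K: "K \<subseteq> Z" "card K = 4" by (rule obtain_subset_with_card_n) blast
    have "Q \<union> Z = K" by (rule solid_clique4[OF F s]) (use K FZ in auto)
    then show False using K Q Z by auto
  qed
  have one: ?thesis if y: "y \<in> Z" "\<And>u v. u \<in> Z - {y} \<Longrightarrow> v \<in> Z - {y} \<Longrightarrow> u \<noteq> v \<Longrightarrow> E u v" for y
  proof -
    define R where "R = Q \<union> (Z - {y})"
    have iR: "insert y R = Q \<union> Z" unfolding R_def using y by auto
    have yR: "y \<notin> R" unfolding R_def using y Z Q by auto
    have wR: "w \<notin> R" unfolding R_def using wQ Z by auto
    have sp: "splits E ?F R y y w"
      unfolding splits_def
    proof (intro conjI ballI)
      show "y \<noteq> w" "E y w" using y(1) Z wX(1)[of y] sym[of y w] by auto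
      show "?F u v \<longleftrightarrow> E u v" if "u \<in> R" "v \<in> R" for u v
        using that FEQ FZ[of u v] y(2)[of u v] irr unfolding R_def by auto
      show "?F y r \<longleftrightarrow> E y r \<or> E w r" if "r \<in> R" for r
        using that FEQ wX FZ[of y r] y unfolding R_def by auto
    qed (use E F yR wR in auto)
    have "split_solid E R y w" by (rule solid_split[OF sp]) (use s iR in simp)
    \<comment> \<open>The preimage without \<open>y\<close> is impossible: the neighbours of
      \<open>w\<close> in it are pairwise adjacent, but no vertex of \<open>Q\<close> is adjacent to
      \<open>w\<close>.\<close>
    moreover have "\<not> solid E (insert w R)"
    proof
      assume sw: "solid E (insert w R)"
      obtain q where q: "q \<in> Q" using Q by auto
      have "q = w \<or> E w q"
      proof (rule solid_simplicial[OF E sw])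
        fix p p' assume "p \<in> insert w R" "p' \<in> insert w R" "E w p" "E w p'" "p \<noteq> p'"
        then show "E p p'" using y(2)[of p p'] wX irr unfolding R_def by auto
      qed (use q R_def in auto)
      then show False using q wX wQ by auto
    qed
    moreover have "insert y (insert w R) = insert w (Q \<union> Z)" using iR by auto
    ultimately show ?thesis unfolding split_solid_def using iR by auto
  qed
  show ?thesis
  proof (cases "\<exists>y\<in>Z. \<forall>u\<in>Z - {y}. \<forall>v\<in>Z - {y}. u \<noteq> v \<longrightarrow> E u v")
    case True then show ?thesis using one by blast
  next
    case False
    show ?thesis
    proof (cases "Z = {}")
      case True
      then have "solid E (Q \<union> Z)" using solid_cong[OF s] FEQ by auto
      then show ?thesis ..
    next
      case Zne: False
      have "card Z = 3"
      proof (rule ccontr)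
        assume "card Z \<noteq> 3"
        then have "card Z \<le> 2" using le3 by simp
        moreover obtain y where y: "y \<in> Z" using Zne by auto
        ultimately have "card (Z - {y}) \<le> 1" using fin by simp
        then have "\<forall>u\<in>Z - {y}. \<forall>v\<in>Z - {y}. u = v" using fin by (metis card_le_Suc0_iff_eq finite_Diff One_nat_def)
        then show False using False y by blast
      qed
      then obtain x1 x2 x3 where x: "Z = {x1, x2, x3}" "x1 \<noteq> x2" "x2 \<noteq> x3" "x1 \<noteq> x3" unfolding card_3_iff by blast
      have non: "\<not> E u v" if uv: "u \<in> Z" "v \<in> Z" "u \<noteq> v" for u v
      proof
        assume "E u v"
        have "{u, v} \<noteq> Z" using \<open>card Z = 3\<close> uv by auto
        then obtain y where "y \<in> Z" "y \<noteq> u" "y \<noteq> v" using uv by auto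
        then have "card {u, v, y} = 3" "{u, v, y} \<subseteq> Z" using uv by auto
        then have "Z = {u, v, y}" using card_subset_eq[OF fin] \<open>card Z = 3\<close> by metis
        then have "Z - {y} = {u, v}" using \<open>y \<noteq> u\<close> \<open>y \<noteq> v\<close> by auto
        then have "\<forall>p\<in>Z - {y}. \<forall>q\<in>Z - {y}. p \<noteq> q \<longrightarrow> E p q" using \<open>E u v\<close> sym[of u v] by auto
        then show False using False \<open>y \<in> Z\<close> by blast
      qed
      have "solid E (insert w (Q \<union> {x1, x2, x3}))"
        by (rule solid_claw[OF E F]) (use x Q Z wQ wX FEQ FZ non s in auto)
      then show ?thesis using x by simp
    qed
  qed
qed

subsection \<open>Alternating cell counts\<close>

definition cell :: "nat \<Rightarrow> ('a \<Rightarrow> 'a \<Rightarrow> bool) \<Rightarrow> 'a set \<Rightarrow> bool" where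
  "cell j E W \<longleftrightarrow> (if j = 0 then W = {} else if j = 1 then \<exists>v. W = {v}
     else if j = 2 then \<exists>u v. W = {u, v} \<and> u \<noteq> v \<and> E u v else if j = 3 then icycle E W else solid E W)"

text \<open>The contribution of the single set \<open>W\<close> to the alternating sum. Attaching
  the sum to sets allows two graphs to be compared on small groups of sets.\<close>

fun wt :: "nat \<Rightarrow> ('a \<Rightarrow> 'a \<Rightarrow> bool) \<Rightarrow> 'a set \<Rightarrow> int" where
  "wt 0 E W = of_bool (cell 0 E W)"
| "wt (Suc j) E W = of_bool (cell (Suc j) E W) - wt j E W"

lemma cell_simps:
  "cell 0 E W \<longleftrightarrow> W = {}"
  "cell (Suc 0) E W \<longleftrightarrow> (\<exists>v. W = {v})"
  "cell (Suc (Suc 0)) E W \<longleftrightarrow> (\<exists>u v. W = {u, v} \<and> u \<noteq> v \<and> E u v)"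
  "cell (Suc (Suc (Suc 0))) E W \<longleftrightarrow> icycle E W"
  "cell (Suc (Suc (Suc (Suc 0)))) E W \<longleftrightarrow> solid E W"
  by (simp_all add: cell_def)

lemma le4_cases:
  "j \<le> (4::nat) \<Longrightarrow> j = 0 \<or> j = Suc 0 \<or> j = Suc (Suc 0) \<or> j = Suc (Suc (Suc 0)) \<or> j = Suc (Suc (Suc (Suc 0)))"
  by auto

lemma cell_cong:
  assumes "\<And>u v. u \<in> W \<Longrightarrow> v \<in> W \<Longrightarrow> E u v \<longleftrightarrow> F u v"
  shows "cell j E W \<longleftrightarrow> cell j F W"
proof -
  have "(\<exists>u v. W = {u, v} \<and> u \<noteq> v \<and> E u v) \<longleftrightarrow> (\<exists>u v. W = {u, v} \<and> u \<noteq> v \<and> F u v)"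
    using assms by blast
  moreover have "icycle E W \<longleftrightarrow> icycle F W" using icycle_cong[of E W F] icycle_cong[of F W E] assms by blast
  moreover have "solid E W \<longleftrightarrow> solid F W" using solid_cong[of E W F] solid_cong[of F W E] assms by blast
  ultimately show ?thesis unfolding cell_def by simp
qed

lemma wt_cong:
  "(\<And>u v. u \<in> W \<Longrightarrow> v \<in> W \<Longrightarrow> E u v \<longleftrightarrow> F u v) \<Longrightarrow> wt j E W = wt j F W"
  by (induction j) (simp_all add: cell_cong[of W E F])

lemma icycle_card: "icycle E C \<Longrightarrow> 3 \<le> card C"
proof -
  assume c: "icycle E C"
  then obtain x P a b where C: "C = insert x P" "x \<notin> P" "ipath E P a b" "a \<noteq> b" unfolding icycle_def by blast
  have "x \<noteq> a" "x \<noteq> b" using ipath_ends[OF C(3)] C(2) by auto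
  then have "{x, a, b} \<subseteq> C" "card {x, a, b} = 3" using ipath_ends[OF C(3)] C(1,4) by auto
  then show ?thesis using card_mono[OF icycle_finite[OF c]] by metis
qed

lemma solid_card: "solid E W \<Longrightarrow> 4 \<le> card W"
proof -
  assume s: "solid E W"
  then obtain D Z s t where D: "W = D \<union> Z" "ears E D Z s t" unfolding solid_def by blast
  then have d: "icycle E D" "D \<inter> Z = {}" "ipath E Z s t" unfolding ears_def by auto
  have "card W = card D + card Z" unfolding D(1) by (rule card_Un_disjoint) (use d icycle_finite ipath_finite in auto)
  moreover have "card Z \<noteq> 0" using ipath_ends[OF d(3)] ipath_finite[OF d(3)] by auto
  ultimately show ?thesis using icycle_card[OF d(1)] by simp
qed

lemma icycle_proper:
  assumes E: "graph_rel E" and "icycle E C" "D \<subset> C" shows "\<not> icycle E D"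
proof
  assume D: "icycle E D"
  obtain x where x: "x \<in> C" "x \<notin> D" using assms by auto
  obtain P a b where P: "C = insert x P" "x \<notin> P" "ipath E P a b" "a \<noteq> b" "\<And>p. p \<in> P \<Longrightarrow> E x p \<longleftrightarrow> p = a \<or> p = b"
    by (rule icycle_at[OF E assms(2) x(1)]) blast
  then show False using ipath_no_icycle[OF E P(3) _ D] assms x by blast
qed

lemma dominating_icycle:
  assumes E: "graph_rel E" and w: "w \<notin> W" "\<And>u. u \<in> W \<Longrightarrow> E w u"
  shows "icycle E (insert w W) \<longleftrightarrow> (\<exists>u v. W = {u, v} \<and> u \<noteq> v \<and> E u v)"
proof
  assume c: "icycle E (insert w W)"
  obtain P a b where P: "insert w W = insert w P" "w \<notin> P" "ipath E P a b" "a \<noteq> b" "\<And>p. p \<in> P \<Longrightarrow> E w p \<longleftrightarrow> p = a \<or> p = b"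
    by (rule icycle_at[OF E c, of w]) auto
  have W: "W = P" using P(1,2) w(1) by (metis insert_ident)
  then have Pab: "P = {a, b}" using P(5) w(2) ipath_ends[OF P(3)] by blast
  obtain n R where R: "P = insert a R" "a \<notin> R" "ipath E R n b" "\<And>p. p \<in> R \<Longrightarrow> E a p \<longleftrightarrow> p = n"
    by (rule ipath_uncons[OF P(3,4)]) blast
  have n: "n \<in> R" using ipath_ends[OF R(3)] by simp
  then have "n \<in> {a, b}" "n \<noteq> a" using R(1,2) Pab by auto
  then have "E a b" using R(4)[OF n] by auto
  then show "\<exists>u v. W = {u, v} \<and> u \<noteq> v \<and> E u v" using W Pab P(4) by blast
next
  assume "\<exists>u v. W = {u, v} \<and> u \<noteq> v \<and> E u v"
  then obtain u v where uv: "W = {u, v}" "u \<noteq> v" "E u v" by blast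
  have "ipath E {u, v} u v" using ipath.step[OF ipath.single, of u v E] uv by auto
  then show "icycle E (insert w W)" unfolding uv(1) by (rule icycleI) (use uv w in auto)
qed

text \<open>The cells through a dominating vertex stand on the cells of one dimension less: edges on
  vertices, triangles on edges, wheels on induced cycles.\<close>

lemma cone_cell:
  assumes E: "graph_rel E" and w: "w \<notin> W" "\<And>u. u \<in> W \<Longrightarrow> E w u" and j: "j \<le> 3"
  shows "cell (Suc j) E (insert w W) \<longleftrightarrow> cell j E W"
proof -
  consider "j = 0" | "j = Suc 0" | "j = Suc (Suc 0)" | "j = Suc (Suc (Suc 0))" using j by linarith
  then show ?thesis
  proof cases
    case 1 then show ?thesis using w(1) by (auto simp: cell_simps)
  next
    case 2
    have "(\<exists>u v. insert w W = {u, v} \<and> u \<noteq> v \<and> E u v) \<longleftrightarrow> (\<exists>v. W = {v})"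
    proof
      assume "\<exists>u v. insert w W = {u, v} \<and> u \<noteq> v \<and> E u v"
      then obtain u v where uv: "insert w W = {u, v}" "u \<noteq> v" by blast
      then have "w = u \<or> w = v" by auto
      then have "W = {v} \<or> W = {u}" using uv w(1) by (metis insert_commute insert_ident singletonD)
      then show "\<exists>v. W = {v}" by blast
    next
      assume "\<exists>v. W = {v}"
      then show "\<exists>u v. insert w W = {u, v} \<and> u \<noteq> v \<and> E u v" using w by auto
    qed
    then show ?thesis using 2 by (simp add: cell_simps)
  next
    case 3 then show ?thesis using dominating_icycle[OF E w] by (simp add: cell_simps)
  next
    case 4 then show ?thesis using dominating_solid[OF E w] by (simp add: cell_simps)
  qed
qed

text \<open>The recursion telescopes: at \<open>Suc j\<close> the cell of \<open>insert w W\<close>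
  cancels the remainder \<open>cell j E W\<close> left by the step before.\<close>

lemma cone_wt:
  assumes E: "graph_rel E" and w: "w \<notin> W" "\<And>u. u \<in> W \<Longrightarrow> E w u" and j: "j \<le> 4"
  shows "wt j E W + wt j E (insert w W) = of_bool (cell j E W)"
  using j
proof (induction j)
  case 0 then show ?case by (simp add: cell_simps)
next
  case (Suc j)
  then have "wt j E W + wt j E (insert w W) = of_bool (cell j E W)" "j \<le> 3" by auto
  then show ?case using cone_cell[OF E w, of j] by simp
qed

section \<open>Induced cycles and weights under the contraction of an edge\<close>

lemma icycle_split:
  assumes sp: "splits E F P y x x'" and c: "icycle F (insert y P)"
  shows "icycle E (insert x P) \<or> icycle E (insert x' P) \<or> icycle E (insert x (insert x' P))"
proof -
  have E: "graph_rel E" and F: "graph_rel F" and xs: "x \<notin> P" "x' \<notin> P" "y \<notin> P" "x \<noteq> x'" "E x x'" using sp unfolding splits_def by auto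
  have FE: "F u v \<longleftrightarrow> E u v" if "u \<in> P" "v \<in> P" for u v using sp that unfolding splits_def by blast
  have Fy: "F y r \<longleftrightarrow> E x r \<or> E x' r" if "r \<in> P" for r using sp that unfolding splits_def by blast
  note sym = graph_rel_sym[OF E]
  obtain P' a b where P': "insert y P = insert y P'" "y \<notin> P'" "ipath F P' a b" "a \<noteq> b" "\<And>r. r \<in> P' \<Longrightarrow> F y r \<longleftrightarrow> r = a \<or> r = b"
    by (rule icycle_at[OF F c, of y]) auto
  have PP: "P' = P" using P'(1,2) xs by (metis insert_ident)
  note P = P'(3-5)[unfolded PP]
  have ab: "a \<in> P" "b \<in> P" using P(1) ipath_ends by metis+
  have iP: "ipath E P a b" by (rule ipath_cong[OF P(1)]) (use FE in blast)
  have xp: "p = a \<or> p = b" if "p \<in> P" "m = x \<or> m = x'" "E m p" for m p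
    using P(3)[OF that(1)] Fy[of p] that by auto
  have one: "icycle E (insert m P)" if "m = x \<or> m = x'" "E m a" "E m b" for m
    by (rule icycleI[OF iP P(2)]) (use xs xp[of _ m] that in auto)
  have two: "icycle E (insert x (insert x' P))" if m: "m = x \<and> m' = x' \<or> m = x' \<and> m' = x" "E m a" "\<not> E m b" "E m' b" "\<not> E m' a" for m m'
  proof -
    have mm: "E m m'" "E m' m" using m xs sym[of x x'] by auto
    have "icycle E (P \<union> {m', m})"
    proof (rule icycle_join[OF E iP])
      show "ipath E {m', m} m' m" using ipath.step[OF ipath.single, of m' m E] m mm xs by auto
      fix u v assume "u \<in> P" "v \<in> {m', m}"
      then show "E u v \<longleftrightarrow> u = b \<and> v = m' \<or> u = a \<and> v = m"
        using m xp[of u v] sym[of u v] P(2) by auto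
    qed (use m xs P(2) in auto)
    moreover have "P \<union> {m', m} = insert x (insert x' P)" using m by auto
    ultimately show ?thesis by simp
  qed
  have cov: "E x a \<or> E x' a" "E x b \<or> E x' b" using P(3) Fy ab by auto
  consider "E x a" "E x b" | "E x' a" "E x' b" | "E x a" "\<not> E x b" "E x' b" "\<not> E x' a"
    | "E x' a" "\<not> E x' b" "E x b" "\<not> E x a" using cov by blast
  then show ?thesis
  proof cases
    case 1 then show ?thesis using one[of x] by blast
  next
    case 2 then show ?thesis using one[of x'] by blast
  next
    case 3 then show ?thesis using two[of x x'] by blast
  next
    case 4 then show ?thesis using two[of x' x] by blast
  qed
qed

lemma icycle_fan_split:
  assumes sp: "splits E F P y x x'" and c: "icycle E (insert x P)" and nc: "\<not> icycle F (insert y P)"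
  shows "solid E (insert x (insert x' P))" "\<not> solid F (insert y P)"
proof -
  have E: "graph_rel E" and F: "graph_rel F" and xs: "x \<notin> P" "x' \<notin> P" "y \<notin> P" "x \<noteq> x'" "E x x'" using sp unfolding splits_def by auto
  have FE: "E u v \<longleftrightarrow> F u v" if "u \<in> P" "v \<in> P" for u v using sp that unfolding splits_def by blast
  have Fy: "F y r \<longleftrightarrow> E x r \<or> E x' r" if "r \<in> P" for r using sp that unfolding splits_def by blast
  obtain P' a b where P': "insert x P = insert x P'" "x \<notin> P'" "ipath E P' a b" "a \<noteq> b" "\<And>r. r \<in> P' \<Longrightarrow> E x r \<longleftrightarrow> r = a \<or> r = b"
    by (rule icycle_at[OF E c, of x]) auto
  have PP: "P' = P" using P'(1,2) xs by (metis insert_ident)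
  note P = P'(3-5)[unfolded PP]
  have iF: "ipath F P a b" by (rule ipath_cong[OF P(1)]) (use FE in blast)
  show "\<not> solid F (insert y P)" by (rule fan_not_solid[OF F iF xs(3)])
  have "\<exists>p\<in>P. E x' p \<and> p \<noteq> a \<and> p \<noteq> b"
  proof (rule ccontr)
    assume "\<not> ?thesis"
    then have "icycle F (insert y P)" using P(3) Fy xs by (intro icycleI[OF iF P(2)]) auto
    then show False using nc by simp
  qed
  then obtain p where p: "p \<in> P" "E x' p" "p \<noteq> a" "p \<noteq> b" by blast
  have "big E (nbrs E x' (insert x P))"
    by (rule big2[of x _ p]) (use p P(3)[OF p(1)] xs graph_rel_sym[OF E, of x x'] in auto)
  then have "solid E (insert x' (insert x P))" using solid_hub[OF c] xs(2) xs(4)[symmetric] by blast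
  then show "solid E (insert x (insert x' P))" by (simp add: insert_commute)
qed

text \<open>Two cycles face one image. Both run through the same path \<open>P\<close>, hence
  through the same ends, and \<open>x'\<close> sees these ends and \<open>x\<close> on the cycle
  through \<open>x\<close>.\<close>

lemma icycle_both_split:
  assumes sp: "splits E F P y x x'" and c: "icycle E (insert x P)" "icycle E (insert x' P)"
  shows "solid E (insert x (insert x' P))" "icycle F (insert y P)"
proof -
  have E: "graph_rel E" and F: "graph_rel F" and xs: "x \<notin> P" "x' \<notin> P" "y \<notin> P" "x \<noteq> x'" "E x x'" using sp unfolding splits_def by auto
  have Fy: "F y r \<longleftrightarrow> E x r \<or> E x' r" if "r \<in> P" for r using sp that unfolding splits_def by blast
  obtain a b where ab: "a \<in> insert x' P" "b \<in> insert x' P" "a \<noteq> b" "a \<noteq> x'" "b \<noteq> x'" "\<And>p. p \<in> insert x' P \<Longrightarrow> E x' p \<longleftrightarrow> p = a \<or> p = b"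
    by (rule icycle_nbrs[OF E c(2), of x']) auto
  have "big E (nbrs E x' (insert x P))"
    by (rule big3[of a _ b x]) (use ab xs graph_rel_sym[OF E, of x x'] in auto)
  then have "solid E (insert x' (insert x P))" using solid_hub[OF c(1)] xs(2) xs(4)[symmetric] by blast
  then show "solid E (insert x (insert x' P))" by (simp add: insert_commute)
  show "icycle F (insert y P)"
  proof (rule ccontr)
    assume nc: "\<not> icycle F (insert y P)"
    obtain P' a b where P': "insert x P = insert x P'" "x \<notin> P'" "ipath E P' a b" "a \<noteq> b" "\<And>r. r \<in> P' \<Longrightarrow> E x r \<longleftrightarrow> r = a \<or> r = b"
      by (rule icycle_at[OF E c(1), of x]) auto
    have PP: "P' = P" using P'(1,2) xs by (metis insert_ident)
    note P = P'(3-5)[unfolded PP]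
    obtain Q a' b' where Q': "insert x' P = insert x' Q" "x' \<notin> Q" "ipath E Q a' b'" "a' \<noteq> b'" "\<And>r. r \<in> Q \<Longrightarrow> E x' r \<longleftrightarrow> r = a' \<or> r = b'"
      by (rule icycle_at[OF E c(2), of x']) auto
    have QP: "Q = P" using Q'(1,2) xs by (metis insert_ident)
    note Q = Q'(3-5)[unfolded QP]
    \<comment> \<open>An end of \<open>P\<close> has at most one neighbour in \<open>P\<close> and
      an inner vertex has two, so the two descriptions of \<open>P\<close> have the same
      ends.\<close>
    have e: "r = a \<or> r = b" if r: "r = a' \<or> r = b'" for r
    proof (rule ccontr)
      assume no: "\<not> (r = a \<or> r = b)"
      have rP: "r \<in> P" using r ipath_ends[OF Q(1)] by auto
      obtain u v where uv: "u \<in> P" "v \<in> P" "u \<noteq> v" "E r u" "E r v"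
        using ipath_interior[OF E P(1) rP] no by metis
      have "ipath E P r a' \<or> ipath E P r b'" using r Q(1) ipath_rev[OF E Q(1)] by auto
      then show False using ipath_end_degree[OF E _ uv(1,2,4,5)] uv(3) by blast
    qed
    have "ipath F P a b" by (rule ipath_cong[OF P(1)]) (use sp in \<open>auto simp: splits_def\<close>)
    then have "icycle F (insert y P)"
      by (rule icycleI) (use P(2,3) Q(3) e Fy xs in auto)
    then show False using nc by simp
  qed
qed

text \<open>The contraction shortens the cycle by one vertex. The last hypothesis excludes a
  triangle, which would shrink to an edge.\<close>

lemma icycle_contract:
  assumes sp: "splits E F P y x x'" and c: "icycle E (insert x (insert x' P))" and P2: "\<nexists>u. P = {u}"
  shows "icycle F (insert y P)"
proof -
  have E: "graph_rel E" and F: "graph_rel F" and xs: "x \<notin> P" "x' \<notin> P" "y \<notin> P" "x \<noteq> x'" "E x x'" using sp unfolding splits_def by auto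
  have FE: "E u v \<longleftrightarrow> F u v" if "u \<in> P" "v \<in> P" for u v using sp that unfolding splits_def by blast
  have Fy: "F y r \<longleftrightarrow> E x r \<or> E x' r" if "r \<in> P" for r using sp that unfolding splits_def by blast
  obtain R a b where R: "insert x (insert x' P) = insert x R" "x \<notin> R" "ipath E R a b" "a \<noteq> b" "\<And>r. r \<in> R \<Longrightarrow> E x r \<longleftrightarrow> r = a \<or> r = b"
    by (rule icycle_at[OF E c, of x]) auto
  have Rx: "R = insert x' P" using R(1,2) xs by (metis insert_iff insert_ident)
  have "x' = a \<or> x' = b" using R(5)[of x'] Rx xs by auto
  then obtain b' where b': "ipath E R x' b'" "x' \<noteq> b'" "\<And>r. r \<in> R \<Longrightarrow> E x r \<longleftrightarrow> r = x' \<or> r = b'"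
  proof
    assume "x' = a" then show thesis using that[of b] R by auto
  next
    assume "x' = b" then show thesis using that[of a] R ipath_rev[OF E R(3)] by auto
  qed
  obtain n S where S: "R = insert x' S" "x' \<notin> S" "ipath E S n b'" "\<And>p. p \<in> S \<Longrightarrow> E x' p \<longleftrightarrow> p = n"
    by (rule ipath_uncons[OF b'(1,2)]) blast
  have SP: "S = P" using S(1,2) Rx xs by (metis insert_ident)
  note S' = S(3,4)[unfolded SP]
  have nb': "n \<noteq> b'" using ipath_eqD[OF S'(1)] P2 by blast
  have mem: "n \<in> P" "b' \<in> P" using S'(1) ipath_ends by metis+
  have "ipath F P n b'" by (rule ipath_cong[OF S'(1)]) (use FE in blast)
  then show ?thesis
    by (rule icycleI[OF _ nb' xs(3)]) (use Fy S'(2) b'(3) Rx xs in auto)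
qed

text \<open>Let \<open>a2\<close>, \<open>a3\<close>, \<open>a4\<close> be the surplus of edges,
  cycles and solids among the three preimages over the image. Since \<open>P\<close> is nonempty,
  dimensions 0 and 1 contribute nothing, and the claim for \<open>j = 2, 3, 4\<close> becomes
  \<open>0 \<le> a2\<close>, \<open>0 \<le> a3 - a2\<close> and
  \<open>0 \<le> a4 - (a3 - a2)\<close>.\<close>

lemma contract_wt:
  assumes sp: "splits E F P y x x'" and P: "P \<noteq> {}" "finite P" and j: "j \<le> 4"
  shows "wt j F (insert y P) \<le> wt j E (insert x P) + wt j E (insert x' P) + wt j E (insert x (insert x' P))"
proof -
  have E: "graph_rel E" and F: "graph_rel F" and xs: "x \<notin> P" "x' \<notin> P" "y \<notin> P" "x \<noteq> x'" "E x x'" using sp unfolding splits_def by auto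
  note sp' = splits_sym[OF sp]
  have Fy: "F y r \<longleftrightarrow> E x r \<or> E x' r" if "r \<in> P" for r using sp that unfolding splits_def by blast
  have c1: "card (insert x P) = card P + 1" "card (insert x' P) = card P + 1" "card (insert y P) = card P + 1"
    "card (insert x (insert x' P)) = card P + 2" using xs P by auto
  have cP: "card P \<ge> 1" using P by (simp add: Suc_le_eq card_gt_0_iff)
  have n1: "\<not> (\<exists>v. insert z P = {v})" if "z \<notin> P" for z
  proof
    assume "\<exists>v. insert z P = {v}"
    then obtain v where "insert z P = {v}" by blast
    then have "card (insert z P) = 1" by (simp only: card_1_singleton_iff One_nat_def) blast
    then show False using that P cP by simp
  qed
  have e2: "cell 2 G (insert z P) \<longleftrightarrow> (\<exists>u. P = {u} \<and> G z u)" if "graph_rel G" "z \<notin> P" for G z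
  proof -
    have "cell 2 G (insert z P) \<longleftrightarrow> (\<exists>u v. insert z P = {u, v} \<and> u \<noteq> v \<and> G u v)" by (simp add: cell_def)
    also have "\<dots> \<longleftrightarrow> (\<exists>u. P = {u} \<and> G z u)"
    proof
      assume "\<exists>u v. insert z P = {u, v} \<and> u \<noteq> v \<and> G u v"
      then obtain u v where uv: "insert z P = {u, v}" "u \<noteq> v" "G u v" by blast
      then consider "z = u" | "z = v" by auto
      then show "\<exists>u. P = {u} \<and> G z u"
      proof cases
        case 1 then have "P = {v}" using uv that by (metis insert_ident singletonD)
        then show ?thesis using 1 uv by auto
      next
        case 2 then have "P = {u}" using uv that by (metis insert_commute insert_ident singletonD)
        then show ?thesis using 2 uv graph_rel_sym[OF that(1)] by auto
      qed
    next
      assume "\<exists>u. P = {u} \<and> G z u"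
      then show "\<exists>u v. insert z P = {u, v} \<and> u \<noteq> v \<and> G u v" using that by auto
    qed
    finally show ?thesis .
  qed
  have e2': "\<not> cell 2 E (insert x (insert x' P))"
  proof
    assume "cell 2 E (insert x (insert x' P))"
    then have "card (insert x (insert x' P)) \<le> 2" by (auto simp: cell_def card_insert_if)
    then show False using c1 cP by simp
  qed
  have w1: "wt 1 E (insert x P) = 0" "wt 1 E (insert x' P) = 0" "wt 1 F (insert y P) = 0" "wt 1 E (insert x (insert x' P)) = 0"
    using n1 xs c1(4) cP by (auto simp: cell_simps card_insert_if)
  define a2 a3 a4 where a:
    "a2 = of_bool (cell 2 E (insert x P)) + of_bool (cell 2 E (insert x' P)) - of_bool (cell 2 F (insert y P)) + (of_bool (cell 2 E (insert x (insert x' P))) :: int)"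
    "a3 = of_bool (icycle E (insert x P)) + of_bool (icycle E (insert x' P)) - of_bool (icycle F (insert y P)) + (of_bool (icycle E (insert x (insert x' P))) :: int)"
    "a4 = of_bool (solid E (insert x P)) + of_bool (solid E (insert x' P)) - of_bool (solid F (insert y P)) + (of_bool (solid E (insert x (insert x' P))) :: int)"
  have s4: "solid F (insert y P) \<Longrightarrow> solid E (insert x P) \<or> solid E (insert x' P) \<or> solid E (insert x (insert x' P))"
    using solid_split[OF sp] unfolding split_solid_def by blast
  have ineq: "0 \<le> a2 \<and> a2 \<le> a3 \<and> a3 - a2 \<le> a4"
  proof (cases "\<exists>u. P = {u}")
    case True
    \<comment> \<open>Two edges collapse to one exactly if \<open>u\<close> sees both
      \<open>x\<close> and \<open>x'\<close>, and exactly then \<open>x x' u\<close> is a triangle: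
      the surpluses of edges and cycles agree.\<close>
    then obtain u where u: "P = {u}" by blast
    have nc: "\<not> icycle E (insert x P)" "\<not> icycle E (insert x' P)" "\<not> icycle F (insert y P)"
      using icycle_card[of E "insert x P"] icycle_card[of E "insert x' P"] icycle_card[of F "insert y P"] c1 u by auto
    have nsF: "\<not> solid F (insert y P)" using solid_card[of F "insert y P"] c1 u by auto
    have c3: "icycle E (insert x (insert x' P))" if "E x u" "E x' u"
    proof -
      have "ipath E {x', u} x' u" using ipath.step[OF ipath.single, of x' u E] that xs u by auto
      then have "icycle E (insert x {x', u})" by (rule icycleI) (use that xs u in auto)
      then show ?thesis using u by simp
    qed
    have c3': "E x u \<and> E x' u" if c: "icycle E (insert x (insert x' P))"
    proof -
      obtain a b where ab: "a \<in> {x, x', u}" "b \<in> {x, x', u}" "a \<noteq> b" "a \<noteq> x" "b \<noteq> x" "\<And>p. p \<in> {x, x', u} \<Longrightarrow> E x p \<longleftrightarrow> p = a \<or> p = b"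
        by (rule icycle_nbrs[OF E c, of x]) (use u in auto)
      obtain a' b' where ab': "a' \<in> {x, x', u}" "b' \<in> {x, x', u}" "a' \<noteq> b'" "a' \<noteq> x'" "b' \<noteq> x'" "\<And>p. p \<in> {x, x', u} \<Longrightarrow> E x' p \<longleftrightarrow> p = a' \<or> p = b'"
        by (rule icycle_nbrs[OF E c, of x']) (use u in auto)
      have "u = a \<or> u = b" using ab by auto
      moreover have "u = a' \<or> u = b'" using ab' by auto
      ultimately show ?thesis using ab(6)[of u] ab'(6)[of u] by auto
    qed
    have "a3 = of_bool (E x u \<and> E x' u)" using nc c3 c3' unfolding a by auto
    moreover have "a2 = of_bool (E x u \<and> E x' u)"
      using e2[OF E xs(1)] e2[OF E xs(2)] e2[OF F xs(3)] e2' Fy[of u] u unfolding a by auto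
    moreover have "a4 \<ge> 0" using nsF unfolding a by simp
    ultimately show ?thesis by simp
  next
    case False
    \<comment> \<open>No edge is involved any more, and each surplus cycle is matched with a surplus
      solid by the lemmas above.\<close>
    have "a2 = 0" using e2[OF E xs(1)] e2[OF E xs(2)] e2[OF F xs(3)] e2' False unfolding a by auto
    moreover have "0 \<le> a3 \<and> a3 \<le> a4"
    proof -
      have sub: "insert x P \<subset> insert x (insert x' P)" "insert x' P \<subset> insert x (insert x' P)" using xs by auto
      have ex: "icycle E (insert x (insert x' P)) \<Longrightarrow> \<not> icycle E (insert x P) \<and> \<not> icycle E (insert x' P)"
        using icycle_proper[OF E _ sub(1)] icycle_proper[OF E _ sub(2)] by blast
      have cF: "icycle F (insert y P) \<Longrightarrow> \<not> solid F (insert y P)" using icycle_not_solid[OF F] by blast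
      have fan': "icycle E (insert x' P) \<Longrightarrow> \<not> icycle F (insert y P) \<Longrightarrow> solid E (insert x (insert x' P)) \<and> \<not> solid F (insert y P)"
        using icycle_fan_split[OF sp'] by (simp add: insert_commute)
      show ?thesis
        using ex cF fan' icycle_fan_split[OF sp] icycle_both_split[OF sp] icycle_contract[OF sp _ False] icycle_split[OF sp] s4
        unfolding a by (auto split: if_splits)
    qed
    ultimately show ?thesis by simp
  qed
  define d where "d j = wt j E (insert x P) + wt j E (insert x' P) + wt j E (insert x (insert x' P)) - wt j F (insert y P)" for j
  have d0: "d 0 = 0" unfolding d_def by (simp add: cell_simps)
  have d1: "d (Suc 0) = 0" using w1 unfolding d_def by simp
  have d2: "d (Suc (Suc 0)) = a2" using d1 unfolding d_def a by (simp add: numeral_2_eq_2)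
  have d3: "d (Suc (Suc (Suc 0))) = a3 - a2" using d2 unfolding d_def a(2) by (simp add: cell_simps(4))
  have d4: "d (Suc (Suc (Suc (Suc 0)))) = a4 - (a3 - a2)" using d3 unfolding d_def a(3) by (simp add: cell_simps(5))
  have "0 \<le> d j" using le4_cases[OF j] d0 d1 d2 d3 d4 ineq by auto
  then show ?thesis unfolding d_def by simp
qed

section \<open>Induced cycles and weights under the completion of a neighbourhood\<close>

lemma icycle_fill:
  assumes E: "graph_rel E" and Q: "Q \<noteq> {}" "Q \<inter> X = {}" and Z: "Z \<subseteq> X" "w \<notin> Z" "w \<in> X"
    and wX: "\<And>x. x \<in> Z \<Longrightarrow> E w x" "\<And>q. q \<in> Q \<Longrightarrow> \<not> E w q"
    and c: "icycle (fill X E) (Q \<union> Z)"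
  shows "icycle E (Q \<union> Z) \<or> icycle E (insert w (Q \<union> Z))"
proof -
  let ?F = "fill X E"
  have F: "graph_rel ?F" using graph_rel_fill[OF E] .
  note sym = graph_rel_sym[OF E] and irr = graph_rel_irrefl[OF E]
  have wQ: "w \<notin> Q" using Q Z by auto
  have FEQ: "?F q u \<longleftrightarrow> E q u" "?F u q \<longleftrightarrow> E u q" if "q \<in> Q" for q u using that Q unfolding fill_def by auto
  have FZ: "?F u v \<longleftrightarrow> u \<noteq> v" if "u \<in> Z" "v \<in> Z" for u v using that Z irr unfolding fill_def by auto
  show ?thesis
  proof (cases "\<exists>z1\<in>Z. \<exists>z2\<in>Z. z1 \<noteq> z2 \<and> \<not> E z1 z2")
    case False
    have "icycle E (Q \<union> Z)"
    proof (rule icycle_cong[OF c])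
      fix u v assume "u \<in> Q \<union> Z" "v \<in> Q \<union> Z"
      then show "?F u v \<longleftrightarrow> E u v" using FEQ FZ[of u v] False irr by (cases "u \<in> Q"; cases "v \<in> Q") auto
    qed
    then show ?thesis ..
  next
    case True
    \<comment> \<open>Only one new edge can occur, because three vertices of \<open>Z\<close> would
      be a triangle and exhaust the cycle. The edge \<open>z1 z2\<close> is replaced by the path
      \<open>z1 w z2\<close>.\<close>
    then obtain z1 z2 where z: "z1 \<in> Z" "z2 \<in> Z" "z1 \<noteq> z2" "\<not> E z1 z2" by blast
    have Zz: "Z = {z1, z2}"
    proof (rule ccontr)
      assume "Z \<noteq> {z1, z2}"
      then obtain z3 where "z3 \<in> Z" "z3 \<noteq> z1" "z3 \<noteq> z2" using z by blast
      then have "Q \<union> Z = {z1, z2, z3}" using icycle_triangle[OF F c, of z1 z2 z3] z FZ by auto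
      then show False using Q Z z \<open>z3 \<in> Z\<close> by auto
    qed
    obtain P a b where P: "Q \<union> Z = insert z1 P" "z1 \<notin> P" "ipath ?F P a b" "a \<noteq> b" "\<And>p. p \<in> P \<Longrightarrow> ?F z1 p \<longleftrightarrow> p = a \<or> p = b"
      by (rule icycle_at[OF F c, of z1]) (use z in auto)
    have z2P: "z2 \<in> P" using P(1) z by auto
    have "z2 = a \<or> z2 = b" using P(5)[OF z2P] FZ z by auto
    then obtain b' where b': "ipath ?F P z2 b'" "z2 \<noteq> b'" "\<And>p. p \<in> P \<Longrightarrow> ?F z1 p \<longleftrightarrow> p = z2 \<or> p = b'"
    proof
      assume "z2 = a" then show thesis using that[of b] P by auto
    next
      assume "z2 = b" then show thesis using that[of a] P ipath_rev[OF F P(3)] by auto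
    qed
    have PQ: "p \<in> Q" if "p \<in> P" "p \<noteq> z2" for p using that P(1,2) Zz by blast
    have iP: "ipath E P z2 b'"
    proof (rule ipath_cong[OF b'(1)])
      fix u v assume "u \<in> P" "v \<in> P"
      then show "?F u v \<longleftrightarrow> E u v" using PQ[of u] PQ[of v] FEQ irr[of z2] FZ[OF z(2,2)] by metis
    qed
    have "ipath E (P \<union> {z1}) z2 z1"
    proof (rule ipath_append[OF iP ipath.single])
      fix u v assume u: "u \<in> P" "v \<in> {z1}"
      show "E u v \<longleftrightarrow> u = b' \<and> v = z1"
      proof (cases "u = z2")
        case True then show ?thesis using u z b'(2) sym[of z1 z2] by auto
      next
        case False
        then show ?thesis using b'(3)[OF u(1)] FEQ(2)[OF PQ[OF u(1) False], of z1] u sym[of u z1] by auto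
      qed
    qed (use P in auto)
    then have "icycle E (insert w (P \<union> {z1}))"
    proof (rule icycleI)
      show "z2 \<noteq> z1" using z by simp
      show "w \<notin> P \<union> {z1}" using P(1) wQ Z by auto
      show "E w p \<longleftrightarrow> p = z2 \<or> p = z1" if "p \<in> P \<union> {z1}" for p
        using that PQ[of p] wX z by auto
    qed
    moreover have "insert w (P \<union> {z1}) = insert w (Q \<union> Z)" using P(1) by auto
    ultimately show ?thesis by simp
  qed
qed

text \<open>Only cycles and solids can change, since \<open>Q\<close> is nonempty and the edges at
  its vertices stay as they are. After completing, \<open>W\<close> with \<open>w\<close> is neither
  a cycle nor a solid. A cycle through \<open>w\<close> survives as the cycle \<open>W\<close>, and
  a cycle \<open>W\<close> that is destroyed makes \<open>W\<close> with \<open>w\<close> a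
  solid.\<close>

lemma fill_wt:
  assumes E: "graph_rel E" and Q: "Q \<noteq> {}" "Q \<inter> X = {}" and Z: "Z \<subseteq> X" "w \<notin> Z" "w \<in> X"
    and wX: "\<And>x. x \<in> Z \<Longrightarrow> E w x" "\<And>q. q \<in> Q \<Longrightarrow> \<not> E w q" and j: "j \<le> 4"
  shows "wt j (fill X E) (Q \<union> Z) + wt j (fill X E) (insert w (Q \<union> Z)) \<le> wt j E (Q \<union> Z) + wt j E (insert w (Q \<union> Z))"
proof -
  let ?F = "fill X E"
  define W where "W = Q \<union> Z"
  have F: "graph_rel ?F" using graph_rel_fill[OF E] .
  note sym = graph_rel_sym[OF E] and irr = graph_rel_irrefl[OF E]
  obtain q where q: "q \<in> Q" using Q by auto
  have wQ: "w \<notin> Q" "w \<notin> W" unfolding W_def using Q Z by auto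
  have qw: "q \<noteq> w" using q wQ by auto
  have FEQ: "?F q u \<longleftrightarrow> E q u" "?F u q \<longleftrightarrow> E u q" if "q \<in> Q" for q u using that Q unfolding fill_def by auto
  have FZ: "?F u v \<longleftrightarrow> u \<noteq> v" if "u \<in> X" "v \<in> X" for u v using that irr unfolding fill_def by auto
  have Fw: "u \<in> Z" if "?F w u" "u \<in> insert w W" for u
    using that FEQ(2)[of u w] wX(2)[of u] graph_rel_irrefl[OF F, of w] unfolding W_def by auto
  have c2: "cell 2 ?F V \<longleftrightarrow> cell 2 E V" if "q \<in> V" for V
  proof -
    have "\<And>u v. V = {u, v} \<Longrightarrow> ?F u v \<longleftrightarrow> E u v" using that FEQ[OF q] by auto
    then show ?thesis by (simp add: cell_def) metis
  qed
  have nF: "\<not> icycle ?F (insert w W)" "\<not> solid ?F (insert w W)"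
  proof
    assume c: "icycle ?F (insert w W)"
    obtain a b where ab: "a \<in> insert w W" "b \<in> insert w W" "a \<noteq> b" "a \<noteq> w" "b \<noteq> w" "\<And>p. p \<in> insert w W \<Longrightarrow> ?F w p \<longleftrightarrow> p = a \<or> p = b"
      by (rule icycle_nbrs[OF F c, of w]) auto
    have "a \<in> Z" "b \<in> Z" using Fw ab by auto
    moreover have "?F w a" "?F w b" using ab by auto
    ultimately have "insert w W = {w, a, b}" using icycle_triangle[OF F c, of w a b] ab FZ Z by auto
    then show False using q qw \<open>a \<in> Z\<close> \<open>b \<in> Z\<close> Q Z unfolding W_def by blast
  next
    show "\<not> solid ?F (insert w W)"
    proof
      assume s: "solid ?F (insert w W)"
      have "q = w \<or> ?F w q"
      proof (rule solid_simplicial[OF F s])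
        show "?F p p'" if "p \<in> insert w W" "p' \<in> insert w W" "?F w p" "?F w p'" "p \<noteq> p'" for p p'
          using Fw[OF that(3,1)] Fw[OF that(4,2)] that(5) FZ Z by auto
      qed (use q W_def in auto)
      then show False using qw Fw[of q] q Q Z unfolding W_def by auto
    qed
  qed
  have sub: "W \<subset> insert w W" using wQ by auto
  have ex: "\<not> (icycle E W \<and> icycle E (insert w W))" using icycle_proper[OF E _ sub] by blast
  have cF: "icycle ?F W \<Longrightarrow> icycle E W \<or> icycle E (insert w W)"
    using icycle_fill[OF E Q Z wX] unfolding W_def by blast
  have sF: "solid ?F W \<Longrightarrow> solid E W \<or> solid E (insert w W)"
    using solid_fill[OF E Q Z wX] unfolding W_def by blast
  have cs: "icycle ?F W \<Longrightarrow> \<not> solid ?F W" using icycle_not_solid[OF F] by blast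
  \<comment> \<open>A shortcut: the neighbours \<open>a\<close>, \<open>b\<close> of
    \<open>w\<close> on the cycle form \<open>Z\<close> and become adjacent. They are not adjacent
    before, since the cycle would be the triangle \<open>w a b\<close>, without a vertex of
    \<open>Q\<close>.\<close>
  have cw: "icycle ?F W" if c: "icycle E (insert w W)"
  proof -
    obtain P a b where P: "insert w W = insert w P" "w \<notin> P" "ipath E P a b" "a \<noteq> b" "\<And>p. p \<in> P \<Longrightarrow> E w p \<longleftrightarrow> p = a \<or> p = b"
      by (rule icycle_at[OF E c, of w]) auto
    have WP: "P = W" using P(1,2) wQ by (metis insert_ident)
    have ab: "a \<in> P" "b \<in> P" "E w a" "E w b" using ipath_ends[OF P(3)] P(5) by auto
    have abZ: "a \<in> Z" "b \<in> Z" using ab wX(2) WP unfolding W_def by auto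
    have Zab: "Z = {a, b}" using abZ P(5) wX(1) WP unfolding W_def by blast
    have nab: "\<not> E a b"
    proof
      assume "E a b"
      then have "insert w W = {w, a, b}" using icycle_triangle[OF E c, of w a b] ab WP by auto
      then show False using q qw abZ Q Z unfolding W_def by blast
    qed
    obtain n R where R: "P = insert a R" "a \<notin> R" "ipath E R n b" "\<And>p. p \<in> R \<Longrightarrow> E a p \<longleftrightarrow> p = n"
      by (rule ipath_uncons[OF P(3,4)]) blast
    have n: "n \<in> R" "b \<in> R" using ipath_ends[OF R(3)] by auto
    have RQ: "r \<in> Q" if "r \<in> R" "r \<noteq> b" for r
      using that R(1,2) WP Zab unfolding W_def by blast
    have iR: "ipath ?F R n b"
    proof (rule ipath_cong[OF R(3)])
      fix u v assume "u \<in> R" "v \<in> R"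
      then show "E u v \<longleftrightarrow> ?F u v" using RQ[of u] RQ[of v] FEQ irr[of b] graph_rel_irrefl[OF F, of b] by metis
    qed
    have "icycle ?F (insert a R)"
    proof (rule icycleI[OF iR _ R(2)])
      show "n \<noteq> b" using nab R(4)[OF n(2)] by auto
      show "?F a p \<longleftrightarrow> p = n \<or> p = b" if "p \<in> R" for p
      proof (cases "p = b")
        case True then show ?thesis using FZ[of a b] abZ Z P(4) by auto
      next
        case False then show ?thesis using FEQ(2)[OF RQ[OF that False], of a] R(4)[OF that] by simp
      qed
    qed
    then show ?thesis using R(1) WP by simp
  qed
  have cn: "solid E (insert w W) \<and> \<not> solid ?F W" if c: "icycle E W" and n: "\<not> icycle ?F W"
  proof
    have "\<exists>z1\<in>Z. \<exists>z2\<in>Z. z1 \<noteq> z2 \<and> \<not> E z1 z2"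
    proof (rule ccontr)
      assume no: "\<not> ?thesis"
      have "icycle ?F W"
      proof (rule icycle_cong[OF c])
        fix u v assume "u \<in> W" "v \<in> W"
        then have "u \<in> Q \<or> v \<in> Q \<or> u \<in> Z \<and> v \<in> Z" unfolding W_def by auto
        moreover have "?F u v \<longleftrightarrow> u \<noteq> v" if "u \<in> Z" "v \<in> Z" using FZ that Z(1) by blast
        moreover have "E u v \<longleftrightarrow> u \<noteq> v" if "u \<in> Z" "v \<in> Z" using no that irr[of u] by blast
        ultimately show "E u v \<longleftrightarrow> ?F u v" using FEQ(1)[of u v] FEQ(2)[of v u] by blast
      qed
      then show False using n by simp
    qed
    then obtain z1 z2 where z: "z1 \<in> Z" "z2 \<in> Z" "z1 \<noteq> z2" "\<not> E z1 z2" by blast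
    have "big E (nbrs E w W)" by (rule big2[of z1 _ z2]) (use z wX W_def in auto)
    then show "solid E (insert w W)" using solid_hub[OF c wQ(2)] by blast
    \<comment> \<open>Vertices of \<open>Q\<close> keep their edges, so they have only two
      neighbours in the cycle \<open>W\<close>. A solid, however, has a vertex of degree at least 3
      outside the clique \<open>Z\<close>.\<close>
    show "\<not> solid ?F W"
    proof
      assume s: "solid ?F W"
      have fin: "finite Z" using solid_finite[OF s] unfolding W_def by simp
      have le3: "card Z \<le> 3"
      proof (rule ccontr)
        assume "\<not> card Z \<le> 3"
        then have "4 \<le> card Z" by simp
        then obtain K where K: "K \<subseteq> Z" "card K = 4" by (rule obtain_subset_with_card_n) blast
        have "?F u v" if "u \<in> K" "v \<in> K" "u \<noteq> v" for u v using FZ that K(1) Z(1) by blast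
        then have "W = K" using K W_def by (intro solid_clique4[OF F s]) auto
        then show False using K q Q Z unfolding W_def by auto
      qed
      have "\<exists>v\<in>W - Z. degree3 ?F W v" by (rule solid_degree3[OF F s fin le3]) (use FZ Z(1) in blast)
      then obtain v where v: "v \<in> Q" "degree3 ?F W v" unfolding W_def by auto
      then obtain a b c' where "a \<in> W" "b \<in> W" "c' \<in> W" "a \<noteq> b" "a \<noteq> c'" "b \<noteq> c'" "E v a" "E v b" "E v c'"
        using FEQ(1)[OF v(1)] unfolding degree3_def by auto
      moreover obtain p p' where "\<And>r. r \<in> W \<Longrightarrow> E v r \<longleftrightarrow> r = p \<or> r = p'"
        by (rule icycle_nbrs[OF E c, of v]) (use v W_def in auto)
      ultimately show False by metis
    qed
  qed
  define d where "d j = wt j E W + wt j E (insert w W) - wt j ?F W - wt j ?F (insert w W)" for j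
  have d0: "d 0 = 0" unfolding d_def by (simp add: cell_simps)
  have d1: "d (Suc 0) = 0" using d0 unfolding d_def by (simp add: cell_simps)
  have d2: "d (Suc (Suc 0)) = 0" using d1 c2[of W] c2[of "insert w W"] q unfolding d_def W_def by (simp add: numeral_2_eq_2)
  have d3: "d (Suc (Suc (Suc 0))) = of_bool (icycle E W) + of_bool (icycle E (insert w W)) - of_bool (icycle ?F W)"
    using d2 nF unfolding d_def by (simp add: cell_simps(4))
  have d4: "d (Suc (Suc (Suc (Suc 0)))) = of_bool (solid E W) + of_bool (solid E (insert w W)) - of_bool (solid ?F W)
    - d (Suc (Suc (Suc 0)))"
    using nF unfolding d_def by (simp add: cell_simps(5))
  have "0 \<le> d (Suc (Suc (Suc 0)))" using cF unfolding d3 by auto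
  moreover have "0 \<le> d (Suc (Suc (Suc (Suc 0))))" using cF ex sF cs cw cn unfolding d4 d3 by auto
  ultimately have "0 \<le> d j" using le4_cases[OF j] d0 d1 d2 by auto
  then show ?thesis unfolding d_def W_def by simp
qed

section \<open>Sums of weights over all vertex sets\<close>

lemma sum_Pow_insert:
  fixes f :: "'a set \<Rightarrow> int"
  assumes "finite V" "x \<notin> V"
  shows "(\<Sum>W\<in>Pow (insert x V). f W) = (\<Sum>W\<in>Pow V. f W + f (insert x W))"
proof -
  have "inj_on (insert x) (Pow V)"
    using assms(2) by (intro inj_onI) (metis PowD in_mono insert_ident)
  moreover have "Pow V \<inter> insert x ` Pow V = {}" using assms(2) by auto
  ultimately show ?thesis
    using assms(1) by (simp add: Pow_insert sum.union_disjoint sum.reindex sum.distrib)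
qed

text \<open>The sets inside \<open>X\<close> are kept with value 0, so that the sum runs over a full
  power set and \<open>sum_Pow_insert\<close> applies to it.\<close>

definition rel_wt :: "nat \<Rightarrow> ('a \<Rightarrow> 'a \<Rightarrow> bool) \<Rightarrow> 'a set \<Rightarrow> 'a set \<Rightarrow> int" where
  "rel_wt j E V X = (\<Sum>W\<in>Pow V. if W \<subseteq> X then 0 else wt j E W)"

definition tot_wt :: "nat \<Rightarrow> ('a \<Rightarrow> 'a \<Rightarrow> bool) \<Rightarrow> 'a set \<Rightarrow> int" where
  "tot_wt j E V = (\<Sum>W\<in>Pow V. wt j E W)"

definition cells :: "nat \<Rightarrow> ('a \<Rightarrow> 'a \<Rightarrow> bool) \<Rightarrow> 'a set \<Rightarrow> 'a set set" where
  "cells j E V = {W \<in> Pow V. cell j E W}"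

lemma tot_rel:
  assumes "finite V" "X \<subseteq> V"
  shows "tot_wt j E V = tot_wt j E X + rel_wt j E V X"
proof -
  have "rel_wt j E V X = (\<Sum>W\<in>Pow V - Pow X. wt j E W)"
    unfolding rel_wt_def using assms(1) by (intro sum.mono_neutral_cong_right) auto
  moreover have "tot_wt j E V = (\<Sum>W\<in>Pow V - Pow X. wt j E W) + (\<Sum>W\<in>Pow X. wt j E W)"
    unfolding tot_wt_def using assms by (intro sum.subset_diff) auto
  ultimately show ?thesis unfolding tot_wt_def by simp
qed

lemma rel_wt_cong:
  assumes "\<And>u v. u \<in> V \<Longrightarrow> v \<in> V \<Longrightarrow> E u v \<longleftrightarrow> F u v"
  shows "rel_wt j E V X = rel_wt j F V X"
  unfolding rel_wt_def by (rule sum.cong) (use assms in \<open>auto intro!: wt_cong\<close>)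

lemma tot_wt_cong:
  assumes "\<And>u v. u \<in> V \<Longrightarrow> v \<in> V \<Longrightarrow> E u v \<longleftrightarrow> F u v"
  shows "tot_wt j E V = tot_wt j F V"
  unfolding tot_wt_def by (rule sum.cong) (use assms in \<open>auto intro!: wt_cong\<close>)

lemma tot_wt_Suc:
  assumes "finite V"
  shows "tot_wt (Suc j) E V = int (card (cells (Suc j) E V)) - tot_wt j E V"
proof -
  have "(\<Sum>W\<in>Pow V. of_bool (cell (Suc j) E W) :: int) = int (card (cells (Suc j) E V))"
    using assms unfolding cells_def by (simp add: of_bool_def sum.If_cases Int_def)
  then show ?thesis unfolding tot_wt_def by (simp add: sum_subtractf)
qed

lemma tot_wt_0: "finite V \<Longrightarrow> tot_wt 0 E V = 1"
proof -
  assume "finite V"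
  then have "(\<Sum>W\<in>Pow V. of_bool (W = {}) :: int) = 1"
    by (simp add: of_bool_def)
  then show ?thesis unfolding tot_wt_def by (simp add: cell_simps)
qed

lemma tot_wt_cone:
  assumes E: "graph_rel E" and V: "finite V" "w \<notin> V" "\<And>u. u \<in> V \<Longrightarrow> E w u" and j: "j \<le> 4"
  shows "tot_wt j E (insert w V) = int (card (cells j E V))"
proof -
  have "tot_wt j E (insert w V) = (\<Sum>W\<in>Pow V. wt j E W + wt j E (insert w W))"
    unfolding tot_wt_def by (rule sum_Pow_insert[OF V(1,2)])
  also have "\<dots> = (\<Sum>W\<in>Pow V. of_bool (cell j E W))"
  proof (rule sum.cong)
    fix W assume "W \<in> Pow V"
    then show "wt j E W + wt j E (insert w W) = of_bool (cell j E W)"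
      using V(2,3) by (intro cone_wt[OF E _ _ j]) auto
  qed simp
  also have "\<dots> = int (card (cells j E V))"
    using V unfolding cells_def by (simp add: of_bool_def sum.If_cases Int_def)
  finally show ?thesis .
qed

text \<open>The merged vertex keeps the name \<open>x\<close>. Since \<open>x\<close> and
  \<open>x'\<close> lie in \<open>X\<close>, a set is contained in \<open>X\<close> if and only if
  its trace \<open>W\<close> outside them is. So whole groups are dropped, and the traces that
  remain are nonempty, as \<open>contract_wt\<close> demands.\<close>

lemma rel_wt_contract:
  assumes E: "graph_rel E" and F: "graph_rel F" and V: "finite V" "X \<subseteq> V" "x \<in> X" "x' \<in> X" "x \<noteq> x'" "E x x'" and j: "j \<le> 4"
    and FE: "\<And>u v. u \<in> V - {x, x'} \<Longrightarrow> v \<in> V - {x, x'} \<Longrightarrow> F u v \<longleftrightarrow> E u v"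
    and Fx: "\<And>u. u \<in> V - {x, x'} \<Longrightarrow> F x u \<longleftrightarrow> E x u \<or> E x' u"
  shows "rel_wt j F (V - {x'}) (X - {x'}) \<le> rel_wt j E V X"
proof -
  define V0 where "V0 = V - {x, x'}"
  have V0: "finite V0" "x \<notin> V0" "x' \<notin> V0" "x \<notin> insert x' V0" "V = insert x (insert x' V0)" "V - {x'} = insert x V0"
    unfolding V0_def using V by auto
  have "rel_wt j F (V - {x'}) (X - {x'}) = (\<Sum>W\<in>Pow V0. (if W \<subseteq> X - {x'} then 0 else wt j F W)
      + (if insert x W \<subseteq> X - {x'} then 0 else wt j F (insert x W)))"
    unfolding rel_wt_def V0(6) by (rule sum_Pow_insert[OF V0(1,2)])
  also have "\<dots> \<le> (\<Sum>W\<in>Pow V0. (if W \<subseteq> X then 0 else wt j E W) + (if insert x' W \<subseteq> X then 0 else wt j E (insert x' W))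
      + ((if insert x W \<subseteq> X then 0 else wt j E (insert x W)) + (if insert x (insert x' W) \<subseteq> X then 0 else wt j E (insert x (insert x' W)))))"
  proof (rule sum_mono)
    fix W assume "W \<in> Pow V0"
    then have W: "W \<subseteq> V0" by simp
    then have xW: "x \<notin> W" "x' \<notin> W" using V0 by auto
    then have sub: "W \<subseteq> X - {x'} \<longleftrightarrow> W \<subseteq> X" "insert x W \<subseteq> X - {x'} \<longleftrightarrow> W \<subseteq> X"
      "insert x' W \<subseteq> X \<longleftrightarrow> W \<subseteq> X" "insert x W \<subseteq> X \<longleftrightarrow> W \<subseteq> X" "insert x (insert x' W) \<subseteq> X \<longleftrightarrow> W \<subseteq> X"
      using V by auto
    have eqF: "wt j F W = wt j E W" by (rule wt_cong) (use FE W V0_def in blast)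
    have le: "wt j F (insert x W) \<le> wt j E (insert x W) + wt j E (insert x' W) + wt j E (insert x (insert x' W))"
      if "\<not> W \<subseteq> X"
    proof (rule contract_wt[OF _ _ _ j])
      show "splits E F W x x x'" unfolding splits_def
        using E F xW V(5,6) FE Fx W V0_def by blast
      show "W \<noteq> {}" using that by auto
      show "finite W" using W V0(1) finite_subset by blast
    qed
    show "(if W \<subseteq> X - {x'} then 0 else wt j F W) + (if insert x W \<subseteq> X - {x'} then 0 else wt j F (insert x W))
      \<le> (if W \<subseteq> X then 0 else wt j E W) + (if insert x' W \<subseteq> X then 0 else wt j E (insert x' W))
      + ((if insert x W \<subseteq> X then 0 else wt j E (insert x W)) + (if insert x (insert x' W) \<subseteq> X then 0 else wt j E (insert x (insert x' W))))"
    proof (cases "W \<subseteq> X")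
      case True then show ?thesis unfolding sub by simp
    next
      case False then show ?thesis unfolding sub using le[OF False] eqF by simp
    qed
  qed
  also have "\<dots> = (\<Sum>W\<in>Pow (insert x' V0). (if W \<subseteq> X then 0 else wt j E W) + (if insert x W \<subseteq> X then 0 else wt j E (insert x W)))"
    using sum_Pow_insert[OF V0(1,3), of "\<lambda>W. (if W \<subseteq> X then 0 else wt j E W) + (if insert x W \<subseteq> X then 0 else wt j E (insert x W))"]
    by (simp add: algebra_simps sum.distrib)
  also have "\<dots> = rel_wt j E V X"
    unfolding rel_wt_def V0(5) by (rule sum_Pow_insert[symmetric]) (use V0 in auto)
  finally show ?thesis .
qed

text \<open>As \<open>w\<close> lies in \<open>X\<close>, the two sets of a pair are both inside
  \<open>X\<close> or both not. In the second case \<open>W - X\<close> is the nonempty set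
  \<open>Q\<close> of \<open>fill_wt\<close>.\<close>

lemma rel_wt_fill:
  assumes E: "graph_rel E" and V: "finite V" "w \<in> V" and X: "X = insert w {v \<in> V. E w v}" and j: "j \<le> 4"
  shows "rel_wt j (fill X E) V X \<le> rel_wt j E V X"
proof -
  define V0 where "V0 = V - {w}"
  have V0: "finite V0" "w \<notin> V0" "V = insert w V0" unfolding V0_def using V by auto
  have eq: "rel_wt j G V X = (\<Sum>W\<in>Pow V0. (if W \<subseteq> X then 0 else wt j G W) + (if insert w W \<subseteq> X then 0 else wt j G (insert w W)))" for G
    unfolding rel_wt_def V0(3) by (rule sum_Pow_insert[OF V0(1,2)])
  show ?thesis unfolding eq
  proof (rule sum_mono)
    fix W assume "W \<in> Pow V0"
    then have W: "W \<subseteq> V0" by simp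
    have sub: "insert w W \<subseteq> X \<longleftrightarrow> W \<subseteq> X" using X by auto
    have "wt j (fill X E) W + wt j (fill X E) (insert w W) \<le> wt j E W + wt j E (insert w W)" if nX: "\<not> W \<subseteq> X"
    proof -
      have "wt j (fill X E) ((W - X) \<union> (W \<inter> X)) + wt j (fill X E) (insert w ((W - X) \<union> (W \<inter> X)))
        \<le> wt j E ((W - X) \<union> (W \<inter> X)) + wt j E (insert w ((W - X) \<union> (W \<inter> X)))"
      proof (rule fill_wt[OF E])
        show "W - X \<noteq> {}" using nX by auto
        show "E w x" if "x \<in> W \<inter> X" for x using that W V0(2) X by auto
        show "\<not> E w q" if "q \<in> W - X" for q using that W X unfolding V0_def by auto
      qed (use W V0 X j in auto)
      moreover have "(W - X) \<union> (W \<inter> X) = W" by auto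
      ultimately show ?thesis by simp
    qed
    then show "(if W \<subseteq> X then 0 else wt j (fill X E) W) + (if insert w W \<subseteq> X then 0 else wt j (fill X E) (insert w W))
      \<le> (if W \<subseteq> X then 0 else wt j E W) + (if insert w W \<subseteq> X then 0 else wt j E (insert w W))"
      unfolding sub by simp
  qed
qed

subsection \<open>Compression of a vertex\<close>

lemma simple_graph_rel: "simple_graph G \<Longrightarrow> graph_rel (adjacent G)"
  unfolding simple_graph_def graph_rel_def adjacent_def by (auto simp: insert_commute)

lemma adjacent_verts: "simple_graph G \<Longrightarrow> adjacent G u v \<Longrightarrow> u \<in> verts G \<and> v \<in> verts G"
  unfolding simple_graph_def adjacent_def by blast

lemma adjacent_induced: "adjacent (induced G W) u v \<longleftrightarrow> adjacent G u v \<and> u \<in> W \<and> v \<in> W"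
  unfolding adjacent_def induced_def by auto

lemma verts_induced [simp]: "verts (induced G W) = W"
  unfolding induced_def by simp

lemma simple_induced: "simple_graph G \<Longrightarrow> W \<subseteq> verts G \<Longrightarrow> simple_graph (induced G W)"
  unfolding simple_graph_def induced_def by (auto intro: finite_subset)

lemma verts_contract [simp]: "verts (contract H u v) = verts H - {v}"
  unfolding contract_def by simp

lemma adjacent_contract:
  assumes "simple_graph H"
  shows "adjacent (contract H u v) a b \<longleftrightarrow>
    adjacent H a b \<and> a \<noteq> v \<and> b \<noteq> v \<or> a = u \<and> adjacent H v b \<or> b = u \<and> adjacent H v a"
  unfolding adjacent_def contract_def by (auto simp: doubleton_eq_iff)

lemma simple_contract:
  assumes H: "simple_graph H" and uv: "u \<in> verts H" "u \<noteq> v" "\<not> adjacent H u v"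
  shows "simple_graph (contract H u v)"
proof -
  have "x \<in> verts H \<and> x \<noteq> v \<and> card {u, x} = 2" if "adjacent H v x" for x
  proof -
    have "u \<noteq> x" using that uv(3) graph_rel_sym[OF simple_graph_rel[OF H], of u v] by auto
    moreover have "x \<noteq> v" using that graph_rel_irrefl[OF simple_graph_rel[OF H]] by auto
    ultimately show ?thesis using adjacent_verts[OF H that] by simp
  qed
  then show ?thesis using H uv unfolding simple_graph_def contract_def by auto
qed

lemma adjacent_contract_image:
  assumes H: "simple_graph H" and uv: "\<not> adjacent H u v" and ab: "adjacent H a b"
  shows "adjacent (contract H u v) (if a = v then u else a) (if b = v then u else b)"
proof -
  note sym = graph_rel_sym[OF simple_graph_rel[OF H]] and irr = graph_rel_irrefl[OF simple_graph_rel[OF H]]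
  have "adjacent H b a" using ab sym by blast
  moreover have "a \<noteq> b" using ab irr by metis
  moreover have "\<not> (a = u \<and> b = v)" "\<not> (a = v \<and> b = u)" using uv ab \<open>adjacent H b a\<close> by blast+
  ultimately show ?thesis unfolding adjacent_contract[OF H] using ab by (cases "a = v"; cases "b = v") simp_all
qed

section \<open>Colourings, connectivity and sequences of contractions\<close>

definition colourable :: "('a \<Rightarrow> 'a \<Rightarrow> bool) \<Rightarrow> 'a set \<Rightarrow> nat \<Rightarrow> bool" where
  "colourable E V n \<longleftrightarrow> (\<exists>c. c ` V \<subseteq> {..<n} \<and> (\<forall>u\<in>V. \<forall>v\<in>V. E u v \<longrightarrow> c u \<noteq> c v))"

lemma colourableE:
  assumes "colourable E V n"
  obtains c where "c ` V \<subseteq> {..<n}" "\<And>u v. u \<in> V \<Longrightarrow> v \<in> V \<Longrightarrow> E u v \<Longrightarrow> c u \<noteq> c v"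
proof -
  from assms obtain c where "c ` V \<subseteq> {..<n} \<and> (\<forall>u\<in>V. \<forall>v\<in>V. E u v \<longrightarrow> c u \<noteq> c v)"
    unfolding colourable_def by (rule exE)
  then show thesis using that[of c] by simp
qed

lemma colourable_induced: "(\<exists>c. proper_colouring (induced G W) n c) \<longleftrightarrow> colourable (adjacent G) W n"
  unfolding proper_colouring_def colourable_def by (auto simp: adjacent_induced)

lemma colourable_card:
  assumes "graph_rel E" "finite V" "card V \<le> n" shows "colourable E V n"
proof -
  obtain h where "bij_betw h V {0..<card V}" using ex_bij_betw_finite_nat[OF assms(2)] by blast
  then have h: "inj_on h V" "h ` V = {0..<card V}" unfolding bij_betw_def by auto
  have "h u \<noteq> h v" if "u \<in> V" "v \<in> V" "E u v" for u v
    using that h(1) graph_rel_irrefl[OF assms(1)] unfolding inj_on_def by metis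
  moreover have "h ` V \<subseteq> {..<n}" using h(2) assms(3) by auto
  ultimately show ?thesis unfolding colourable_def by blast
qed

lemma colourable_add_vertex:
  assumes "graph_rel E" "colourable E V n" shows "colourable E (insert w V) (Suc n)"
proof -
  obtain c where c: "c ` V \<subseteq> {..<n}" "\<And>u v. u \<in> V \<Longrightarrow> v \<in> V \<Longrightarrow> E u v \<Longrightarrow> c u \<noteq> c v"
    by (rule colourableE[OF assms(2)]) blast
  define d where "d = c(w := n)"
  have lt: "v \<in> V \<Longrightarrow> c v < n" for v using c(1) by auto
  have "d u \<noteq> d v" if uv: "u \<in> insert w V" "v \<in> insert w V" "E u v" for u v
  proof -
    have "u \<noteq> v" using uv(3) graph_rel_irrefl[OF assms(1)] by auto
    then consider "u = w" "v \<in> V" "v \<noteq> w" | "v = w" "u \<in> V" "u \<noteq> w" | "u \<noteq> w" "v \<noteq> w" "u \<in> V" "v \<in> V"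
      using uv by blast
    then show ?thesis
    proof cases
      case 1 then show ?thesis using lt[of v] unfolding d_def by simp
    next
      case 2 then show ?thesis using lt[of u] unfolding d_def by simp
    next
      case 3 then show ?thesis using c(2)[of u v] uv(3) unfolding d_def by simp
    qed
  qed
  moreover have "d ` insert w V \<subseteq> {..<Suc n}" using lt unfolding d_def by (auto simp: less_Suc_eq)
  ultimately show ?thesis unfolding colourable_def by blast
qed

text \<open>A colouring is pulled back along the identification map \<open>f\<close>, which takes
  edges to edges because \<open>u\<close> and \<open>v\<close> are not adjacent.\<close>

lemma colourable_contract:
  assumes H: "simple_graph H" and uv: "u \<in> S" "u \<noteq> v" "\<not> adjacent H u v" and c: "colourable (adjacent (contract H u v)) (S - {v}) n"
  shows "colourable (adjacent H) S n"
proof -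
  note sym = graph_rel_sym[OF simple_graph_rel[OF H]]
  obtain c where c: "c ` (S - {v}) \<subseteq> {..<n}"
    "\<And>a b. a \<in> S - {v} \<Longrightarrow> b \<in> S - {v} \<Longrightarrow> adjacent (contract H u v) a b \<Longrightarrow> c a \<noteq> c b"
    by (rule colourableE[OF c]) blast
  define f where "f a = (if a = v then u else a)" for a
  have fS: "f a \<in> S - {v}" if "a \<in> S" for a using that uv unfolding f_def by auto
  have "c (f a) \<noteq> c (f b)" if "a \<in> S" "b \<in> S" "adjacent H a b" for a b
  proof (rule c(2)[OF fS fS])
    show "adjacent (contract H u v) (f a) (f b)"
      using adjacent_contract_image[OF H uv(3) that(3)] unfolding f_def .
  qed (use that in auto)
  moreover have "(c \<circ> f) ` S \<subseteq> {..<n}" using c(1) fS by auto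
  ultimately show ?thesis unfolding colourable_def by (intro exI[of _ "c \<circ> f"]) auto
qed

lemma connected_contract:
  assumes H: "simple_graph H" and uv: "u \<in> verts H" "u \<noteq> v" "\<not> adjacent H u v" and c: "connected_graph H"
  shows "connected_graph (contract H u v)"
proof -
  note sym = graph_rel_sym[OF simple_graph_rel[OF H]]
  define f where "f a = (if a = v then u else a)" for a
  have step: "adjacent (contract H u v) (f a) (f b)" if "adjacent H a b" for a b
    using adjacent_contract_image[OF H uv(3) that] unfolding f_def .
  have reach: "(adjacent (contract H u v))\<^sup>*\<^sup>* (f a) (f b)" if "(adjacent H)\<^sup>*\<^sup>* a b" for a b
    using that by (induction rule: rtranclp_induct) (auto intro: rtranclp.rtrancl_into_rtrancl step)
  have "(adjacent (contract H u v))\<^sup>*\<^sup>* a b" if "a \<in> verts H - {v}" "b \<in> verts H - {v}" for a b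
    using reach[of a b] c that unfolding connected_graph_def f_def by auto
  then show ?thesis using uv unfolding connected_graph_def by auto
qed

text \<open>The weights are compared in the completed graphs: there all vertices of \<open>X\<close>
  are adjacent, so that a nonedge contraction of \<open>H\<close> becomes the contraction of an
  edge. The last alternative lets the inductions by compression make progress.\<close>

lemma contractions_invariant:
  assumes G: "simple_graph G" and W: "W \<subseteq> verts G" "W \<noteq> {}" and c: "nonedge_contractions G W H X"
  shows "simple_graph H" "X \<subseteq> verts H" "X \<noteq> {}"
    "connected_graph G \<Longrightarrow> connected_graph H"
    "colourable (adjacent H) (verts H) n \<Longrightarrow> colourable (adjacent G) (verts G) n"
    "colourable (adjacent H) X n \<Longrightarrow> colourable (adjacent G) W n"
    "j \<le> 4 \<Longrightarrow> rel_wt j (fill X (adjacent H)) (verts H) X \<le> rel_wt j (fill W (adjacent G)) (verts G) W"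
    "H = G \<and> X = W \<or> card (verts H) < card (verts G)"
proof -
  have "simple_graph H \<and> X \<subseteq> verts H \<and> X \<noteq> {} \<and> (connected_graph G \<longrightarrow> connected_graph H) \<and>
    (colourable (adjacent H) (verts H) n \<longrightarrow> colourable (adjacent G) (verts G) n) \<and> (colourable (adjacent H) X n \<longrightarrow> colourable (adjacent G) W n)
    \<and> (j \<le> 4 \<longrightarrow> rel_wt j (fill X (adjacent H)) (verts H) X \<le> rel_wt j (fill W (adjacent G)) (verts G) W)
    \<and> (H = G \<and> X = W \<or> card (verts H) < card (verts G))"
    using c
  proof (induction rule: nonedge_contractions.induct)
    case refl
    then show ?case using G W by simp
  next
    case (step H X u v)
    have H: "simple_graph H" "X \<subseteq> verts H" using step.IH by auto
    have uv: "u \<in> verts H" "v \<in> verts H" using step.hyps H by auto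
    have fin: "finite (verts H)" using H unfolding simple_graph_def by simp
    have "card (verts H - {v}) < card (verts H)" by (rule card_Diff1_less[OF fin uv(2)])
    moreover have "card (verts H) \<le> card (verts G)" using step.IH by auto
    ultimately have cd: "card (verts (contract H u v)) < card (verts G)" by simp
    have sc: "simple_graph (contract H u v)" using simple_contract[OF H(1) uv(1)] step.hyps by blast
    \<comment> \<open>Completing commutes with contracting: the completion of the contracted graph
      is the contraction of the completed one.\<close>
    have rl: "rel_wt j (fill (X - {v}) (adjacent (contract H u v))) (verts H - {v}) (X - {v})
      \<le> rel_wt j (fill X (adjacent H)) (verts H) X" if "j \<le> 4"
    proof (rule rel_wt_contract[OF graph_rel_fill[OF simple_graph_rel[OF H(1)]] graph_rel_fill[OF simple_graph_rel[OF sc]] fin H(2) step.hyps(2-4) _ that])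
      show "fill X (adjacent H) u v" using step.hyps unfolding fill_def by auto
      fix a assume a: "a \<in> verts H - {u, v}"
      show "fill (X - {v}) (adjacent (contract H u v)) u a \<longleftrightarrow> fill X (adjacent H) u a \<or> fill X (adjacent H) v a"
        using a step.hyps(2-4) unfolding fill_def adjacent_contract[OF H(1)] by auto
      fix b assume "b \<in> verts H - {u, v}"
      then show "fill (X - {v}) (adjacent (contract H u v)) a b \<longleftrightarrow> fill X (adjacent H) a b"
        using a unfolding fill_def adjacent_contract[OF H(1)] by auto
    qed
    have cc: "colourable (adjacent (contract H u v)) (verts H - {v}) n \<longrightarrow> colourable (adjacent H) (verts H) n"
      "colourable (adjacent (contract H u v)) (X - {v}) n \<longrightarrow> colourable (adjacent H) X n"
      using colourable_contract[OF H(1)] uv step.hyps by blast+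
    have cn: "connected_graph H \<longrightarrow> connected_graph (contract H u v)"
      using connected_contract[OF H(1) uv(1)] step.hyps by blast
    note IH = step.IH
    have "X - {v} \<subseteq> verts (contract H u v)" "X - {v} \<noteq> {}" using H(2) step.hyps by auto
    moreover have "connected_graph G \<longrightarrow> connected_graph (contract H u v)" using IH cn by blast
    moreover have "colourable (adjacent (contract H u v)) (verts (contract H u v)) n \<longrightarrow> colourable (adjacent G) (verts G) n"
      "colourable (adjacent (contract H u v)) (X - {v}) n \<longrightarrow> colourable (adjacent G) W n"
      using IH cc by simp_all
    moreover have "j \<le> 4 \<longrightarrow> rel_wt j (fill (X - {v}) (adjacent (contract H u v))) (verts (contract H u v)) (X - {v})
      \<le> rel_wt j (fill W (adjacent G)) (verts G) W"
      using IH order_trans[OF rl] by simp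
    ultimately show ?case using sc cd by simp
  qed
  then show "simple_graph H" "X \<subseteq> verts H" "X \<noteq> {}"
    "connected_graph G \<Longrightarrow> connected_graph H"
    "colourable (adjacent H) (verts H) n \<Longrightarrow> colourable (adjacent G) (verts G) n"
    "colourable (adjacent H) X n \<Longrightarrow> colourable (adjacent G) W n"
    "j \<le> 4 \<Longrightarrow> rel_wt j (fill X (adjacent H)) (verts H) X \<le> rel_wt j (fill W (adjacent G)) (verts G) W"
    "H = G \<and> X = W \<or> card (verts H) < card (verts G)" by blast+
qed

text \<open>Among the contractions of \<open>W\<close> whose image is still colourable with
  \<open>k\<close> colours, \<open>k\<close> being the chromatic number, one with the smallest image
  is taken. Its colouring is injective, since vertices of equal colour could be identified, so the
  image has at most \<open>k\<close> vertices. A nonadjacent pair could be identified as well, and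
  \<open>W\<close> would be colourable with fewer than \<open>k\<close> colours.\<close>

lemma compression_exists:
  assumes G: "simple_graph G" and W: "W \<subseteq> verts G" "W \<noteq> {}"
  obtains H X where "nonedge_contractions G W H X" "complete_graph (induced H X)" "\<not> colourable (adjacent G) W (card X - 1)"
proof -
  have finW: "finite W" using G W finite_subset unfolding simple_graph_def by blast
  have ex: "\<exists>k. colourable (adjacent G) W k" using colourable_card[OF simple_graph_rel[OF G] finW] by blast
  define k where "k = (LEAST k. colourable (adjacent G) W k)"
  have k: "colourable (adjacent G) W k" unfolding k_def using ex by (rule LeastI_ex)
  have nk: "\<not> colourable (adjacent G) W i" if "i < k" for i using that unfolding k_def by (rule not_less_Least)
  define S where "S = {(H, X). nonedge_contractions G W H X \<and> colourable (adjacent H) X k}"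
  have "(G, W) \<in> S" unfolding S_def using k nonedge_contractions.refl by auto
  then obtain HX where HX: "HX \<in> S" "\<And>HX'. HX' \<in> S \<Longrightarrow> card (snd HX) \<le> card (snd HX')"
    using ex_has_least_nat[of "\<lambda>p. p \<in> S" "(G, W)" "\<lambda>p. card (snd p)"] by blast
  obtain H X where HXe: "HX = (H, X)" by fastforce
  have c: "nonedge_contractions G W H X" and cX: "colourable (adjacent H) X k" using HX(1) HXe unfolding S_def by auto
  note inv = contractions_invariant[OF G W c]
  have finX: "finite X" using inv(1,2) finite_subset unfolding simple_graph_def by blast
  have cardX: "card (X - {v}) < card X" if "v \<in> X" for v by (rule card_Diff1_less[OF finX that])
  obtain f where f: "f ` X \<subseteq> {..<k}" "\<And>u v. u \<in> X \<Longrightarrow> v \<in> X \<Longrightarrow> adjacent H u v \<Longrightarrow> f u \<noteq> f v"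
    by (rule colourableE[OF cX]) blast
  have "inj_on f X"
  proof (rule inj_onI, rule ccontr)
    fix u v assume uv: "u \<in> X" "v \<in> X" "f u = f v" "u \<noteq> v"
    then have nadj: "\<not> adjacent H u v" using f(2) by blast
    have c': "nonedge_contractions G W (contract H u v) (X - {v})"
      by (rule nonedge_contractions.step[OF c uv(1,2,4) nadj])
    have "f a \<noteq> f b" if "a \<in> X - {v}" "b \<in> X - {v}" "adjacent (contract H u v) a b" for a b
      using that f(2)[of a b] f(2)[of v b] f(2)[of v a] uv unfolding adjacent_contract[OF inv(1)] by auto
    then have "colourable (adjacent (contract H u v)) (X - {v}) k" unfolding colourable_def using f(1) by blast
    then have "(contract H u v, X - {v}) \<in> S" using c' unfolding S_def by auto
    then show False using HX(2) HXe cardX[OF uv(2)] by fastforce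
  qed
  then have le: "card X \<le> k" using card_inj_on_le[OF _ f(1)] by simp
  have "complete_graph (induced H X)"
    unfolding complete_graph_def
  proof (intro ballI impI, rule ccontr)
    fix u v assume uv: "u \<in> verts (induced H X)" "v \<in> verts (induced H X)" "u \<noteq> v" "\<not> adjacent (induced H X) u v"
    then have nadj: "\<not> adjacent H u v" by (auto simp: adjacent_induced)
    have c': "nonedge_contractions G W (contract H u v) (X - {v})"
      by (rule nonedge_contractions.step[OF c _ _ uv(3) nadj]) (use uv in auto)
    note inv' = contractions_invariant[OF G W c']
    have "card (X - {v}) < k" using cardX[of v] uv le by simp
    moreover have "colourable (adjacent (contract H u v)) (X - {v}) (card (X - {v}))"
      by (rule colourable_card[OF simple_graph_rel[OF inv'(1)]]) (use finX in auto)
    ultimately show False using nk inv'(6) by blast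
  qed
  moreover have "\<not> colourable (adjacent G) W (card X - 1)"
  proof -
    have "card X \<noteq> 0" using inv(3) finX by simp
    then show ?thesis using nk[of "card X - 1"] le by simp
  qed
  ultimately show thesis using that c by blast
qed

section \<open>The alternating sum under the compression of a vertex\<close>

lemma clique_cell_card:
  assumes E: "graph_rel E" and cl: "\<And>u v. u \<in> W \<Longrightarrow> v \<in> W \<Longrightarrow> u \<noteq> v \<Longrightarrow> E u v" and j: "j \<le> 4" and c: "cell j E W"
  shows "card W = j"
proof -
  consider "j = 0" | "j = Suc 0" | "j = Suc (Suc 0)" | "j = Suc (Suc (Suc 0))" | "j = Suc (Suc (Suc (Suc 0)))" using j by linarith
  then show ?thesis
  proof cases
    case 4
    then have cy: "icycle E W" using c by (simp add: cell_simps)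
    then have "3 \<le> card W" by (rule icycle_card)
    then obtain T where T: "T \<subseteq> W" "card T = 3" by (rule obtain_subset_with_card_n) blast
    then obtain p q r where "T = {p, q, r}" "p \<noteq> q" "q \<noteq> r" "p \<noteq> r" unfolding card_3_iff by blast
    then have "W = T" using icycle_triangle[OF E cy, of p q r] cl T by auto
    then show ?thesis using T 4 by simp
  next
    case 5
    then have s: "solid E W" using c by (simp add: cell_simps)
    then have "4 \<le> card W" by (rule solid_card)
    then obtain K where K: "K \<subseteq> W" "card K = 4" by (rule obtain_subset_with_card_n) blast
    have "W = K" by (rule solid_clique4[OF E s K]) (use cl K in blast)
    then show ?thesis using K 5 by simp
  qed (use c in \<open>auto simp: cell_simps\<close>)
qed

lemma clique_tot_wt:
  assumes E: "graph_rel E" and X: "finite X" "X \<noteq> {}" and cl: "\<And>u v. u \<in> X \<Longrightarrow> v \<in> X \<Longrightarrow> u \<noteq> v \<Longrightarrow> E u v" and j: "j \<le> 4"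
  shows "tot_wt j E X \<le> int ((card X - 1) choose j)"
proof -
  obtain w where w: "w \<in> X" using X by auto
  have "tot_wt j E (insert w (X - {w})) = int (card (cells j E (X - {w})))"
    by (rule tot_wt_cone[OF E _ _ _ j]) (use X cl w in auto)
  moreover have "cells j E (X - {w}) \<subseteq> {T. T \<subseteq> X - {w} \<and> card T = j}"
    unfolding cells_def using clique_cell_card[OF E _ j] cl by blast
  then have "card (cells j E (X - {w})) \<le> card {T. T \<subseteq> X - {w} \<and> card T = j}"
    using X by (intro card_mono) auto
  moreover have "card {T. T \<subseteq> X - {w} \<and> card T = j} = (card X - 1) choose j"
    using n_subsets[of "X - {w}" j] X w by simp
  ultimately show ?thesis using w by (simp add: insert_absorb)
qed

text \<open>The inequality \<open>N\<close> is left as a hypothesis because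
  \<open>many_cells\<close>, which supplies it, uses the present lemma in its own induction.\<close>

lemma tot_wt_compression:
  assumes G: "simple_graph G" and w: "w \<in> verts G" and j: "j \<le> 4"
    and c: "nonedge_contractions G (closed_neighbourhood G w) H X" and X: "complete_graph (induced H X)"
    and N: "(card X - 1) choose j \<le> card (cells j (adjacent G) (neighbours G w))"
  shows "tot_wt j (adjacent H) (verts H) \<le> tot_wt j (adjacent G) (verts G)"
proof -
  define N where "N = neighbours G w"
  let ?W = "closed_neighbourhood G w"
  have E: "graph_rel (adjacent G)" by (rule simple_graph_rel[OF G])
  have W: "?W = insert w N" "?W \<subseteq> verts G" "?W \<noteq> {}" "w \<notin> N" "?W = insert w {v \<in> verts G. adjacent G w v}"
    unfolding N_def closed_neighbourhood_def neighbours_def using adjacent_verts[OF G] w graph_rel_irrefl[OF E] by auto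
  note inv = contractions_invariant[OF G W(2,3) c]
  have fin: "finite (verts G)" "finite (verts H)" using G inv(1) unfolding simple_graph_def by auto
  then have finN: "finite N" and finX: "finite X" using W inv(2) finite_subset by auto
  have cl: "adjacent H u v" if "u \<in> X" "v \<in> X" "u \<noteq> v" for u v
    using X that unfolding complete_graph_def by (auto simp: adjacent_induced)
  \<comment> \<open>The image \<open>X\<close> is already complete in \<open>H\<close>, so
    completing it changes nothing.\<close>
  have "rel_wt j (adjacent H) (verts H) X = rel_wt j (fill X (adjacent H)) (verts H) X"
    by (rule rel_wt_cong) (use cl in \<open>auto simp: fill_def\<close>)
  also have "\<dots> \<le> rel_wt j (fill ?W (adjacent G)) (verts G) ?W" by (rule inv(7)[OF j])
  also have "\<dots> \<le> rel_wt j (adjacent G) (verts G) ?W" by (rule rel_wt_fill[OF E fin(1) w W(5) j])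
  finally have rel: "rel_wt j (adjacent H) (verts H) X \<le> rel_wt j (adjacent G) (verts G) ?W" .
  have "tot_wt j (adjacent H) X \<le> int ((card X - 1) choose j)"
    by (rule clique_tot_wt[OF simple_graph_rel[OF inv(1)] finX inv(3) cl j])
  also have "\<dots> \<le> int (card (cells j (adjacent G) N))" using assms(6) N_def by simp
  also have "\<dots> = tot_wt j (adjacent G) ?W"
    unfolding W(1) by (rule tot_wt_cone[symmetric, OF E finN W(4) _ j]) (auto simp: N_def neighbours_def)
  finally show ?thesis using rel tot_rel[OF fin(1) W(2)] tot_rel[OF fin(2) inv(2)] by (metis add_mono)
qed

text \<open>If all closed neighbourhoods are complete, the neighbourhood of \<open>w\<close> grows
  along every path. Contrapositively, a connected graph without a dominating vertex has a vertex
  whose compression really identifies something.\<close>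

lemma complete_neighbourhood:
  assumes G: "simple_graph G" and conn: "connected_graph G" and w: "w \<in> verts G"
    and cl: "\<And>v. v \<in> verts G \<Longrightarrow> complete_graph (induced G (closed_neighbourhood G v))"
  shows "closed_neighbourhood G w = verts G"
proof -
  have sub: "closed_neighbourhood G w \<subseteq> verts G"
    unfolding closed_neighbourhood_def neighbours_def using adjacent_verts[OF G] w by auto
  have "v \<in> closed_neighbourhood G w" if "(adjacent G)\<^sup>*\<^sup>* w v" for v
    using that
  proof (induction rule: rtranclp_induct)
    case base then show ?case unfolding closed_neighbourhood_def by simp
  next
    case (step u v)
    have uv: "u \<in> verts G" using adjacent_verts[OF G step.hyps(2)] by simp
    have "w \<in> closed_neighbourhood G u" "v \<in> closed_neighbourhood G u"
      using step graph_rel_sym[OF simple_graph_rel[OF G]] unfolding closed_neighbourhood_def neighbours_def by auto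
    then have "w = v \<or> adjacent G w v" using cl[OF uv] unfolding complete_graph_def by (auto simp: adjacent_induced)
    then show ?case unfolding closed_neighbourhood_def neighbours_def by auto
  qed
  then show ?thesis using sub conn w unfolding connected_graph_def by blast
qed

text \<open>Colourings of the components combine to a colouring of the graph, so one of the
  components is not colourable.\<close>

lemma component_not_colourable:
  assumes G: "simple_graph G" and nc: "\<not> colourable (adjacent G) (verts G) n"
  obtains C where "C \<subseteq> verts G" "connected_graph (induced G C)" "\<not> colourable (adjacent G) C n"
proof -
  note sym = graph_rel_sym[OF simple_graph_rel[OF G]]
  define comp where "comp u = {v \<in> verts G. (adjacent G)\<^sup>*\<^sup>* u v}" for u
  have symr: "(adjacent G)\<^sup>*\<^sup>* v u" if "(adjacent G)\<^sup>*\<^sup>* u v" for u v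
    using that
  proof (induction rule: rtranclp_induct)
    case (step y z)
    have "adjacent G z y" using step.hyps(2) sym by blast
    then show ?case using step.IH by (rule converse_rtranclp_into_rtranclp)
  qed simp
  have "\<exists>u\<in>verts G. \<not> colourable (adjacent G) (comp u) n"
  proof (rule ccontr)
    assume "\<not> ?thesis"
    then have "\<forall>u\<in>verts G. \<exists>c. c ` comp u \<subseteq> {..<n} \<and> (\<forall>a\<in>comp u. \<forall>b\<in>comp u. adjacent G a b \<longrightarrow> c a \<noteq> c b)"
      unfolding colourable_def by blast
    then have *: "\<exists>c. c ` comp u \<subseteq> {..<n} \<and> (\<forall>a\<in>comp u. \<forall>b\<in>comp u. adjacent G a b \<longrightarrow> c a \<noteq> c b)" if "u \<in> verts G" for u
      using that by blast
    \<comment> \<open>The choice depends only on the set \<open>S\<close>, so all vertices of a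
      component are coloured by the same function.\<close>
    define c where "c S = (SOME c. c ` S \<subseteq> {..<n} \<and> (\<forall>a\<in>S. \<forall>b\<in>S. adjacent G a b \<longrightarrow> c a \<noteq> c b))" for S
    have c: "c (comp u) ` comp u \<subseteq> {..<n} \<and> (\<forall>a\<in>comp u. \<forall>b\<in>comp u. adjacent G a b \<longrightarrow> c (comp u) a \<noteq> c (comp u) b)"
      if "u \<in> verts G" for u
      unfolding c_def by (rule someI_ex[OF *[OF that]])
    have self: "u \<in> comp u" if "u \<in> verts G" for u using that unfolding comp_def by auto
    have eq: "comp u = comp v" if "adjacent G u v" for u v
    proof -
      have "(adjacent G)\<^sup>*\<^sup>* u v" "(adjacent G)\<^sup>*\<^sup>* v u" using that sym by auto
      then show ?thesis unfolding comp_def by (auto intro: rtranclp_trans)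
    qed
    have "c (comp a) a \<noteq> c (comp b) b" if "a \<in> verts G" "b \<in> verts G" "adjacent G a b" for a b
      using c[OF that(1)] self[OF that(1)] self[OF that(2)] eq[OF that(3)] that(3) by auto
    moreover have "(\<lambda>a. c (comp a) a) ` verts G \<subseteq> {..<n}" using c self by fastforce
    ultimately have "colourable (adjacent G) (verts G) n" unfolding colourable_def by (intro exI[of _ "\<lambda>a. c (comp a) a"]) auto
    then show False using nc by simp
  qed
  then obtain u where u: "u \<in> verts G" "\<not> colourable (adjacent G) (comp u) n" by blast
  have reach: "v \<in> comp u \<and> (adjacent (induced G (comp u)))\<^sup>*\<^sup>* u v" if "(adjacent G)\<^sup>*\<^sup>* u v" for v
    using that
  proof (induction rule: rtranclp_induct)
    case base then show ?case using u unfolding comp_def by auto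
  next
    case (step a b)
    have "b \<in> comp u" using step.hyps adjacent_verts[OF G step.hyps(2)] unfolding comp_def
      by (auto intro: rtranclp.rtrancl_into_rtrancl)
    then have "adjacent (induced G (comp u)) a b" using step by (auto simp: adjacent_induced)
    then show ?case using step.IH \<open>b \<in> comp u\<close> by (auto intro: rtranclp.rtrancl_into_rtrancl)
  qed
  have sc: "simple_graph (induced G (comp u))" by (rule simple_induced[OF G]) (auto simp: comp_def)
  have symr': "(adjacent (induced G (comp u)))\<^sup>*\<^sup>* b a" if "(adjacent (induced G (comp u)))\<^sup>*\<^sup>* a b" for a b
    using that
  proof (induction rule: rtranclp_induct)
    case (step y z)
    have "adjacent (induced G (comp u)) z y" using step.hyps(2) graph_rel_sym[OF simple_graph_rel[OF sc]] by blast
    then show ?case using step.IH by (rule converse_rtranclp_into_rtranclp)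
  qed simp
  have "(adjacent (induced G (comp u)))\<^sup>*\<^sup>* a b" if "a \<in> comp u" "b \<in> comp u" for a b
    using reach[of a] reach[of b] that symr'[of u a] unfolding comp_def by (auto intro: rtranclp_trans)
  then have "connected_graph (induced G (comp u))"
    unfolding connected_graph_def using u reach[of u] by auto
  then show thesis using that[of "comp u"] u(2) unfolding comp_def by auto
qed

section \<open>Lower bounds for the numbers of cells\<close>

lemma card_cells_mono: "finite V \<Longrightarrow> U \<subseteq> V \<Longrightarrow> card (cells j E U) \<le> card (cells j E V)"
  unfolding cells_def by (intro card_mono) auto

lemma cells_cong:
  assumes "\<And>u v. u \<in> V \<Longrightarrow> v \<in> V \<Longrightarrow> E u v \<longleftrightarrow> F u v"
  shows "cells j E V = cells j F V"
proof -
  have "cell j E W \<longleftrightarrow> cell j F W" if "W \<subseteq> V" for W by (rule cell_cong) (use assms that in blast)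
  then show ?thesis unfolding cells_def by auto
qed

lemma cells_0: "cells 0 E V = {{}}"
  unfolding cells_def by (auto simp: cell_simps)

lemma colourable_cong:
  "(\<And>u v. u \<in> V \<Longrightarrow> v \<in> V \<Longrightarrow> E u v \<longleftrightarrow> F u v) \<Longrightarrow> colourable E V n \<longleftrightarrow> colourable F V n"
  unfolding colourable_def by simp

lemma induced_cong:
  "colourable (adjacent (induced G V)) V n \<longleftrightarrow> colourable (adjacent G) V n"
  "cells j (adjacent (induced G V)) V = cells j (adjacent G) V"
  "tot_wt j (adjacent (induced G V)) V = tot_wt j (adjacent G) V"
  by (auto intro!: colourable_cong cells_cong tot_wt_cong simp: adjacent_induced)

text \<open>The outer induction supplies the cell counts of neighbourhoods, which are smaller than
  the graph; the inner one, in \<open>conn\<close>, compresses a connected graph to a smaller one.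
  \<open>n\<close> is generalised because a neighbourhood needs one colour less, and
  \<open>j\<close> because the last step uses two dimensions.\<close>

theorem many_cells:
  assumes "simple_graph G" "\<not> colourable (adjacent G) (verts G) n" "j \<le> 4"
  shows "(Suc n choose j) \<le> card (cells j (adjacent G) (verts G))"
  using assms
proof (induction "card (verts G)" arbitrary: G n j rule: less_induct)
  case less
  have IH: "(Suc n choose j) \<le> card (cells j (adjacent G') V)"
    if "simple_graph G'" "V \<subseteq> verts G'" "card V < card (verts G)" "\<not> colourable (adjacent G') V n" "j \<le> 4" for G' :: "'a graph" and V n j
  proof -
    have "(Suc n choose j) \<le> card (cells j (adjacent (induced G' V)) (verts (induced G' V)))"
      by (rule less.hyps) (use that simple_induced in \<open>simp_all add: induced_cong\<close>)
    then show ?thesis by (simp add: induced_cong)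
  qed
  \<comment> \<open>Without \<open>w\<close> one colour can be saved at most, so the neighbourhood
    is not colourable with one colour less than \<open>k - 1\<close>. If \<open>k - 1 = 0\<close>,
    only the empty cell is to be counted.\<close>
  have nbhd: "((k - 1) choose j) \<le> card (cells j (adjacent G') (neighbours G' w))"
    if G': "simple_graph G'" "w \<in> verts G'" "card (verts G') \<le> card (verts G)"
      and nc: "\<not> colourable (adjacent G') (closed_neighbourhood G' w) (k - 1)" and j: "j \<le> 4" for G' :: "'a graph" and w k j
  proof (cases "k - 1")
    case 0
    show ?thesis
    proof (cases "j = 0")
      case True then show ?thesis by (simp add: cells_0)
    next
      case False then show ?thesis using 0 by (simp add: binomial_eq_0)
    qed
  next
    case (Suc i)
    have sub: "neighbours G' w \<subseteq> verts G'" "w \<notin> neighbours G' w"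
      unfolding neighbours_def using adjacent_verts[OF G'(1)] graph_rel_irrefl[OF simple_graph_rel[OF G'(1)]] by auto
    have "\<not> colourable (adjacent G') (neighbours G' w) i"
      using colourable_add_vertex[OF simple_graph_rel[OF G'(1)], of "neighbours G' w" i w] nc Suc
      unfolding closed_neighbourhood_def by auto
    moreover have "card (neighbours G' w) < card (verts G')"
      by (rule psubset_card_mono) (use G' sub in \<open>auto simp: simple_graph_def\<close>)
    ultimately show ?thesis using IH[OF G'(1) sub(1) _ _ j] G'(3) Suc by auto
  qed
  \<comment> \<open>The bound is the alternating sum of the complete graph on \<open>n + 1\<close>
    vertices, which is a cone over the complete graph on \<open>n\<close> vertices.\<close>
  have conn: "int (n choose j) \<le> tot_wt j (adjacent G') (verts G')"
    if "simple_graph G'" "connected_graph G'" "card (verts G') \<le> card (verts G)" "\<not> colourable (adjacent G') (verts G') n" "j \<le> 4"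
    for G' :: "'a graph" and n j
    using that
  proof (induction "card (verts G')" arbitrary: G' rule: less_induct)
    case (less G')
    note G' = \<open>simple_graph G'\<close> and c' = \<open>connected_graph G'\<close> and le = \<open>card (verts G') \<le> card (verts G)\<close>
      and nc = \<open>\<not> colourable (adjacent G') (verts G') n\<close>
    obtain w0 where w0: "w0 \<in> verts G'" using c' unfolding connected_graph_def by auto
    have fin: "finite (verts G')" using G' unfolding simple_graph_def by simp
    have subN: "closed_neighbourhood G' v \<subseteq> verts G'" if "v \<in> verts G'" for v
      unfolding closed_neighbourhood_def neighbours_def using adjacent_verts[OF G'] that by auto
    show ?case
    proof (cases "\<exists>w\<in>verts G'. closed_neighbourhood G' w = verts G'")
      case True
      \<comment> \<open>A dominating vertex stops the compressions: the alternating sum is the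
        number of cells in its neighbourhood, which is bounded by the outer induction.\<close>
      then obtain w where w: "w \<in> verts G'" "closed_neighbourhood G' w = verts G'" by blast
      have V: "verts G' = insert w (neighbours G' w)" "w \<notin> neighbours G' w" "finite (neighbours G' w)"
        using w fin graph_rel_irrefl[OF simple_graph_rel[OF G']] unfolding closed_neighbourhood_def neighbours_def by (auto intro: finite_subset)
      have "(Suc n - 1) choose j \<le> card (cells j (adjacent G') (neighbours G' w))"
        using nbhd[OF G' w(1) le, of "Suc n" j] nc w(2) \<open>j \<le> 4\<close> by simp
      then show ?thesis unfolding V(1)
        using tot_wt_cone[OF simple_graph_rel[OF G'] V(3,2) _ \<open>j \<le> 4\<close>] by (simp add: neighbours_def)
    next
      case False
      obtain v where v: "v \<in> verts G'" "\<not> complete_graph (induced G' (closed_neighbourhood G' v))"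
        using complete_neighbourhood[OF G' c' w0] False w0 by blast
      let ?W = "closed_neighbourhood G' v"
      have Wne: "?W \<noteq> {}" unfolding closed_neighbourhood_def by simp
      obtain H X where H: "nonedge_contractions G' ?W H X" "complete_graph (induced H X)" "\<not> colourable (adjacent G') ?W (card X - 1)"
        by (rule compression_exists[OF G' subN[OF v(1)] Wne]) blast
      note inv = contractions_invariant[OF G' subN[OF v(1)] Wne H(1)]
      have small: "card (verts H) < card (verts G')" using inv(8) H(2) v(2) by blast
      have "int (n choose j) \<le> tot_wt j (adjacent H) (verts H)"
        by (rule less.hyps[OF small inv(1) inv(4)[OF c']]) (use small le inv(5) nc \<open>j \<le> 4\<close> in auto)
      also have "\<dots> \<le> tot_wt j (adjacent G') (verts G')"
        by (rule tot_wt_compression[OF G' v(1) \<open>j \<le> 4\<close> H(1,2) nbhd[OF G' v(1) le H(3) \<open>j \<le> 4\<close>]])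
      finally show ?thesis .
    qed
  qed
  \<comment> \<open>The alternating sums are bounded for connected graphs only. A component that is
    not \<open>n\<close>-colourable suffices, because its cells are cells of the graph.\<close>
  obtain C where C: "C \<subseteq> verts G" "connected_graph (induced G C)" "\<not> colourable (adjacent G) C n"
    by (rule component_not_colourable[OF less.prems(1,2)]) blast
  have fin: "finite (verts G)" "finite C" using less.prems(1) C(1) finite_subset unfolding simple_graph_def by auto
  have t: "int (n choose i) \<le> tot_wt i (adjacent G) C" if "i \<le> 4" for i
    using conn[OF simple_induced[OF less.prems(1) C(1)] C(2) _ _ that, of n] C(1,3) fin(1)
    by (simp add: card_mono induced_cong)
  have "(Suc n choose j) \<le> card (cells j (adjacent G) C)"
  proof (cases j)
    case 0 then show ?thesis by (simp add: cells_0)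
  next
    case (Suc i)
    have "int (card (cells j (adjacent G) C)) = tot_wt j (adjacent G) C + tot_wt i (adjacent G) C"
      using tot_wt_Suc[OF fin(2), of i "adjacent G"] Suc by simp
    then show ?thesis using t[of i] t[of j] Suc less.prems(3) by simp
  qed
  also have "\<dots> \<le> card (cells j (adjacent G) (verts G))" by (rule card_cells_mono[OF fin(1) C(1)])
  finally show ?case .
qed

theorem compression_tot_wt:
  assumes G: "simple_graph G" and w: "w \<in> verts G" and c: "vertex_compression G w H"
  shows "tot_wt 4 (adjacent H) (verts H) \<le> tot_wt 4 (adjacent G) (verts G)"
proof -
  let ?W = "closed_neighbourhood G w"
  obtain X where X: "nonedge_contractions G ?W H X" "complete_graph (induced H X)" "card X = chromatic_number (induced G ?W)"
    using c unfolding vertex_compression_def by blast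
  have W: "?W \<subseteq> verts G" "?W \<noteq> {}"
    unfolding closed_neighbourhood_def neighbours_def using adjacent_verts[OF G] w by auto
  note inv = contractions_invariant[OF G W X(1)]
  have "finite X" using inv(1,2) finite_subset unfolding simple_graph_def by blast
  then have "card X \<noteq> 0" using inv(3) by simp
  then have nc: "\<not> colourable (adjacent G) ?W (card X - 1)"
    using not_less_Least[of "card X - 1" "\<lambda>k. \<exists>c. proper_colouring (induced G ?W) k c"] X(3)
    unfolding chromatic_number_def colourable_induced by simp
  have "(card X - 1) choose 4 \<le> card (cells 4 (adjacent G) (neighbours G w))"
  proof (cases "card X - 1")
    case 0 then show ?thesis by (simp add: binomial_eq_0)
  next
    case (Suc i)
    have sub: "neighbours G w \<subseteq> verts G" unfolding neighbours_def using adjacent_verts[OF G] by auto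
    have "\<not> colourable (adjacent G) (neighbours G w) i"
      using colourable_add_vertex[OF simple_graph_rel[OF G], of "neighbours G w" i w] nc Suc unfolding closed_neighbourhood_def by auto
    then have "\<not> colourable (adjacent (induced G (neighbours G w))) (verts (induced G (neighbours G w))) i"
      by (simp add: induced_cong)
    then show ?thesis using many_cells[OF simple_induced[OF G sub], of i 4] Suc by (simp add: induced_cong)
  qed
  then show ?thesis using tot_wt_compression[OF G w _ X(1,2)] by simp
qed

subsection \<open>Solids as graphs\<close>

lemma path_edges_simps:
  "path_edges [] = {}" "path_edges [a] = {}"
  "path_edges (a # b # l) = insert {a, b} (path_edges (b # l))"
proof -
  show "path_edges (a # b # l) = insert {a, b} (path_edges (b # l))" (is "?L = ?R")
  proof (intro set_eqI iffI)
    fix e assume "e \<in> ?L"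
    then obtain i where i: "e = {(a # b # l) ! i, (a # b # l) ! Suc i}" "Suc i < length (a # b # l)"
      unfolding path_edges_def by blast
    show "e \<in> ?R"
    proof (cases i)
      case 0 then show ?thesis using i by simp
    next
      case (Suc k)
      then have "e = {(b # l) ! k, (b # l) ! Suc k}" "Suc k < length (b # l)" using i by auto
      then show ?thesis unfolding path_edges_def by blast
    qed
  next
    fix e assume "e \<in> ?R"
    then consider "e = {a, b}" | k where "e = {(b # l) ! k, (b # l) ! Suc k}" "Suc k < length (b # l)"
      unfolding path_edges_def by blast
    then show "e \<in> ?L"
    proof cases
      case 1
      then have "e = {(a # b # l) ! 0, (a # b # l) ! Suc 0}" "Suc 0 < length (a # b # l)" by auto
      then show ?thesis unfolding path_edges_def by blast
    next
      case 2
      then have "e = {(a # b # l) ! Suc k, (a # b # l) ! Suc (Suc k)}" "Suc (Suc k) < length (a # b # l)" by auto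
      then show ?thesis unfolding path_edges_def by blast
    qed
  qed
qed (auto simp: path_edges_def)

lemma path_edges_Cons: "l \<noteq> [] \<Longrightarrow> path_edges (a # l) = insert {a, hd l} (path_edges l)"
  by (cases l) (auto simp: path_edges_simps)

lemma path_edges_snoc: "l \<noteq> [] \<Longrightarrow> path_edges (l @ [b]) = insert {last l, b} (path_edges l)"
proof (induction l)
  case (Cons a l)
  then show ?case
    by (cases "l = []") (auto simp: path_edges_simps path_edges_Cons insert_commute)
qed simp

lemma path_edges_sub: "e \<in> path_edges l \<Longrightarrow> \<exists>u\<in>set l. \<exists>v\<in>set l. e = {u, v}"
  unfolding path_edges_def using nth_mem Suc_lessD by blast

lemma path_edges_in: "{u, v} \<in> path_edges l \<Longrightarrow> u \<in> set l \<and> v \<in> set l"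
  using path_edges_sub[of "{u, v}" l] by (auto simp: doubleton_eq_iff)

text \<open>Mediates between \<open>ipath\<close> and the lists of vertices by which the solid
  graphs are defined.\<close>

definition path_list :: "('a \<Rightarrow> 'a \<Rightarrow> bool) \<Rightarrow> 'a list \<Rightarrow> bool" where
  "path_list E l \<longleftrightarrow> l \<noteq> [] \<and> distinct l \<and> (\<forall>u\<in>set l. \<forall>v\<in>set l. E u v \<longleftrightarrow> {u, v} \<in> path_edges l)"

lemma ipath_path_list:
  assumes E: "graph_rel E" and "ipath E P a b"
  obtains l where "path_list E l" "set l = P" "hd l = a" "last l = b"
proof -
  have "\<exists>l. path_list E l \<and> set l = P \<and> hd l = a \<and> last l = b"
    using assms(2)
  proof (induction rule: ipath.induct)
    case (single a)
    show ?case by (rule exI[of _ "[a]"]) (auto simp: path_list_def path_edges_simps graph_rel_irrefl[OF E])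
  next
    case (step P b c a)
    then obtain l where l: "path_list E l" "set l = P" "hd l = b" "last l = c" by blast
    have ne: "l \<noteq> []" using l(1) unfolding path_list_def by simp
    have pe: "path_edges (a # l) = insert {a, b} (path_edges l)" using path_edges_Cons[OF ne] l by simp
    have no: "{a, v} \<notin> path_edges l" "{v, a} \<notin> path_edges l" for v
      using path_edges_in[of a v l] path_edges_in[of v a l] l step.hyps by auto
    have bP: "b \<in> P" using ipath_ends[OF step.hyps(1)] by simp
    have "E u v \<longleftrightarrow> {u, v} \<in> path_edges (a # l)" if uv: "u \<in> insert a P" "v \<in> insert a P" for u v
    proof -
      consider "u = a" "v = a" | "u = a" "v \<in> P" | "v = a" "u \<in> P" | "u \<in> P" "v \<in> P" using uv by blast
      then show ?thesis
      proof cases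
        case 1 then show ?thesis using no(1)[of a] pe graph_rel_irrefl[OF E] step.hyps(2) bP by auto
      next
        case 2 then show ?thesis using no pe step.hyps(2) step.hyps(3)[of v] by (auto simp: doubleton_eq_iff)
      next
        case 3 then show ?thesis using no pe step.hyps(2) step.hyps(3)[of u] graph_rel_sym[OF E, of u a] by (auto simp: doubleton_eq_iff)
      next
        case 4
        then have "{u, v} \<noteq> {a, b}" using step.hyps(2) by (auto simp: doubleton_eq_iff)
        then show ?thesis using l 4 pe unfolding path_list_def by auto
      qed
    qed
    then have "path_list E (a # l)" using l step.hyps(2) unfolding path_list_def by simp
    then show ?case using l ne by (intro exI[of _ "a # l"]) simp
  qed
  then show thesis using that by blast
qed

lemma path_list_ipath:
  assumes E: "graph_rel E" and "path_list E l" shows "ipath E (set l) (hd l) (last l)"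
  using assms(2)
proof (induction l)
  case Nil then show ?case by (simp add: path_list_def)
next
  case (Cons a l)
  show ?case
  proof (cases "l = []")
    case True then show ?thesis by (simp add: ipath.single)
  next
    case False
    have pe: "path_edges (a # l) = insert {a, hd l} (path_edges l)" by (rule path_edges_Cons[OF False])
    have al: "a \<notin> set l" "distinct l" using Cons.prems unfolding path_list_def by auto
    have adj: "E u v \<longleftrightarrow> {u, v} \<in> path_edges (a # l)" if "u \<in> set (a # l)" "v \<in> set (a # l)" for u v
      using Cons.prems that unfolding path_list_def by blast
    have "E u v \<longleftrightarrow> {u, v} \<in> path_edges l" if "u \<in> set l" "v \<in> set l" for u v
    proof -
      have "{u, v} \<noteq> {a, hd l}" using that al by (auto simp: doubleton_eq_iff)
      then show ?thesis using adj[of u v] that pe by auto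
    qed
    then have "path_list E l" using False al unfolding path_list_def by blast
    then have "ipath E (set l) (hd l) (last l)" by (rule Cons.IH)
    then have "ipath E (insert a (set l)) a (last l)"
    proof (rule ipath.step[OF _ al(1)])
      fix p assume p: "p \<in> set l"
      have "{a, p} \<notin> path_edges l" using path_edges_in[of a p l] al by auto
      then show "E a p \<longleftrightarrow> p = hd l" using adj[of a p] p pe al by (auto simp: doubleton_eq_iff)
    qed
    then show ?thesis using False by simp
  qed
qed

text \<open>Reduces an equality of graphs to an equivalence of adjacencies. The elements of
  \<open>ES\<close> must be pairs from \<open>V\<close>, because the adjacency does not see any
  other sets.\<close>

lemma induced_eq_iff:
  assumes G: "simple_graph G" and W: "W \<subseteq> verts G"
    and ES: "\<And>e. e \<in> ES \<Longrightarrow> \<exists>u\<in>V. \<exists>v\<in>V. e = {u, v}"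
  shows "induced G W = Graph V ES \<longleftrightarrow> V = W \<and> (\<forall>u\<in>W. \<forall>v\<in>W. adjacent G u v \<longleftrightarrow> {u, v} \<in> ES)"
proof
  assume "induced G W = Graph V ES"
  then have "V = W" "ES = {e \<in> edges G. e \<subseteq> W}" unfolding induced_def by auto
  then show "V = W \<and> (\<forall>u\<in>W. \<forall>v\<in>W. adjacent G u v \<longleftrightarrow> {u, v} \<in> ES)" unfolding adjacent_def by auto
next
  assume h: "V = W \<and> (\<forall>u\<in>W. \<forall>v\<in>W. adjacent G u v \<longleftrightarrow> {u, v} \<in> ES)"
  have "{e \<in> edges G. e \<subseteq> W} = ES"
  proof (intro set_eqI iffI)
    fix e assume e: "e \<in> {e \<in> edges G. e \<subseteq> W}"
    then have "card e = 2" using G unfolding simple_graph_def by auto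
    then obtain u v where "e = {u, v}" unfolding card_2_iff by blast
    then show "e \<in> ES" using e h unfolding adjacent_def by auto
  next
    fix e assume e: "e \<in> ES"
    then obtain u v where "u \<in> W" "v \<in> W" "e = {u, v}" using ES h by blast
    then show "e \<in> {e \<in> edges G. e \<subseteq> W}" using e h unfolding adjacent_def by auto
  qed
  then show "induced G W = Graph V ES" using h unfolding induced_def by simp
qed

section \<open>Cycles and pyramids given by lists\<close>

definition icycle_list :: "('a \<Rightarrow> 'a \<Rightarrow> bool) \<Rightarrow> 'a list \<Rightarrow> bool" where
  "icycle_list E c \<longleftrightarrow> cycle_list c \<and> (\<forall>u\<in>set c. \<forall>v\<in>set c. E u v \<longleftrightarrow> {u, v} \<in> cycle_edges c)"

lemma cycle_edges_in:
  assumes "e \<in> cycle_edges c" "c \<noteq> []" shows "\<exists>u\<in>set c. \<exists>v\<in>set c. e = {u, v}"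
proof -
  have "last c \<in> set c" "hd c \<in> set c" using assms(2) by auto
  moreover from assms(1) have "e \<in> path_edges c \<or> e = {last c, hd c}" unfolding cycle_edges_def by auto
  ultimately show ?thesis using path_edges_sub[of e c] by blast
qed

lemma cycle_edges_Cons:
  "l \<noteq> [] \<Longrightarrow> cycle_edges (x # l) = insert {x, hd l} (insert {x, last l} (path_edges l))"
  unfolding cycle_edges_def by (auto simp: path_edges_Cons insert_commute)

lemma icycle_iff_icycle_list:
  assumes E: "graph_rel E"
  shows "icycle E C \<longleftrightarrow> (\<exists>c. icycle_list E c \<and> set c = C)"
proof
  assume "icycle E C"
  then obtain x P a b where C: "C = insert x P" "x \<notin> P" "ipath E P a b" "a \<noteq> b" "\<forall>p\<in>P. E x p \<longleftrightarrow> p = a \<or> p = b"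
    unfolding icycle_def by blast
  obtain l where l: "path_list E l" "set l = P" "hd l = a" "last l = b" by (rule ipath_path_list[OF E C(3)])
  have ne: "l \<noteq> []" "distinct l" using l(1) unfolding path_list_def by auto
  have len: "2 \<le> length l"
  proof (rule ccontr)
    assume "\<not> ?thesis"
    moreover have "length l \<noteq> 0" using ne by simp
    ultimately have "length l = 1" by linarith
    then have "hd l = last l" by (cases l) auto
    then show False using l C(4) by simp
  qed
  have ce: "cycle_edges (x # l) = insert {x, a} (insert {x, b} (path_edges l))" using cycle_edges_Cons[OF ne(1)] l by simp
  have no: "{x, v} \<notin> path_edges l" "{v, x} \<notin> path_edges l" for v
    using path_edges_in[of x v l] path_edges_in[of v x l] l C(2) by auto
  have ab: "a \<in> P" "b \<in> P" using ipath_ends[OF C(3)] by auto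
  have "E u v \<longleftrightarrow> {u, v} \<in> cycle_edges (x # l)" if uv: "u \<in> insert x P" "v \<in> insert x P" for u v
  proof -
    consider "u = x" "v = x" | "u = x" "v \<in> P" | "v = x" "u \<in> P" | "u \<in> P" "v \<in> P" using uv by blast
    then show ?thesis
    proof cases
      case 1 then show ?thesis using no(1)[of x] ce graph_rel_irrefl[OF E] C(2) ab by auto
    next
      case 2 then show ?thesis using no ce C(2,5) by (auto simp: doubleton_eq_iff)
    next
      case 3 then show ?thesis using no ce C(2,5) graph_rel_sym[OF E, of u x] by (auto simp: doubleton_eq_iff)
    next
      case 4
      then have "{u, v} \<noteq> {x, a}" "{u, v} \<noteq> {x, b}" using C(2) by (auto simp: doubleton_eq_iff)
      then show ?thesis using l 4 ce unfolding path_list_def by auto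
    qed
  qed
  then have "icycle_list E (x # l)" using l(2) C(2) ne len unfolding icycle_list_def cycle_list_def by simp
  then show "\<exists>c. icycle_list E c \<and> set c = C" using l(2) C(1) by (intro exI[of _ "x # l"]) simp
next
  assume "\<exists>c. icycle_list E c \<and> set c = C"
  then obtain c where c: "icycle_list E c" "set c = C" by blast
  then obtain x l where xl: "c = x # l" unfolding icycle_list_def cycle_list_def by (cases c) auto
  have d: "distinct l" "x \<notin> set l" "2 \<le> length l" using c(1) xl unfolding icycle_list_def cycle_list_def by auto
  then have ne: "l \<noteq> []" by auto
  have adj: "E u v \<longleftrightarrow> {u, v} \<in> cycle_edges (x # l)" if "u \<in> set (x # l)" "v \<in> set (x # l)" for u v
    using c(1) that unfolding icycle_list_def xl by blast
  note ce = cycle_edges_Cons[OF ne, of x]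
  have "E u v \<longleftrightarrow> {u, v} \<in> path_edges l" if "u \<in> set l" "v \<in> set l" for u v
  proof -
    have "{u, v} \<noteq> {x, hd l}" "{u, v} \<noteq> {x, last l}" using that d(2) by (auto simp: doubleton_eq_iff)
    then show ?thesis using adj[of u v] that ce by auto
  qed
  then have "path_list E l" using d ne unfolding path_list_def by blast
  then have ipath: "ipath E (set l) (hd l) (last l)" by (rule path_list_ipath[OF E])
  have "hd l \<noteq> last l"
  proof -
    obtain a b k where "l = a # b # k" using d(3) by (cases l; cases "tl l") auto
    then show ?thesis using d(1) by auto
  qed
  then have "icycle E (insert x (set l))"
  proof (rule icycleI[OF ipath _ d(2)])
    fix p assume p: "p \<in> set l"
    have "{x, p} \<notin> path_edges l" using path_edges_in[of x p l] d(2) by auto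
    then show "E x p \<longleftrightarrow> p = hd l \<or> p = last l" using adj[of x p] p ce d(2) by (auto simp: doubleton_eq_iff)
  qed
  then show "icycle E C" using c(2) xl by simp
qed

lemma cycle_graph_iff:
  assumes G: "simple_graph G" and W: "W \<subseteq> verts G"
  shows "cycle_graph (induced G W) \<longleftrightarrow> icycle (adjacent G) W"
proof -
  have "(cycle_list c \<and> induced G W = Graph (set c) (cycle_edges c)) \<longleftrightarrow> icycle_list (adjacent G) c \<and> set c = W" for c
  proof (cases "c = []")
    case True then show ?thesis unfolding icycle_list_def cycle_list_def by simp
  next
    case False
    have "induced G W = Graph (set c) (cycle_edges c) \<longleftrightarrow> set c = W \<and> (\<forall>u\<in>W. \<forall>v\<in>W. adjacent G u v \<longleftrightarrow> {u, v} \<in> cycle_edges c)"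
      by (rule induced_eq_iff[OF G W]) (rule cycle_edges_in[OF _ False])
    then show ?thesis unfolding icycle_list_def by auto
  qed
  then show ?thesis unfolding cycle_graph_def icycle_iff_icycle_list[OF simple_graph_rel[OF G]] by blast
qed

lemma pyramid_iff:
  assumes G: "simple_graph G" and W: "W \<subseteq> verts G"
  shows "pyramid (induced G W) \<longleftrightarrow>
    (\<exists>D h. W = insert h D \<and> h \<notin> D \<and> icycle (adjacent G) D \<and> 3 \<le> card (nbrs (adjacent G) h D))"
proof
  note E = simple_graph_rel[OF G]
  note sym = graph_rel_sym[OF E] and irr = graph_rel_irrefl[OF E]
  assume "pyramid (induced G W)"
  then obtain c a N where c: "cycle_list c" "a \<notin> set c" "N \<subseteq> set c" "3 \<le> card N"
    and eq: "induced G W = Graph (set c \<union> {a}) (cycle_edges c \<union> {{a, x} | x. x \<in> N})"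
    unfolding pyramid_def by blast
  have ne: "c \<noteq> []" using c(1) unfolding cycle_list_def by auto
  have "set c \<union> {a} = W \<and> (\<forall>u\<in>W. \<forall>v\<in>W. adjacent G u v \<longleftrightarrow> {u, v} \<in> cycle_edges c \<union> {{a, x} | x. x \<in> N})"
    by (rule induced_eq_iff[OF G W, THEN iffD1, OF _ eq]) (use cycle_edges_in[OF _ ne] c(3) in blast)
  then have W': "set c \<union> {a} = W" and adj: "\<And>u v. u \<in> W \<Longrightarrow> v \<in> W \<Longrightarrow> adjacent G u v \<longleftrightarrow> {u, v} \<in> cycle_edges c \<union> {{a, x} | x. x \<in> N}"
    by auto
  have "icycle_list (adjacent G) c"
    unfolding icycle_list_def
  proof (intro conjI ballI c(1))
    fix u v assume uv: "u \<in> set c" "v \<in> set c"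
    then have "{u, v} \<notin> {{a, x} | x. x \<in> N}" using c(2) by (auto simp: doubleton_eq_iff)
    then show "adjacent G u v \<longleftrightarrow> {u, v} \<in> cycle_edges c" using adj[of u v] uv W' by auto
  qed
  then have "icycle (adjacent G) (set c)" using icycle_iff_icycle_list[OF E] by blast
  moreover have "nbrs (adjacent G) a (set c) = N"
  proof -
    have "{a, x} \<notin> cycle_edges c" for x using cycle_edges_in[OF _ ne, of "{a, x}"] c(2) by (auto simp: doubleton_eq_iff)
    then have "adjacent G a x \<longleftrightarrow> x \<in> N" if "x \<in> set c" for x
      using adj[of a x] that W' c(2) by (auto simp: doubleton_eq_iff)
    then show ?thesis using c(3) by auto
  qed
  ultimately show "\<exists>D h. W = insert h D \<and> h \<notin> D \<and> icycle (adjacent G) D \<and> 3 \<le> card (nbrs (adjacent G) h D)"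
    using W' c by (intro exI[of _ "set c"] exI[of _ a]) auto
next
  note E = simple_graph_rel[OF G]
  note sym = graph_rel_sym[OF E] and irr = graph_rel_irrefl[OF E]
  assume "\<exists>D h. W = insert h D \<and> h \<notin> D \<and> icycle (adjacent G) D \<and> 3 \<le> card (nbrs (adjacent G) h D)"
  then obtain D h where D: "W = insert h D" "h \<notin> D" "icycle (adjacent G) D" "3 \<le> card (nbrs (adjacent G) h D)" by blast
  obtain c where c: "icycle_list (adjacent G) c" "set c = D" using D(3) icycle_iff_icycle_list[OF E] by blast
  have cl: "cycle_list c" and ne: "c \<noteq> []" using c(1) unfolding icycle_list_def cycle_list_def by auto
  define N where "N = nbrs (adjacent G) h D"
  have N: "N \<subseteq> set c" unfolding N_def c(2) by auto
  have "induced G W = Graph (set c \<union> {h}) (cycle_edges c \<union> {{h, x} | x. x \<in> N})"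
  proof (rule induced_eq_iff[OF G W, THEN iffD2])
    show "\<And>e. e \<in> cycle_edges c \<union> {{h, x} |x. x \<in> N} \<Longrightarrow> \<exists>u\<in>set c \<union> {h}. \<exists>v\<in>set c \<union> {h}. e = {u, v}"
      using cycle_edges_in[OF _ ne] N by blast
    have "adjacent G u v \<longleftrightarrow> {u, v} \<in> cycle_edges c \<union> {{h, x} |x. x \<in> N}" if uv: "u \<in> W" "v \<in> W" for u v
    proof -
      have no: "{h, x} \<notin> cycle_edges c" "{x, h} \<notin> cycle_edges c" for x
        using cycle_edges_in[OF _ ne, of "{h, x}"] cycle_edges_in[OF _ ne, of "{x, h}"] c(2) D(2) by (auto simp: doubleton_eq_iff)
      have hN: "h \<notin> N" using N c(2) D(2) by auto
      consider "u = h" "v = h" | "u = h" "v \<in> D" | "v = h" "u \<in> D" | "u \<in> D" "v \<in> D" using uv D(1) by blast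
      then show ?thesis
      proof cases
        case 1 then show ?thesis using no(1)[of h] irr hN by (auto simp: doubleton_eq_iff)
      next
        case 2 then show ?thesis using no D(2) by (auto simp: doubleton_eq_iff N_def)
      next
        case 3 then show ?thesis using no D(2) sym[of u h] by (auto simp: doubleton_eq_iff N_def)
      next
        case 4
        then have "{u, v} \<notin> {{h, x} |x. x \<in> N}" using D(2) by (auto simp: doubleton_eq_iff)
        then show ?thesis using 4 c unfolding icycle_list_def by auto
      qed
    qed
    then show "set c \<union> {h} = W \<and> (\<forall>u\<in>W. \<forall>v\<in>W. adjacent G u v \<longleftrightarrow> {u, v} \<in> cycle_edges c \<union> {{h, x} |x. x \<in> N})"
      using D(1) c(2) by auto
  qed
  then show "pyramid (induced G W)" unfolding pyramid_def using cl c(2) D(2,4) N N_def by blast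
qed

text \<open>In contrast to \<open>ipath_cut\<close>, it is unknown which of \<open>q\<close>,
  \<open>q'\<close> comes first on the path, so both orders have to appear.\<close>

lemma ipath_cut_edge:
  assumes E: "graph_rel E" and "ipath E P a b" "q \<in> P" "q' \<in> P" "q \<noteq> q'" "E q q'"
  shows "\<exists>P1 P2. P = P1 \<union> P2 \<and> P1 \<inter> P2 = {} \<and>
    (ipath E P1 a q \<and> ipath E P2 q' b \<and> (\<forall>u\<in>P1. \<forall>r\<in>P2. E u r \<longleftrightarrow> u = q \<and> r = q') \<or>
     ipath E P1 a q' \<and> ipath E P2 q b \<and> (\<forall>u\<in>P1. \<forall>r\<in>P2. E u r \<longleftrightarrow> u = q' \<and> r = q))"
  using assms(2-)
proof (induction rule: ipath.induct)
  case (single a) then show ?case by auto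
next
  case (step P b0 c a)
  have e: "E q' q" using step.prems graph_rel_sym[OF E] by blast
  show ?case
  proof (cases "a = q \<or> a = q'")
    case True
    then show ?thesis
    proof
      assume a: "a = q"
      then have "q' = b0" using step.prems step.hyps(3)[of q'] by auto
      then show ?thesis using a step.hyps ipath.single[of E q]
        by (intro exI[of _ "{q}"] exI[of _ P]) auto
    next
      assume a: "a = q'"
      then have "q = b0" using step.prems step.hyps(3)[of q] e by auto
      then show ?thesis using a step.hyps ipath.single[of E q']
        by (intro exI[of _ "{q'}"] exI[of _ P]) auto
    qed
  next
    case False
    then have "q \<in> P" "q' \<in> P" using step.prems by auto
    then obtain P1 P2 where c: "P = P1 \<union> P2" "P1 \<inter> P2 = {}"
      "ipath E P1 b0 q \<and> ipath E P2 q' c \<and> (\<forall>u\<in>P1. \<forall>r\<in>P2. E u r \<longleftrightarrow> u = q \<and> r = q') \<or>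
       ipath E P1 b0 q' \<and> ipath E P2 q c \<and> (\<forall>u\<in>P1. \<forall>r\<in>P2. E u r \<longleftrightarrow> u = q' \<and> r = q)"
      using step.IH step.prems by metis
    have b0: "b0 \<in> P1" using c(3) ipath_ends by metis
    have up: "ipath E (insert a P1) a z" if "ipath E P1 b0 z" for z
      by (rule ipath.step[OF that]) (use step.hyps c(1) in auto)
    have no: "\<not> E a r" if "r \<in> P2" for r using step.hyps(3)[of r] that c(1,2) b0 by auto
    show ?thesis
      using c(3)
    proof
      assume h: "ipath E P1 b0 q \<and> ipath E P2 q' c \<and> (\<forall>u\<in>P1. \<forall>r\<in>P2. E u r \<longleftrightarrow> u = q \<and> r = q')"
      then show ?thesis using up[of q] no c(1,2) step.hyps(2) False
        by (intro exI[of _ "insert a P1"] exI[of _ P2]) auto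
    next
      assume h: "ipath E P1 b0 q' \<and> ipath E P2 q c \<and> (\<forall>u\<in>P1. \<forall>r\<in>P2. E u r \<longleftrightarrow> u = q' \<and> r = q)"
      then show ?thesis using up[of q'] no c(1,2) step.hyps(2) False
        by (intro exI[of _ "insert a P1"] exI[of _ P2]) auto
    qed
  qed
qed

text \<open>The flags tell, for each end of the three rows, whether the row ends span a triangle (True) or
  are joined to an apex x resp. y (False).\<close>

definition rows :: "('a \<Rightarrow> 'a \<Rightarrow> bool) \<Rightarrow> bool \<Rightarrow> bool \<Rightarrow> (nat \<Rightarrow> 'a set) \<Rightarrow> (nat \<Rightarrow> 'a) \<Rightarrow> (nat \<Rightarrow> 'a) \<Rightarrow> bool" where
  "rows E \<alpha> \<beta> Q a b \<longleftrightarrow> (\<forall>i<3. ipath E (Q i) (a i) (b i)) \<and> (\<forall>i<3. \<forall>j<3. i \<noteq> j \<longrightarrow> Q i \<inter> Q j = {} \<and>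
     (\<forall>u\<in>Q i. \<forall>v\<in>Q j. E u v \<longleftrightarrow> \<alpha> \<and> u = a i \<and> v = a j \<or> \<beta> \<and> u = b i \<and> v = b j))"

definition apex :: "('a \<Rightarrow> 'a \<Rightarrow> bool) \<Rightarrow> (nat \<Rightarrow> 'a set) \<Rightarrow> (nat \<Rightarrow> 'a) \<Rightarrow> 'a \<Rightarrow> bool" where
  "apex E Q b x \<longleftrightarrow> (\<forall>i<3. x \<notin> Q i \<and> (\<forall>u\<in>Q i. E x u \<longleftrightarrow> u = b i))"

lemma rowsD:
  assumes "rows E \<alpha> \<beta> Q a b" "i < 3"
  shows "ipath E (Q i) (a i) (b i)" "a i \<in> Q i" "b i \<in> Q i"
    "j < 3 \<Longrightarrow> i \<noteq> j \<Longrightarrow> Q i \<inter> Q j = {}"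
    "j < 3 \<Longrightarrow> i \<noteq> j \<Longrightarrow> u \<in> Q i \<Longrightarrow> v \<in> Q j \<Longrightarrow> E u v \<longleftrightarrow> \<alpha> \<and> u = a i \<and> v = a j \<or> \<beta> \<and> u = b i \<and> v = b j"
proof -
  have r: "\<And>i. i < 3 \<Longrightarrow> ipath E (Q i) (a i) (b i)"
    "\<And>i j. i < 3 \<Longrightarrow> j < 3 \<Longrightarrow> i \<noteq> j \<Longrightarrow> Q i \<inter> Q j = {}"
    "\<And>i j u v. i < 3 \<Longrightarrow> j < 3 \<Longrightarrow> i \<noteq> j \<Longrightarrow> u \<in> Q i \<Longrightarrow> v \<in> Q j \<Longrightarrow> E u v \<longleftrightarrow> \<alpha> \<and> u = a i \<and> v = a j \<or> \<beta> \<and> u = b i \<and> v = b j"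
    using assms(1) unfolding rows_def by auto
  show "ipath E (Q i) (a i) (b i)" by (rule r(1)[OF assms(2)])
  then show "a i \<in> Q i" "b i \<in> Q i" using ipath_ends by metis+
  show "j < 3 \<Longrightarrow> i \<noteq> j \<Longrightarrow> Q i \<inter> Q j = {}" by (rule r(2)[OF assms(2)])
  show "j < 3 \<Longrightarrow> i \<noteq> j \<Longrightarrow> u \<in> Q i \<Longrightarrow> v \<in> Q j \<Longrightarrow> E u v \<longleftrightarrow> \<alpha> \<and> u = a i \<and> v = a j \<or> \<beta> \<and> u = b i \<and> v = b j"
    by (rule r(3)[OF assms(2)])
qed

section \<open>Prisms, stamps and trihedra are cycles with an ear\<close>

lemma UN3: "(\<Union>i<3. f i) = f 0 \<union> f 1 \<union> f (2::nat)"
  by (auto simp: numeral_3_eq_3 numeral_2_eq_2 less_Suc_eq)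

lemma all3: "(\<forall>i<3. P i) \<longleftrightarrow> P 0 \<and> P 1 \<and> P (2::nat)"
  by (auto simp: numeral_3_eq_3 numeral_2_eq_2 less_Suc_eq)

text \<open>Two rows with the edges between their ends form the cycle, and the third row is the ear.
  Each of its ends sees the two vertices of one edge of the cycle.\<close>

lemma prism_solid:
  assumes E: "graph_rel E" and r: "rows E True True Q a b" and ab: "\<And>i. i < 3 \<Longrightarrow> a i \<noteq> b i"
  shows "solid E (\<Union>i<3. Q i)"
proof -
  have l: "0 < (3::nat)" "1 < (3::nat)" "2 < (3::nat)" by auto
  note r0 = rowsD[OF r l(1)] and r1 = rowsD[OF r l(2)] and r2 = rowsD[OF r l(3)]
  have ex: "Q 2 \<inter> Q 0 = {}" "Q 2 \<inter> Q 1 = {}" "Q 0 \<inter> Q 1 = {}" using r0(4)[of 1] r2(4)[of 0] r2(4)[of 1] l by auto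
  have e0: "E u v \<longleftrightarrow> u = a 2 \<and> v = a 0 \<or> u = b 2 \<and> v = b 0" if "u \<in> Q 2" "v \<in> Q 0" for u v using r2(5)[of 0 u v] l that by simp
  have e1: "E u v \<longleftrightarrow> u = a 2 \<and> v = a 1 \<or> u = b 2 \<and> v = b 1" if "u \<in> Q 2" "v \<in> Q 1" for u v using r2(5)[of 1 u v] l that by simp
  have e01: "E u v \<longleftrightarrow> u = a 0 \<and> v = a 1 \<or> u = b 0 \<and> v = b 1" if "u \<in> Q 0" "v \<in> Q 1" for u v using r0(5)[of 1 u v] l that by simp
  have c: "icycle E (Q 0 \<union> Q 1)"
    by (rule icycle_join[OF E r0(1) ipath_rev[OF E r1(1)] ex(3)]) (use ab l e01 in auto)
  have nbz: "nbrs E z (Q 0 \<union> Q 1) = (if z = a 2 then {a 0, a 1} else {}) \<union> (if z = b 2 then {b 0, b 1} else {})" if "z \<in> Q 2" for z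
    using e0[OF that] e1[OF that] r0(2,3) r1(2,3) by auto
  have ab2: "a 2 \<noteq> b 2" using ab l by auto
  have nn: "nbrs E (a 2) (Q 0 \<union> Q 1) = {a 0, a 1}" "nbrs E (b 2) (Q 0 \<union> Q 1) = {b 0, b 1}"
    using nbz r2(2,3) ab2 by auto
  have "solid E ((Q 0 \<union> Q 1) \<union> Q 2)"
  proof (rule solid_earI[OF c r2(1)])
    show "(Q 0 \<union> Q 1) \<inter> Q 2 = {}" using ex by auto
    show "\<not> big E (nbrs E (a 2) (Q 0 \<union> Q 1))" unfolding nn using e01 r0(2) r1(2) by (simp add: big_pair[OF E])
    show "\<not> big E (nbrs E (b 2) (Q 0 \<union> Q 1))" unfolding nn using e01 r0(3) r1(3) by (simp add: big_pair[OF E])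
    have "a 0 \<noteq> a 1" "a 0 \<noteq> b 0" "a 1 \<noteq> b 0" using ex r0(2,3) r1(2,3) ab l by auto
    then show "big E (nbrs E (a 2) (Q 0 \<union> Q 1) \<union> nbrs E (b 2) (Q 0 \<union> Q 1))"
      unfolding nn by (intro big3[of "a 0" _ "a 1" "b 0"]) auto
    show "nbrs E z (Q 0 \<union> Q 1) = {}" if "z \<in> Q 2" "z \<noteq> a 2" "z \<noteq> b 2" for z using nbz[OF that(1)] that by simp
  qed (use ab2 in auto)
  then show ?thesis by (simp add: UN3 Un_assoc)
qed

text \<open>The cycle consists of two rows and the apex. If the third row is a single vertex, it is
  no ear with two ends but a hub that sees \<open>a 0\<close>, \<open>a 1\<close> and
  \<open>x\<close>.\<close>

lemma stamp_solid:
  assumes E: "graph_rel E" and r: "rows E True False Q a b" and x: "apex E Q b x"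
  shows "solid E (insert x (\<Union>i<3. Q i))"
proof -
  have l: "0 < (3::nat)" "1 < (3::nat)" "2 < (3::nat)" by auto
  note r0 = rowsD[OF r l(1)] and r1 = rowsD[OF r l(2)] and r2 = rowsD[OF r l(3)]
  have ex: "Q 2 \<inter> Q 0 = {}" "Q 2 \<inter> Q 1 = {}" "Q 0 \<inter> Q 1 = {}" using r0(4)[of 1] r2(4)[of 0] r2(4)[of 1] l by auto
  have e0: "E u v \<longleftrightarrow> u = a 2 \<and> v = a 0" if "u \<in> Q 2" "v \<in> Q 0" for u v using r2(5)[of 0 u v] l that by simp
  have e1: "E u v \<longleftrightarrow> u = a 2 \<and> v = a 1" if "u \<in> Q 2" "v \<in> Q 1" for u v using r2(5)[of 1 u v] l that by simp
  have e01: "E u v \<longleftrightarrow> u = a 0 \<and> v = a 1" if "u \<in> Q 0" "v \<in> Q 1" for u v using r0(5)[of 1 u v] l that by simp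
  have xn: "x \<notin> Q i" "u \<in> Q i \<Longrightarrow> E x u \<longleftrightarrow> u = b i" "u \<in> Q i \<Longrightarrow> E u x \<longleftrightarrow> u = b i" if "i < 3" for i u
    using x that graph_rel_sym[OF E, of u x] unfolding apex_def by auto
  have ip0: "ipath E (Q 0 \<union> {x}) (a 0) x"
    by (rule ipath_append[OF r0(1) ipath.single]) (use xn l in auto)
  have c: "icycle E ((Q 0 \<union> {x}) \<union> Q 1)"
  proof (rule icycle_join[OF E ip0 ipath_rev[OF E r1(1)]])
    show "(Q 0 \<union> {x}) \<inter> Q 1 = {}" using ex xn l by auto
    show "a 0 \<noteq> x \<or> b 1 \<noteq> a 1" using xn(1)[OF l(1)] r0(2) by auto
    fix u v assume "u \<in> Q 0 \<union> {x}" "v \<in> Q 1"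
    then show "E u v \<longleftrightarrow> u = x \<and> v = b 1 \<or> u = a 0 \<and> v = a 1"
      using e01[of u v] xn(1)[OF l(1)] xn(2)[OF l(2), of v] r0(2) by auto
  qed
  let ?D = "(Q 0 \<union> {x}) \<union> Q 1"
  have nbz: "nbrs E z ?D = (if z = a 2 then {a 0, a 1} else {}) \<union> (if z = b 2 then {x} else {})" if "z \<in> Q 2" for z
    using e0[OF that] e1[OF that] r0(2) r1(2) xn(3)[OF l(3) that] by auto
  have na: "{a 0, a 1} \<subseteq> nbrs E (a 2) ?D" and nx: "x \<in> nbrs E (b 2) ?D" using nbz[OF r2(2)] nbz[OF r2(3)] by auto
  have "a 0 \<noteq> a 1" "a 0 \<noteq> x" "a 1 \<noteq> x" using ex r0(2) r1(2) xn(1) l by auto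
  then have bg: "big E (nbrs E (a 2) ?D \<union> nbrs E (b 2) ?D)" using na nx by (intro big3[of "a 0" _ "a 1" x]) auto
  have DZ: "?D \<inter> Q 2 = {}" using ex xn l by auto
  have "solid E (?D \<union> Q 2)"
  proof (cases "a 2 = b 2")
    case True
    then have "Q 2 = {a 2}" using ipath_eqD[OF r2(1)] by simp
    moreover have "solid E (insert (a 2) ?D)" by (rule solid_hub[OF c]) (use DZ r2(2) bg True in auto)
    ultimately show ?thesis by simp
  next
    case False
    show ?thesis
    proof (rule solid_earI[OF c r2(1) DZ False _ _ bg])
      have "nbrs E (a 2) ?D = {a 0, a 1}" "nbrs E (b 2) ?D = {x}" using nbz r2(2,3) False by auto
      then show "\<not> big E (nbrs E (a 2) ?D)" "\<not> big E (nbrs E (b 2) ?D)" using e01 r0(2) r1(2) by (simp_all add: big_pair[OF E])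
      show "nbrs E z ?D = {}" if "z \<in> Q 2" "z \<noteq> a 2" "z \<noteq> b 2" for z using nbz[OF that(1)] that by simp
    qed simp
  qed
  moreover have "?D \<union> Q 2 = insert x (\<Union>i<3. Q i)" unfolding UN3 by auto
  ultimately show ?thesis by simp
qed

text \<open>Two rows and the apices form the cycle. The third row is attached to the nonadjacent
  vertices \<open>x\<close> and \<open>y\<close>, so even a row with one vertex has a big
  attachment.\<close>

lemma trihedron_solid:
  assumes E: "graph_rel E" and r: "rows E False False Q a b" and x: "apex E Q a x" and y: "apex E Q b y" and xy: "x \<noteq> y" "\<not> E x y"
  shows "solid E (insert x (insert y (\<Union>i<3. Q i)))"
proof -
  have l: "0 < (3::nat)" "1 < (3::nat)" "2 < (3::nat)" by auto
  note r0 = rowsD[OF r l(1)] and r1 = rowsD[OF r l(2)] and r2 = rowsD[OF r l(3)]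
  have ex: "Q 2 \<inter> Q 0 = {}" "Q 2 \<inter> Q 1 = {}" "Q 0 \<inter> Q 1 = {}" using r0(4)[of 1] r2(4)[of 0] r2(4)[of 1] l by auto
  have e0: "\<not> E u v" if "u \<in> Q 2" "v \<in> Q 0" for u v using r2(5)[of 0 u v] l that by simp
  have e1: "\<not> E u v" if "u \<in> Q 2" "v \<in> Q 1" for u v using r2(5)[of 1 u v] l that by simp
  have e01: "\<not> E u v" if "u \<in> Q 0" "v \<in> Q 1" for u v using r0(5)[of 1 u v] l that by simp
  have xn: "x \<notin> Q i" "u \<in> Q i \<Longrightarrow> E x u \<longleftrightarrow> u = a i" "u \<in> Q i \<Longrightarrow> E u x \<longleftrightarrow> u = a i" if "i < 3" for i u
    using x that graph_rel_sym[OF E, of u x] unfolding apex_def by auto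
  have yn: "y \<notin> Q i" "u \<in> Q i \<Longrightarrow> E y u \<longleftrightarrow> u = b i" "u \<in> Q i \<Longrightarrow> E u y \<longleftrightarrow> u = b i" if "i < 3" for i u
    using y that graph_rel_sym[OF E, of u y] unfolding apex_def by auto
  have ip0: "ipath E (Q 0 \<union> {y}) (a 0) y"
    by (rule ipath_append[OF r0(1) ipath.single]) (use yn l in auto)
  have ip0': "ipath E (insert x (Q 0 \<union> {y})) x y"
    by (rule ipath.step[OF ip0]) (use xn(1)[OF l(1)] xn(2)[OF l(1)] xy yn(1)[OF l(1)] r0(2) in auto)
  let ?D = "insert x (Q 0 \<union> {y}) \<union> Q 1"
  have c: "icycle E ?D"
  proof (rule icycle_join[OF E ip0' ipath_rev[OF E r1(1)]])
    show "insert x (Q 0 \<union> {y}) \<inter> Q 1 = {}" using ex xn yn l by auto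
    fix u v assume "u \<in> insert x (Q 0 \<union> {y})" "v \<in> Q 1"
    then show "E u v \<longleftrightarrow> u = y \<and> v = b 1 \<or> u = x \<and> v = a 1"
      using e01[of u v] xn(1)[OF l(1)] yn(1)[OF l(1)] xn(2)[OF l(2), of v] yn(2)[OF l(2), of v] xy by auto
  qed (use xy in auto)
  have nbz: "nbrs E z ?D = (if z = a 2 then {x} else {}) \<union> (if z = b 2 then {y} else {})" if z: "z \<in> Q 2" for z
  proof -
    have "E z d \<longleftrightarrow> z = a 2 \<and> d = x \<or> z = b 2 \<and> d = y" if dD: "d \<in> ?D" for d
    proof -
      consider "d = x" | "d = y" | "d \<in> Q 0" | "d \<in> Q 1" using dD by blast
      then show ?thesis
      proof cases
        case 1 then show ?thesis using xn(3)[OF l(3) z] xy(1) by simp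
      next
        case 2 then show ?thesis using yn(3)[OF l(3) z] xy(1) by simp
      next
        case 3
        then have "d \<noteq> x" "d \<noteq> y" using xn(1)[OF l(1)] yn(1)[OF l(1)] by auto
        then show ?thesis using e0[OF z 3] by simp
      next
        case 4
        then have "d \<noteq> x" "d \<noteq> y" using xn(1)[OF l(2)] yn(1)[OF l(2)] by auto
        then show ?thesis using e1[OF z 4] by simp
      qed
    qed
    then have "nbrs E z ?D = {d \<in> ?D. z = a 2 \<and> d = x \<or> z = b 2 \<and> d = y}" unfolding nbrs_def by (rule Collect_cong[OF conj_cong[OF HOL.refl]])
    also have "\<dots> = (if z = a 2 then {x} else {}) \<union> (if z = b 2 then {y} else {})" by auto
    finally show ?thesis .
  qed
  have na: "x \<in> nbrs E (a 2) ?D" and nx: "y \<in> nbrs E (b 2) ?D" using nbz[OF r2(2)] nbz[OF r2(3)] by auto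
  then have bg: "big E (nbrs E (a 2) ?D \<union> nbrs E (b 2) ?D)" using xy by (intro big2[of x _ y]) auto
  have DZ: "?D \<inter> Q 2 = {}" using ex xn yn l by auto
  have "solid E (?D \<union> Q 2)"
  proof (cases "a 2 = b 2")
    case True
    then have "Q 2 = {a 2}" using ipath_eqD[OF r2(1)] by simp
    moreover have "solid E (insert (a 2) ?D)" by (rule solid_hub[OF c]) (use DZ r2(2) bg True in auto)
    ultimately show ?thesis by simp
  next
    case False
    show ?thesis
    proof (rule solid_earI[OF c r2(1) DZ False _ _ bg])
      have "nbrs E (a 2) ?D = {x}" "nbrs E (b 2) ?D = {y}" using nbz r2(2,3) False by auto
      then show "\<not> big E (nbrs E (a 2) ?D)" "\<not> big E (nbrs E (b 2) ?D)" by simp_all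
      show "nbrs E z ?D = {}" if "z \<in> Q 2" "z \<noteq> a 2" "z \<noteq> b 2" for z using nbz[OF that(1)] that by simp
    qed simp
  qed
  moreover have "?D \<union> Q 2 = insert x (insert y (\<Union>i<3. Q i))" unfolding UN3 by auto
  ultimately show ?thesis by simp
qed

section \<open>Every cycle with an ear is one of the four solids\<close>

definition triple :: "'b \<Rightarrow> 'b \<Rightarrow> 'b \<Rightarrow> nat \<Rightarrow> 'b" where
  "triple p q r i = (if i = 0 then p else if i = 1 then q else r)"

lemma triple_simps [simp]: "triple p q r 0 = p" "triple p q r 1 = q" "triple p q r (Suc 0) = q" "triple p q r 2 = r"
  by (simp_all add: triple_def)

lemma rows_triple:
  assumes E: "graph_rel E" and ips: "ipath E Q0 a0 b0" "ipath E Q1 a1 b1" "ipath E Q2 a2 b2"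
    and disj: "Q0 \<inter> Q1 = {}" "Q0 \<inter> Q2 = {}" "Q1 \<inter> Q2 = {}"
    and cr: "\<And>u v. u \<in> Q0 \<Longrightarrow> v \<in> Q1 \<Longrightarrow> E u v \<longleftrightarrow> \<alpha> \<and> u = a0 \<and> v = a1 \<or> \<beta> \<and> u = b0 \<and> v = b1"
      "\<And>u v. u \<in> Q0 \<Longrightarrow> v \<in> Q2 \<Longrightarrow> E u v \<longleftrightarrow> \<alpha> \<and> u = a0 \<and> v = a2 \<or> \<beta> \<and> u = b0 \<and> v = b2"
      "\<And>u v. u \<in> Q1 \<Longrightarrow> v \<in> Q2 \<Longrightarrow> E u v \<longleftrightarrow> \<alpha> \<and> u = a1 \<and> v = a2 \<or> \<beta> \<and> u = b1 \<and> v = b2"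
  shows "rows E \<alpha> \<beta> (triple Q0 Q1 Q2) (triple a0 a1 a2) (triple b0 b1 b2)"
proof -
  have cr': "E v u \<longleftrightarrow> \<alpha> \<and> v = a1 \<and> u = a0 \<or> \<beta> \<and> v = b1 \<and> u = b0" if "u \<in> Q0" "v \<in> Q1" for u v
    using cr(1)[OF that] graph_rel_sym[OF E, of u v] by auto
  have cr2: "E v u \<longleftrightarrow> \<alpha> \<and> v = a2 \<and> u = a0 \<or> \<beta> \<and> v = b2 \<and> u = b0" if "u \<in> Q0" "v \<in> Q2" for u v
    using cr(2)[OF that] graph_rel_sym[OF E, of u v] by auto
  have cr3: "E v u \<longleftrightarrow> \<alpha> \<and> v = a2 \<and> u = a1 \<or> \<beta> \<and> v = b2 \<and> u = b1" if "u \<in> Q1" "v \<in> Q2" for u v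
    using cr(3)[OF that] graph_rel_sym[OF E, of u v] by auto
  show ?thesis unfolding rows_def all3
    using ips disj cr cr' cr2 cr3 by (simp add: Int_commute)
qed

text \<open>A nonempty attachment that is not big is a vertex or an edge, so an ear with two ends
  yields a trihedron, a stamp or a prism according to how many of its two attachments are edges. A
  one-vertex ear is the hub of a pyramid, or it sees exactly two nonadjacent vertices and is the
  middle of the third path of a trihedron.\<close>

lemma solid_cases:
  assumes E: "graph_rel E" and s: "solid E W"
  shows "(\<exists>D h. W = insert h D \<and> h \<notin> D \<and> icycle E D \<and> 3 \<le> card (nbrs E h D))
    \<or> (\<exists>Q a b x y. rows E False False Q a b \<and> apex E Q a x \<and> apex E Q b y \<and> x \<noteq> y \<and> \<not> E x y \<and> W = insert x (insert y (\<Union>i<3. Q i)))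
    \<or> (\<exists>Q a b x. rows E True False Q a b \<and> apex E Q b x \<and> W = insert x (\<Union>i<3. Q i))
    \<or> (\<exists>Q a b. rows E True True Q a b \<and> (\<forall>i<3. a i \<noteq> b i) \<and> W = (\<Union>i<3. Q i))"
    (is "?pyr \<or> ?triple \<or> ?stamp \<or> ?prism")
proof -
  note sym = graph_rel_sym[OF E] and irr = graph_rel_irrefl[OF E]
  obtain D Z s t where D: "W = D \<union> Z" "ears E D Z s t" "s \<noteq> t \<Longrightarrow> nbrs E s D \<inter> nbrs E t D = {}"
    using solid_disjoint[OF E s] by metis
  have cD: "icycle E D" and DZ: "D \<inter> Z = {}" and iZ: "ipath E Z s t" and big: "big E (nbrs E s D \<union> nbrs E t D)"
    using D(2) unfolding ears_def by auto
  have stZ: "s \<in> Z" "t \<in> Z" using iZ ipath_ends by metis+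
  \<comment> \<open>\<open>p\<close> and \<open>q\<close> become the apices; the two arcs of the
    cycle between them and \<open>Z\<close> are the three rows.\<close>
  have theta: ?triple if pq: "p \<in> D" "q \<in> D" "p \<noteq> q" "\<not> E p q"
    and zp: "\<And>z. z \<in> Z \<Longrightarrow> E p z \<longleftrightarrow> z = s" and zq: "\<And>z. z \<in> Z \<Longrightarrow> E q z \<longleftrightarrow> z = t"
    and zo: "\<And>z d. z \<in> Z \<Longrightarrow> d \<in> D \<Longrightarrow> d \<noteq> p \<Longrightarrow> d \<noteq> q \<Longrightarrow> \<not> E z d" for p q
  proof -
    obtain P a b where P: "D = insert p P" "p \<notin> P" "ipath E P a b" "a \<noteq> b" "\<And>r. r \<in> P \<Longrightarrow> E p r \<longleftrightarrow> r = a \<or> r = b"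
      by (rule icycle_at[OF E cD pq(1)]) blast
    have qP: "q \<in> P" using P(1) pq by auto
    have qab: "q \<noteq> a" "q \<noteq> b" using P(5)[OF qP] pq(4) by auto
    obtain P1 P2 c where c: "P = P1 \<union> P2" "P1 \<inter> P2 = {}" "ipath E P1 a c" "ipath E P2 q b"
      "\<And>u r. u \<in> P1 \<Longrightarrow> r \<in> P2 \<Longrightarrow> E u r \<longleftrightarrow> u = c \<and> r = q" by (rule ipath_cut[OF P(3) qP qab(1)]) blast
    obtain n P3 where n: "P2 = insert q P3" "q \<notin> P3" "ipath E P3 n b" "\<And>r. r \<in> P3 \<Longrightarrow> E q r \<longleftrightarrow> r = n"
      by (rule ipath_uncons[OF c(4) qab(2)]) blast
    have mem: "a \<in> P1" "c \<in> P1" "n \<in> P3" "b \<in> P3" using ipath_ends[OF c(3)] ipath_ends[OF n(3)] by auto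
    have inD: "u \<in> D" "u \<noteq> p" "u \<noteq> q" if "u \<in> P1 \<or> u \<in> P3" for u using that P(1,2) c(1,2) n(1,2) by auto
    have r: "rows E False False (triple P1 P3 Z) (triple a b s) (triple c n t)"
    proof (rule rows_triple[OF E c(3) ipath_rev[OF E n(3)] iZ])
      show "P1 \<inter> P3 = {}" using c(2) n(1) by auto
      show "P1 \<inter> Z = {}" "P3 \<inter> Z = {}" using inD DZ by blast+
      show "E u v \<longleftrightarrow> False \<and> u = a \<and> v = b \<or> False \<and> u = c \<and> v = n" if "u \<in> P1" "v \<in> P3" for u v
        using c(5)[of u v] n(1,2) that by auto
      show "E u v \<longleftrightarrow> False \<and> u = a \<and> v = s \<or> False \<and> u = c \<and> v = t" if "u \<in> P1" "v \<in> Z" for u v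
        using zo[of v u] inD[of u] that sym[of u v] by auto
      show "E u v \<longleftrightarrow> False \<and> u = b \<and> v = s \<or> False \<and> u = n \<and> v = t" if "u \<in> P3" "v \<in> Z" for u v
        using zo[of v u] inD[of u] that sym[of u v] by auto
    qed
    have ab: "a \<notin> P3" "b \<notin> P1" "c \<notin> P3" using c(2) n(1) mem by auto
    have "apex E (triple P1 P3 Z) (triple a b s) p"
      unfolding apex_def all3 using P(1,2) c(1) n(1) DZ pq(1) P(5) zp ab by auto
    moreover have "apex E (triple P1 P3 Z) (triple c n t) q"
    proof -
      have "E q u \<longleftrightarrow> u = c" if "u \<in> P1" for u using c(5)[of u q] that n(1) sym[of q u] by auto
      then show ?thesis unfolding apex_def all3 using c(2) n DZ pq(2) zq by auto
    qed
    moreover have "W = insert p (insert q (\<Union>i<3. triple P1 P3 Z i))" unfolding UN3 using D(1) P(1) c(1) n(1) by auto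
    ultimately show ?triple using r pq(3,4) by blast
  qed
  show ?thesis
  proof (cases "s = t")
    case True
    then have Z: "Z = {s}" using ipath_eqD[OF iZ] by simp
    have sD: "s \<notin> D" using stZ DZ by auto
    have fin: "finite (nbrs E s D)" using icycle_finite[OF cD] by (simp add: nbrs_def)
    show ?thesis
    proof (cases "3 \<le> card (nbrs E s D)")
      case True
      then have ?pyr using D(1) Z sD cD by (intro exI[of _ D] exI[of _ s]) auto
      then show ?thesis by blast
    next
      case False
      have "\<not> (\<exists>p\<in>nbrs E s D. \<exists>q\<in>nbrs E s D. \<exists>r\<in>nbrs E s D. p \<noteq> q \<and> p \<noteq> r \<and> q \<noteq> r)"
      proof
        assume "\<exists>p\<in>nbrs E s D. \<exists>q\<in>nbrs E s D. \<exists>r\<in>nbrs E s D. p \<noteq> q \<and> p \<noteq> r \<and> q \<noteq> r"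
        then obtain p q r where "{p, q, r} \<subseteq> nbrs E s D" "p \<noteq> q" "p \<noteq> r" "q \<noteq> r" by blast
        then have "card {p, q, r} = 3" "card {p, q, r} \<le> card (nbrs E s D)" using card_mono[OF fin, of "{p, q, r}"] by simp_all
        then show False using False by simp
      qed
      note no3 = this
      then have "\<exists>p\<in>nbrs E s D. \<exists>q\<in>nbrs E s D. p \<noteq> q \<and> \<not> E p q" using big unfolding \<open>s = t\<close> big_def by (simp, blast)
      then obtain p q where pq: "p \<in> nbrs E s D" "q \<in> nbrs E s D" "p \<noteq> q" "\<not> E p q" by blast
      have ps: "E s p" "E s q" "E p s" "E q s" using pq sym by auto
      have ?triple
      proof (rule theta[of p q])
        show "\<not> E z d" if "z \<in> Z" "d \<in> D" "d \<noteq> p" "d \<noteq> q" for z d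
        proof
          assume "E z d"
          then have "d \<in> nbrs E s D" using that Z by simp
          then show False using no3 pq(1-3) that by blast
        qed
      qed (use pq ps Z True in auto)
      then show ?thesis by blast
    qed
  next
    case st: False
    have nbg: "\<not> big E (nbrs E s D)" "\<not> big E (nbrs E t D)" using D(2) st unfolding ears_def by auto
    have ne: "nbrs E s D \<noteq> {}" "nbrs E t D \<noteq> {}" using big nbg by auto
    have disj: "nbrs E s D \<inter> nbrs E t D = {}" using D(3) st by blast
    have int: "\<not> E z d" if "z \<in> Z" "z \<noteq> s" "z \<noteq> t" "d \<in> D" for z d
      using D(2) st that unfolding ears_def nbrs_empty by blast
    have shape: "(\<exists>p. S = {p}) \<or> (\<exists>p p'. S = {p, p'} \<and> p \<noteq> p' \<and> E p p')" if nS: "\<not> big E S" "S \<noteq> {}" for S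
    proof -
      obtain p where p: "p \<in> S" using nS(2) by auto
      show ?thesis using not_big_at[OF nS(1) p] by metis
    qed
    have setD: "E z d \<longleftrightarrow> d \<in> S" if "nbrs E z D = S" "d \<in> D" for z d S
      using that(2) unfolding that(1)[symmetric] by simp
    have stampc: ?stamp if iZ: "ipath E Z s t" and st: "s \<noteq> t" and A: "nbrs E s D = {p}" and B: "nbrs E t D = {q, q'}" "q \<noteq> q'" "E q q'"
      and int: "\<And>z d. z \<in> Z \<Longrightarrow> z \<noteq> s \<Longrightarrow> z \<noteq> t \<Longrightarrow> d \<in> D \<Longrightarrow> \<not> E z d" and disj: "nbrs E s D \<inter> nbrs E t D = {}" for s t p q q'
    proof -
      have stZ: "s \<in> Z" "t \<in> Z" using iZ ipath_ends by metis+
      have pD: "p \<in> D" "q \<in> D" "q' \<in> D" using nbrs_subset[of E s D] nbrs_subset[of E t D] unfolding A B(1) by simp_all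
      have pq: "p \<noteq> q" "p \<noteq> q'" using disj A B(1) by auto
      obtain P a b where P: "D = insert p P" "p \<notin> P" "ipath E P a b" "a \<noteq> b" "\<And>r. r \<in> P \<Longrightarrow> E p r \<longleftrightarrow> r = a \<or> r = b"
        by (rule icycle_at[OF E cD pD(1)]) blast
      have qP: "q \<in> P" "q' \<in> P" using P(1) pD pq by auto
      \<comment> \<open>The rows have to start at the triangle \<open>q q' t\<close> and to end at
        the neighbours of the apex \<open>p\<close>; hence \<open>P1\<close> and \<open>Z\<close>
        are reversed.\<close>
      have fin: ?stamp if c: "P = P1 \<union> P2" "P1 \<inter> P2 = {}" "ipath E P1 a q" "ipath E P2 q' b"
        "\<And>u r. u \<in> P1 \<Longrightarrow> r \<in> P2 \<Longrightarrow> E u r \<longleftrightarrow> u = q \<and> r = q'" and B: "nbrs E t D = {q, q'}" for P1 P2 q q'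
      proof -
        have mem: "a \<in> P1" "q \<in> P1" "q' \<in> P2" "b \<in> P2" using ipath_ends[OF c(3)] ipath_ends[OF c(4)] by auto
        have inD: "u \<in> D" "u \<noteq> p" if "u \<in> P1 \<or> u \<in> P2" for u using that P(1,2) c(1) by auto
        have zd: "E d z \<longleftrightarrow> z = s \<and> d = p \<or> z = t \<and> (d = q \<or> d = q')" if "z \<in> Z" "d \<in> D" for z d
        proof -
          have "E z d \<longleftrightarrow> z = s \<and> d = p \<or> z = t \<and> (d = q \<or> d = q')"
            using int[OF that(1) _ _ that(2)] setD[OF A that(2)] setD[OF B that(2)] st by auto
          then show ?thesis using sym[of d z] by simp
        qed
        have qq: "q \<notin> P2" "q' \<notin> P1" "a \<notin> P2" "b \<notin> P1" using mem c(2) by auto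
        have r: "rows E True False (triple P1 P2 Z) (triple q q' t) (triple a b s)"
        proof (rule rows_triple[OF E ipath_rev[OF E c(3)] c(4) ipath_rev[OF E iZ] c(2)])
          show "P1 \<inter> Z = {}" "P2 \<inter> Z = {}" using inD DZ by blast+
          show "E u v \<longleftrightarrow> True \<and> u = q \<and> v = q' \<or> False \<and> u = a \<and> v = b" if "u \<in> P1" "v \<in> P2" for u v
            using c(5)[OF that] by simp
          show "E u v \<longleftrightarrow> True \<and> u = q \<and> v = t \<or> False \<and> u = a \<and> v = s" if "u \<in> P1" "v \<in> Z" for u v
            using zd[OF that(2) inD(1)] inD[of u] that qq by auto
          show "E u v \<longleftrightarrow> True \<and> u = q' \<and> v = t \<or> False \<and> u = b \<and> v = s" if "u \<in> P2" "v \<in> Z" for u v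
            using zd[OF that(2) inD(1)] inD[of u] that qq by auto
        qed
        have pz: "E p z \<longleftrightarrow> z = s" if "z \<in> Z" for z using zd[OF that pD(1)] inD(2)[of q] inD(2)[of q'] mem by auto
        have "apex E (triple P1 P2 Z) (triple a b s) p"
          unfolding apex_def all3 using P(2) c(1) DZ pD(1) P(5) pz qq by auto
        moreover have "W = insert p (\<Union>i<3. triple P1 P2 Z i)" unfolding UN3 using D(1) P(1) c(1) by auto
        ultimately show ?stamp using r by blast
      qed
      show ?stamp
        using ipath_cut_edge[OF E P(3) qP B(2,3)]
      proof (elim exE conjE disjE)
        fix P1 P2 assume c: "P = P1 \<union> P2" "P1 \<inter> P2 = {}" "ipath E P1 a q" "ipath E P2 q' b" "\<forall>u\<in>P1. \<forall>r\<in>P2. E u r \<longleftrightarrow> u = q \<and> r = q'"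
        show ?stamp by (rule fin[OF c(1-4) _ B(1)]) (use c(5) in blast)
      next
        fix P1 P2 assume c: "P = P1 \<union> P2" "P1 \<inter> P2 = {}" "ipath E P1 a q'" "ipath E P2 q b" "\<forall>u\<in>P1. \<forall>r\<in>P2. E u r \<longleftrightarrow> u = q' \<and> r = q"
        have "nbrs E t D = {q', q}" using B(1) by auto
        then show ?stamp by (intro fin[OF c(1-4) _ _]) (use c(5) in blast)
      qed
    qed
    have prismc: ?prism if A: "nbrs E s D = {p, p'}" "p \<noteq> p'" "E p p'" and B: "nbrs E t D = {q, q'}" "q \<noteq> q'" "E q q'" for p p' q q'
    proof -
      have pD: "p \<in> D" "p' \<in> D" "q \<in> D" "q' \<in> D" using nbrs_subset[of E s D] nbrs_subset[of E t D] unfolding A(1) B(1) by simp_all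
      have pq: "p \<noteq> q" "p \<noteq> q'" "p' \<noteq> q" "p' \<noteq> q'" using disj A B(1) by auto
      obtain P0 a0 b0 where P0: "D = insert p P0" "p \<notin> P0" "ipath E P0 a0 b0" "a0 \<noteq> b0" "\<And>r. r \<in> P0 \<Longrightarrow> E p r \<longleftrightarrow> r = a0 \<or> r = b0"
        by (rule icycle_at[OF E cD pD(1)]) blast
      have "p' = a0 \<or> p' = b0" using P0 pD A by auto
      then obtain P b where P: "D = insert p P" "p \<notin> P" "ipath E P p' b" "p' \<noteq> b" "\<And>r. r \<in> P \<Longrightarrow> E p r \<longleftrightarrow> r = p' \<or> r = b"
        using P0 ipath_rev[OF E P0(3)] that by metis
      have qP: "q \<in> P" "q' \<in> P" using P(1) pD pq by auto
      \<comment> \<open>The vertex \<open>p\<close> is put in front of the reversed arc from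
        \<open>b\<close> to \<open>q'\<close>. Then the rows lead from the triangle
        \<open>p' p s\<close> to the triangle \<open>q q' t\<close>.\<close>
      have fin: ?prism if c: "P = P1 \<union> P2" "P1 \<inter> P2 = {}" "ipath E P1 p' q" "ipath E P2 q' b"
        "\<And>u r. u \<in> P1 \<Longrightarrow> r \<in> P2 \<Longrightarrow> E u r \<longleftrightarrow> u = q \<and> r = q'" and B: "nbrs E t D = {q, q'}" and pq: "p \<noteq> q" "p \<noteq> q'" "p' \<noteq> q" "p' \<noteq> q'" for P1 P2 q q'
      proof -
        have mem: "p' \<in> P1" "q \<in> P1" "q' \<in> P2" "b \<in> P2" using ipath_ends[OF c(3)] ipath_ends[OF c(4)] by auto
        have inD: "u \<in> D" "u \<noteq> p" if "u \<in> P1 \<or> u \<in> P2" for u using that P(1,2) c(1) by auto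
        have zd: "E d z \<longleftrightarrow> z = s \<and> (d = p \<or> d = p') \<or> z = t \<and> (d = q \<or> d = q')" if "z \<in> Z" "d \<in> D" for z d
        proof -
          have "E z d \<longleftrightarrow> z = s \<and> (d = p \<or> d = p') \<or> z = t \<and> (d = q \<or> d = q')"
            using int[OF that(1) _ _ that(2)] setD[OF A(1) that(2)] setD[OF B that(2)] st by auto
          then show ?thesis using sym[of d z] by simp
        qed
        have qq: "q \<notin> P2" "q' \<notin> P1" "p' \<notin> P2" "b \<notin> P1" using mem c(2) by auto
        have pP: "p \<notin> P1" "p \<notin> P2" using P(2) c(1) by auto
        have ipp: "ipath E (insert p P2) p q'"
          by (rule ipath.step[OF ipath_rev[OF E c(4)] pP(2)]) (use P(5) c(1) qq in auto)
        have r: "rows E True True (triple P1 (insert p P2) Z) (triple p' p s) (triple q q' t)"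
        proof (rule rows_triple[OF E c(3) ipp iZ])
          show "P1 \<inter> insert p P2 = {}" using c(2) pP by auto
          show "P1 \<inter> Z = {}" "insert p P2 \<inter> Z = {}" using inD DZ pD by blast+
          show "E u v \<longleftrightarrow> True \<and> u = p' \<and> v = p \<or> True \<and> u = q \<and> v = q'" if "u \<in> P1" "v \<in> insert p P2" for u v
          proof (cases "v = p")
            case True then show ?thesis using P(5)[of u] c(1) that qq pq sym[of u p] by auto
          next
            case False then show ?thesis using c(5)[of u v] that by auto
          qed
          show "E u v \<longleftrightarrow> True \<and> u = p' \<and> v = s \<or> True \<and> u = q \<and> v = t" if "u \<in> P1" "v \<in> Z" for u v
            using zd[OF that(2) inD(1)] inD[of u] that qq by auto
          show "E u v \<longleftrightarrow> True \<and> u = p \<and> v = s \<or> True \<and> u = q' \<and> v = t" if "u \<in> insert p P2" "v \<in> Z" for u v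
          proof (cases "u = p")
            case True then show ?thesis using zd[OF that(2) pD(1)] pq A(2) by auto
          next
            case False
            then have "u \<in> P2" using that by simp
            then show ?thesis using zd[OF that(2) inD(1)] inD[of u] qq by auto
          qed
        qed
        have "\<forall>i<3. triple p' p s i \<noteq> triple q q' t i" unfolding all3 using pq st by simp
        moreover have "W = (\<Union>i<3. triple P1 (insert p P2) Z i)" unfolding UN3 using D(1) P(1) c(1) by auto
        ultimately show ?prism using r by blast
      qed
      show ?prism
        using ipath_cut_edge[OF E P(3) qP B(2,3)]
      proof (elim exE conjE disjE)
        fix P1 P2 assume c: "P = P1 \<union> P2" "P1 \<inter> P2 = {}" "ipath E P1 p' q" "ipath E P2 q' b" "\<forall>u\<in>P1. \<forall>r\<in>P2. E u r \<longleftrightarrow> u = q \<and> r = q'"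
        show ?prism by (rule fin[OF c(1-4) _ B(1) pq]) (use c(5) in blast)
      next
        fix P1 P2 assume c: "P = P1 \<union> P2" "P1 \<inter> P2 = {}" "ipath E P1 p' q'" "ipath E P2 q b" "\<forall>u\<in>P1. \<forall>r\<in>P2. E u r \<longleftrightarrow> u = q' \<and> r = q"
        have "nbrs E t D = {q', q}" using B(1) by auto
        then show ?prism by (intro fin[OF c(1-4) _ _ pq(2,1,4,3)]) (use c(5) in blast)
      qed
    qed
    have singles: ?triple if A: "nbrs E s D = {p}" and B: "nbrs E t D = {q}" for p q
    proof -
      have "big E {p, q}" using big A B by (simp add: insert_commute)
      then have pq: "p \<noteq> q" "\<not> E p q" by (simp_all add: big_pair[OF E])
      have pD: "p \<in> D" "q \<in> D" using nbrs_subset[of E s D] nbrs_subset[of E t D] unfolding A B by simp_all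
      have zd: "E z d \<longleftrightarrow> z = s \<and> d = p \<or> z = t \<and> d = q" if "z \<in> Z" "d \<in> D" for z d
        using int[OF that(1) _ _ that(2)] setD[OF A that(2)] setD[OF B that(2)] st by auto
      show ?triple
      proof (rule theta[OF pD pq])
        show "E p z \<longleftrightarrow> z = s" if "z \<in> Z" for z using zd[OF that pD(1)] pq(1) sym[of p z] by auto
        show "E q z \<longleftrightarrow> z = t" if "z \<in> Z" for z using zd[OF that pD(2)] pq(1) sym[of q z] by auto
        show "\<not> E z d" if "z \<in> Z" "d \<in> D" "d \<noteq> p" "d \<noteq> q" for z d using zd[OF that(1,2)] that(3,4) by auto
      qed
    qed
    show ?thesis using shape[OF nbg(1) ne(1)] shape[OF nbg(2) ne(2)]
    proof (elim disjE exE conjE)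
      fix p q assume "nbrs E s D = {p}" "nbrs E t D = {q}"
      then have ?triple by (rule singles)
      then show ?thesis by (rule disjI2[OF disjI1])
    next
      fix p q q' assume "nbrs E s D = {p}" "nbrs E t D = {q, q'}" "q \<noteq> q'" "E q q'"
      then have ?stamp by (rule stampc[OF iZ st _ _ _ _ int disj])
      then show ?thesis by blast
    next
      fix p p' q assume h: "nbrs E s D = {p, p'}" "p \<noteq> p'" "E p p'" "nbrs E t D = {q}"
      have "nbrs E t D \<inter> nbrs E s D = {}" using disj by auto
      then have ?stamp by (intro stampc[OF ipath_rev[OF E iZ] st[symmetric] h(4) h(1-3)] int)
      then show ?thesis by blast
    next
      fix p p' q q' assume "nbrs E s D = {p, p'}" "p \<noteq> p'" "E p p'" "nbrs E t D = {q, q'}" "q \<noteq> q'" "E q q'"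
      then have ?prism by (rule prismc)
      then show ?thesis by blast
    qed
  qed
qed

section \<open>Trihedron, stamp and prism as three rows given by lists\<close>

definition row_edges :: "bool \<Rightarrow> bool \<Rightarrow> (nat \<Rightarrow> 'a list) \<Rightarrow> 'a \<Rightarrow> 'a \<Rightarrow> 'a set set" where
  "row_edges \<alpha> \<beta> q x y = (\<Union>i<3. path_edges (q i))
     \<union> (if \<alpha> then triangle_edges (\<lambda>i. hd (q i)) else {{x, hd (q i)} | i. i < 3})
     \<union> (if \<beta> then triangle_edges (\<lambda>i. last (q i)) else {{y, last (q i)} | i. i < 3})"

definition row_verts :: "bool \<Rightarrow> bool \<Rightarrow> (nat \<Rightarrow> 'a list) \<Rightarrow> 'a \<Rightarrow> 'a \<Rightarrow> 'a set" where
  "row_verts \<alpha> \<beta> q x y = (\<Union>i<3. set (q i)) \<union> (if \<alpha> then {} else {x}) \<union> (if \<beta> then {} else {y})"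

text \<open>Only distinctness is recorded here; the adjacency is treated separately in
  \<open>row_adjacency\<close>, so that one set of lemmas serves all three kinds of graphs.\<close>

definition row_lists :: "bool \<Rightarrow> bool \<Rightarrow> (nat \<Rightarrow> 'a list) \<Rightarrow> 'a \<Rightarrow> 'a \<Rightarrow> bool" where
  "row_lists \<alpha> \<beta> q x y \<longleftrightarrow> (\<forall>i<3. q i \<noteq> [] \<and> distinct (q i)) \<and>
     (\<forall>i<3. \<forall>j<3. i \<noteq> j \<longrightarrow> set (q i) \<inter> set (q j) = {}) \<and>
     (\<not> \<alpha> \<longrightarrow> (\<forall>i<3. x \<notin> set (q i))) \<and> (\<not> \<beta> \<longrightarrow> (\<forall>i<3. y \<notin> set (q i))) \<and> (\<not> \<alpha> \<and> \<not> \<beta> \<longrightarrow> x \<noteq> y)"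

lemma row_edges_iff:
  "e \<in> row_edges \<alpha> \<beta> q x y \<longleftrightarrow> (\<exists>i<3. e \<in> path_edges (q i))
     \<or> \<alpha> \<and> (\<exists>i<3. \<exists>j<3. i \<noteq> j \<and> e = {hd (q i), hd (q j)}) \<or> \<not> \<alpha> \<and> (\<exists>i<3. e = {x, hd (q i)})
     \<or> \<beta> \<and> (\<exists>i<3. \<exists>j<3. i \<noteq> j \<and> e = {last (q i), last (q j)}) \<or> \<not> \<beta> \<and> (\<exists>i<3. e = {y, last (q i)})"
  unfolding row_edges_def triangle_edges_def by auto

lemma row_lists_facts:
  assumes "row_lists \<alpha> \<beta> q x y" "i < 3"
  shows "q i \<noteq> []" "distinct (q i)" "hd (q i) \<in> set (q i)" "last (q i) \<in> set (q i)"
    "j < 3 \<Longrightarrow> u \<in> set (q i) \<Longrightarrow> u \<in> set (q j) \<Longrightarrow> i = j"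
    "\<not> \<alpha> \<Longrightarrow> x \<notin> set (q i)" "\<not> \<beta> \<Longrightarrow> y \<notin> set (q i)" "\<not> \<alpha> \<Longrightarrow> \<not> \<beta> \<Longrightarrow> x \<noteq> y"
proof -
  have "q i \<noteq> []" using assms unfolding row_lists_def by blast
  then show "q i \<noteq> []" "hd (q i) \<in> set (q i)" "last (q i) \<in> set (q i)" by auto
qed (use assms in \<open>auto simp: row_lists_def\<close>)

text \<open>The edges of the triangles join different rows, and those at an apex leave the rows, so
  no row gets a chord.\<close>

lemma row_edges_within:
  assumes r: "row_lists \<alpha> \<beta> q x y" and i: "i < 3" and u: "u \<in> set (q i)" "v \<in> set (q i)"
  shows "{u, v} \<in> row_edges \<alpha> \<beta> q x y \<longleftrightarrow> {u, v} \<in> path_edges (q i)"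
proof
  note f = row_lists_facts[OF r]
  assume "{u, v} \<in> row_edges \<alpha> \<beta> q x y"
  then consider k where "k < 3" "{u, v} \<in> path_edges (q k)"
    | k l where "k < 3" "l < 3" "k \<noteq> l" "{u, v} = {hd (q k), hd (q l)}" | k where "\<not> \<alpha>" "k < 3" "{u, v} = {x, hd (q k)}"
    | k l where "k < 3" "l < 3" "k \<noteq> l" "{u, v} = {last (q k), last (q l)}" | k where "\<not> \<beta>" "k < 3" "{u, v} = {y, last (q k)}"
    unfolding row_edges_iff by blast
  then show "{u, v} \<in> path_edges (q i)"
  proof cases
    case 1
    then have "u \<in> set (q k)" using path_edges_in by metis
    then have "i = k" using f(5)[OF i 1(1) u(1)] by simp
    then show ?thesis using 1 by simp
  next
    case 2
    then have "hd (q k) \<in> set (q i)" "hd (q l) \<in> set (q i)" using u by (auto simp: doubleton_eq_iff)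
    then show ?thesis using f(3)[OF 2(1)] f(3)[OF 2(2)] f(5)[OF i 2(1)] f(5)[OF i 2(2)] 2(3) by metis
  next
    case 3
    then have "x \<in> set (q i)" using u by (auto simp: doubleton_eq_iff)
    then show ?thesis using f(6)[OF i 3(1)] by simp
  next
    case 4
    then have "last (q k) \<in> set (q i)" "last (q l) \<in> set (q i)" using u by (auto simp: doubleton_eq_iff)
    then show ?thesis using f(4)[OF 4(1)] f(4)[OF 4(2)] f(5)[OF i 4(1)] f(5)[OF i 4(2)] 4(3) by metis
  next
    case 5
    then have "y \<in> set (q i)" using u by (auto simp: doubleton_eq_iff)
    then show ?thesis using f(7)[OF i 5(1)] by simp
  qed
next
  assume "{u, v} \<in> path_edges (q i)"
  then show "{u, v} \<in> row_edges \<alpha> \<beta> q x y" unfolding row_edges_iff using i by blast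
qed

lemma row_edges_cross:
  assumes r: "row_lists \<alpha> \<beta> q x y" and i: "i < 3" "j < 3" "i \<noteq> j" and u: "u \<in> set (q i)" "v \<in> set (q j)"
  shows "{u, v} \<in> row_edges \<alpha> \<beta> q x y \<longleftrightarrow> \<alpha> \<and> u = hd (q i) \<and> v = hd (q j) \<or> \<beta> \<and> u = last (q i) \<and> v = last (q j)"
proof
  note f = row_lists_facts[OF r]
  assume "{u, v} \<in> row_edges \<alpha> \<beta> q x y"
  then consider k where "k < 3" "{u, v} \<in> path_edges (q k)"
    | k l where "\<alpha>" "k < 3" "l < 3" "k \<noteq> l" "{u, v} = {hd (q k), hd (q l)}" | k where "\<not> \<alpha>" "k < 3" "{u, v} = {x, hd (q k)}"
    | k l where "\<beta>" "k < 3" "l < 3" "k \<noteq> l" "{u, v} = {last (q k), last (q l)}" | k where "\<not> \<beta>" "k < 3" "{u, v} = {y, last (q k)}"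
    unfolding row_edges_iff by blast
  then show "\<alpha> \<and> u = hd (q i) \<and> v = hd (q j) \<or> \<beta> \<and> u = last (q i) \<and> v = last (q j)"
  proof cases
    case 1
    then have "u \<in> set (q k)" "v \<in> set (q k)" using path_edges_in by metis+
    then have "i = k" "j = k" using f(5)[OF i(1) 1(1) u(1)] f(5)[OF i(2) 1(1) u(2)] by simp_all
    then show ?thesis using i by simp
  next
    case 2
    then consider "u = hd (q k)" "v = hd (q l)" | "u = hd (q l)" "v = hd (q k)" by (auto simp: doubleton_eq_iff)
    then show ?thesis
    proof cases
      case a: 1
      have "i = k" "j = l" using f(5)[OF i(1) 2(2) u(1)] f(5)[OF i(2) 2(3) u(2)] f(3)[OF 2(2)] f(3)[OF 2(3)] a by simp_all
      then show ?thesis using a 2(1) by simp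
    next
      case a: 2
      have "i = l" "j = k" using f(5)[OF i(1) 2(3) u(1)] f(5)[OF i(2) 2(2) u(2)] f(3)[OF 2(2)] f(3)[OF 2(3)] a by simp_all
      then show ?thesis using a 2(1) by simp
    qed
  next
    case 3
    then have "x \<in> set (q i) \<or> x \<in> set (q j)" using u by (auto simp: doubleton_eq_iff)
    then show ?thesis using f(6)[OF i(1) 3(1)] f(6)[OF i(2) 3(1)] by simp
  next
    case 4
    then consider "u = last (q k)" "v = last (q l)" | "u = last (q l)" "v = last (q k)" by (auto simp: doubleton_eq_iff)
    then show ?thesis
    proof cases
      case a: 1
      have "i = k" "j = l" using f(5)[OF i(1) 4(2) u(1)] f(5)[OF i(2) 4(3) u(2)] f(4)[OF 4(2)] f(4)[OF 4(3)] a by simp_all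
      then show ?thesis using a 4(1) by simp
    next
      case a: 2
      have "i = l" "j = k" using f(5)[OF i(1) 4(3) u(1)] f(5)[OF i(2) 4(2) u(2)] f(4)[OF 4(2)] f(4)[OF 4(3)] a by simp_all
      then show ?thesis using a 4(1) by simp
    qed
  next
    case 5
    then have "y \<in> set (q i) \<or> y \<in> set (q j)" using u by (auto simp: doubleton_eq_iff)
    then show ?thesis using f(7)[OF i(1) 5(1)] f(7)[OF i(2) 5(1)] by simp
  qed
next
  assume "\<alpha> \<and> u = hd (q i) \<and> v = hd (q j) \<or> \<beta> \<and> u = last (q i) \<and> v = last (q j)"
  then show "{u, v} \<in> row_edges \<alpha> \<beta> q x y"
  proof
    assume "\<alpha> \<and> u = hd (q i) \<and> v = hd (q j)"
    then have "\<alpha> \<and> (\<exists>i<3. \<exists>j<3. i \<noteq> j \<and> {u, v} = {hd (q i), hd (q j)})" using i by metis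
    then show ?thesis unfolding row_edges_iff by simp
  next
    assume "\<beta> \<and> u = last (q i) \<and> v = last (q j)"
    then have "\<beta> \<and> (\<exists>i<3. \<exists>j<3. i \<noteq> j \<and> {u, v} = {last (q i), last (q j)})" using i by metis
    then show ?thesis unfolding row_edges_iff by simp
  qed
qed

lemma row_edges_apex1:
  assumes r: "row_lists False \<beta> q x y" and i: "i < 3" and u: "u \<in> set (q i)"
  shows "{x, u} \<in> row_edges False \<beta> q x y \<longleftrightarrow> u = hd (q i)"
proof
  note f = row_lists_facts[OF r]
  assume "{x, u} \<in> row_edges False \<beta> q x y"
  then consider k where "k < 3" "{x, u} \<in> path_edges (q k)" | k where "k < 3" "{x, u} = {x, hd (q k)}"
    | k l where "k < 3" "l < 3" "{x, u} = {last (q k), last (q l)}" | k where "\<not> \<beta>" "k < 3" "{x, u} = {y, last (q k)}"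
    unfolding row_edges_iff by blast
  then show "u = hd (q i)"
  proof cases
    case 1 then show ?thesis using path_edges_in[of x u] f(6)[OF 1(1)] by blast
  next
    case 2
    then have "u = hd (q k)" using f(6)[OF i] u by (auto simp: doubleton_eq_iff)
    then show ?thesis using f(3)[OF 2(1)] f(5)[OF i 2(1) u] by simp
  next
    case 3 then show ?thesis using f(4)[OF 3(1)] f(4)[OF 3(2)] f(6)[OF 3(1)] f(6)[OF 3(2)] by (auto simp: doubleton_eq_iff)
  next
    case 4 then show ?thesis using f(4)[OF 4(2)] f(6)[OF 4(2)] f(8)[OF i] by (auto simp: doubleton_eq_iff)
  qed
next
  assume "u = hd (q i)"
  then show "{x, u} \<in> row_edges False \<beta> q x y" unfolding row_edges_iff using i by blast
qed

lemma row_edges_apex2: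
  assumes r: "row_lists \<alpha> False q x y" and i: "i < 3" and u: "u \<in> set (q i)"
  shows "{y, u} \<in> row_edges \<alpha> False q x y \<longleftrightarrow> u = last (q i)"
proof
  note f = row_lists_facts[OF r]
  assume "{y, u} \<in> row_edges \<alpha> False q x y"
  then consider k where "k < 3" "{y, u} \<in> path_edges (q k)" | k where "k < 3" "{y, u} = {y, last (q k)}"
    | k l where "k < 3" "l < 3" "{y, u} = {hd (q k), hd (q l)}" | k where "\<not> \<alpha>" "k < 3" "{y, u} = {x, hd (q k)}"
    unfolding row_edges_iff by blast
  then show "u = last (q i)"
  proof cases
    case 1 then show ?thesis using path_edges_in[of y u] f(7)[OF 1(1)] by blast
  next
    case 2
    then have "u = last (q k)" using f(7)[OF i] u by (auto simp: doubleton_eq_iff)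
    then show ?thesis using f(4)[OF 2(1)] f(5)[OF i 2(1) u] by simp
  next
    case 3 then show ?thesis using f(3)[OF 3(1)] f(3)[OF 3(2)] f(7)[OF 3(1)] f(7)[OF 3(2)] by (auto simp: doubleton_eq_iff)
  next
    case 4 then show ?thesis using f(3)[OF 4(2)] f(7)[OF 4(2)] f(8)[OF i] by (auto simp: doubleton_eq_iff)
  qed
next
  assume "u = last (q i)"
  then show "{y, u} \<in> row_edges \<alpha> False q x y" unfolding row_edges_iff using i by blast
qed

lemma row_edges_apices:
  assumes r: "row_lists \<alpha> \<beta> q x y"
  shows "\<not> \<alpha> \<Longrightarrow> {x} \<notin> row_edges \<alpha> \<beta> q x y" "\<not> \<beta> \<Longrightarrow> {y} \<notin> row_edges \<alpha> \<beta> q x y"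
    "\<not> \<alpha> \<Longrightarrow> \<not> \<beta> \<Longrightarrow> {x, y} \<notin> row_edges \<alpha> \<beta> q x y"
proof -
  note f = row_lists_facts[OF r]
  have pe: "{p, p'} \<notin> path_edges (q k)" if "p \<notin> set (q k)" for p p' k using path_edges_in that by metis
  show "{x} \<notin> row_edges \<alpha> \<beta> q x y" if a: "\<not> \<alpha>"
    unfolding row_edges_iff using pe[of x _ x] f(3,4) f(6)[OF _ a] f(8)[OF _ a] a by (auto simp: doubleton_eq_iff)
  show "{y} \<notin> row_edges \<alpha> \<beta> q x y" if b: "\<not> \<beta>"
    unfolding row_edges_iff using pe[of y _ y] f(3,4) f(7)[OF _ b] f(8)[OF _ _ b] b by (auto simp: doubleton_eq_iff)
  show "{x, y} \<notin> row_edges \<alpha> \<beta> q x y" if "\<not> \<alpha>" "\<not> \<beta>"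
    unfolding row_edges_iff using pe[of x _ y] f(3,4) f(6)[OF _ that(1)] f(7)[OF _ that(2)] that by (auto simp: doubleton_eq_iff) metis+
qed

lemma row_edges_sub:
  assumes r: "row_lists \<alpha> \<beta> q x y" and e: "e \<in> row_edges \<alpha> \<beta> q x y"
  shows "\<exists>u\<in>row_verts \<alpha> \<beta> q x y. \<exists>v\<in>row_verts \<alpha> \<beta> q x y. e = {u, v}"
proof -
  note f = row_lists_facts[OF r]
  have in1: "u \<in> row_verts \<alpha> \<beta> q x y" if "i < 3" "u \<in> set (q i)" for i u using that unfolding row_verts_def by auto
  have xy: "\<not> \<alpha> \<Longrightarrow> x \<in> row_verts \<alpha> \<beta> q x y" "\<not> \<beta> \<Longrightarrow> y \<in> row_verts \<alpha> \<beta> q x y" unfolding row_verts_def by auto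
  consider k where "k < 3" "e \<in> path_edges (q k)"
    | k l where "k < 3" "l < 3" "e = {hd (q k), hd (q l)}" | k where "\<not> \<alpha>" "k < 3" "e = {x, hd (q k)}"
    | k l where "k < 3" "l < 3" "e = {last (q k), last (q l)}" | k where "\<not> \<beta>" "k < 3" "e = {y, last (q k)}"
    using e unfolding row_edges_iff by blast
  then show ?thesis
  proof cases
    case 1 then show ?thesis using path_edges_sub[OF 1(2)] in1 by blast
  next
    case 2 then show ?thesis using in1 f(3) by blast
  next
    case 3 then show ?thesis using in1 f(3) xy by blast
  next
    case 4 then show ?thesis using in1 f(4) by blast
  next
    case 5 then show ?thesis using in1 f(4) xy by blast
  qed
qed

text \<open>Translates the edge set into \<open>rows\<close> and \<open>apex\<close> for all values
  of the flags at once. Every pair of vertices lies in one row, in two rows, or contains an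
  apex.\<close>

lemma row_adjacency:
  assumes E: "graph_rel E" and r: "row_lists \<alpha> \<beta> q x y"
  shows "(\<forall>u\<in>row_verts \<alpha> \<beta> q x y. \<forall>v\<in>row_verts \<alpha> \<beta> q x y. E u v \<longleftrightarrow> {u, v} \<in> row_edges \<alpha> \<beta> q x y) \<longleftrightarrow>
    (\<forall>i<3. path_list E (q i)) \<and> rows E \<alpha> \<beta> (\<lambda>i. set (q i)) (\<lambda>i. hd (q i)) (\<lambda>i. last (q i)) \<and>
    (\<not> \<alpha> \<longrightarrow> apex E (\<lambda>i. set (q i)) (\<lambda>i. hd (q i)) x) \<and> (\<not> \<beta> \<longrightarrow> apex E (\<lambda>i. set (q i)) (\<lambda>i. last (q i)) y) \<and>
    (\<not> \<alpha> \<and> \<not> \<beta> \<longrightarrow> \<not> E x y)" (is "?L \<longleftrightarrow> ?R")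
proof
  note f = row_lists_facts[OF r]
  assume L: ?L
  have in1: "u \<in> row_verts \<alpha> \<beta> q x y" if "i < 3" "u \<in> set (q i)" for i u using that unfolding row_verts_def by auto
  have xy: "\<not> \<alpha> \<Longrightarrow> x \<in> row_verts \<alpha> \<beta> q x y" "\<not> \<beta> \<Longrightarrow> y \<in> row_verts \<alpha> \<beta> q x y" unfolding row_verts_def by auto
  have pl: "path_list E (q i)" if "i < 3" for i
    unfolding path_list_def using f(1,2)[OF that] L in1[OF that] row_edges_within[OF r that] by auto
  moreover have "rows E \<alpha> \<beta> (\<lambda>i. set (q i)) (\<lambda>i. hd (q i)) (\<lambda>i. last (q i))"
    unfolding rows_def
  proof (intro conjI allI impI ballI)
    show "ipath E (set (q i)) (hd (q i)) (last (q i))" if "i < 3" for i using path_list_ipath[OF E pl[OF that]] .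
    show "set (q i) \<inter> set (q j) = {}" if "i < 3" "j < 3" "i \<noteq> j" for i j using f(5)[OF that(1,2)] that(3) by auto
    show "E u v \<longleftrightarrow> \<alpha> \<and> u = hd (q i) \<and> v = hd (q j) \<or> \<beta> \<and> u = last (q i) \<and> v = last (q j)"
      if "i < 3" "j < 3" "i \<noteq> j" "u \<in> set (q i)" "v \<in> set (q j)" for i j u v
      using row_edges_cross[OF r that] L in1[OF that(1,4)] in1[OF that(2,5)] by simp
  qed
  moreover have "apex E (\<lambda>i. set (q i)) (\<lambda>i. hd (q i)) x" if "\<not> \<alpha>"
    unfolding apex_def using f(6)[OF _ that] row_edges_apex1[of \<beta> q x y] r L xy(1)[OF that] in1 that by simp
  moreover have "apex E (\<lambda>i. set (q i)) (\<lambda>i. last (q i)) y" if "\<not> \<beta>"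
    unfolding apex_def using f(7)[OF _ that] row_edges_apex2[of \<alpha> q x y] r L xy(2)[OF that] in1 that by simp
  moreover have "\<not> E x y" if "\<not> \<alpha>" "\<not> \<beta>" using row_edges_apices(3)[OF r that] L xy(1)[OF that(1)] xy(2)[OF that(2)] by simp
  ultimately show ?R by blast
next
  note f = row_lists_facts[OF r]
  note sym = graph_rel_sym[OF E]
  assume R: ?R
  then have pl: "\<And>i. i < 3 \<Longrightarrow> path_list E (q i)" and rw: "rows E \<alpha> \<beta> (\<lambda>i. set (q i)) (\<lambda>i. hd (q i)) (\<lambda>i. last (q i))"
    and a1: "\<And>i u. \<not> \<alpha> \<Longrightarrow> i < 3 \<Longrightarrow> u \<in> set (q i) \<Longrightarrow> E x u \<longleftrightarrow> u = hd (q i)"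
    and a2: "\<And>i u. \<not> \<beta> \<Longrightarrow> i < 3 \<Longrightarrow> u \<in> set (q i) \<Longrightarrow> E y u \<longleftrightarrow> u = last (q i)" and nxy: "\<not> \<alpha> \<Longrightarrow> \<not> \<beta> \<Longrightarrow> \<not> E x y"
    unfolding apex_def by auto
  let ?RE = "row_edges \<alpha> \<beta> q x y"
  have e1: "E x u \<longleftrightarrow> {x, u} \<in> ?RE" if "\<not> \<alpha>" "i < 3" "u \<in> set (q i)" for i u
    using a1[OF that] row_edges_apex1[of \<beta> q x y i u] r that by simp
  have e2: "E y u \<longleftrightarrow> {y, u} \<in> ?RE" if "\<not> \<beta>" "i < 3" "u \<in> set (q i)" for i u
    using a2[OF that] row_edges_apex2[of \<alpha> q x y i u] r that by simp
  have e3: "E u v \<longleftrightarrow> {u, v} \<in> ?RE" if "i < 3" "u \<in> set (q i)" "j < 3" "v \<in> set (q j)" for i j u v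
  proof (cases "i = j")
    case True
    then show ?thesis using row_edges_within[OF r that(1,2)] that pl[OF that(1)] unfolding path_list_def by auto
  next
    case False
    then show ?thesis using row_edges_cross[OF r that(1,3) False that(2,4)] rowsD(5)[OF rw that(1,3) False that(2,4)] by simp
  qed
  show ?L
  proof (intro ballI)
    fix u v assume u: "u \<in> row_verts \<alpha> \<beta> q x y" and v: "v \<in> row_verts \<alpha> \<beta> q x y"
    have split: "(\<exists>i<3. z \<in> set (q i)) \<or> (\<not> \<alpha> \<and> z = x) \<or> (\<not> \<beta> \<and> z = y)" if "z \<in> row_verts \<alpha> \<beta> q x y" for z
      using that unfolding row_verts_def by (auto split: if_splits)
    consider i j where "i < 3" "u \<in> set (q i)" "j < 3" "v \<in> set (q j)"
      | i where "i < 3" "u \<in> set (q i)" "\<not> \<alpha>" "v = x" | i where "i < 3" "u \<in> set (q i)" "\<not> \<beta>" "v = y"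
      | j where "\<not> \<alpha>" "u = x" "j < 3" "v \<in> set (q j)" | j where "\<not> \<beta>" "u = y" "j < 3" "v \<in> set (q j)"
      | "\<not> \<alpha>" "u = x" "v = x" | "\<not> \<beta>" "u = y" "v = y" | "\<not> \<alpha>" "\<not> \<beta>" "u = x" "v = y" | "\<not> \<alpha>" "\<not> \<beta>" "u = y" "v = x"
      using split[OF u] split[OF v] by blast
    then show "E u v \<longleftrightarrow> {u, v} \<in> ?RE"
    proof cases
      case 1 then show ?thesis by (rule e3)
    next
      case 2 then show ?thesis using e1[OF 2(3,1,2)] sym[of u v] by (simp add: insert_commute)
    next
      case 3 then show ?thesis using e2[OF 3(3,1,2)] sym[of u v] by (simp add: insert_commute)
    next
      case 4 then show ?thesis using e1[OF 4(1,3,4)] by simp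
    next
      case 5 then show ?thesis using e2[OF 5(1,3,4)] by simp
    next
      case 6 then show ?thesis using row_edges_apices(1)[OF r] graph_rel_irrefl[OF E] by simp
    next
      case 7 then show ?thesis using row_edges_apices(2)[OF r] graph_rel_irrefl[OF E] by simp
    next
      case 8 then show ?thesis using row_edges_apices(3)[OF r] nxy by simp
    next
      case 9 then show ?thesis using row_edges_apices(3)[OF r] nxy sym[of x y] by (simp add: insert_commute)
    qed
  qed
qed

lemma induced_rows_iff:
  assumes G: "simple_graph G" and W: "W \<subseteq> verts G" and r: "row_lists \<alpha> \<beta> q x y"
  shows "induced G W = Graph (row_verts \<alpha> \<beta> q x y) (row_edges \<alpha> \<beta> q x y) \<longleftrightarrow> W = row_verts \<alpha> \<beta> q x y \<and>
    (\<forall>i<3. path_list (adjacent G) (q i)) \<and> rows (adjacent G) \<alpha> \<beta> (\<lambda>i. set (q i)) (\<lambda>i. hd (q i)) (\<lambda>i. last (q i)) \<and>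
    (\<not> \<alpha> \<longrightarrow> apex (adjacent G) (\<lambda>i. set (q i)) (\<lambda>i. hd (q i)) x) \<and>
    (\<not> \<beta> \<longrightarrow> apex (adjacent G) (\<lambda>i. set (q i)) (\<lambda>i. last (q i)) y) \<and> (\<not> \<alpha> \<and> \<not> \<beta> \<longrightarrow> \<not> adjacent G x y)"
  using induced_eq_iff[OF G W row_edges_sub[OF r], of "row_edges \<alpha> \<beta> q x y"] row_adjacency[OF simple_graph_rel[OF G] r] by auto

text \<open>The rows are the three paths without their common ends; they are nonempty because the
  paths have length at least 2.\<close>

lemma trihedron_iff:
  fixes H :: "'a graph"
  shows
  "trihedron H \<longleftrightarrow> (\<exists>x y q. row_lists False False q x y \<and> H = Graph (row_verts False False q x y) (row_edges False False q x y))"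
proof
  assume "trihedron H"
  then obtain x y and P :: "nat \<Rightarrow> 'a list" where xy: "x \<noteq> y" and P: "\<And>i. i < 3 \<Longrightarrow> path_between x (P i) y \<and> 2 \<le> length (P i) - 1"
    and dj: "\<And>i j. i < 3 \<Longrightarrow> j < 3 \<Longrightarrow> i \<noteq> j \<Longrightarrow> (set (P i) - {x, y}) \<inter> set (P j) = {}"
    and H: "H = Graph (\<Union>i<3. set (P i)) (\<Union>i<3. path_edges (P i))"
    unfolding trihedron_def by blast
  define q where "q i = butlast (tl (P i))" for i :: nat
  have Pq: "P i = x # q i @ [y] \<and> q i \<noteq> []" if "i < 3" for i
  proof -
    have p: "P i \<noteq> []" "hd (P i) = x" "last (P i) = y" "3 \<le> length (P i)" using P[OF that] unfolding path_between_def by auto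
    then have "tl (P i) \<noteq> []" "last (tl (P i)) = y" by (cases "P i"; auto)+
    then have "P i = x # q i @ [y]" unfolding q_def using p by (metis append_butlast_last_id list.collapse)
    then show ?thesis using p(4) by auto
  qed
  have d: "distinct (x # q i @ [y])" if "i < 3" for i using P[OF that] Pq[OF that] unfolding path_between_def by auto
  have rl: "row_lists False False q x y"
    unfolding row_lists_def
  proof (intro conjI allI impI)
    show "set (q i) \<inter> set (q j) = {}" if "i < 3" "j < 3" "i \<noteq> j" for i j
      using dj[OF that] Pq[OF that(1)] Pq[OF that(2)] d[OF that(1)] by auto
  qed (use Pq d xy in auto)
  have "(\<Union>i<3. set (P i)) = row_verts False False q x y"
    unfolding row_verts_def UN3 using Pq by (auto simp: Pq)
  moreover have "(\<Union>i<3. path_edges (P i)) = row_edges False False q x y"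
  proof -
    have "path_edges (P i) = insert {x, hd (q i)} (insert {y, last (q i)} (path_edges (q i)))" if "i < 3" for i
      using Pq[OF that] by (simp add: path_edges_Cons path_edges_snoc insert_commute)
    then show ?thesis unfolding row_edges_def by auto
  qed
  ultimately show "\<exists>x y q. row_lists False False q x y \<and> H = Graph (row_verts False False q x y) (row_edges False False q x y)"
    using rl H by auto
next
  assume "\<exists>x y q. row_lists False False q x y \<and> H = Graph (row_verts False False q x y) (row_edges False False q x y)"
  then obtain x y q where r: "row_lists False False q x y" and H: "H = Graph (row_verts False False q x y) (row_edges False False q x y)" by blast
  note f = row_lists_facts[OF r]
  define P where "P i = x # q i @ [y]" for i :: nat
  have pe: "path_edges (P i) = insert {x, hd (q i)} (insert {y, last (q i)} (path_edges (q i)))" if "i < 3" for i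
    using f(1)[OF that] unfolding P_def by (simp add: path_edges_Cons path_edges_snoc insert_commute)
  have "x \<noteq> y" using f(8)[of 0] by simp
  moreover have "path_between x (P i) y \<and> 2 \<le> length (P i) - 1" if "i < 3" for i
    using f(1,2,6,7)[OF that] \<open>x \<noteq> y\<close> unfolding path_between_def P_def by (cases "q i") auto
  moreover have "(set (P i) - {x, y}) \<inter> set (P j) = {}" if "i < 3" "j < 3" "i \<noteq> j" for i j
    using f(5)[OF that(1,2)] that(3) unfolding P_def by auto
  moreover have "row_verts False False q x y = (\<Union>i<3. set (P i))" unfolding row_verts_def P_def UN3 by auto
  moreover have "row_edges False False q x y = (\<Union>i<3. path_edges (P i))" unfolding row_edges_def using pe by auto
  ultimately show "trihedron H" unfolding trihedron_def using H by (intro exI[of _ x] exI[of _ y] exI[of _ P]) auto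
qed

text \<open>The rows are the paths without their last vertex, so they start at the triangle.
  \<open>x\<close> fills both places for an apex, as only the right end of the rows has one.\<close>

lemma stamp_iff:
  fixes H :: "'a graph"
  shows
  "stamp H \<longleftrightarrow> (\<exists>x q. row_lists True False q x x \<and> H = Graph (row_verts True False q x x) (row_edges True False q x x))"
proof
  assume "stamp H"
  then obtain t :: "nat \<Rightarrow> 'a" and x and P :: "nat \<Rightarrow> 'a list" where t: "inj_on t {..<3}" "x \<notin> t ` {..<3}"
    and P: "\<And>i. i < 3 \<Longrightarrow> path_between (t i) (P i) x \<and> 1 \<le> length (P i) - 1 \<and> set (P i) \<inter> t ` {..<3} = {t i}"
    and dj: "\<And>i j. i < 3 \<Longrightarrow> j < 3 \<Longrightarrow> i \<noteq> j \<Longrightarrow> (set (P i) - {x}) \<inter> (set (P j) - {x}) = {}"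
    and H: "H = Graph (t ` {..<3} \<union> (\<Union>i<3. set (P i))) (triangle_edges t \<union> (\<Union>i<3. path_edges (P i)))"
    unfolding stamp_def by blast
  define q where "q i = butlast (P i)" for i :: nat
  have Pq: "P i = q i @ [x] \<and> q i \<noteq> [] \<and> hd (q i) = t i" if "i < 3" for i
  proof -
    have p: "P i \<noteq> []" "hd (P i) = t i" "last (P i) = x" "2 \<le> length (P i)" using P[OF that] unfolding path_between_def by auto
    then have "P i = q i @ [x]" unfolding q_def by (metis append_butlast_last_id)
    moreover have "q i \<noteq> []" using calculation p(4) by auto
    ultimately show ?thesis using p(2) by auto
  qed
  have d: "distinct (q i @ [x])" if "i < 3" for i using P[OF that] Pq[OF that] unfolding path_between_def by auto
  have rl: "row_lists True False q x x"
    unfolding row_lists_def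
  proof (intro conjI allI impI)
    show "set (q i) \<inter> set (q j) = {}" if "i < 3" "j < 3" "i \<noteq> j" for i j
      using dj[OF that] Pq[OF that(1)] Pq[OF that(2)] d[OF that(1)] by auto
  qed (use Pq d in auto)
  have "t ` {..<3} \<union> (\<Union>i<3. set (P i)) = row_verts True False q x x"
  proof -
    have "t i \<in> set (q i)" if "i < 3" for i using Pq[OF that] by (metis list.set_sel(1))
    moreover have "(\<Union>i<3. set (P i)) = (\<Union>i<3. set (q i)) \<union> {x}" unfolding UN3 by (auto simp: Pq)
    ultimately show ?thesis unfolding row_verts_def by auto
  qed
  moreover have "triangle_edges t \<union> (\<Union>i<3. path_edges (P i)) = row_edges True False q x x"
  proof -
    have "path_edges (P i) = insert {x, last (q i)} (path_edges (q i))" if "i < 3" for i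
      using Pq[OF that] by (simp add: path_edges_snoc insert_commute)
    moreover have "triangle_edges t = triangle_edges (\<lambda>i. hd (q i))"
      unfolding triangle_edges_def using Pq by (metis (no_types, opaque_lifting))
    ultimately show ?thesis unfolding row_edges_def by auto
  qed
  ultimately show "\<exists>x q. row_lists True False q x x \<and> H = Graph (row_verts True False q x x) (row_edges True False q x x)"
    using rl H by auto
next
  assume "\<exists>x q. row_lists True False q x x \<and> H = Graph (row_verts True False q x x) (row_edges True False q x x)"
  then obtain x q where r: "row_lists True False q x x" and H: "H = Graph (row_verts True False q x x) (row_edges True False q x x)" by blast
  note f = row_lists_facts[OF r]
  define P where "P i = q i @ [x]" for i :: nat
  define t where "t i = hd (q i)" for i :: nat
  have tq: "t i \<in> set (q i)" if "i < 3" for i using f(3)[OF that] unfolding t_def .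
  have pe: "path_edges (P i) = insert {x, last (q i)} (path_edges (q i))" if "i < 3" for i
    using f(1)[OF that] unfolding P_def by (simp add: path_edges_snoc insert_commute)
  have "inj_on t {..<3}" using f(5) tq unfolding inj_on_def by (metis lessThan_iff)
  moreover have "x \<notin> t ` {..<3}" using f(7) tq by force
  moreover have "path_between (t i) (P i) x \<and> 1 \<le> length (P i) - 1 \<and> set (P i) \<inter> t ` {..<3} = {t i}" if "i < 3" for i
  proof -
    have "path_between (t i) (P i) x" "1 \<le> length (P i) - 1"
      using f(1,2,7)[OF that] unfolding path_between_def P_def t_def by (cases "q i"; auto)+
    moreover have "set (P i) \<inter> t ` {..<3} = {t i}"
    proof
      show "set (P i) \<inter> t ` {..<3} \<subseteq> {t i}"
      proof
        fix z assume "z \<in> set (P i) \<inter> t ` {..<3}"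
        then obtain k where k: "k < 3" "z = t k" "z \<in> set (P i)" by auto
        have "z \<noteq> x" using k tq[OF k(1)] f(7)[OF k(1)] by auto
        then have "z \<in> set (q i)" using k(3) unfolding P_def by auto
        then have "i = k" using f(5)[OF that k(1)] tq[OF k(1)] k(2) by blast
        then show "z \<in> {t i}" using k by simp
      qed
      show "{t i} \<subseteq> set (P i) \<inter> t ` {..<3}" using tq[OF that] that unfolding P_def by auto
    qed
    ultimately show ?thesis by blast
  qed
  moreover have "(set (P i) - {x}) \<inter> (set (P j) - {x}) = {}" if "i < 3" "j < 3" "i \<noteq> j" for i j
    using f(5)[OF that(1,2)] that(3) unfolding P_def by auto
  moreover have "row_verts True False q x x = t ` {..<3} \<union> (\<Union>i<3. set (P i))"
  proof -
    have "(\<Union>i<3. set (P i)) = (\<Union>i<3. set (q i)) \<union> {x}" unfolding UN3 P_def by auto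
    then show ?thesis unfolding row_verts_def using tq by auto
  qed
  moreover have "row_edges True False q x x = triangle_edges t \<union> (\<Union>i<3. path_edges (P i))"
    unfolding row_edges_def t_def using pe by auto
  ultimately show "stamp H" unfolding stamp_def using H by (intro exI[of _ t] exI[of _ x] exI[of _ P]) auto
qed

text \<open>The rows are the whole paths. As different rows are disjoint,
  \<open>hd (q i) \<noteq> last (q i)\<close> expresses that the two triangles are disjoint.\<close>

lemma prism_iff:
  fixes H :: "'a graph"
  shows
  "prism H \<longleftrightarrow> (\<exists>q x. row_lists True True q x x \<and> (\<forall>i<3. hd (q i) \<noteq> last (q i)) \<and>
     H = Graph (row_verts True True q x x) (row_edges True True q x x))"
proof
  assume "prism H"
  then obtain s t :: "nat \<Rightarrow> 'a" and P :: "nat \<Rightarrow> 'a list" where st: "inj_on s {..<3}" "inj_on t {..<3}" "s ` {..<3} \<inter> t ` {..<3} = {}"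
    and P: "\<And>i. i < 3 \<Longrightarrow> path_between (s i) (P i) (t i) \<and> set (P i) \<inter> (s ` {..<3} \<union> t ` {..<3}) = {s i, t i}"
    and dj: "\<And>i j. i < 3 \<Longrightarrow> j < 3 \<Longrightarrow> i \<noteq> j \<Longrightarrow> set (P i) \<inter> set (P j) = {}"
    and H: "H = Graph (s ` {..<3} \<union> t ` {..<3} \<union> (\<Union>i<3. set (P i))) (triangle_edges s \<union> triangle_edges t \<union> (\<Union>i<3. path_edges (P i)))"
    unfolding prism_def by blast
  have h: "hd (P i) = s i" "last (P i) = t i" "P i \<noteq> []" "distinct (P i)" if "i < 3" for i
    using P[OF that] unfolding path_between_def by auto
  have rl: "row_lists True True P x x" for x unfolding row_lists_def using h dj by simp
  moreover have "hd (P i) \<noteq> last (P i)" if "i < 3" for i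
  proof -
    have "s i \<in> s ` {..<3}" "t i \<in> t ` {..<3}" using that by auto
    then show ?thesis using h[OF that] st(3) by (metis disjoint_iff)
  qed
  moreover have "s ` {..<3} \<union> t ` {..<3} \<union> (\<Union>i<3. set (P i)) = row_verts True True P x x" for x
  proof -
    have "s i \<in> set (P i)" "t i \<in> set (P i)" if "i < 3" for i using h[OF that] by (metis list.set_sel(1), metis last_in_set)
    then show ?thesis unfolding row_verts_def by auto
  qed
  moreover have "triangle_edges s \<union> triangle_edges t \<union> (\<Union>i<3. path_edges (P i)) = row_edges True True P x x" for x
  proof -
    have "triangle_edges s = triangle_edges (\<lambda>i. hd (P i))" "triangle_edges t = triangle_edges (\<lambda>i. last (P i))"
      unfolding triangle_edges_def using h(1,2) by (metis (no_types, opaque_lifting))+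
    then show ?thesis unfolding row_edges_def by auto
  qed
  ultimately show "\<exists>q x. row_lists True True q x x \<and> (\<forall>i<3. hd (q i) \<noteq> last (q i)) \<and>
     H = Graph (row_verts True True q x x) (row_edges True True q x x)" using H by (intro exI[of _ P] exI) auto
next
  assume "\<exists>q x. row_lists True True q x x \<and> (\<forall>i<3. hd (q i) \<noteq> last (q i)) \<and>
     H = Graph (row_verts True True q x x) (row_edges True True q x x)"
  then obtain q x where r: "row_lists True True q x x" and ne: "\<And>i. i < 3 \<Longrightarrow> hd (q i) \<noteq> last (q i)"
    and H: "H = Graph (row_verts True True q x x) (row_edges True True q x x)" by blast
  note f = row_lists_facts[OF r]
  define s t where "s i = hd (q i)" and "t i = last (q i)" for i :: nat
  have stq: "s i \<in> set (q i)" "t i \<in> set (q i)" if "i < 3" for i using f(3,4)[OF that] unfolding s_def t_def by auto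
  have un: "z = s i \<or> z = t i" if h: "i < 3" "z \<in> set (q i)" "z \<in> s ` {..<3} \<union> t ` {..<3}" for i z
  proof -
    obtain k where k: "k < 3" "z = s k \<or> z = t k" using h(3) by auto
    then have "z \<in> set (q k)" using stq[OF k(1)] by auto
    then have "i = k" by (rule f(5)[OF h(1) k(1) h(2)])
    then show ?thesis using k(2) by simp
  qed
  have "inj_on s {..<3}" "inj_on t {..<3}" using f(5) stq unfolding inj_on_def by (metis lessThan_iff)+
  moreover have "s ` {..<3} \<inter> t ` {..<3} = {}"
  proof -
    have "s i \<noteq> t j" if "i < 3" "j < 3" for i j
    proof
      assume "s i = t j"
      then have "i = j" using f(5)[OF that] stq(1)[OF that(1)] stq(2)[OF that(2)] by metis
      then show False using \<open>s i = t j\<close> ne[OF that(1)] unfolding s_def t_def by simp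
    qed
    then show ?thesis by auto
  qed
  moreover have "path_between (s i) (q i) (t i) \<and> set (q i) \<inter> (s ` {..<3} \<union> t ` {..<3}) = {s i, t i}" if "i < 3" for i
  proof -
    have "path_between (s i) (q i) (t i)" unfolding path_between_def s_def t_def using f(1,2)[OF that] by simp
    moreover have "set (q i) \<inter> (s ` {..<3} \<union> t ` {..<3}) = {s i, t i}" using un[OF that] stq[OF that] that by blast
    ultimately show ?thesis by blast
  qed
  moreover have "set (q i) \<inter> set (q j) = {}" if "i < 3" "j < 3" "i \<noteq> j" for i j
    using f(5)[OF that(1,2)] that(3) by auto
  moreover have "row_verts True True q x x = s ` {..<3} \<union> t ` {..<3} \<union> (\<Union>i<3. set (q i))"
    unfolding row_verts_def using stq by auto
  moreover have "row_edges True True q x x = triangle_edges s \<union> triangle_edges t \<union> (\<Union>i<3. path_edges (q i))"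
    unfolding row_edges_def s_def t_def by auto
  ultimately show "prism H" unfolding prism_def using H by (intro exI[of _ s] exI[of _ t] exI[of _ q]) auto
qed

lemma rows_lists:
  assumes E: "graph_rel E" and r: "rows E \<alpha> \<beta> Q a b"
  obtains q where "\<And>i. i < 3 \<Longrightarrow> path_list E (q i)" "\<And>i. i < 3 \<Longrightarrow> set (q i) = Q i" "\<And>i. i < 3 \<Longrightarrow> hd (q i) = a i"
    "\<And>i. i < 3 \<Longrightarrow> last (q i) = b i"
proof -
  have "\<exists>l. path_list E l \<and> set l = Q i \<and> hd l = a i \<and> last l = b i" if "i < 3" for i
    by (rule ipath_path_list[OF E rowsD(1)[OF r that]]) blast
  then have "\<forall>i. \<exists>l. i < 3 \<longrightarrow> path_list E l \<and> set l = Q i \<and> hd l = a i \<and> last l = b i" by blast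
  then obtain q where "\<forall>i. i < 3 \<longrightarrow> path_list E (q i) \<and> set (q i) = Q i \<and> hd (q i) = a i \<and> last (q i) = b i" by (rule choice[THEN exE])
  then show thesis using that[of q] by blast
qed

text \<open>This equivalence is all that the counting needs to know about the four kinds of solid
  graphs.\<close>

lemma solid_graph_iff:
  assumes G: "simple_graph G" and W: "W \<subseteq> verts G"
  shows "solid_graph (induced G W) \<longleftrightarrow> solid (adjacent G) W"
proof
  note E = simple_graph_rel[OF G]
  assume "solid_graph (induced G W)"
  then consider "pyramid (induced G W)" | "trihedron (induced G W)" | "stamp (induced G W)" | "prism (induced G W)"
    unfolding solid_graph_def by blast
  then show "solid (adjacent G) W"
  proof cases
    case 1
    then obtain D h where D: "W = insert h D" "h \<notin> D" "icycle (adjacent G) D" "3 \<le> card (nbrs (adjacent G) h D)"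
      unfolding pyramid_iff[OF G W] by blast
    obtain T where T: "T \<subseteq> nbrs (adjacent G) h D" "card T = 3" by (rule obtain_subset_with_card_n[OF D(4)]) blast
    obtain p q r where "T = {p, q, r}" "p \<noteq> q" "q \<noteq> r" "p \<noteq> r" using T(2) unfolding card_3_iff by blast
    then have "big (adjacent G) (nbrs (adjacent G) h D)" using T(1) by (intro big3[of p _ q r]) auto
    then show ?thesis using solid_hub[OF D(3,2)] D(1) by simp
  next
    case 2
    then obtain x y q where r: "row_lists False False q x y" and eq: "induced G W = Graph (row_verts False False q x y) (row_edges False False q x y)"
      unfolding trihedron_iff by blast
    note h = induced_rows_iff[OF G W r, THEN iffD1, OF eq]
    have "x \<noteq> y" using row_lists_facts(8)[OF r, of 0] by simp
    then have "solid (adjacent G) (insert x (insert y (\<Union>i<3. set (q i))))" using h by (intro trihedron_solid[OF E]) auto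
    moreover have "insert x (insert y (\<Union>i<3. set (q i))) = W" using h unfolding row_verts_def by auto
    ultimately show ?thesis by simp
  next
    case 3
    then obtain x q where r: "row_lists True False q x x" and eq: "induced G W = Graph (row_verts True False q x x) (row_edges True False q x x)"
      unfolding stamp_iff by blast
    note h = induced_rows_iff[OF G W r, THEN iffD1, OF eq]
    have "solid (adjacent G) (insert x (\<Union>i<3. set (q i)))" using h by (intro stamp_solid[OF E]) auto
    moreover have "insert x (\<Union>i<3. set (q i)) = W" using h unfolding row_verts_def by auto
    ultimately show ?thesis by simp
  next
    case 4
    then obtain x q where r: "row_lists True True q x x" and ne: "\<And>i. i < 3 \<Longrightarrow> hd (q i) \<noteq> last (q i)"
      and eq: "induced G W = Graph (row_verts True True q x x) (row_edges True True q x x)"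
      unfolding prism_iff by blast
    note h = induced_rows_iff[OF G W r, THEN iffD1, OF eq]
    have "solid (adjacent G) (\<Union>i<3. set (q i))" using h ne by (intro prism_solid[OF E]) auto
    moreover have "(\<Union>i<3. set (q i)) = W" using h unfolding row_verts_def by auto
    ultimately show ?thesis by simp
  qed
next
  note E = simple_graph_rel[OF G]
  assume "solid (adjacent G) W"
  then show "solid_graph (induced G W)" using solid_cases[OF E]
  proof (elim disjE[OF solid_cases[OF E]])
    assume "\<exists>D h. W = insert h D \<and> h \<notin> D \<and> icycle (adjacent G) D \<and> 3 \<le> card (nbrs (adjacent G) h D)"
    then show ?thesis unfolding solid_graph_def pyramid_iff[OF G W] by blast
  next
    assume "(\<exists>Q a b x y. rows (adjacent G) False False Q a b \<and> apex (adjacent G) Q a x \<and> apex (adjacent G) Q b y \<and> x \<noteq> y \<and>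
        \<not> adjacent G x y \<and> W = insert x (insert y (\<Union>i<3. Q i)))
      \<or> (\<exists>Q a b x. rows (adjacent G) True False Q a b \<and> apex (adjacent G) Q b x \<and> W = insert x (\<Union>i<3. Q i))
      \<or> (\<exists>Q a b. rows (adjacent G) True True Q a b \<and> (\<forall>i<3. a i \<noteq> b i) \<and> W = (\<Union>i<3. Q i))"
    then show ?thesis
    proof (elim disjE exE conjE)
      fix Q a b x y assume h: "rows (adjacent G) False False Q a b" "apex (adjacent G) Q a x" "apex (adjacent G) Q b y" "x \<noteq> y"
        "\<not> adjacent G x y" "W = insert x (insert y (\<Union>i<3. Q i))"
      obtain q where q: "\<And>i. i < 3 \<Longrightarrow> path_list (adjacent G) (q i)" "\<And>i. i < 3 \<Longrightarrow> set (q i) = Q i" "\<And>i. i < 3 \<Longrightarrow> hd (q i) = a i"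
        "\<And>i. i < 3 \<Longrightarrow> last (q i) = b i" by (rule rows_lists[OF E h(1)]) blast
      have rl: "row_lists False False q x y" unfolding row_lists_def
        using q(1,2) h(2-4) rowsD(4)[OF h(1)] unfolding path_list_def apex_def by simp
      have "induced G W = Graph (row_verts False False q x y) (row_edges False False q x y)"
        by (rule induced_rows_iff[OF G W rl, THEN iffD2])
          (use h q in \<open>auto simp: row_verts_def rows_def apex_def\<close>)
      then show ?thesis unfolding solid_graph_def trihedron_iff using rl by blast
    next
      fix Q a b x assume h: "rows (adjacent G) True False Q a b" "apex (adjacent G) Q b x" "W = insert x (\<Union>i<3. Q i)"
      obtain q where q: "\<And>i. i < 3 \<Longrightarrow> path_list (adjacent G) (q i)" "\<And>i. i < 3 \<Longrightarrow> set (q i) = Q i" "\<And>i. i < 3 \<Longrightarrow> hd (q i) = a i"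
        "\<And>i. i < 3 \<Longrightarrow> last (q i) = b i" by (rule rows_lists[OF E h(1)]) blast
      have rl: "row_lists True False q x x" unfolding row_lists_def
        using q(1,2) h(2) rowsD(4)[OF h(1)] unfolding path_list_def apex_def by simp
      have "induced G W = Graph (row_verts True False q x x) (row_edges True False q x x)"
        by (rule induced_rows_iff[OF G W rl, THEN iffD2])
          (use h q in \<open>auto simp: row_verts_def rows_def apex_def\<close>)
      then show ?thesis unfolding solid_graph_def stamp_iff using rl by blast
    next
      fix Q a b assume h: "rows (adjacent G) True True Q a b" "\<forall>i<3. a i \<noteq> b i" "W = (\<Union>i<3. Q i)"
      obtain q where q: "\<And>i. i < 3 \<Longrightarrow> path_list (adjacent G) (q i)" "\<And>i. i < 3 \<Longrightarrow> set (q i) = Q i" "\<And>i. i < 3 \<Longrightarrow> hd (q i) = a i"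
        "\<And>i. i < 3 \<Longrightarrow> last (q i) = b i" by (rule rows_lists[OF E h(1)]) blast
      have rl: "row_lists True True q undefined undefined" unfolding row_lists_def
        using q(1,2) rowsD(4)[OF h(1)] unfolding path_list_def by simp
      have "induced G W = Graph (row_verts True True q undefined undefined) (row_edges True True q undefined undefined)"
        by (rule induced_rows_iff[OF G W rl, THEN iffD2])
          (use h q in \<open>auto simp: row_verts_def rows_def\<close>)
      moreover have "\<forall>i<3. hd (q i) \<noteq> last (q i)" using q h(2) by simp
      ultimately show ?thesis unfolding solid_graph_def prism_iff using rl by blast
    qed
  qed
qed

section \<open>The third graph characteristic as an alternating sum, and the result\<close>

lemma induced_inj: "inj_on (induced G) S"
  by (rule inj_onI) (metis verts_induced)

lemma beth3_tot_wt:
  assumes G: "simple_graph G"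
  shows "beth3 G = tot_wt 4 (adjacent G) (verts G) - 1"
proof -
  let ?E = "adjacent G" and ?V = "verts G"
  have fin: "finite ?V" using G unfolding simple_graph_def by simp
  \<comment> \<open>A vertex set can be read off from the subgraph it induces, so counting subgraphs
    and counting vertex sets agree.\<close>
  have "solids G = induced G ` cells 4 ?E ?V"
    unfolding solids_def induced_subgraphs_def cells_def using solid_graph_iff[OF G] by (auto simp: cell_def)
  then have s: "card (solids G) = card (cells 4 ?E ?V)" by (simp add: card_image induced_inj)
  have "induced_cycles G = induced G ` cells 3 ?E ?V"
    unfolding induced_cycles_def induced_subgraphs_def cells_def using cycle_graph_iff[OF G] by (auto simp: cell_def)
  then have c: "card (induced_cycles G) = card (cells 3 ?E ?V)" by (simp add: card_image induced_inj)
  have "edges G = cells 2 ?E ?V"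
  proof (intro set_eqI iffI)
    fix e assume e: "e \<in> edges G"
    then have "card e = 2" "e \<subseteq> ?V" using G unfolding simple_graph_def by auto
    then obtain u v where "e = {u, v}" "u \<noteq> v" unfolding card_2_iff by blast
    then show "e \<in> cells 2 ?E ?V" using e \<open>e \<subseteq> ?V\<close> unfolding cells_def cell_def adjacent_def by auto
  next
    fix e assume "e \<in> cells 2 ?E ?V"
    then show "e \<in> edges G" unfolding cells_def cell_def adjacent_def by auto
  qed
  then have e: "card (edges G) = card (cells 2 ?E ?V)" by simp
  have "cells 1 ?E ?V = (\<lambda>v. {v}) ` ?V" unfolding cells_def by (auto simp: cell_def)
  then have v: "card ?V = card (cells 1 ?E ?V)" by (simp add: card_image)
  have "tot_wt 4 ?E ?V = int (card (cells 4 ?E ?V)) - (int (card (cells 3 ?E ?V)) - (int (card (cells 2 ?E ?V)) - (int (card (cells 1 ?E ?V)) - 1)))"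
    using tot_wt_Suc[OF fin, of 3 ?E] tot_wt_Suc[OF fin, of 2 ?E] tot_wt_Suc[OF fin, of 1 ?E] tot_wt_Suc[OF fin, of 0 ?E] tot_wt_0[OF fin, of ?E]
    by (simp add: eval_nat_numeral)
  then show ?thesis unfolding beth3_def s c e using v by simp
qed

theorem theorem4p3p1:
  fixes G H :: "'a graph" and w :: 'a
  assumes "simple_graph G" and "connected_graph G"
    and "w \<in> verts G"
    and "vertex_compression G w H"
  shows "beth3 H \<le> beth3 G"
proof -
  have W: "closed_neighbourhood G w \<subseteq> verts G" "closed_neighbourhood G w \<noteq> {}"
    unfolding closed_neighbourhood_def neighbours_def using adjacent_verts[OF assms(1)] assms(3) by auto
  obtain X where "nonedge_contractions G (closed_neighbourhood G w) H X"
    using assms(4) unfolding vertex_compression_def by blast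
  then have "simple_graph H" by (rule contractions_invariant(1)[OF assms(1) W])
  then show ?thesis
    using compression_tot_wt[OF assms(1,3,4)] beth3_tot_wt[OF assms(1)] beth3_tot_wt[of H] by simp
qed

end
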